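(* Let $s\ge 0$, $T_0>0$, and let $A\in C([0,T_0],H^{5+s}(\mathbb{R}))$ be a real-valued solution of the KdV equation $$\partial_T A=\tfrac12\,\partial_X^3A-\tfrac12\,\partial_X(A^2),\qquad X\in\mathbb{R},\ T\in[0,T_0].$$ Then there exist $\varepsilon_0>0$ and $C>0$ such that for all $\varepsilon\in(0,\varepsilon_0)$ there are solutions $u=u(x,t)$ of the Boussinesq equation $$\partial_t^2u=\partial_x^2u-\partial_x^4u+\partial_x^2(u^2),\qquad x\in\mathbb{R},$$ with $$\sup_{t\in[0,T_0/\varepsilon^3]}\big\|u(\cdot,t)-\varepsilon^2A(\varepsilon(\cdot-t),\varepsilon^3t)\big\|_{H^{1+s}(\mathbb{R})}\le C\,\varepsilon^{7/2}.$$
   Context: $u(x,t)\in\mathbb{R}$. $H^r(\mathbb{R})$ is the $L^2$-based Sobolev space with norm $\|u\|_{H^r}^2=\int|\widehat u(k)|^2(1+k^2)^r\,dk$. Constants such as $C$ are independent of the small parameter $\varepsilon$. *)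

theory Defs
  imports "HOL-Analysis.Analysis"
begin

text \<open>
  Functions stand for their almost-everywhere classes, with Borel measurable representatives.
  A function of space and time is a curve \<open>u :: real \<Rightarrow> real \<Rightarrow> real\<close> whose first argument is
  the time: \<open>u t x\<close> is the value at position \<open>x\<close> and time \<open>t\<close>.
\<close>

definition square_integrable :: "(real \<Rightarrow> real) \<Rightarrow> bool" where
  "square_integrable f \<longleftrightarrow>
     f \<in> borel_measurable lborel \<and> integrable lborel (\<lambda>x. (f x)\<^sup>2)"

definition truncated_fourier :: "(real \<Rightarrow> real) \<Rightarrow> real \<Rightarrow> real \<Rightarrow> complex" where
  "truncated_fourier f R k =
     complex_of_real (1 / sqrt (2 * pi)) *
       (LINT x:{-R..R}|lborel. complex_of_real (f x) * cis (- (k * x)))"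

text \<open>
  The Fourier transform on the square integrable functions, as the mean-square limit of the
  truncated integrals. By Plancherel's theorem the limit exists; it is unique only up to null
  sets, whence \<open>SOME\<close>. The normalization is the unitary one.
\<close>

definition fourier :: "(real \<Rightarrow> real) \<Rightarrow> real \<Rightarrow> complex" where
  "fourier f = (SOME g. g \<in> borel_measurable lborel \<and>
     ((\<lambda>R. \<integral>\<^sup>+ k. ennreal ((cmod (truncated_fourier f R k - g k))\<^sup>2) \<partial>lborel)
        \<longlongrightarrow> 0) at_top)"

text \<open>
  The Sobolev space of real-valued functions on the line, for orders \<open>r \<ge> 0\<close> only: for negative
  orders the space would also contain distributions that are not functions.
\<close>

definition sobolev :: "real \<Rightarrow> (real \<Rightarrow> real) set" where
  "sobolev r = {f. square_integrable f \<and>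
     integrable lborel (\<lambda>k. (cmod (fourier f k))\<^sup>2 * (1 + k\<^sup>2) powr r)}"

definition sobolev_norm :: "real \<Rightarrow> (real \<Rightarrow> real) \<Rightarrow> ennreal" where
  "sobolev_norm r f =
     (if f \<in> sobolev r
      then ennreal (sqrt (LINT k|lborel. (cmod (fourier f k))\<^sup>2 * (1 + k\<^sup>2) powr r))
      else \<infinity>)"

definition continuous_into_sobolev :: "real \<Rightarrow> real \<Rightarrow> (real \<Rightarrow> real \<Rightarrow> real) \<Rightarrow> bool" where
  "continuous_into_sobolev \<tau> r u \<longleftrightarrow>
     (\<forall>t\<in>{0..\<tau>}. u t \<in> sobolev r \<and>
        ((\<lambda>t'. sobolev_norm r (\<lambda>x. u t' x - u t x)) \<longlongrightarrow> 0) (at t within {0..\<tau>}))"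

definition test_function :: "(real \<Rightarrow> real) \<Rightarrow> bool" where
  "test_function \<phi> \<longleftrightarrow>
     (\<forall>n x. (deriv ^^ n) \<phi> field_differentiable at x) \<and> bounded {x. \<phi> x \<noteq> 0}"

text \<open>
  The equations are understood in the sense of distributions in space: all spatial derivatives
  are moved to the test function. The pairing with a fixed test function is differentiated in
  time in the ordinary sense, one-sidedly at the end points of the time interval. For
  \<open>u \<in> C([0, \<tau>], H\<^sup>1)\<close>, the lowest regularity occurring here, the Boussinesq equation contains
  spatial derivatives that are in general no functions.
\<close>

definition kdv_solution :: "real \<Rightarrow> (real \<Rightarrow> real \<Rightarrow> real) \<Rightarrow> bool" where
  "kdv_solution \<tau> A \<longleftrightarrow>
     (\<forall>\<phi>. test_function \<phi> \<longrightarrow> (\<forall>T\<in>{0..\<tau>}.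
        ((\<lambda>T'. LINT X|lborel. A T' X * \<phi> X) has_real_derivative
          (LINT X|lborel. - (1/2) * (A T X * (deriv ^^ 3) \<phi> X)
                          + (1/2) * ((A T X)\<^sup>2 * deriv \<phi> X)))
        (at T within {0..\<tau>})))"

definition boussinesq_solution :: "real \<Rightarrow> (real \<Rightarrow> real \<Rightarrow> real) \<Rightarrow> bool" where
  "boussinesq_solution \<tau> u \<longleftrightarrow>
     (\<forall>\<phi>. test_function \<phi> \<longrightarrow> (\<exists>v. \<forall>t\<in>{0..\<tau>}.
        ((\<lambda>t'. LINT x|lborel. u t' x * \<phi> x) has_real_derivative v t) (at t within {0..\<tau>}) \<and>
        (v has_real_derivative
          (LINT x|lborel. u t x * (deriv ^^ 2) \<phi> x - u t x * (deriv ^^ 4) \<phi> x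
                          + (u t x)\<^sup>2 * (deriv ^^ 2) \<phi> x))
        (at t within {0..\<tau>})))"

end

theory Submission
  imports Defs "HOL-Probability.Probability"
begin

text \<open>
  The equation is written as the system \<open>u\<^sub>t = p\<^sub>x\<close>, \<open>p\<^sub>t = (u - u\<^sub>x\<^sub>x + u\<^sup>2)\<^sub>x\<close>. For
  \<open>u = \<Psi>\<close> with \<open>\<Psi> = \<epsilon>\<^sup>2 A(\<epsilon> (x - t), \<epsilon>\<^sup>3 t)\<close> and
  \<open>p = - \<epsilon>\<^sup>2 A + \<epsilon>\<^sup>4 (\<partial>\<^sub>X\<^sup>2 A - A\<^sup>2) / 2\<close> the first equation holds exactly, because \<open>A\<close>
  solves the KdV equation, and the residual of the second one is of size \<open>\<epsilon>\<^sup>1\<^sup>3\<^sup>/\<^sup>2\<close> in \<open>H\<^sup>s\<close>. The error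
  \<open>(r, p)\<close> lives in \<open>H\<^sup>1\<^sup>+\<^sup>s \<times> H\<^sup>s\<close>, where the linear part of the system is a unitary group
  and the nonlinearity is locally Lipschitz. The linear term \<open>2 (\<Psi> r)\<^sub>x\<close> is of size \<open>\<epsilon>\<^sup>2\<close>, too large
  for times of order \<open>\<epsilon>\<^sup>-\<^sup>3\<close>; but up to a commutator of size \<open>\<epsilon>\<^sup>3\<close> it is the time derivative
  of the quadratic form with kernel \<open>\<Psi>\<close>, which is added to the energy. Gronwall's inequality then keeps the
  error below \<open>C \<epsilon>\<^sup>7\<^sup>/\<^sup>2\<close>. Everything is done on the Fourier side: an element of \<open>H\<^sup>r\<close> is
  represented by its Fourier transform times \<open>(1 + k\<^sup>2)\<^sup>r\<^sup>/\<^sup>2\<close>, an element of \<open>L\<^sup>2\<close>.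
\<close>

section \<open>The Hilbert space of square integrable functions\<close>

text \<open>The exponents leave no room: a residual \<epsilon>^(13/2) acting for a time
  \<epsilon>^(-3) gives \<epsilon>^(7/2), so every term of the energy estimate has to grow at a rate
  of at most \<epsilon>^3. The L^2 norm of the profile, however, is only \<epsilon>^(3/2). In the
  energy estimate its products with the error are therefore bounded by the L^1 norm of its Fourier
  transform, which is of size \<epsilon>^2 and gains a further \<epsilon> with each derivative. The
  term quadratic in the error is cut off at radius \<epsilon>^3, which gives it the right rate; for
  small \<epsilon> the bound C \<epsilon>^(7/2) lies below this radius. Five derivatives of A are
  spent because the residual is a time derivative of (\<partial>^2 A - A^2) / 2, and the KdV
  equation trades a time derivative for three in space. In the unknowns of the error the generator
  is unbounded of order two, so the equations hold only after smoothing; undoing the free evolution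
  removes the generator and leaves an ordinary differential equation for the contraction
  principle.\<close>

definition sq :: "(real \<Rightarrow> complex) \<Rightarrow> bool" where
  "sq f \<longleftrightarrow> f \<in> borel_measurable lborel \<and> integrable lborel (\<lambda>x. (cmod (f x))\<^sup>2)"

lemma sq_measurable [measurable_dest]: "sq f \<Longrightarrow> f \<in> borel_measurable lborel"
  by (simp add: sq_def)

lemma sq_integrable: "sq f \<Longrightarrow> integrable lborel (\<lambda>x. (cmod (f x))\<^sup>2)"
  by (simp add: sq_def)

lemma sq_dominated:
  assumes "sq g" and [measurable]: "f \<in> borel_measurable lborel" and "AE x in lborel. cmod (f x) \<le> C * cmod (g x)"
  shows "sq f"
  unfolding sq_def
proof
  show "integrable lborel (\<lambda>x. (cmod (f x))\<^sup>2)"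
  proof (rule Bochner_Integration.integrable_bound)
    show "integrable lborel (\<lambda>x. C\<^sup>2 * (cmod (g x))\<^sup>2)" using sq_integrable[OF assms(1)] by simp
    show "AE x in lborel. norm ((cmod (f x))\<^sup>2) \<le> norm (C\<^sup>2 * (cmod (g x))\<^sup>2)"
      using assms(3)
    proof eventually_elim
      case (elim x)
      have "(cmod (f x))\<^sup>2 \<le> (C * cmod (g x))\<^sup>2" by (rule power_mono[OF elim]) simp
      then show ?case by (simp add: power_mult_distrib)
    qed
  qed measurable
qed fact

lemma sq_zero [simp]: "sq (\<lambda>_. 0)"
  by (simp add: sq_def)

lemma sq_mult_bounded:
  assumes "sq f" and [measurable]: "m \<in> borel_measurable lborel" and "\<And>k. cmod (m k) \<le> C"
  shows "sq (\<lambda>k. m k * f k)"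
  by (rule sq_dominated[OF assms(1), where C = C])
    (use assms sq_measurable[OF assms(1)] in \<open>auto simp: norm_mult intro!: mult_right_mono\<close>)

lemma sq_add: assumes "sq f" "sq g" shows "sq (\<lambda>x. f x + g x)"
  unfolding sq_def
proof
  have [measurable]: "f \<in> borel_measurable lborel" "g \<in> borel_measurable lborel"
    using assms by (auto simp: sq_def)
  show "(\<lambda>x. f x + g x) \<in> borel_measurable lborel" by measurable
  show "integrable lborel (\<lambda>x. (cmod (f x + g x))\<^sup>2)"
  proof (rule Bochner_Integration.integrable_bound)
    show "integrable lborel (\<lambda>x. 2 * (cmod (f x))\<^sup>2 + 2 * (cmod (g x))\<^sup>2)"
      using assms[THEN sq_integrable] by simp
    show "AE x in lborel. norm ((cmod (f x + g x))\<^sup>2) \<le> norm (2 * (cmod (f x))\<^sup>2 + 2 * (cmod (g x))\<^sup>2)"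
    proof (rule AE_I2)
      fix x
      have "(cmod (f x + g x))\<^sup>2 \<le> (cmod (f x) + cmod (g x))\<^sup>2"
        by (simp add: norm_triangle_ineq power_mono)
      also have "\<dots> \<le> 2 * (cmod (f x))\<^sup>2 + 2 * (cmod (g x))\<^sup>2"
        using sum_squares_bound[of "cmod (f x)" "cmod (g x)"] by (simp add: power2_sum)
      finally show "norm ((cmod (f x + g x))\<^sup>2) \<le> norm (2 * (cmod (f x))\<^sup>2 + 2 * (cmod (g x))\<^sup>2)"
        by simp
    qed
  qed measurable
qed

lemma sq_scaleR: "sq f \<Longrightarrow> sq (\<lambda>x. c *\<^sub>R f x)"
  by (rule sq_dominated[where C = "\<bar>c\<bar>"]) (auto dest: sq_measurable)

lemma sq_cmult: "sq f \<Longrightarrow> sq (\<lambda>x. c * f x)"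
  by (rule sq_dominated[where C = "cmod c"]) (auto dest: sq_measurable simp: norm_mult)

lemma sq_uminus: "sq f \<Longrightarrow> sq (\<lambda>x. - f x)"
  by (rule sq_dominated[where C = 1]) (auto dest: sq_measurable)

lemma sq_diff: "sq f \<Longrightarrow> sq g \<Longrightarrow> sq (\<lambda>x. f x - g x)"
  using sq_add[of f "\<lambda>x. - g x"] sq_uminus[of g] by simp

lemma sq_cnj: "sq f \<Longrightarrow> sq (\<lambda>x. cnj (f x))"
proof -
  assume f: "sq f"
  have [measurable]: "f \<in> borel_measurable lborel" using f by (rule sq_measurable)
  have "(\<lambda>x. cnj (f x)) \<in> borel_measurable lborel"
    using borel_measurable_continuous_on[of cnj f lborel] by (simp add: continuous_on_cnj)
  then show ?thesis using f by (simp add: sq_def)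
qed

lemma measurable_cnj [measurable]: "cnj \<in> borel_measurable borel"
  by (intro borel_measurable_continuous_onI continuous_on_cnj continuous_on_id)

lemma sq_cong_AE:
  assumes "sq f" "AE x in lborel. f x = g x" "g \<in> borel_measurable lborel"
  shows "sq g"
  by (rule sq_dominated[OF assms(1) assms(3), where C = 1]) (use assms(2) in auto)

lemma sq_integrable_mult:
  assumes "sq f" "sq g"
  shows "integrable lborel (\<lambda>x. f x * g x)"
proof (rule Bochner_Integration.integrable_bound)
  have [measurable]: "f \<in> borel_measurable lborel" "g \<in> borel_measurable lborel"
    using assms by (auto simp: sq_def)
  show "integrable lborel (\<lambda>x. (cmod (f x))\<^sup>2 + (cmod (g x))\<^sup>2)"
    using assms[THEN sq_integrable] by simp
  show "AE x in lborel. norm (f x * g x) \<le> norm ((cmod (f x))\<^sup>2 + (cmod (g x))\<^sup>2)"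
  proof (rule AE_I2)
    fix x
    have "2 * (cmod (f x) * cmod (g x)) \<le> (cmod (f x))\<^sup>2 + (cmod (g x))\<^sup>2"
      using sum_squares_bound[of "cmod (f x)" "cmod (g x)"] by simp
    moreover have "0 \<le> cmod (f x) * cmod (g x)" by simp
    ultimately have "cmod (f x) * cmod (g x) \<le> (cmod (f x))\<^sup>2 + (cmod (g x))\<^sup>2" by linarith
    then show "norm (f x * g x) \<le> norm ((cmod (f x))\<^sup>2 + (cmod (g x))\<^sup>2)"
      by (simp add: norm_mult)
  qed
  show "(\<lambda>x. f x * g x) \<in> borel_measurable lborel" by measurable
qed

definition sqclass :: "(real \<Rightarrow> complex) \<Rightarrow> (real \<Rightarrow> complex) set" where
  "sqclass f = {g. sq g \<and> (AE x in lborel. f x = g x)}"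

text \<open>As a type of its own the quotient can be an instance of \<open>banach\<close>, on which
  vector-valued derivatives, integrals and the fixed point theorem rest.\<close>

typedef l2 = "{C. \<exists>f. sq f \<and> C = sqclass f}"
  by (auto intro!: exI[of _ "\<lambda>_. 0"])

definition l2_of :: "(real \<Rightarrow> complex) \<Rightarrow> l2" where
  "l2_of f = Abs_l2 (sqclass f)"

text \<open>One representative is fixed for each class. Algebraic laws for \<open>rep\<close> thus
  hold only almost everywhere, and equations between classes are reduced to them by
  \<open>l2_eqI\<close>.\<close>

definition rep :: "l2 \<Rightarrow> real \<Rightarrow> complex" where
  "rep u = (SOME f. sq f \<and> Rep_l2 u = sqclass f)"

lemma rep_props: "sq (rep u) \<and> Rep_l2 u = sqclass (rep u)"
proof -
  have "\<exists>f. sq f \<and> Rep_l2 u = sqclass f" using Rep_l2[of u] by simp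
  then show ?thesis unfolding rep_def by (rule someI_ex)
qed

lemma sq_rep [simp]: "sq (rep u)"
  using rep_props by blast

lemma rep_measurable [measurable]: "rep u \<in> borel_measurable borel"
  using sq_measurable[OF sq_rep] by simp

lemma l2_of_rep [simp]: "l2_of (rep u) = u"
  unfolding l2_of_def using rep_props[of u] Rep_l2_inverse by metis

lemma sqclass_eq_iff:
  assumes "sq f" "sq g"
  shows "sqclass f = sqclass g \<longleftrightarrow> (AE x in lborel. f x = g x)"
proof
  assume "sqclass f = sqclass g"
  then have "g \<in> sqclass f" using assms by (auto simp: sqclass_def)
  then show "AE x in lborel. f x = g x" by (simp add: sqclass_def)
next
  assume *: "AE x in lborel. f x = g x"
  have "(AE x in lborel. f x = h x) \<longleftrightarrow> (AE x in lborel. g x = h x)" for h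
    using * by (auto elim!: AE_mp)
  then show "sqclass f = sqclass g" by (simp add: sqclass_def)
qed

lemma l2_of_eq_iff: "sq f \<Longrightarrow> sq g \<Longrightarrow> l2_of f = l2_of g \<longleftrightarrow> (AE x in lborel. f x = g x)"
  unfolding l2_of_def by (subst Abs_l2_inject) (auto simp: sqclass_eq_iff)

lemma rep_l2_of: "sq f \<Longrightarrow> AE x in lborel. rep (l2_of f) x = f x"
  using l2_of_eq_iff[of "rep (l2_of f)" f] by simp

lemma l2_eqI: "AE x in lborel. rep u x = rep v x \<Longrightarrow> u = v"
  using l2_of_eq_iff[of "rep u" "rep v"] by simp

lemma l2_of_cong_AE:
  assumes "AE x in lborel. f x = g x" "sq f" "g \<in> borel_measurable lborel"
  shows "l2_of f = l2_of g"
  using l2_of_eq_iff[of f g] sq_cong_AE[of f g] assms by blast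

instantiation l2 :: real_vector
begin
definition "zero_l2 = l2_of (\<lambda>_. 0)"
definition "plus_l2 u v = l2_of (\<lambda>x. rep u x + rep v x)"
definition "uminus_l2 u = l2_of (\<lambda>x. - rep u x)"
definition "minus_l2 u v = l2_of (\<lambda>x. rep u x - rep v x)"
definition "scaleR_l2 c u = l2_of (\<lambda>x. c *\<^sub>R rep u x)"

lemma rep_zero': "AE x in lborel. rep 0 x = 0"
  unfolding zero_l2_def by (rule rep_l2_of) simp
lemma rep_add': "AE x in lborel. rep (u + v) x = rep u x + rep v x"
  unfolding plus_l2_def by (rule rep_l2_of) (simp add: sq_add)
lemma rep_uminus': "AE x in lborel. rep (- u) x = - rep u x"
  unfolding uminus_l2_def by (rule rep_l2_of) (simp add: sq_uminus)
lemma rep_diff': "AE x in lborel. rep (u - v) x = rep u x - rep v x"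
  unfolding minus_l2_def by (rule rep_l2_of) (simp add: sq_diff)
lemma rep_scaleR': "AE x in lborel. rep (c *\<^sub>R u) x = c *\<^sub>R rep u x"
  unfolding scaleR_l2_def by (rule rep_l2_of) (simp add: sq_scaleR)

instance
proof
  fix a b c :: l2 and r t :: real
  show "a + b + c = a + (b + c)"
    by (rule l2_eqI)
      (use rep_add'[of "a + b" c] rep_add'[of a b] rep_add'[of a "b + c"] rep_add'[of b c] in eventually_elim, auto)
  show "a + b = b + a"
    by (rule l2_eqI) (use rep_add'[of a b] rep_add'[of b a] in eventually_elim, auto)
  show "0 + a = a"
    by (rule l2_eqI) (use rep_add'[of 0 a] rep_zero' in eventually_elim, auto)
  show "- a + a = 0"
    by (rule l2_eqI) (use rep_add'[of "-a" a] rep_zero' rep_uminus'[of a] in eventually_elim, auto)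
  show "a - b = a + - b"
    by (rule l2_eqI) (use rep_diff'[of a b] rep_add'[of a "-b"] rep_uminus'[of b] in eventually_elim, auto)
  show "r *\<^sub>R (a + b) = r *\<^sub>R a + r *\<^sub>R b"
    by (rule l2_eqI)
      (use rep_scaleR'[of r "a + b"] rep_add'[of a b] rep_add'[of "r *\<^sub>R a" "r *\<^sub>R b"] rep_scaleR'[of r a]
        rep_scaleR'[of r b] in eventually_elim, auto simp: scaleR_add_right)
  show "(r + t) *\<^sub>R a = r *\<^sub>R a + t *\<^sub>R a"
    by (rule l2_eqI)
      (use rep_scaleR'[of "r + t" a] rep_add'[of "r *\<^sub>R a" "t *\<^sub>R a"] rep_scaleR'[of r a]
        rep_scaleR'[of t a] in eventually_elim, auto simp: scaleR_add_left)
  show "r *\<^sub>R t *\<^sub>R a = (r * t) *\<^sub>R a"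
    by (rule l2_eqI)
      (use rep_scaleR'[of r "t *\<^sub>R a"] rep_scaleR'[of t a] rep_scaleR'[of "r * t" a] in eventually_elim, auto)
  show "1 *\<^sub>R a = a"
    by (rule l2_eqI) (use rep_scaleR'[of 1 a] in eventually_elim, auto)
qed
end

lemmas rep_zero = rep_zero' and rep_add = rep_add' and rep_uminus = rep_uminus'
  and rep_diff = rep_diff' and rep_scaleR = rep_scaleR'

lemma l2_of_add: "sq f \<Longrightarrow> sq g \<Longrightarrow> l2_of f + l2_of g = l2_of (\<lambda>x. f x + g x)"
  unfolding plus_l2_def by (intro l2_of_eq_iff[THEN iffD2] sq_add sq_rep)
    (use rep_l2_of[of f] rep_l2_of[of g] in \<open>auto elim: eventually_elim2\<close>)
lemma l2_of_diff: "sq f \<Longrightarrow> sq g \<Longrightarrow> l2_of f - l2_of g = l2_of (\<lambda>x. f x - g x)"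
  unfolding minus_l2_def by (intro l2_of_eq_iff[THEN iffD2] sq_diff sq_rep)
    (use rep_l2_of[of f] rep_l2_of[of g] in \<open>auto elim: eventually_elim2\<close>)
lemma l2_of_scaleR: "sq f \<Longrightarrow> c *\<^sub>R l2_of f = l2_of (\<lambda>x. c *\<^sub>R f x)"
  unfolding scaleR_l2_def by (intro l2_of_eq_iff[THEN iffD2] sq_scaleR sq_rep)
    (use rep_l2_of[of f] in \<open>auto elim: eventually_mono\<close>)

lemma integrable_inner_rep: "integrable lborel (\<lambda>x. rep u x * cnj (rep v x))"
  by (intro sq_integrable_mult sq_cnj sq_rep)

instantiation l2 :: real_inner
begin
text \<open>The real part of the Hermitian product: the space is a real Hilbert space, and complex
  factors act on it as multipliers. For transforms of real functions the Hermitian product is itself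
  real.\<close>

definition inner_l2 :: "l2 \<Rightarrow> l2 \<Rightarrow> real" where
  "inner_l2 u v = (LINT x|lborel. Re (rep u x * cnj (rep v x)))"
definition norm_l2 :: "l2 \<Rightarrow> real" where
  "norm_l2 u = sqrt (inner u u)"
definition sgn_l2 :: "l2 \<Rightarrow> l2" where
  "sgn_l2 u = u /\<^sub>R norm u"
definition dist_l2 :: "l2 \<Rightarrow> l2 \<Rightarrow> real" where
  "dist_l2 u v = norm (u - v)"
definition uniformity_l2 :: "(l2 \<times> l2) filter" where
  "uniformity_l2 = (INF e\<in>{0 <..}. principal {(x, y). dist x y < e})"
definition open_l2 :: "l2 set \<Rightarrow> bool" where
  "open_l2 U \<longleftrightarrow> (\<forall>x\<in>U. \<forall>\<^sub>F (x', y) in uniformity. x' = x \<longrightarrow> y \<in> U)"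
instance
proof
  fix a b c :: l2 and r :: real and U :: "l2 set"
  have int: "integrable lborel (\<lambda>x. Re (rep u x * cnj (rep v x)))" for u v
    by (rule integrable_Re[OF integrable_inner_rep])
  show "dist a b = norm (a - b)" by (rule dist_l2_def)
  show "sgn a = a /\<^sub>R norm a" by (rule sgn_l2_def)
  show "(uniformity :: (l2 \<times> l2) filter) = (INF e\<in>{0 <..}. principal {(x, y). dist x y < e})"
    by (rule uniformity_l2_def)
  show "open U \<longleftrightarrow> (\<forall>x\<in>U. \<forall>\<^sub>F (x', y) in uniformity. x' = x \<longrightarrow> y \<in> U)"
    by (rule open_l2_def)
  show "inner a b = inner b a"
    unfolding inner_l2_def by (rule Bochner_Integration.integral_cong) (auto simp: algebra_simps)
  show "inner (a + b) c = inner a c + inner b c"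
  proof -
    have "inner (a + b) c = (LINT x|lborel. Re (rep a x * cnj (rep c x)) + Re (rep b x * cnj (rep c x)))"
      unfolding inner_l2_def
      by (rule integral_cong_AE) (measurable, use rep_add[of a b] in eventually_elim, simp add: algebra_simps)
    then show ?thesis using int by (simp add: inner_l2_def)
  qed
  show "inner (r *\<^sub>R a) b = r * inner a b"
  proof -
    have "inner (r *\<^sub>R a) b = (LINT x|lborel. r * Re (rep a x * cnj (rep b x)))"
      unfolding inner_l2_def
      by (rule integral_cong_AE) (measurable, use rep_scaleR[of r a] in eventually_elim, simp add: algebra_simps)
    then show ?thesis using int by (simp add: inner_l2_def)
  qed
  have sqr: "Re (z * cnj z) = (cmod z)\<^sup>2" for z
    by (metis Re_complex_of_real complex_norm_square)
  show "0 \<le> inner a a"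
    unfolding inner_l2_def sqr by (rule integral_nonneg_AE) simp
  show "inner a a = 0 \<longleftrightarrow> a = 0"
  proof -
    have "inner a a = 0 \<longleftrightarrow> (AE x in lborel. (cmod (rep a x))\<^sup>2 = 0)"
      unfolding inner_l2_def sqr
      by (rule integral_nonneg_eq_0_iff_AE) (auto intro: sq_integrable)
    also have "\<dots> \<longleftrightarrow> (AE x in lborel. rep a x = 0)" by simp
    also have "\<dots> \<longleftrightarrow> l2_of (rep a) = l2_of (\<lambda>_. 0)" by (subst l2_of_eq_iff) auto
    finally show ?thesis by (simp add: zero_l2_def)
  qed
  show "norm a = sqrt (inner a a)" by (rule norm_l2_def)
qed
end

lemma inner_l2_of:
  assumes "sq f" "sq g"
  shows "inner (l2_of f) (l2_of g) = (LINT x|lborel. Re (f x * cnj (g x)))"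
proof -
  have [measurable]: "f \<in> borel_measurable lborel" "g \<in> borel_measurable lborel"
    using assms by (auto simp: sq_def)
  show ?thesis unfolding inner_l2_def
    by (rule integral_cong_AE) (measurable, use rep_l2_of[OF assms(1)] rep_l2_of[OF assms(2)] in eventually_elim, simp)
qed

lemma Re_mult_cnj_self: "Re (z * cnj z) = (cmod z)\<^sup>2"
  by (metis Re_complex_of_real complex_norm_square)

lemma norm_l2_sq: "(norm u)\<^sup>2 = (LINT x|lborel. (cmod (rep u x))\<^sup>2)"
  by (simp add: power2_norm_eq_inner inner_l2_def Re_mult_cnj_self del: times_complex.sel)

lemma norm_l2_of_sq: "sq f \<Longrightarrow> (norm (l2_of f))\<^sup>2 = (LINT x|lborel. (cmod (f x))\<^sup>2)"
  by (simp add: power2_norm_eq_inner inner_l2_of Re_mult_cnj_self del: times_complex.sel)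

lemma nn_norm_l2_of: "sq f \<Longrightarrow> (\<integral>\<^sup>+x. ennreal ((cmod (f x))\<^sup>2) \<partial>lborel) = ennreal ((norm (l2_of f))\<^sup>2)"
  unfolding norm_l2_of_sq by (intro nn_integral_eq_integral sq_integrable) auto

lemma nn_norm_l2_of_diff:
  assumes "sq f"
  shows "(\<integral>\<^sup>+x. ennreal ((cmod (rep u x - f x))\<^sup>2) \<partial>lborel) = ennreal ((norm (u - l2_of f))\<^sup>2)"
proof -
  have [measurable]: "f \<in> borel_measurable lborel" using assms by (rule sq_measurable)
  have "u - l2_of f = l2_of (\<lambda>x. rep u x - f x)" using l2_of_diff[of "rep u" f] assms by simp
  then show ?thesis using nn_norm_l2_of[of "\<lambda>x. rep u x - f x"] assms by (simp add: sq_diff)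
qed

lemma sqI_nn:
  assumes "f \<in> borel_measurable lborel" "(\<integral>\<^sup>+x. ennreal ((cmod (f x))\<^sup>2) \<partial>lborel) < \<infinity>"
  shows "sq f"
  unfolding sq_def
  by (intro conjI integrableI_bounded) (use assms in auto)

text \<open>The form in which Fatou's lemma and Tonelli's theorem deliver estimates: square
  integrability is part of the conclusion.\<close>

lemma norm_l2_of_le:
  assumes [measurable]: "f \<in> borel_measurable lborel"
    and "(\<integral>\<^sup>+x. ennreal ((cmod (f x))\<^sup>2) \<partial>lborel) \<le> ennreal (C\<^sup>2)" "C \<ge> 0"
  shows "sq f" "norm (l2_of f) \<le> C"
proof -
  show f: "sq f" using assms by (intro sqI_nn) (auto intro: le_less_trans)
  have "ennreal ((norm (l2_of f))\<^sup>2) \<le> ennreal (C\<^sup>2)" using assms nn_norm_l2_of[OF f] by simp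
  then have "(norm (l2_of f))\<^sup>2 \<le> C\<^sup>2" by (simp add: ennreal_le_iff)
  then show "norm (l2_of f) \<le> C" using assms(3) by (rule power2_le_imp_le)
qed

lemma integrable_inverse_one_plus_square: "integrable lborel (\<lambda>x::real. inverse (1 + x\<^sup>2))"
  using integrable_inverse_1_plus_square by (simp add: set_integrable_def)

lemma norm_l2_of_cmod: "sq f \<Longrightarrow> sq (\<lambda>x. of_real (cmod (f x)))" "sq f \<Longrightarrow> norm (l2_of (\<lambda>x. of_real (cmod (f x)))) = norm (l2_of f)"
proof -
  assume f: "sq f"
  then have [measurable]: "f \<in> borel_measurable lborel" by (rule sq_measurable)
  show sq: "sq (\<lambda>x. of_real (cmod (f x)))" by (rule sq_dominated[OF f, where C = 1]) auto
  have "(norm (l2_of (\<lambda>x. of_real (cmod (f x)))))\<^sup>2 = (norm (l2_of f))\<^sup>2"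
    unfolding norm_l2_of_sq[OF f] norm_l2_of_sq[OF sq] by simp
  then show "norm (l2_of (\<lambda>x. of_real (cmod (f x)))) = norm (l2_of f)" by simp
qed

lemma cauchy_schwarz_l2_of:
  assumes "sq f" "sq g"
  shows "(LINT x|lborel. cmod (f x * g x)) \<le> norm (l2_of f) * norm (l2_of g)"
proof -
  have "(LINT x|lborel. cmod (f x * g x)) = inner (l2_of (\<lambda>x. of_real (cmod (f x)))) (l2_of (\<lambda>x. of_real (cmod (g x))))"
    using norm_l2_of_cmod assms by (subst inner_l2_of) (auto simp: norm_mult)
  also have "\<dots> \<le> norm (l2_of f) * norm (l2_of g)"
    using norm_cauchy_schwarz[of "l2_of (\<lambda>x. of_real (cmod (f x)))" "l2_of (\<lambda>x. of_real (cmod (g x)))"] assms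
    by (simp add: norm_l2_of_cmod)
  finally show ?thesis .
qed

section \<open>Completeness of the space\<close>

lemma sq_std_normal: "sq (\<lambda>x. of_real (std_normal_density x))"
  unfolding sq_def
proof
  show "integrable lborel (\<lambda>x. (cmod (of_real (std_normal_density x)))\<^sup>2)"
  proof (rule Bochner_Integration.integrable_bound[OF integrable_normal_density[of 1 0]])
    show "AE x in lborel. norm ((cmod (of_real (std_normal_density x)))\<^sup>2) \<le> norm (std_normal_density x)"
    proof (rule AE_I2)
      fix x
      have "sqrt (2 * pi) \<ge> 1" using pi_gt3 by (simp add: real_le_rsqrt)
      then have "1 / sqrt (2 * pi) * exp (- x\<^sup>2 / 2) \<le> 1 * 1"
        by (intro mult_mono) auto
      then have "std_normal_density x \<le> 1" by (simp add: std_normal_density_def)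
      moreover have "0 \<le> std_normal_density x" by simp
      ultimately have "(std_normal_density x)\<^sup>2 \<le> std_normal_density x"
        by (simp add: power2_eq_square mult_left_le)
      then show "norm ((cmod (of_real (std_normal_density x)))\<^sup>2) \<le> norm (std_normal_density x)" by simp
    qed
  qed simp_all
qed simp

text \<open>Riesz-Fischer. The Gaussian weight \<open>w\<close> is square integrable, so by
  Cauchy-Schwarz the increments times \<open>w\<close> have L^1 norms bounded by a geometric series
  and are summable almost everywhere. As \<open>w\<close> has no zero, it can be divided
  out.\<close>

lemma l2_limit_sequence:
  assumes "\<And>n. norm (X (Suc n) - X n) \<le> (1/2) ^ n"
  shows "\<exists>f. f \<in> borel_measurable lborel \<and> (AE x in lborel. (\<lambda>n. rep (X n) x) \<longlonglongrightarrow> f x)"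
proof -
  define w :: "real \<Rightarrow> complex" where "w = (\<lambda>x. of_real (std_normal_density x))"
  have w: "sq w" unfolding w_def by (rule sq_std_normal)
  have [measurable]: "w \<in> borel_measurable lborel" using w by (rule sq_measurable)
  define d where "d n x = cmod ((rep (X (Suc n)) x - rep (X n) x) * w x)" for n x
  have [measurable]: "d n \<in> borel_measurable lborel" for n unfolding d_def by measurable
  have sd: "sq (\<lambda>x. rep (X (Suc n)) x - rep (X n) x)" for n by (intro sq_diff sq_rep)
  have nn: "(\<integral>\<^sup>+x. ennreal (d n x) \<partial>lborel) \<le> ennreal ((1/2) ^ n * norm (l2_of w))" for n
  proof -
    have "(\<integral>\<^sup>+x. ennreal (d n x) \<partial>lborel) = ennreal (LINT x|lborel. d n x)"
      unfolding d_def by (intro nn_integral_eq_integral integrable_norm sq_integrable_mult sd w) auto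
    also have "\<dots> \<le> ennreal (norm (X (Suc n) - X n) * norm (l2_of w))"
      unfolding d_def using cauchy_schwarz_l2_of[OF sd w, of n] by (intro ennreal_leI) (simp add: minus_l2_def)
    also have "\<dots> \<le> ennreal ((1/2) ^ n * norm (l2_of w))"
      using assms by (intro ennreal_leI mult_right_mono) auto
    finally show ?thesis .
  qed
  have "(\<integral>\<^sup>+x. (\<Sum>n. ennreal (d n x)) \<partial>lborel) = (\<Sum>n. \<integral>\<^sup>+x. ennreal (d n x) \<partial>lborel)"
    by (rule nn_integral_suminf) measurable
  also have "\<dots> \<le> (\<Sum>n. ennreal ((1/2) ^ n * norm (l2_of w)))"
    by (rule suminf_le) (use nn in auto)
  also have "\<dots> = ennreal (\<Sum>n. (1/2) ^ n * norm (l2_of w))"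
    by (rule suminf_ennreal2) (auto intro!: summable_mult2 summable_geometric)
  also have "\<dots> < \<infinity>" by simp
  finally have "AE x in lborel. (\<Sum>n. ennreal (d n x)) \<noteq> \<infinity>"
    by (intro nn_integral_PInf_AE) (auto simp: less_top)
  then have AE: "AE x in lborel. convergent (\<lambda>n. rep (X n) x)"
  proof eventually_elim
    case (elim x)
    have "summable (\<lambda>n. d n x)"
      by (rule summable_suminf_not_top) (use elim in \<open>auto simp: d_def\<close>)
    then have "summable (\<lambda>n. cmod (rep (X (Suc n)) x - rep (X n) x) * cmod (w x))"
      by (simp add: d_def norm_mult)
    note s = summable_mult2[OF this, of "inverse (cmod (w x))"]
    have "cmod (w x) * inverse (cmod (w x)) = 1"
      by (rule right_inverse) (simp add: w_def normal_density_def)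
    with s have "summable (\<lambda>n. cmod (rep (X (Suc n)) x - rep (X n) x))"
      by (simp only: mult.assoc mult_1_right)
    then have "summable (\<lambda>n. rep (X (Suc n)) x - rep (X n) x)" by (rule summable_norm_cancel)
    then show ?case
      unfolding summable_iff_convergent sum_lessThan_telescope[of "\<lambda>n. rep (X n) x"] by (simp add: convergent_diff_const_right_iff)
  qed
  show ?thesis
  proof (intro exI conjI)
    show "(\<lambda>x. lim (\<lambda>n. rep (X n) x)) \<in> borel_measurable lborel" by measurable
    show "AE x in lborel. (\<lambda>n. rep (X n) x) \<longlonglongrightarrow> lim (\<lambda>n. rep (X n) x)"
      using AE by eventually_elim (simp add: convergent_LIMSEQ_iff)
  qed
qed

text \<open>Fatou's lemma carries the bound for the tail of the sequence over to its pointwise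
  limit.\<close>

lemma l2_complete_aux:
  assumes [measurable]: "f \<in> borel_measurable lborel" and lim: "AE x in lborel. (\<lambda>n. rep (X n) x) \<longlonglongrightarrow> f x"
    and C: "\<And>n. n \<ge> N \<Longrightarrow> norm (X n - u) \<le> e" "e \<ge> 0"
  shows "sq f \<and> norm (l2_of f - u) \<le> e"
proof -
  define g where "g n x = ennreal ((cmod (rep (X n) x - rep u x))\<^sup>2)" for n x
  have [measurable]: "g n \<in> borel_measurable lborel" for n unfolding g_def by measurable
  have gn: "(\<integral>\<^sup>+x. g n x \<partial>lborel) = ennreal ((norm (X n - u))\<^sup>2)" for n
    unfolding g_def using nn_norm_l2_of_diff[of "rep u" "X n"] by simp
  have "(\<integral>\<^sup>+x. ennreal ((cmod (f x - rep u x))\<^sup>2) \<partial>lborel) = (\<integral>\<^sup>+x. liminf (\<lambda>n. g n x) \<partial>lborel)"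
  proof (rule nn_integral_cong_AE, use lim in eventually_elim)
    case (elim x)
    have "(\<lambda>n. g n x) \<longlonglongrightarrow> ennreal ((cmod (f x - rep u x))\<^sup>2)"
      unfolding g_def by (intro tendsto_intros elim tendsto_ennrealI)
    then show ?case by (simp add: lim_imp_Liminf)
  qed
  also have "\<dots> \<le> liminf (\<lambda>n. \<integral>\<^sup>+x. g n x \<partial>lborel)" by (rule nn_integral_liminf) simp
  also have "\<dots> \<le> ennreal (e\<^sup>2)"
  proof (rule Liminf_le)
    show "\<forall>\<^sub>F n in sequentially. integral\<^sup>N lborel (g n) \<le> ennreal (e\<^sup>2)"
      using eventually_ge_at_top[of N]
      by eventually_elim (simp add: gn C power_mono ennreal_leI)
  qed simp
  finally have *: "(\<integral>\<^sup>+x. ennreal ((cmod (f x - rep u x))\<^sup>2) \<partial>lborel) \<le> ennreal (e\<^sup>2)" .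
  then have sq: "sq (\<lambda>x. f x - rep u x)" "norm (l2_of (\<lambda>x. f x - rep u x)) \<le> e"
    using norm_l2_of_le[of "\<lambda>x. f x - rep u x" e] C by auto
  have "sq f" using sq_add[OF sq(1) sq_rep[of u]] by simp
  then show ?thesis using sq l2_of_diff[of f "rep u"] by simp
qed

instance l2 :: complete_space
proof
  fix X :: "nat \<Rightarrow> l2" assume X: "Cauchy X"
  have "\<exists>M. \<forall>m\<ge>M. \<forall>k\<ge>M. norm (X m - X k) < (1/2) ^ n" for n
    using CauchyD[OF X, of "(1/2) ^ n"] by simp
  then obtain M where M: "\<And>n m k. m \<ge> M n \<Longrightarrow> k \<ge> M n \<Longrightarrow> norm (X m - X k) < (1/2) ^ n"
    by metis
  \<comment> \<open>Strictly increasing indices with \<open>M n \<le> r n\<close>, so that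
    consecutive members of the subsequence differ by less than \<open>(1/2) ^ n\<close>.\<close>
  define r where "r = rec_nat (M 0) (\<lambda>n rn. max (Suc rn) (M (Suc n)))"
  have r: "r (Suc n) = max (Suc (r n)) (M (Suc n))" "r 0 = M 0" for n by (simp_all add: r_def)
  have mono: "strict_mono r" by (rule strict_mono_Suc_iff[THEN iffD2]) (simp add: r less_max_iff_disj)
  have rM: "r n \<ge> M n" for n by (cases n) (auto simp: r)
  have rM': "r m \<ge> M n" if "m \<ge> n" for m n
    using rM[of n] strict_mono_less_eq[OF mono, of n m] that by linarith
  define Y where "Y n = X (r n)" for n
  have "norm (Y (Suc n) - Y n) \<le> (1/2) ^ n" for n
    unfolding Y_def using M[OF rM'[of n "Suc n"] rM'[of n n]] by simp
  from l2_limit_sequence[of Y, OF this] obtain f where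
    f: "f \<in> borel_measurable lborel" "AE x in lborel. (\<lambda>n. rep (Y n) x) \<longlonglongrightarrow> f x" by blast
  have *: "sq f \<and> norm (l2_of f - Y n) \<le> (1/2) ^ n" for n
    using f by (rule l2_complete_aux[where N = n and e = "(1/2) ^ n"])
      (use M[OF rM'[of n] rM'[of n n]] in \<open>auto simp: Y_def less_imp_le\<close>)
  have "(\<lambda>n. Y n - l2_of f) \<longlonglongrightarrow> 0"
  proof (rule tendsto_norm_zero_cancel, rule tendsto_sandwich[OF _ _ tendsto_const])
    show "(\<lambda>n. (1/2) ^ n :: real) \<longlonglongrightarrow> 0" by (rule LIMSEQ_power_zero) simp
  qed (use * in \<open>auto simp: norm_minus_commute\<close>)
  then have "(X \<circ> r) \<longlonglongrightarrow> l2_of f"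
    using LIM_zero_cancel by (fastforce simp: Y_def o_def)
  then show "convergent X" using Cauchy_converges_subseq[OF X mono] by (auto simp: convergent_def)
qed

instance l2 :: banach ..

section \<open>The Fourier integral\<close>

definition fourier_int :: "(real \<Rightarrow> complex) \<Rightarrow> real \<Rightarrow> complex" where
  "fourier_int f k = of_real (1 / sqrt (2 * pi)) * (LINT x|lborel. f x * cis (- (k * x)))"

text \<open>With the factor \<open>1 / sqrt (2 * pi)\<close> the unitary Fourier transform exchanges
  products and convolutions without any further constant.\<close>

definition convol :: "(real \<Rightarrow> complex) \<Rightarrow> (real \<Rightarrow> complex) \<Rightarrow> real \<Rightarrow> complex" where
  "convol f g k = of_real (1 / sqrt (2 * pi)) * (LINT l|lborel. f (k - l) * g l)"

lemma measurable_cis [measurable]: "cis \<in> borel_measurable borel"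
  by (intro borel_measurable_continuous_onI continuous_on_cis continuous_on_id)

lemma fourier_int_measurable [measurable]:
  assumes [measurable]: "f \<in> borel_measurable borel"
  shows "fourier_int f \<in> borel_measurable borel"
  unfolding fourier_int_def by measurable

lemma convol_measurable [measurable]:
  assumes [measurable]: "f \<in> borel_measurable borel" "g \<in> borel_measurable borel"
  shows "convol f g \<in> borel_measurable borel"
  unfolding convol_def by measurable

lemma integrable_times_cis:
  assumes "integrable lborel f"
  shows "integrable lborel (\<lambda>x. f x * cis (c * x))" "integrable lborel (\<lambda>x. f x * cis (- (c * x)))"
proof -
  have [measurable]: "f \<in> borel_measurable lborel" using assms by simp
  show "integrable lborel (\<lambda>x. f x * cis (c * x))" "integrable lborel (\<lambda>x. f x * cis (- (c * x)))"
    by (rule Bochner_Integration.integrable_bound[OF assms], measurable, simp add: norm_mult)+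
qed

lemma fourier_int_add: "integrable lborel f \<Longrightarrow> integrable lborel g \<Longrightarrow> fourier_int (\<lambda>x. f x + g x) k = fourier_int f k + fourier_int g k"
  unfolding fourier_int_def using integrable_times_cis[of f k] integrable_times_cis[of g k] by (simp add: algebra_simps)

lemma fourier_int_diff: "integrable lborel f \<Longrightarrow> integrable lborel g \<Longrightarrow> fourier_int (\<lambda>x. f x - g x) k = fourier_int f k - fourier_int g k"
  unfolding fourier_int_def using integrable_times_cis[of f k] integrable_times_cis[of g k] by (simp add: algebra_simps)

lemma fourier_int_cmult: "fourier_int (\<lambda>x. c * f x) k = c * fourier_int f k"
  by (simp add: fourier_int_def mult.assoc)

text \<open>Convolutions are defined at every point, yet depend only on the classes of the factors:
  reflection and translation preserve null sets.\<close>

lemma convol_cong_AE: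
  assumes f: "AE x in lborel. f x = f' x" and g: "AE x in lborel. g x = g' x"
    and [measurable]: "f \<in> borel_measurable borel" "f' \<in> borel_measurable borel"
     "g \<in> borel_measurable borel" "g' \<in> borel_measurable borel"
  shows "convol f g k = convol f' g' k"
proof -
  have "AE x in distr lborel borel (\<lambda>x. k + (-1) * x). f x = f' x"
  proof -
    have "lborel = density (distr lborel borel (\<lambda>x. k + (-1) * x)) (\<lambda>_. ennreal 1)"
      using lborel_real_affine[of "-1" k] by simp
    then have "lborel = distr lborel borel (\<lambda>x. k + (-1::real) * x)" by (simp add: density_1)
    then show ?thesis using f by metis
  qed
  then have "AE x in lborel. f (k - x) = f' (k - x)"
    by (subst (asm) AE_distr_iff) auto
  then show ?thesis
    unfolding convol_def by (intro arg_cong2[where f = "(*)"] refl integral_cong_AE)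
      (measurable, use g in \<open>auto elim: eventually_elim2\<close>)
qed

lemma convol_commute: "convol f g k = convol g f k"
proof -
  have "(LINT l|lborel. f (k - l) * g l) = (LINT l|lborel. f l * g (k - l))"
    by (subst lborel_integral_real_affine[where c = "-1" and t = k]) auto
  then show ?thesis by (simp add: convol_def mult.commute)
qed

lemma fourier_int_bound: "cmod (fourier_int f k) \<le> 1 / sqrt (2 * pi) * (LINT x|lborel. cmod (f x))"
proof -
  have "cmod (LINT x|lborel. f x * cis (- (k * x))) \<le> (LINT x|lborel. cmod (f x * cis (- (k * x))))"
    by (rule integral_norm_bound)
  then show ?thesis by (simp add: fourier_int_def norm_mult norm_divide divide_right_mono)
qed

lemma integrable_pair_bound:
  fixes h :: "real \<times> real \<Rightarrow> complex"
  assumes [measurable]: "h \<in> borel_measurable (borel \<Otimes>\<^sub>M borel)"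
    and f: "integrable lborel f" and g: "integrable lborel g"
    and b: "\<And>x y. cmod (h (x, y)) \<le> cmod (f x) * cmod (g y)"
  shows "integrable (lborel \<Otimes>\<^sub>M lborel) h"
proof (rule integrableI_bounded)
  have [measurable]: "f \<in> borel_measurable borel" "g \<in> borel_measurable borel" using f g by auto
  show "h \<in> borel_measurable (lborel \<Otimes>\<^sub>M lborel)" by measurable
  have "(\<integral>\<^sup>+x. ennreal (cmod (h x)) \<partial>(lborel \<Otimes>\<^sub>M lborel)) \<le> (\<integral>\<^sup>+x. ennreal (cmod (f (fst x))) * ennreal (cmod (g (snd x))) \<partial>(lborel \<Otimes>\<^sub>M lborel))"
    by (intro nn_integral_mono) (use b in \<open>auto simp: ennreal_mult[symmetric] intro!: ennreal_leI\<close>)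
  also have "\<dots> = (\<integral>\<^sup>+x. \<integral>\<^sup>+y. ennreal (cmod (f x)) * ennreal (cmod (g y)) \<partial>lborel \<partial>lborel)"
    by (subst lborel.nn_integral_fst[symmetric]) auto
  also have "\<dots> = (\<integral>\<^sup>+x. ennreal (cmod (f x)) \<partial>lborel) * (\<integral>\<^sup>+y. ennreal (cmod (g y)) \<partial>lborel)"
    by (simp add: nn_integral_cmult nn_integral_multc)
  also have "\<dots> < \<infinity>"
    using f g by (auto simp: integrable_iff_bounded intro: ennreal_mult_less_top[THEN iffD2])
  finally show "(\<integral>\<^sup>+x. ennreal (cmod (h x)) \<partial>(lborel \<Otimes>\<^sub>M lborel)) < \<infinity>" .
qed

text \<open>The multiplication formula: the kernel is symmetric in the two variables and Fubini's
  theorem applies. It is the source both of Plancherel's identity and of the adjoint of the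
  transform.\<close>

lemma fourier_int_mult:
  assumes f: "integrable lborel f" and g: "integrable lborel g"
  shows "(LINT k|lborel. fourier_int f k * g k) = (LINT x|lborel. f x * fourier_int g x)"
proof -
  have [measurable]: "f \<in> borel_measurable borel" "g \<in> borel_measurable borel" using f g by auto
  have int: "integrable (lborel \<Otimes>\<^sub>M lborel) (\<lambda>(x, k). f x * g k * cis (- (k * x)))"
    by (rule integrable_pair_bound[OF _ f g]) (auto simp: norm_mult)
  have "(LINT k|lborel. fourier_int f k * g k) = of_real (1 / sqrt (2 * pi)) * (LINT k|lborel. LINT x|lborel. f x * g k * cis (- (k * x)))"
    unfolding fourier_int_def integral_mult_right_zero[symmetric] integral_mult_left_zero[symmetric]
    by (intro Bochner_Integration.integral_cong refl) (simp add: ac_simps)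
  also have "\<dots> = of_real (1 / sqrt (2 * pi)) * (LINT x|lborel. LINT k|lborel. f x * g k * cis (- (k * x)))"
    using lborel_pair.Fubini_integral[OF int] by simp
  also have "\<dots> = (LINT x|lborel. f x * fourier_int g x)"
    unfolding fourier_int_def integral_mult_right_zero[symmetric] integral_mult_left_zero[symmetric]
    by (intro Bochner_Integration.integral_cong refl) (simp add: ac_simps)
  finally show ?thesis .
qed

lemma integrable_wconv_pair:
  fixes f g :: "real \<Rightarrow> complex"
  assumes f: "integrable lborel f" and g: "integrable lborel g"
  shows "integrable (lborel \<Otimes>\<^sub>M lborel) (\<lambda>(l, k). f (k - l) * g l :: complex)"
proof (rule integrableI_bounded)
  have [measurable]: "f \<in> borel_measurable borel" "g \<in> borel_measurable borel" using f g by auto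
  show "(\<lambda>(l, k). f (k - l) * g l) \<in> borel_measurable (lborel \<Otimes>\<^sub>M lborel)" by measurable
  have *: "(\<integral>\<^sup>+k. ennreal (cmod (f (k - l))) \<partial>lborel) = (\<integral>\<^sup>+k. ennreal (cmod (f k)) \<partial>lborel)" for l :: real
    by (subst nn_integral_real_affine[where c = 1 and t = "-l"]) auto
  have "(\<integral>\<^sup>+x. ennreal (cmod (case x of (l, k) \<Rightarrow> f (k - l) * g l)) \<partial>(lborel \<Otimes>\<^sub>M lborel))
      = (\<integral>\<^sup>+l. \<integral>\<^sup>+k. ennreal (cmod (g l)) * ennreal (cmod (f (k - l))) \<partial>lborel \<partial>lborel)"
    by (subst lborel.nn_integral_fst[symmetric]) (auto simp: norm_mult ennreal_mult mult.commute)
  also have "\<dots> = (\<integral>\<^sup>+x. ennreal (cmod (g x)) \<partial>lborel) * (\<integral>\<^sup>+y. ennreal (cmod (f y)) \<partial>lborel)"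
    by (simp add: nn_integral_cmult nn_integral_multc *)
  also have "\<dots> < \<infinity>"
    using f g by (auto simp: integrable_iff_bounded intro: ennreal_mult_less_top[THEN iffD2])
  finally show "(\<integral>\<^sup>+x. ennreal (cmod (case x of (l, k) \<Rightarrow> f (k - l) * g l)) \<partial>(lborel \<Otimes>\<^sub>M lborel)) < \<infinity>" .
qed

lemma convol_integrable: "integrable lborel f \<Longrightarrow> integrable lborel g \<Longrightarrow> integrable lborel (convol f g)"
  using lborel_pair.integrable_snd[OF integrable_wconv_pair[of f g]] by (auto simp: convol_def[abs_def] intro: integrable_mult_right)

lemma fourier_int_convol:
  assumes f: "integrable lborel f" and g: "integrable lborel g"
  shows "fourier_int (convol f g) k = fourier_int f k * fourier_int g k"
proof -
  have [measurable]: "f \<in> borel_measurable borel" "g \<in> borel_measurable borel" using f g by auto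
  let ?h = "\<lambda>l x. f (x - l) * g l * cis (- (k * x))"
  have int: "integrable (lborel \<Otimes>\<^sub>M lborel) (\<lambda>(l, x). ?h l x)"
    by (rule Bochner_Integration.integrable_bound[OF integrable_wconv_pair[OF f g]])
      (auto simp: norm_mult)
  have cis_eq: "cis (- (k * (l + x))) = cis (- (k * x)) * cis (- (k * l))" for l x
    unfolding cis_mult by (rule arg_cong[where f = cis]) (simp add: algebra_simps)
  have inner: "(LINT x|lborel. ?h l x) = (LINT x|lborel. f x * cis (- (k * x))) * (g l * cis (- (k * l)))" for l
  proof -
    have "(LINT x|lborel. ?h l x) = (LINT x|lborel. f x * g l * cis (- (k * (l + x))))"
      by (subst lborel_integral_real_affine[where c = 1 and t = l]) auto
    also have "\<dots> = (LINT x|lborel. (f x * cis (- (k * x))) * (g l * cis (- (k * l))))"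
      unfolding cis_eq
      by (intro Bochner_Integration.integral_cong refl) (simp add: ac_simps)
    finally show ?thesis by simp
  qed
  have "fourier_int (convol f g) k = of_real (1 / sqrt (2 * pi)) * (of_real (1 / sqrt (2 * pi)) * (LINT x|lborel. LINT l|lborel. ?h l x))"
    unfolding fourier_int_def convol_def integral_mult_right_zero[symmetric] integral_mult_left_zero[symmetric]
    by (intro Bochner_Integration.integral_cong refl) (simp add: ac_simps flip: integral_mult_right_zero)
  also have "(LINT x|lborel. LINT l|lborel. ?h l x) = (LINT l|lborel. LINT x|lborel. ?h l x)"
    by (rule lborel_pair.Fubini_integral[OF int])
  also have "\<dots> = (LINT x|lborel. f x * cis (- (k * x))) * (LINT x|lborel. g x * cis (- (k * x)))"
    unfolding inner by simp
  finally show ?thesis by (simp add: fourier_int_def)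
qed

section \<open>Plancherel's identity by Gaussian regularization\<close>

definition gauss :: "real \<Rightarrow> real \<Rightarrow> complex" where
  "gauss d k = of_real (exp (- (d * k)\<^sup>2 / 2))"

lemma gauss_measurable [measurable]: "gauss d \<in> borel_measurable borel"
  unfolding gauss_def[abs_def] by measurable

lemma gauss_std_normal: "gauss 1 x = of_real (sqrt (2 * pi) * std_normal_density x)"
  by (simp add: gauss_def std_normal_density_def)

lemma integrable_gauss: "d > 0 \<Longrightarrow> integrable lborel (gauss d)"
proof -
  assume d: "d > 0"
  have "integrable lborel (\<lambda>x. of_real (sqrt (2 * pi) * std_normal_density x) :: complex)"
    by (intro integrable_of_real integrable_mult_right integrable_normal_density) simp
  then have "integrable lborel (gauss 1)" by (simp add: gauss_std_normal[abs_def])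
  then have "integrable lborel (\<lambda>x. gauss 1 (0 + d * x))"
    by (rule lborel_integrable_real_affine) (use d in simp)
  then show ?thesis by (simp add: gauss_def[abs_def])
qed

text \<open>The characteristic function of the standard normal distribution at
  \<open>- (z / d)\<close>; a substitution reduces every width \<open>d\<close> to the standard
  one.\<close>

lemma fourier_int_gauss:
  assumes d: "d > 0"
  shows "fourier_int (gauss d) z = of_real (1 / d) * gauss (1 / d) z"
proof -
  have "char std_normal_distribution (- (z / d)) = (CLINT x|lborel. std_normal_density x *\<^sub>R iexp (- (z / d) * x))"
    unfolding char_def by (subst integral_density) auto
  also have "\<dots> = (CLINT x|lborel. of_real (1 / sqrt (2 * pi)) * (gauss 1 x * cis (- (z / d * x))))"
    by (intro Bochner_Integration.integral_cong refl) (simp add: gauss_std_normal cis_conv_exp scaleR_conv_of_real)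
  finally have *: "of_real (1 / sqrt (2 * pi)) * (CLINT x|lborel. gauss 1 x * cis (- (z / d * x))) = gauss (1 / d) z"
    by (simp add: char_std_normal_distribution gauss_def)
  have "(CLINT x|lborel. gauss d x * cis (- (z * x))) = \<bar>1 / d\<bar> *\<^sub>R (CLINT x|lborel. gauss d (0 + 1 / d * x) * cis (- (z * (0 + 1 / d * x))))"
    by (rule lborel_integral_real_affine) (use d in simp)
  also have "\<dots> = of_real (1 / d) * (CLINT x|lborel. gauss 1 x * cis (- (z / d * x)))"
    using d by (simp add: gauss_def scaleR_conv_of_real)
  finally show ?thesis unfolding fourier_int_def using * by (simp add: algebra_simps)
qed

text \<open>The cross-correlation, up to a factor the convolution of \<open>f\<close> with the
  reflected conjugate of \<open>g\<close>. Its value at 0 is the Hermitian product.\<close>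

definition corr :: "(real \<Rightarrow> complex) \<Rightarrow> (real \<Rightarrow> complex) \<Rightarrow> real \<Rightarrow> complex" where
  "corr f g z = (LINT y|lborel. f (y + z) * cnj (g y))"

lemma corr_measurable [measurable]:
  assumes [measurable]: "f \<in> borel_measurable borel" "g \<in> borel_measurable borel"
  shows "corr f g \<in> borel_measurable borel"
  unfolding corr_def[abs_def] by measurable

lemma fourier_int_reflect_cnj: "fourier_int (\<lambda>y. cnj (g (- y))) k = cnj (fourier_int g k)"
proof -
  have "(LINT x|lborel. cnj (g (- x)) * cis (- (k * x))) = (LINT x|lborel. cnj (g x) * cis (k * x))"
    by (subst lborel_integral_real_affine[where c = "-1" and t = 0]) auto
  also have "\<dots> = cnj (LINT x|lborel. g x * cis (- (k * x)))"
    by (simp add: cis_cnj flip: Bochner_Integration.integral_cnj)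
  finally show ?thesis by (simp add: fourier_int_def)
qed

lemma integrable_reflect:
  fixes g :: "real \<Rightarrow> complex"
  shows "integrable lborel g \<Longrightarrow> integrable lborel (\<lambda>y. g (- y))"
  using lborel_integrable_real_affine[of g "-1" 0] by simp

text \<open>The Gaussian makes all integrals converge absolutely; letting \<open>d \<rightarrow> 0\<close> yields Plancherel's identity.\<close>

lemma plancherel_gauss:
  assumes f: "integrable lborel f" and g: "integrable lborel g" and d: "d > 0"
  shows "(LINT k|lborel. fourier_int f k * cnj (fourier_int g k) * gauss d k) = (LINT w|lborel. of_real (std_normal_density w) * corr f g (d * w))"
proof -
  have [measurable]: "f \<in> borel_measurable borel" "g \<in> borel_measurable borel" using f g by auto
  define h where "h = (\<lambda>y. cnj (g (- y)))"
  have h: "integrable lborel h" unfolding h_def using integrable_reflect[OF g] by simp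
  have c: "convol f h z = of_real (1 / sqrt (2 * pi)) * corr f g z" for z
  proof -
    have "(LINT l|lborel. f (z - l) * h l) = corr f g z"
      unfolding corr_def h_def
      by (subst lborel_integral_real_affine[where c = "-1" and t = 0]) (auto simp: add.commute)
    then show ?thesis by (simp add: convol_def)
  qed
  have "(LINT k|lborel. fourier_int f k * cnj (fourier_int g k) * gauss d k) = (LINT k|lborel. fourier_int (convol f h) k * gauss d k)"
    using fourier_int_convol[OF f h] by (simp add: h_def fourier_int_reflect_cnj)
  also have "\<dots> = (LINT z|lborel. convol f h z * fourier_int (gauss d) z)"
    by (intro fourier_int_mult convol_integrable f h integrable_gauss d)
  also have "\<dots> = (LINT z|lborel. of_real (1 / d) * (of_real (1 / sqrt (2 * pi)) * gauss (1 / d) z * corr f g z))"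
    by (simp add: fourier_int_gauss[OF d] c ac_simps)
  also have "\<dots> = \<bar>d\<bar> *\<^sub>R (LINT z|lborel. of_real (1 / d) * (of_real (1 / sqrt (2 * pi)) * gauss (1 / d) (0 + d * z) * corr f g (0 + d * z)))"
    by (rule lborel_integral_real_affine) (use d in simp)
  also have "\<dots> = (LINT w|lborel. of_real (std_normal_density w) * corr f g (d * w))"
    using d by (simp add: scaleR_conv_of_real gauss_def std_normal_density_def)
  finally show ?thesis .
qed

text \<open>The correlation of \<open>f\<close> with itself is bounded by the squared norm, hence so
  are its Gaussian averages, and Fatou's lemma removes the Gaussian. Equality is obtained later by
  duality with indicators of intervals, whose correlations are continuous at 0.\<close>

lemma fourier_int_sq_contraction:
  assumes f: "integrable lborel f" and sqf: "sq f"
  shows "sq (fourier_int f)" "norm (l2_of (fourier_int f)) \<le> norm (l2_of f)"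
proof -
  have fm [measurable]: "f \<in> borel_measurable borel" using f by auto
  let ?N = "(norm (l2_of f))\<^sup>2"
  have shift: "integrable lborel (\<lambda>y. (cmod (f (y + z)))\<^sup>2)" "(LINT y|lborel. (cmod (f (y + z)))\<^sup>2) = ?N" for z
    using lborel_integrable_real_affine[OF sq_integrable[OF sqf], of 1 z]
      lborel_integral_real_affine[of 1 "\<lambda>y. (cmod (f y))\<^sup>2" z] norm_l2_of_sq[OF sqf] by (simp_all add: add.commute)
  have corr: "cmod (corr f f z) \<le> ?N" for z
  proof -
    have "cmod (corr f f z) \<le> (LINT y|lborel. cmod (f (y + z) * cnj (f y)))"
      unfolding corr_def by (rule integral_norm_bound)
    also have "\<dots> \<le> (LINT y|lborel. ((cmod (f (y + z)))\<^sup>2 + (cmod (f (y + 0)))\<^sup>2) / 2)"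
    proof (rule integral_mono)
      have "sq (\<lambda>y. f (y + z))" unfolding sq_def using shift by auto
      then show "integrable lborel (\<lambda>y. cmod (f (y + z) * cnj (f y)))"
        by (intro integrable_norm sq_integrable_mult sq_cnj sqf)
      show "integrable lborel (\<lambda>y. ((cmod (f (y + z)))\<^sup>2 + (cmod (f (y + 0)))\<^sup>2) / 2)"
        using shift(1)[of z] shift(1)[of 0] by simp
      show "cmod (f (y + z) * cnj (f y)) \<le> ((cmod (f (y + z)))\<^sup>2 + (cmod (f (y + 0)))\<^sup>2) / 2" for y
        using sum_squares_bound[of "cmod (f (y + z))" "cmod (f y)"] by (simp add: norm_mult)
    qed
    also have "\<dots> = ?N"
      using shift(1)[of z] shift(1)[of 0] shift(2)[of z] shift(2)[of 0] by simp
    finally show ?thesis .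
  qed
  have cm: "cmod (gauss d k) = exp (- (d * k)\<^sup>2 / 2)" for d k by (simp add: gauss_def)
  have le: "(\<integral>\<^sup>+k. ennreal ((cmod (fourier_int f k))\<^sup>2 * exp (- (d * k)\<^sup>2 / 2)) \<partial>lborel) \<le> ennreal ?N" if d: "d > 0" for d
  proof -
    have eq: "fourier_int f k * cnj (fourier_int f k) * gauss d k = of_real ((cmod (fourier_int f k))\<^sup>2 * exp (- (d * k)\<^sup>2 / 2))" for k
      by (simp add: gauss_def complex_norm_square del: of_real_power flip: of_real_power)
    have bound: "(cmod (fourier_int f k))\<^sup>2 \<le> (1 / sqrt (2 * pi) * (LINT x|lborel. cmod (f x)))\<^sup>2" for k
      by (rule power_mono[OF fourier_int_bound]) simp
    have int: "integrable lborel (\<lambda>k. (cmod (fourier_int f k))\<^sup>2 * exp (- (d * k)\<^sup>2 / 2))"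
    proof (rule Bochner_Integration.integrable_bound)
      show "integrable lborel (\<lambda>k. (1 / sqrt (2 * pi) * (LINT x|lborel. cmod (f x)))\<^sup>2 * cmod (gauss d k))"
        by (intro integrable_mult_right integrable_norm integrable_gauss d)
      show "AE k in lborel. norm ((cmod (fourier_int f k))\<^sup>2 * exp (- (d * k)\<^sup>2 / 2))
          \<le> norm ((1 / sqrt (2 * pi) * (LINT x|lborel. cmod (f x)))\<^sup>2 * cmod (gauss d k))"
        by (intro AE_I2) (simp only: cm norm_mult real_norm_def abs_exp_cancel abs_power2 power2_abs abs_mult, intro mult_right_mono bound, simp)
    qed measurable
    have "of_real (LINT k|lborel. (cmod (fourier_int f k))\<^sup>2 * exp (- (d * k)\<^sup>2 / 2)) = (LINT k|lborel. fourier_int f k * cnj (fourier_int f k) * gauss d k)"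
      unfolding eq by (rule integral_complex_of_real[symmetric])
    also have "\<dots> = (LINT w|lborel. of_real (std_normal_density w) * corr f f (d * w))"
      by (rule plancherel_gauss[OF f f d])
    finally have "cmod (of_real (LINT k|lborel. (cmod (fourier_int f k))\<^sup>2 * exp (- (d * k)\<^sup>2 / 2)))
      = cmod (LINT w|lborel. of_real (std_normal_density w) * corr f f (d * w))" by simp
    also have "\<dots> \<le> (LINT w|lborel. cmod (of_real (std_normal_density w) * corr f f (d * w)))"
      by (rule integral_norm_bound)
    also have "\<dots> \<le> (LINT w|lborel. std_normal_density w * ?N)"
    proof (rule integral_mono)
      show int': "integrable lborel (\<lambda>w. std_normal_density w * ?N)" by simp
      have "cmod (of_real (std_normal_density w) * corr f f (d * w)) \<le> std_normal_density w * ?N" for w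
        using mult_left_mono[OF corr normal_density_nonneg] by (simp add: norm_mult)
      then show "cmod (of_real (std_normal_density w) * corr f f (d * w)) \<le> std_normal_density w * ?N" for w .
      then show "integrable lborel (\<lambda>w. cmod (of_real (std_normal_density w) * corr f f (d * w)))"
        by (intro Bochner_Integration.integrable_bound[OF int']) auto
    qed
    also have "\<dots> = ?N" by simp
    finally have "(LINT k|lborel. (cmod (fourier_int f k))\<^sup>2 * exp (- (d * k)\<^sup>2 / 2)) \<le> ?N"
      by simp
    then show ?thesis
      by (subst nn_integral_eq_integral[OF int]) (auto intro: ennreal_leI)
  qed
  have "(\<integral>\<^sup>+k. ennreal ((cmod (fourier_int f k))\<^sup>2) \<partial>lborel)
    = (\<integral>\<^sup>+k. liminf (\<lambda>n. ennreal ((cmod (fourier_int f k))\<^sup>2 * exp (- (inverse (real (Suc n)) * k)\<^sup>2 / 2))) \<partial>lborel)"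
  proof (rule nn_integral_cong)
    fix k
    have "(\<lambda>n. (cmod (fourier_int f k))\<^sup>2 * exp (- (inverse (real (Suc n)) * k)\<^sup>2 / 2)) \<longlonglongrightarrow> (cmod (fourier_int f k))\<^sup>2 * exp (- (0 * k)\<^sup>2 / 2)"
      by (intro tendsto_intros LIMSEQ_inverse_real_of_nat) simp
    then have "(\<lambda>n. ennreal ((cmod (fourier_int f k))\<^sup>2 * exp (- (inverse (real (Suc n)) * k)\<^sup>2 / 2))) \<longlonglongrightarrow> ennreal ((cmod (fourier_int f k))\<^sup>2)"
      by (intro tendsto_ennrealI) simp
    then show "ennreal ((cmod (fourier_int f k))\<^sup>2) = liminf (\<lambda>n. ennreal ((cmod (fourier_int f k))\<^sup>2 * exp (- (inverse (real (Suc n)) * k)\<^sup>2 / 2)))"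
      by (rule lim_imp_Liminf[OF sequentially_bot, symmetric])
  qed
  also have "\<dots> \<le> liminf (\<lambda>n. \<integral>\<^sup>+k. ennreal ((cmod (fourier_int f k))\<^sup>2 * exp (- (inverse (real (Suc n)) * k)\<^sup>2 / 2)) \<partial>lborel)"
    by (rule nn_integral_liminf) measurable
  also have "\<dots> \<le> ennreal ?N"
    by (rule Liminf_le) (use le in \<open>auto simp del: of_nat_Suc\<close>)
  finally have *: "(\<integral>\<^sup>+k. ennreal ((cmod (fourier_int f k))\<^sup>2) \<partial>lborel) \<le> ennreal ?N" .
  show "sq (fourier_int f)" "norm (l2_of (fourier_int f)) \<le> norm (l2_of f)"
    using norm_l2_of_le[of "fourier_int f" "norm (l2_of f)"] * by auto
qed

lemma indicator_interval: "integrable lborel (indicator {a..b::real} :: real \<Rightarrow> complex)" "sq (indicator {a..b})"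
proof -
  have i: "integrable lborel (indicator {a..b} :: real \<Rightarrow> real)"
    by (auto simp: integrable_indicator_iff emeasure_lborel_Icc_eq)
  have "(\<lambda>x. of_real (indicator {a..b} x)) = (indicator {a..b} :: real \<Rightarrow> complex)"
    "(\<lambda>x. (cmod (indicator {a..b} x))\<^sup>2) = (indicator {a..b} :: real \<Rightarrow> real)"
    by (auto simp: indicator_def)
  then show "integrable lborel (indicator {a..b} :: real \<Rightarrow> complex)" "sq (indicator {a..b})"
    using i integrable_of_real[OF i, where 'a = complex] by (auto simp: sq_def)
qed

text \<open>Letting the Gaussian tend to 1 requires continuity of the correlation at 0. For a
  multiple of an indicator this is dominated convergence, since its translates converge off the two
  end points.\<close>

lemma plancherel_interval:
  assumes f: "integrable lborel f" and sqf: "sq f"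
    and g: "g = (\<lambda>x. c * indicator {a..b} x)"
  shows "sq g" "integrable lborel g" "(LINT k|lborel. fourier_int f k * cnj (fourier_int g k)) = (LINT x|lborel. f x * cnj (g x))"
proof -
  have fm [measurable]: "f \<in> borel_measurable borel" using f by auto
  have gm [measurable]: "g \<in> borel_measurable borel" unfolding g by measurable
  show gi: "integrable lborel g" unfolding g
    by (rule integrable_mult_right[OF indicator_interval(1)])
  show sqg: "sq g" unfolding g by (rule sq_cmult[OF indicator_interval(2)])
  note fourier_int = fourier_int_sq_contraction(1)[OF f sqf] fourier_int_sq_contraction(1)[OF gi sqg]
  define e where "e n = inverse (real (Suc n))" for n
  have e0: "e \<longlonglongrightarrow> 0" unfolding e_def by (rule LIMSEQ_inverse_real_of_nat)
  have e: "e n > 0" for n by (simp add: e_def)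
  have "(\<lambda>n. LINT k|lborel. fourier_int f k * cnj (fourier_int g k) * gauss (e n) k) \<longlonglongrightarrow> (LINT k|lborel. fourier_int f k * cnj (fourier_int g k))"
  proof (rule integral_dominated_convergence)
    show "integrable lborel (\<lambda>k. cmod (fourier_int f k * cnj (fourier_int g k)))"
      by (intro integrable_norm sq_integrable_mult sq_cnj fourier_int)
    show "AE k in lborel. (\<lambda>n. fourier_int f k * cnj (fourier_int g k) * gauss (e n) k) \<longlonglongrightarrow> fourier_int f k * cnj (fourier_int g k)"
    proof (rule AE_I2)
      fix k
      have "(\<lambda>n. fourier_int f k * cnj (fourier_int g k) * gauss (e n) k) \<longlonglongrightarrow> fourier_int f k * cnj (fourier_int g k) * of_real (exp (- (0 * k)\<^sup>2 / 2))"
        unfolding gauss_def by (intro tendsto_intros e0) simp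
      then show "(\<lambda>n. fourier_int f k * cnj (fourier_int g k) * gauss (e n) k) \<longlonglongrightarrow> fourier_int f k * cnj (fourier_int g k)" by simp
    qed
    show "AE k in lborel. norm (fourier_int f k * cnj (fourier_int g k) * gauss (e n) k) \<le> cmod (fourier_int f k * cnj (fourier_int g k))" for n
      by (intro AE_I2) (simp add: norm_mult gauss_def mult_left_le)
  qed measurable
  then have lim1: "(\<lambda>n. LINT w|lborel. of_real (std_normal_density w) * corr f g (e n * w)) \<longlonglongrightarrow> (LINT k|lborel. fourier_int f k * cnj (fourier_int g k))"
    by (simp add: plancherel_gauss[OF f gi e])
  have corr: "corr f g z = (LINT x|lborel. f x * cnj (g (x - z)))" for z
    unfolding corr_def by (subst lborel_integral_real_affine[where c = 1 and t = z]) (auto simp: add.commute)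
  have gb: "cmod (g x) \<le> cmod c" for x by (simp add: g indicator_def norm_mult)
  have corr_bound: "cmod (corr f g z) \<le> (LINT x|lborel. cmod (f x) * cmod c)" for z
  proof -
    have "cmod (corr f g z) \<le> (LINT x|lborel. cmod (f x * cnj (g (x - z))))"
      unfolding corr by (rule integral_norm_bound)
    also have "\<dots> \<le> (LINT x|lborel. cmod (f x) * cmod c)"
    proof (rule integral_mono)
      show i: "integrable lborel (\<lambda>x. cmod (f x) * cmod c)" using f by simp
      show le: "cmod (f x * cnj (g (x - z))) \<le> cmod (f x) * cmod c" for x
        using gb by (simp add: norm_mult mult_left_mono)
      show "integrable lborel (\<lambda>x. cmod (f x * cnj (g (x - z))))"
        by (rule Bochner_Integration.integrable_bound[OF i]) (use le in auto)
    qed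
    finally show ?thesis .
  qed
  have corr_lim: "(\<lambda>n. corr f g (e n * w)) \<longlonglongrightarrow> corr f g 0" for w
    unfolding corr
  proof (rule integral_dominated_convergence)
    show "integrable lborel (\<lambda>x. cmod (f x) * cmod c)" using f by simp
    show "AE x in lborel. norm (f x * cnj (g (x - e n * w))) \<le> cmod (f x) * cmod c" for n
      using gb by (intro AE_I2) (simp add: norm_mult mult_left_mono)
    have "AE x in lborel. x \<noteq> a \<and> x \<noteq> b" using AE_lborel_singleton[of a] AE_lborel_singleton[of b] by eventually_elim simp
    then show "AE x in lborel. (\<lambda>n. f x * cnj (g (x - e n * w))) \<longlonglongrightarrow> f x * cnj (g (x - 0))"
    proof eventually_elim
      case (elim x)
      have l: "(\<lambda>n. x - e n * w) \<longlonglongrightarrow> x - 0 * w" by (intro tendsto_intros e0)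
      have "\<forall>\<^sub>F n in sequentially. g (x - e n * w) = g x"
      proof (cases "x \<in> {a<..<b}")
        case True
        then have "\<forall>\<^sub>F n in sequentially. x - e n * w \<in> {a<..<b}"
          using topological_tendstoD[OF l, of "{a<..<b}"] by simp
        then show ?thesis by eventually_elim (use True in \<open>auto simp: g\<close>)
      next
        case False
        with elim have "x \<in> - {a..b}" by auto
        then have "\<forall>\<^sub>F n in sequentially. x - e n * w \<in> - {a..b}"
          using topological_tendstoD[OF l, of "- {a..b}"] by (simp add: open_Compl)
        then show ?thesis by eventually_elim (use \<open>x \<in> - {a..b}\<close> in \<open>auto simp: g\<close>)
      qed
      then have "\<forall>\<^sub>F n in sequentially. f x * cnj (g (x - e n * w)) = f x * cnj (g (x - 0))"
        by eventually_elim simp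
      then show ?case by (rule tendsto_eventually)
    qed
  qed measurable
  have "(\<lambda>n. LINT w|lborel. of_real (std_normal_density w) * corr f g (e n * w)) \<longlonglongrightarrow> (LINT w|lborel. of_real (std_normal_density w) * corr f g 0)"
  proof (rule integral_dominated_convergence)
    show "integrable lborel (\<lambda>w. std_normal_density w * (LINT x|lborel. cmod (f x) * cmod c))" by simp
    show "AE w in lborel. (\<lambda>n. of_real (std_normal_density w) * corr f g (e n * w)) \<longlonglongrightarrow> of_real (std_normal_density w) * corr f g 0"
      by (intro AE_I2 tendsto_intros corr_lim)
    show "AE w in lborel. norm (of_real (std_normal_density w) * corr f g (e n * w)) \<le> std_normal_density w * (LINT x|lborel. cmod (f x) * cmod c)" for n
    proof (rule AE_I2)
      fix w
      show "norm (of_real (std_normal_density w) * corr f g (e n * w)) \<le> std_normal_density w * (LINT x|lborel. cmod (f x) * cmod c)"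
        unfolding norm_mult norm_of_real abs_of_nonneg[OF normal_density_nonneg]
        by (intro mult_left_mono corr_bound normal_density_nonneg)
    qed
  qed measurable
  moreover have "(LINT w|lborel. of_real (std_normal_density w) * corr f g 0) = corr f g 0" by simp
  ultimately show "(LINT k|lborel. fourier_int f k * cnj (fourier_int g k)) = (LINT x|lborel. f x * cnj (g x))"
    using LIMSEQ_unique[OF lim1] by (simp add: corr)
qed

section \<open>Plancherel's theorem\<close>

text \<open>The dense class on which the transform is an absolutely convergent integral and
  contracts the L^2 norm.\<close>

definition l1_l2 :: "(real \<Rightarrow> complex) \<Rightarrow> bool" where
  "l1_l2 f \<longleftrightarrow> sq f \<and> integrable lborel f"

definition truncation :: "real \<Rightarrow> (real \<Rightarrow> complex) \<Rightarrow> real \<Rightarrow> complex" where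
  "truncation R f x = indicator {-R..R} x * f x"

lemma l1_l2_truncation:
  assumes f: "sq f"
  shows "l1_l2 (truncation R f)"
  unfolding l1_l2_def
proof
  have [measurable]: "f \<in> borel_measurable lborel" using f by (rule sq_measurable)
  show "sq (truncation R f)"
    unfolding truncation_def by (rule sq_mult_bounded[OF f, where C = 1]) (auto simp: indicator_def)
  show "integrable lborel (truncation R f)" unfolding truncation_def by (rule sq_integrable_mult[OF indicator_interval(2) f])
qed

lemma truncation_tendsto:
  assumes f: "sq f"
  shows "((\<lambda>R. l2_of (truncation R f)) \<longlongrightarrow> l2_of f) at_top"
proof -
  have [measurable]: "f \<in> borel_measurable lborel" using f by (rule sq_measurable)
  have trm [measurable]: "truncation R f \<in> borel_measurable lborel" for R unfolding truncation_def[abs_def] by measurable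
  have "((\<lambda>R. LINT x|lborel. (cmod (truncation R f x - f x))\<^sup>2) \<longlongrightarrow> (LINT x|(lborel::real measure). 0)) at_top"
  proof (rule integral_dominated_convergence_at_top)
    show "integrable lborel (\<lambda>x. (cmod (f x))\<^sup>2)" by (rule sq_integrable[OF f])
    show "\<forall>\<^sub>F R in at_top. AE x in lborel. norm ((cmod (truncation R f x - f x))\<^sup>2) \<le> (cmod (f x))\<^sup>2"
      by (intro always_eventually allI AE_I2) (auto simp: truncation_def indicator_def)
    show "AE x in lborel. ((\<lambda>R. (cmod (truncation R f x - f x))\<^sup>2) \<longlongrightarrow> 0) at_top"
    proof (rule AE_I2)
      fix x
      have "\<forall>\<^sub>F R in at_top. (cmod (truncation R f x - f x))\<^sup>2 = 0"
        using eventually_ge_at_top[of "\<bar>x\<bar>"] by eventually_elim (auto simp: truncation_def indicator_def)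
      then show "((\<lambda>R. (cmod (truncation R f x - f x))\<^sup>2) \<longlongrightarrow> 0) at_top" by (rule tendsto_eventually)
    qed
  qed measurable
  moreover have "(LINT x|lborel. (cmod (truncation R f x - f x))\<^sup>2) = (norm (l2_of (truncation R f) - l2_of f))\<^sup>2" for R
    using l1_l2_truncation[OF f, of R] f by (simp add: l1_l2_def l2_of_diff norm_l2_of_sq sq_diff)
  ultimately have "((\<lambda>R. (norm (l2_of (truncation R f) - l2_of f))\<^sup>2) \<longlongrightarrow> 0) at_top" by simp
  then have "((\<lambda>R. sqrt ((norm (l2_of (truncation R f) - l2_of f))\<^sup>2)) \<longlongrightarrow> sqrt 0) at_top" by (rule tendsto_real_sqrt)
  then show ?thesis by (simp add: tendsto_norm_zero_iff LIM_zero_iff)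
qed

lemma l1_l2_diff: "l1_l2 f \<Longrightarrow> l1_l2 g \<Longrightarrow> l1_l2 (\<lambda>x. f x - g x)"
  by (simp add: l1_l2_def sq_diff)

lemma fourier_int_l1_l2_diff:
  assumes f: "l1_l2 f" and g: "l1_l2 g"
  shows "norm (l2_of (fourier_int f) - l2_of (fourier_int g)) \<le> norm (l2_of f - l2_of g)"
proof -
  have "l2_of (fourier_int f) - l2_of (fourier_int g) = l2_of (\<lambda>k. fourier_int f k - fourier_int g k)"
    using f g by (intro l2_of_diff) (auto simp: l1_l2_def fourier_int_sq_contraction)
  also have "(\<lambda>k. fourier_int f k - fourier_int g k) = fourier_int (\<lambda>x. f x - g x)"
    using f g by (auto simp: l1_l2_def fourier_int_diff)
  finally show ?thesis
    using fourier_int_sq_contraction(2)[of "\<lambda>x. f x - g x"] l1_l2_diff[OF f g] f g by (simp add: l1_l2_def l2_of_diff)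
qed

text \<open>Extension by continuity from the truncations; \<open>fourier_l2_close\<close> shows that
  the limit exists and compares it with the transform of every function in \<open>l1_l2\<close>, so
  other approximations lead to the same limit.\<close>

definition fourier_l2 :: "l2 \<Rightarrow> l2" where
  "fourier_l2 u = lim (\<lambda>n. l2_of (fourier_int (truncation (real n) (rep u))))"

lemma fourier_l2_close:
  assumes f: "l1_l2 f"
  shows "norm (l2_of (fourier_int f) - fourier_l2 u) \<le> norm (l2_of f - u)"
proof -
  let ?t = "\<lambda>n. truncation (real n) (rep u)"
  have lim: "(\<lambda>n. l2_of (?t n)) \<longlonglongrightarrow> u"
    using filterlim_compose[OF truncation_tendsto[OF sq_rep] filterlim_real_sequentially] by simp
  have "Cauchy (\<lambda>n. l2_of (fourier_int (?t n)))"
  proof (rule CauchyI)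
    fix e :: real assume "e > 0"
    from CauchyD[OF LIMSEQ_imp_Cauchy[OF lim] this]
    show "\<exists>M. \<forall>m\<ge>M. \<forall>n\<ge>M. norm (l2_of (fourier_int (?t m)) - l2_of (fourier_int (?t n))) < e"
      by (meson fourier_int_l1_l2_diff le_less_trans l1_l2_truncation sq_rep)
  qed
  then have fourier_l2: "(\<lambda>n. l2_of (fourier_int (?t n))) \<longlonglongrightarrow> fourier_l2 u"
    unfolding fourier_l2_def by (simp add: Cauchy_convergent_iff convergent_LIMSEQ_iff)
  show ?thesis
  proof (rule tendsto_le[OF sequentially_bot])
    show "(\<lambda>n. norm (l2_of f - l2_of (?t n))) \<longlonglongrightarrow> norm (l2_of f - u)" by (intro tendsto_intros lim)
    show "(\<lambda>n. norm (l2_of (fourier_int f) - l2_of (fourier_int (?t n)))) \<longlonglongrightarrow> norm (l2_of (fourier_int f) - fourier_l2 u)" by (intro tendsto_intros fourier_l2)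
    show "\<forall>\<^sub>F n in sequentially. norm (l2_of (fourier_int f) - l2_of (fourier_int (?t n))) \<le> norm (l2_of f - l2_of (?t n))"
      by (intro always_eventually allI fourier_int_l1_l2_diff f l1_l2_truncation sq_rep)
  qed
qed

lemma fourier_l2_l2_of: "l1_l2 f \<Longrightarrow> fourier_l2 (l2_of f) = l2_of (fourier_int f)"
  using fourier_l2_close[of f "l2_of f"] by simp

lemma fourier_l2_tendsto:
  assumes "sq f"
  shows "((\<lambda>R. l2_of (fourier_int (truncation R f))) \<longlongrightarrow> fourier_l2 (l2_of f)) at_top"
proof (rule LIM_zero_cancel, rule tendsto_norm_zero_cancel, rule tendsto_sandwich[OF _ _ tendsto_const])
  show "((\<lambda>R. norm (l2_of (truncation R f) - l2_of f)) \<longlongrightarrow> 0) at_top"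
    using tendsto_norm_zero[OF LIM_zero[OF truncation_tendsto[OF assms]]] .
qed (auto intro!: always_eventually fourier_l2_close l1_l2_truncation assms)

text \<open>Density as an induction rule: identities between continuous maps have to be checked only
  where the transform is an integral.\<close>

lemma l2_dense_induct:
  assumes "closed {u. P u}" "\<And>f. l1_l2 f \<Longrightarrow> P (l2_of f)"
  shows "P u"
proof -
  have "(\<lambda>n. l2_of (truncation (real n) (rep u))) \<longlonglongrightarrow> u"
    using filterlim_compose[OF truncation_tendsto[OF sq_rep] filterlim_real_sequentially] by simp
  then have "u \<in> {u. P u}"
    by (rule closed_sequentially[OF assms(1), rotated]) (simp_all add: assms(2) l1_l2_truncation)
  then show ?thesis by simp
qed

text \<open>The positive and the negative part of \<open>g\<close>, cut off to
  \<open>{- real n..real n}\<close>, are densities of finite measures with the same distribution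
  function. So the measures agree, and with them the densities; as one of the two parts vanishes at
  each point, both do.\<close>

lemma AE_zero_of_interval_integrals:
  fixes g :: "real \<Rightarrow> real"
  assumes int: "\<And>a b. integrable lborel (\<lambda>x. indicator {a..b} x * g x)"
    and zero: "\<And>a b. (LINT x|lborel. indicator {a..b} x * g x) = 0"
    and [measurable]: "g \<in> borel_measurable borel"
  shows "AE x in lborel. g x = 0"
proof -
  define h where "h s n x = ennreal (indicator {- real n..real n} x * max 0 (s * g x))" for s :: real and n x
  define M where "M s n = density lborel (h s n)" for s n
  have [measurable]: "h s n \<in> borel_measurable borel" for s n unfolding h_def by measurable
  have int': "integrable lborel (\<lambda>x. indicator {a..b} x * max 0 (s * g x))" for a b s
    by (rule Bochner_Integration.integrable_bound[OF integrable_mult_right[OF int[of a b], of s]])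
      (auto simp: indicator_def)
  have eval: "emeasure (M s n) {..y} = ennreal (LINT x|lborel. indicator {- real n..min (real n) y} x * max 0 (s * g x))" for s n y
  proof -
    have "emeasure (M s n) {..y} = (\<integral>\<^sup>+x. ennreal (indicator {- real n..min (real n) y} x * max 0 (s * g x)) \<partial>lborel)"
      unfolding M_def by (subst emeasure_density) (auto intro!: nn_integral_cong simp: h_def indicator_def)
    then show ?thesis by (simp add: nn_integral_eq_integral int')
  qed
  have fin: "finite_borel_measure (M s n)" for s n
  proof (intro finite_borel_measure.intro finite_measureI finite_borel_measure_axioms.intro)
    have "emeasure (M s n) (space (M s n)) = (\<integral>\<^sup>+x. ennreal (indicator {- real n..real n} x * max 0 (s * g x)) \<partial>lborel)"
      unfolding M_def by (subst emeasure_density) (auto intro!: nn_integral_cong simp: h_def indicator_def)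
    then show "emeasure (M s n) (space (M s n)) \<noteq> \<infinity>" by (simp add: nn_integral_eq_integral int')
    show "sets (M s n) = sets borel" by (simp add: M_def)
  qed
  have "cdf (M 1 n) y = cdf (M (-1) n) y" for n y
  proof -
    let ?I = "\<lambda>x. indicator {- real n..min (real n) y} x :: real"
    have "(LINT x|lborel. ?I x * max 0 (1 * g x)) - (LINT x|lborel. ?I x * max 0 (-1 * g x))
       = (LINT x|lborel. ?I x * max 0 (1 * g x) - ?I x * max 0 (-1 * g x))"
      by (rule Bochner_Integration.integral_diff[symmetric]) (rule int')+
    also have "\<dots> = (LINT x|lborel. ?I x * g x)"
      by (rule Bochner_Integration.integral_cong) (auto simp: indicator_def max_def)
    finally have "(LINT x|lborel. ?I x * max 0 (1 * g x)) = (LINT x|lborel. ?I x * max 0 (-1 * g x))"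
      using zero by simp
    then show ?thesis unfolding cdf_def measure_def eval by simp
  qed
  then have "M 1 n = M (-1) n" for n by (intro cdf_unique' fin ext)
  then have "AE x in lborel. h 1 n x = h (-1) n x" for n
    unfolding M_def by (intro sigma_finite_measure.density_unique[OF lborel.sigma_finite_measure_axioms]) auto
  then have "AE x in lborel. \<forall>n. h 1 n x = h (-1) n x" by (simp add: AE_all_countable)
  then show ?thesis
  proof eventually_elim
    case (elim x)
    obtain n where "real n \<ge> \<bar>x\<bar>" using real_arch_simple by blast
    then have "x \<in> {- real n..real n}" by auto
    then show ?case using elim[rule_format, of n] by (auto simp: h_def max_def split: if_splits)
  qed
qed

lemma integrable_sq_interval:
  assumes "sq f"
  shows "integrable lborel (\<lambda>x. indicator {a..b} x * f x)"
  using sq_integrable_mult[OF indicator_interval(2) assms] .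

text \<open>The inner product records real parts only; the constants \<open>c = 1\<close> and
  \<open>c = \<i>\<close> bring out the real and the imaginary part of \<open>u\<close>.\<close>

lemma l2_zero_of_intervals:
  assumes "\<And>a b c. inner u (l2_of (\<lambda>x. c * indicator {a..b} x)) = 0"
  shows "u = 0"
proof -
  have sqi: "sq (\<lambda>x. c * indicator {a..b} x)" for c and a b :: real by (rule sq_cmult[OF indicator_interval(2)])
  have i: "inner u (l2_of (\<lambda>x. c * indicator {a..b} x)) = (LINT x|lborel. Re (rep u x * cnj (c * indicator {a..b} x)))" for a b c
    using inner_l2_of[OF sq_rep[of u] sqi[of c a b]] by simp
  have ci: "integrable lborel (\<lambda>x. indicator {a..b} x * rep u x)" for a b
    by (rule integrable_sq_interval[OF sq_rep])
  have intR: "integrable lborel (\<lambda>x. indicator {a..b} x * Re (rep u x))" for a b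
    using integrable_Re[OF ci[of a b]] by (rule back_subst[of "integrable lborel"]) (auto simp: indicator_def)
  have intI: "integrable lborel (\<lambda>x. indicator {a..b} x * Im (rep u x))" for a b
    using integrable_Im[OF ci[of a b]] by (rule back_subst[of "integrable lborel"]) (auto simp: indicator_def)
  have "AE x in lborel. Re (rep u x) = 0"
  proof (rule AE_zero_of_interval_integrals[OF intR])
    fix a b
    have "(LINT x|lborel. indicator {a..b} x * Re (rep u x)) = inner u (l2_of (\<lambda>x. 1 * indicator {a..b} x))"
      unfolding i by (rule Bochner_Integration.integral_cong) (auto simp: indicator_def)
    then show "(LINT x|lborel. indicator {a..b} x * Re (rep u x)) = 0" using assms[of 1 a b] by simp
  qed measurable
  moreover have "AE x in lborel. Im (rep u x) = 0"
  proof (rule AE_zero_of_interval_integrals[OF intI])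
    fix a b
    have "(LINT x|lborel. indicator {a..b} x * Im (rep u x)) = inner u (l2_of (\<lambda>x. \<i> * indicator {a..b} x))"
      unfolding i by (rule Bochner_Integration.integral_cong) (auto simp: indicator_def)
    then show "(LINT x|lborel. indicator {a..b} x * Im (rep u x)) = 0" using assms[of \<i> a b] by simp
  qed measurable
  ultimately have "AE x in lborel. rep u x = 0" by eventually_elim (simp add: complex_eq_iff)
  with rep_zero have "AE x in lborel. rep u x = rep 0 x" by eventually_elim simp
  then show ?thesis by (rule l2_eqI)
qed

section \<open>Reflection, conjugation and linearity of the transform\<close>

lemma AE_reflect:
  assumes "AE x in lborel. P x" "Measurable.pred borel P"
  shows "AE x in lborel. P (- x :: real)"
  using AE_borel_affine[of "-1" P 0] assms by simp

lemma sq_reflect: "sq f \<Longrightarrow> sq (\<lambda>x. f (- x))"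
proof -
  assume f: "sq f"
  have [measurable]: "f \<in> borel_measurable borel" using f by (auto simp: sq_def)
  have "(\<lambda>x. f (- x)) \<in> borel_measurable borel" by measurable
  then show "sq (\<lambda>x. f (- x))"
    using lborel_integrable_real_affine[OF sq_integrable[OF f], of "-1" 0] by (simp add: sq_def)
qed

definition refl :: "l2 \<Rightarrow> l2" where "refl u = l2_of (\<lambda>x. rep u (- x))"
definition cnjl :: "l2 \<Rightarrow> l2" where "cnjl u = l2_of (\<lambda>x. cnj (rep u x))"

lemma rep_cnjl: "AE x in lborel. rep (cnjl u) x = cnj (rep u x)"
  unfolding cnjl_def by (intro rep_l2_of sq_cnj sq_rep)

lemma refl_l2_of: assumes f: "sq f" shows "refl (l2_of f) = l2_of (\<lambda>x. f (- x))"
proof -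
  have [measurable]: "f \<in> borel_measurable borel" using f by (auto simp: sq_def)
  have "AE x in lborel. rep (l2_of f) (- x) = f (- x)" by (rule AE_reflect[OF rep_l2_of[OF f]]) measurable
  then show ?thesis unfolding refl_def by (subst l2_of_eq_iff) (auto intro: sq_reflect f)
qed

lemma cnjl_l2_of: assumes f: "sq f" shows "cnjl (l2_of f) = l2_of (\<lambda>x. cnj (f x))"
  unfolding cnjl_def by (subst l2_of_eq_iff) (use rep_l2_of[OF f] in \<open>auto intro: sq_cnj f elim: eventually_mono\<close>)

lemma l2_induct_l2_of: "(\<And>f. sq f \<Longrightarrow> P (l2_of f)) \<Longrightarrow> P u"
  by (metis l2_of_rep sq_rep)

lemma norm_refl [simp]: "norm (refl u) = norm u"
proof (induction u rule: l2_induct_l2_of)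
  case (1 f)
  have "(norm (refl (l2_of f)))\<^sup>2 = (norm (l2_of f))\<^sup>2"
    using lborel_integral_real_affine[of "-1" "\<lambda>y. (cmod (f y))\<^sup>2" 0]
    by (simp add: refl_l2_of 1 norm_l2_of_sq sq_reflect)
  then show ?case by simp
qed

lemma norm_cnjl [simp]: "norm (cnjl u) = norm u"
proof (induction u rule: l2_induct_l2_of)
  case (1 f)
  have "(norm (cnjl (l2_of f)))\<^sup>2 = (norm (l2_of f))\<^sup>2" by (simp add: cnjl_l2_of 1 norm_l2_of_sq sq_cnj)
  then show ?case by simp
qed

lemma bounded_linear_refl: "bounded_linear refl"
proof (rule bounded_linear_intro[where K = 1])
  fix u v :: l2 and r :: real
  show "refl (u + v) = refl u + refl v"
  proof (induction u rule: l2_induct_l2_of)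
    case (1 f) show ?case
    proof (induction v rule: l2_induct_l2_of)
      case (1 g) then show ?case using \<open>sq f\<close> by (simp add: l2_of_add refl_l2_of sq_add sq_reflect)
    qed
  qed
  show "refl (r *\<^sub>R u) = r *\<^sub>R refl u"
    by (induction u rule: l2_induct_l2_of) (simp add: l2_of_scaleR refl_l2_of sq_scaleR sq_reflect)
qed simp

lemma bounded_linear_cnjl: "bounded_linear cnjl"
proof (rule bounded_linear_intro[where K = 1])
  fix u v :: l2 and r :: real
  show "cnjl (u + v) = cnjl u + cnjl v"
  proof (induction u rule: l2_induct_l2_of)
    case (1 f) show ?case
    proof (induction v rule: l2_induct_l2_of)
      case (1 g) then show ?case using \<open>sq f\<close> by (simp add: l2_of_add cnjl_l2_of sq_add sq_cnj)
    qed
  qed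
  show "cnjl (r *\<^sub>R u) = r *\<^sub>R cnjl u"
    by (induction u rule: l2_induct_l2_of) (simp add: l2_of_scaleR cnjl_l2_of sq_scaleR sq_cnj)
qed simp

lemma refl_refl [simp]: "refl (refl u) = u"
  by (induction u rule: l2_induct_l2_of) (simp add: refl_l2_of sq_reflect)
lemma refl_cnjl: "refl (cnjl u) = cnjl (refl u)"
  by (induction u rule: l2_induct_l2_of) (simp add: cnjl_l2_of refl_l2_of sq_cnj sq_reflect)

lemma l1_l2_sq: "l1_l2 f \<Longrightarrow> sq f" by (simp add: l1_l2_def)
lemma l1_l2_reflect: "l1_l2 f \<Longrightarrow> l1_l2 (\<lambda>x. f (- x))"
  by (simp add: l1_l2_def sq_reflect integrable_reflect)
lemma l1_l2_cnj: "l1_l2 f \<Longrightarrow> l1_l2 (\<lambda>x. cnj (f x))"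
  by (simp add: l1_l2_def sq_cnj)
lemma l1_l2_add: "l1_l2 f \<Longrightarrow> l1_l2 g \<Longrightarrow> l1_l2 (\<lambda>x. f x + g x)"
  by (simp add: l1_l2_def sq_add)
lemma l1_l2_scaleR: "l1_l2 f \<Longrightarrow> l1_l2 (\<lambda>x. c *\<^sub>R f x)"
  by (simp add: l1_l2_def sq_scaleR)

lemma norm_fourier_l2_le: "norm (fourier_l2 u) \<le> norm u"
proof (rule tendsto_le[OF trivial_limit_at_top_linorder])
  show "((\<lambda>R. norm (l2_of (truncation R (rep u)))) \<longlongrightarrow> norm u) at_top"
    using tendsto_norm[OF truncation_tendsto[OF sq_rep[of u]]] by simp
  show "((\<lambda>R. norm (l2_of (fourier_int (truncation R (rep u))))) \<longlongrightarrow> norm (fourier_l2 u)) at_top"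
    using tendsto_norm[OF fourier_l2_tendsto[OF sq_rep[of u]]] by simp
  show "\<forall>\<^sub>F R in at_top. norm (l2_of (fourier_int (truncation R (rep u)))) \<le> norm (l2_of (truncation R (rep u)))"
    using l1_l2_truncation[OF sq_rep[of u]] by (intro always_eventually allI fourier_int_sq_contraction) (auto simp: l1_l2_def)
qed

lemma sq_fourier_int: "l1_l2 f \<Longrightarrow> sq (fourier_int f)"
  by (simp add: l1_l2_def fourier_int_sq_contraction)

lemma fourier_int_l1_l2_add: "l1_l2 f \<Longrightarrow> l1_l2 g \<Longrightarrow> fourier_int (\<lambda>x. f x + g x) = (\<lambda>k. fourier_int f k + fourier_int g k)"
  by (rule ext) (simp add: l1_l2_def fourier_int_add)

lemma fourier_int_scaleR: "fourier_int (\<lambda>x. r *\<^sub>R f x) = (\<lambda>k. r *\<^sub>R fourier_int f k)"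
  by (rule ext) (simp add: scaleR_conv_of_real fourier_int_cmult)

lemma bounded_linear_fourier_l2: "bounded_linear fourier_l2"
proof (rule bounded_linear_intro[where K = 1])
  fix u v :: l2 and r :: real
  let ?t = "\<lambda>w R. truncation R (rep w)"
  have t: "((\<lambda>R. l2_of (?t w R)) \<longlongrightarrow> w) at_top" "((\<lambda>R. l2_of (fourier_int (?t w R))) \<longlongrightarrow> fourier_l2 w) at_top" "l1_l2 (?t w R)" for w R
    using truncation_tendsto[OF sq_rep[of w]] fourier_l2_tendsto[OF sq_rep[of w]] l1_l2_truncation[OF sq_rep] by simp_all
  have closeI: "((\<lambda>R. l2_of (fourier_int (f R))) \<longlongrightarrow> fourier_l2 w) at_top" if "\<And>R. l1_l2 (f R)" "((\<lambda>R. l2_of (f R)) \<longlongrightarrow> w) at_top" for f :: "real \<Rightarrow> real \<Rightarrow> complex" and w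
  proof (rule LIM_zero_cancel, rule tendsto_norm_zero_cancel, rule tendsto_sandwich[OF _ _ tendsto_const])
    show "((\<lambda>R. norm (l2_of (f R) - w)) \<longlongrightarrow> 0) at_top"
      using tendsto_norm_zero[OF LIM_zero[OF that(2)]] .
  qed (auto intro!: always_eventually fourier_l2_close that)
  show "fourier_l2 (u + v) = fourier_l2 u + fourier_l2 v"
  proof (rule tendsto_unique[OF trivial_limit_at_top_linorder])
    have a: "l2_of (?t u R) + l2_of (?t v R) = l2_of (\<lambda>x. ?t u R x + ?t v R x)" for R
      using t(3) by (simp add: l2_of_add l1_l2_def)
    show "((\<lambda>R. l2_of (fourier_int (\<lambda>x. ?t u R x + ?t v R x))) \<longlongrightarrow> fourier_l2 (u + v)) at_top"
      by (rule closeI) (auto intro!: l1_l2_add t tendsto_intros simp flip: a)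
    have b: "l2_of (fourier_int (\<lambda>x. ?t u R x + ?t v R x)) = l2_of (fourier_int (?t u R)) + l2_of (fourier_int (?t v R))" for R
      using l2_of_add[OF sq_fourier_int[OF t(3)[of R u]] sq_fourier_int[OF t(3)[of R v]]] fourier_int_l1_l2_add[OF t(3)[of R u] t(3)[of R v]] by simp
    show "((\<lambda>R. l2_of (fourier_int (\<lambda>x. ?t u R x + ?t v R x))) \<longlongrightarrow> fourier_l2 u + fourier_l2 v) at_top"
      unfolding b by (intro tendsto_intros t)
  qed
  show "fourier_l2 (r *\<^sub>R u) = r *\<^sub>R fourier_l2 u"
  proof (rule tendsto_unique[OF trivial_limit_at_top_linorder])
    have a: "r *\<^sub>R l2_of (?t u R) = l2_of (\<lambda>x. r *\<^sub>R ?t u R x)" for R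
      using t(3) by (simp add: l2_of_scaleR l1_l2_def)
    show "((\<lambda>R. l2_of (fourier_int (\<lambda>x. r *\<^sub>R ?t u R x))) \<longlongrightarrow> fourier_l2 (r *\<^sub>R u)) at_top"
      by (rule closeI) (auto intro!: l1_l2_scaleR t tendsto_intros simp flip: a)
    have b: "l2_of (fourier_int (\<lambda>x. r *\<^sub>R ?t u R x)) = r *\<^sub>R l2_of (fourier_int (?t u R))" for R
      using sq_fourier_int[OF t(3)] fourier_int_scaleR[of r "?t u R"] by (simp add: l2_of_scaleR)
    show "((\<lambda>R. l2_of (fourier_int (\<lambda>x. r *\<^sub>R ?t u R x))) \<longlongrightarrow> r *\<^sub>R fourier_l2 u) at_top"
      unfolding b by (intro tendsto_intros t)
  qed
qed (use norm_fourier_l2_le in simp)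

lemmas fourier_l2_linear_simps =
  bounded_linear.linear[OF bounded_linear_fourier_l2, THEN linear_add]
  bounded_linear.linear[OF bounded_linear_fourier_l2, THEN linear_diff]
  bounded_linear.linear[OF bounded_linear_fourier_l2, THEN linear_scale]

lemma closed_eq_bounded_linear: "bounded_linear f \<Longrightarrow> bounded_linear g \<Longrightarrow> closed {u. f u = g u}"
  by (intro closed_Collect_eq linear_continuous_on)

lemma fourier_int_reflect: "fourier_int (\<lambda>x. f (- x)) = (\<lambda>k. fourier_int f (- k))"
  unfolding fourier_int_def fun_eq_iff
  by (rule allI, subst lborel_integral_real_affine[where c = "-1" and t = 0]) auto

lemma fourier_l2_refl: "fourier_l2 (refl u) = refl (fourier_l2 u)"
proof (rule l2_dense_induct[of "\<lambda>u. fourier_l2 (refl u) = refl (fourier_l2 u)"])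
  show "closed {u. fourier_l2 (refl u) = refl (fourier_l2 u)}"
    by (intro closed_eq_bounded_linear bounded_linear_compose[OF bounded_linear_fourier_l2 bounded_linear_refl]
      bounded_linear_compose[OF bounded_linear_refl bounded_linear_fourier_l2])
  fix f assume f: "l1_l2 f"
  have "fourier_l2 (refl (l2_of f)) = l2_of (fourier_int (\<lambda>x. f (- x)))" using fourier_l2_l2_of[OF l1_l2_reflect[OF f]] l1_l2_sq[OF f] by (simp add: refl_l2_of)
  also have "\<dots> = refl (fourier_l2 (l2_of f))" using f by (simp add: fourier_l2_l2_of refl_l2_of sq_fourier_int fourier_int_reflect[of f])
  finally show "fourier_l2 (refl (l2_of f)) = refl (fourier_l2 (l2_of f))" .
qed

lemma fourier_int_cnj: "fourier_int (\<lambda>x. cnj (f x)) = (\<lambda>k. cnj (fourier_int f (- k)))"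
  using fourier_int_reflect_cnj[of "\<lambda>x. f (- x)"] by (simp add: fourier_int_reflect[of f] fun_eq_iff)

lemma fourier_l2_cnjl: "fourier_l2 (cnjl u) = refl (cnjl (fourier_l2 u))"
proof (rule l2_dense_induct[of "\<lambda>u. fourier_l2 (cnjl u) = refl (cnjl (fourier_l2 u))"])
  show "closed {u. fourier_l2 (cnjl u) = refl (cnjl (fourier_l2 u))}"
    by (intro closed_eq_bounded_linear bounded_linear_compose[OF bounded_linear_fourier_l2 bounded_linear_cnjl]
      bounded_linear_compose[OF bounded_linear_refl] bounded_linear_compose[OF bounded_linear_cnjl bounded_linear_fourier_l2])
  fix f assume f: "l1_l2 f"
  have "fourier_l2 (cnjl (l2_of f)) = l2_of (fourier_int (\<lambda>x. cnj (f x)))" using fourier_l2_l2_of[OF l1_l2_cnj[OF f]] l1_l2_sq[OF f] by (simp add: cnjl_l2_of)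
  also have "\<dots> = refl (cnjl (fourier_l2 (l2_of f)))" using f by (simp add: fourier_l2_l2_of refl_l2_of cnjl_l2_of sq_fourier_int sq_cnj fourier_int_cnj[of f])
  finally show "fourier_l2 (cnjl (l2_of f)) = refl (cnjl (fourier_l2 (l2_of f)))" .
qed

lemma inner_refl: "inner (refl u) v = inner u (refl v)"
proof (induction u rule: l2_induct_l2_of)
  case (1 f) show ?case
  proof (induction v rule: l2_induct_l2_of)
    case (1 g)
    then show ?case using \<open>sq f\<close> lborel_integral_real_affine[of "-1" "\<lambda>x. Re (f (- x) * cnj (g x))" 0]
      by (simp add: refl_l2_of inner_l2_of sq_reflect del: times_complex.sel)
  qed
qed

section \<open>The inverse transform\<close>

definition inv_fourier_l2 :: "l2 \<Rightarrow> l2" where "inv_fourier_l2 u = refl (fourier_l2 u)"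

lemma bounded_linear_inv_fourier_l2: "bounded_linear inv_fourier_l2"
  unfolding inv_fourier_l2_def by (rule bounded_linear_compose[OF bounded_linear_refl bounded_linear_fourier_l2])

text \<open>The multiplication formula for \<open>f\<close> and the conjugate of \<open>g\<close>,
  extended by density in each argument: the adjoint is the transform followed by reflection.\<close>

lemma inner_fourier_l2: "inner (fourier_l2 u) v = inner u (inv_fourier_l2 v)"
proof (rule l2_dense_induct[of "\<lambda>u. inner (fourier_l2 u) v = inner u (inv_fourier_l2 v)"])
  show "closed {u. inner (fourier_l2 u) v = inner u (inv_fourier_l2 v)}"
    by (intro closed_eq_bounded_linear bounded_linear_compose[OF bounded_linear_inner_left bounded_linear_fourier_l2]
      bounded_linear_inner_left)
  fix f assume f: "l1_l2 f"
  show "inner (fourier_l2 (l2_of f)) v = inner (l2_of f) (inv_fourier_l2 v)"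
  proof (rule l2_dense_induct[of "\<lambda>v. inner (fourier_l2 (l2_of f)) v = inner (l2_of f) (inv_fourier_l2 v)"])
    show "closed {v. inner (fourier_l2 (l2_of f)) v = inner (l2_of f) (inv_fourier_l2 v)}"
      by (intro closed_eq_bounded_linear bounded_linear_inner_right
        bounded_linear_compose[OF bounded_linear_inner_right bounded_linear_inv_fourier_l2])
    fix g assume g: "l1_l2 g"
    have i: "integrable lborel f" "integrable lborel (\<lambda>x. cnj (g x))" using f g by (auto simp: l1_l2_def)
    have s: "sq (fourier_int f)" "sq g" "sq f" "sq (fourier_int (\<lambda>x. cnj (g x)))" "sq (fourier_int g)" using f g sq_fourier_int l1_l2_cnj by (auto simp: l1_l2_def)
    have "inner (fourier_l2 (l2_of f)) (l2_of g) = Re (LINT x|lborel. fourier_int f x * cnj (g x))"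
      using f g s by (simp add: fourier_l2_l2_of inner_l2_of integral_Re sq_integrable_mult sq_cnj del: times_complex.sel)
    also have "\<dots> = Re (LINT x|lborel. f x * fourier_int (\<lambda>x. cnj (g x)) x)" using fourier_int_mult[OF i] by simp
    also have "\<dots> = (LINT x|lborel. Re (f x * cnj (fourier_int g (- x))))"
      using s sq_integrable_mult[OF s(3,4)] by (simp add: fourier_int_cnj integral_Re del: times_complex.sel)
    also have "\<dots> = inner (l2_of f) (inv_fourier_l2 (l2_of g))"
      using f g s by (simp add: inv_fourier_l2_def fourier_l2_l2_of refl_l2_of inner_l2_of sq_reflect)
    finally show "inner (fourier_l2 (l2_of f)) (l2_of g) = inner (l2_of f) (inv_fourier_l2 (l2_of g))" .
  qed
qed

lemma inner_inv_fourier_l2: "inner (inv_fourier_l2 u) v = inner u (fourier_l2 v)"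
  by (simp add: inv_fourier_l2_def inner_refl inner_fourier_l2 fourier_l2_refl)

text \<open>Fourier inversion: the adjoint is a left inverse, because Plancherel's identity is known
  against indicators of intervals and these determine an element. It is also a right inverse, as the
  transform commutes with reflection.\<close>

lemma inv_fourier_l2_fourier_l2 [simp]: "inv_fourier_l2 (fourier_l2 u) = u"
proof -
  have "inner (inv_fourier_l2 (fourier_l2 u) - u) (l2_of (\<lambda>x. c * indicator {a..b} x)) = 0" for a b c
  proof -
    let ?g = "\<lambda>x. c * indicator {a..b} x"
    have "sq ?g" "integrable lborel ?g"
      by (intro sq_cmult indicator_interval integrable_mult_right)+
    then have g: "l1_l2 ?g" by (simp add: l1_l2_def)
    have "inner (fourier_l2 u) (fourier_l2 (l2_of ?g)) = inner u (l2_of ?g)"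
    proof (rule l2_dense_induct[of "\<lambda>u. inner (fourier_l2 u) (fourier_l2 (l2_of ?g)) = inner u (l2_of ?g)"])
      show "closed {u. inner (fourier_l2 u) (fourier_l2 (l2_of ?g)) = inner u (l2_of ?g)}"
        by (intro closed_eq_bounded_linear bounded_linear_compose[OF bounded_linear_inner_left bounded_linear_fourier_l2]
          bounded_linear_inner_left)
      fix f assume f: "l1_l2 f"
      have eq: "(LINT k|lborel. fourier_int f k * cnj (fourier_int ?g k)) = (LINT x|lborel. f x * cnj (?g x))"
        by (rule plancherel_interval[OF _ _ HOL.refl]) (use f in \<open>auto simp: l1_l2_def\<close>)
      have Re: "inner (l2_of f') (l2_of g') = Re (LINT x|lborel. f' x * cnj (g' x))" if "sq f'" "sq g'" for f' g'
        by (subst inner_l2_of[OF that]) (intro integral_Re sq_integrable_mult sq_cnj that)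
      show "inner (fourier_l2 (l2_of f)) (fourier_l2 (l2_of ?g)) = inner (l2_of f) (l2_of ?g)"
        unfolding fourier_l2_l2_of[OF f] fourier_l2_l2_of[OF g] Re[OF sq_fourier_int[OF f] sq_fourier_int[OF g]] Re[OF l1_l2_sq[OF f] l1_l2_sq[OF g]]
        by (rule arg_cong[OF eq])
    qed
    then show ?thesis by (simp add: inner_diff_left inner_inv_fourier_l2)
  qed
  then have "inv_fourier_l2 (fourier_l2 u) - u = 0" by (rule l2_zero_of_intervals)
  then show ?thesis by simp
qed

lemma fourier_l2_inv_fourier_l2 [simp]: "fourier_l2 (inv_fourier_l2 u) = u"
  using inv_fourier_l2_fourier_l2[of u] by (simp add: inv_fourier_l2_def fourier_l2_refl)

lemma inner_fourier_l2_fourier_l2: "inner (fourier_l2 u) (fourier_l2 v) = inner u v"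
  by (simp add: inner_fourier_l2)

section \<open>Fourier multipliers\<close>

definition bdd_mult :: "(real \<Rightarrow> complex) \<Rightarrow> bool" where
  "bdd_mult m \<longleftrightarrow> m \<in> borel_measurable borel \<and> (\<exists>C. \<forall>k. cmod (m k) \<le> C)"

definition mul :: "(real \<Rightarrow> complex) \<Rightarrow> l2 \<Rightarrow> l2" where
  "mul m u = l2_of (\<lambda>k. m k * rep u k)"

lemma bdd_mult_measurable [measurable_dest]: "bdd_mult m \<Longrightarrow> m \<in> borel_measurable borel"
  by (simp add: bdd_mult_def)

lemma bmI: "m \<in> borel_measurable borel \<Longrightarrow> (\<And>k. cmod (m k) \<le> C) \<Longrightarrow> bdd_mult m"
  by (auto simp: bdd_mult_def)

lemma sq_bdd_mult: "bdd_mult m \<Longrightarrow> sq f \<Longrightarrow> sq (\<lambda>k. m k * f k)"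
  unfolding bdd_mult_def by (auto intro: sq_mult_bounded)

lemma bdd_mult_mult: assumes "bdd_mult m" "bdd_mult n" shows "bdd_mult (\<lambda>k. m k * n k)"
proof -
  obtain C D where C: "\<And>k. cmod (m k) \<le> C" "\<And>k. cmod (n k) \<le> D" using assms by (auto simp: bdd_mult_def)
  have [measurable]: "m \<in> borel_measurable borel" "n \<in> borel_measurable borel" using assms by (auto simp: bdd_mult_def)
  have "cmod (m k * n k) \<le> C * D" for k
    unfolding norm_mult using C order_trans[OF norm_ge_zero C(1)] by (intro mult_mono) auto
  then show ?thesis by (intro bmI) auto
qed

lemma bdd_mult_add: assumes "bdd_mult m" "bdd_mult n" shows "bdd_mult (\<lambda>k. m k + n k)"
proof -
  obtain C D where C: "\<And>k. cmod (m k) \<le> C" "\<And>k. cmod (n k) \<le> D" using assms by (auto simp: bdd_mult_def)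
  have [measurable]: "m \<in> borel_measurable borel" "n \<in> borel_measurable borel" using assms by (auto simp: bdd_mult_def)
  show ?thesis by (rule bmI[where C = "C + D"]) (measurable, intro order_trans[OF norm_triangle_ineq] add_mono C)
qed

lemma bdd_mult_const: "bdd_mult (\<lambda>_. c)" by (auto simp: bdd_mult_def)
lemma bdd_mult_cnj: "bdd_mult m \<Longrightarrow> bdd_mult (\<lambda>k. cnj (m k))" by (auto simp: bdd_mult_def)
lemma bdd_mult_reflect: assumes "bdd_mult m" shows "bdd_mult (\<lambda>k. m (- k))"
proof -
  have [measurable]: "m \<in> borel_measurable borel" using assms by (auto simp: bdd_mult_def)
  show ?thesis using assms by (auto simp: bdd_mult_def)
qed

lemma rep_mul: "bdd_mult m \<Longrightarrow> AE k in lborel. rep (mul m u) k = m k * rep u k"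
  unfolding mul_def by (intro rep_l2_of sq_bdd_mult sq_rep)

lemma mul_l2_of: assumes "bdd_mult m" "sq f" shows "mul m (l2_of f) = l2_of (\<lambda>k. m k * f k)"
proof -
  have "AE k in lborel. m k * rep (l2_of f) k = m k * f k" using rep_l2_of[OF assms(2)] by eventually_elim simp
  then show ?thesis
    unfolding mul_def by (rule l2_of_eq_iff[OF sq_bdd_mult[OF assms(1) sq_rep[of "l2_of f"]] sq_bdd_mult[OF assms], THEN iffD2])
qed

lemma norm_l2_of_mono:
  assumes g: "sq g" and [measurable]: "f \<in> borel_measurable lborel"
    and le: "AE x in lborel. cmod (f x) \<le> C * cmod (g x)" and C: "C \<ge> 0"
  shows "sq f" "norm (l2_of f) \<le> C * norm (l2_of g)"
proof -
  show f: "sq f" by (rule sq_dominated[OF g _ le]) simp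
  have "(norm (l2_of f))\<^sup>2 \<le> (C * norm (l2_of g))\<^sup>2"
    unfolding power_mult_distrib norm_l2_of_sq[OF f] norm_l2_of_sq[OF g] integral_mult_right_zero[symmetric]
  proof (rule integral_mono_AE)
    show "AE x in lborel. (cmod (f x))\<^sup>2 \<le> C\<^sup>2 * (cmod (g x))\<^sup>2"
      using le by eventually_elim (metis norm_ge_zero power_mono power_mult_distrib)
  qed (use f g in \<open>auto intro: sq_integrable\<close>)
  then show "norm (l2_of f) \<le> C * norm (l2_of g)" by (rule power2_le_imp_le) (use C in simp)
qed

lemma norm_mul_le:
  assumes "m \<in> borel_measurable borel" "\<And>k. cmod (m k) \<le> C"
  shows "norm (mul m u) \<le> C * norm u"
proof -
  have C: "C \<ge> 0" using order_trans[OF norm_ge_zero assms(2)] .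
  have [measurable]: "m \<in> borel_measurable borel" by fact
  have "norm (l2_of (\<lambda>k. m k * rep u k)) \<le> C * norm (l2_of (rep u))"
    by (rule norm_l2_of_mono) (use assms(2) C in \<open>auto simp: norm_mult intro!: mult_right_mono\<close>)
  then show ?thesis by (simp add: mul_def)
qed

lemma bounded_linear_mul: assumes "bdd_mult m" shows "bounded_linear (mul m)"
proof -
  obtain C where C: "\<And>k. cmod (m k) \<le> C" and m: "m \<in> borel_measurable borel" using assms by (auto simp: bdd_mult_def)
  show ?thesis
  proof (rule bounded_linear_intro[where K = C])
    fix u v :: l2 and r :: real
    show "mul m (u + v) = mul m u + mul m v"
    proof (rule l2_eqI)
      show "AE x in lborel. rep (mul m (u + v)) x = rep (mul m u + mul m v) x"
        using rep_mul[OF assms, of "u + v"] rep_mul[OF assms, of u] rep_mul[OF assms, of v]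
          rep_add[of u v] rep_add[of "mul m u" "mul m v"]
        by eventually_elim (simp add: algebra_simps)
    qed
    show "mul m (r *\<^sub>R u) = r *\<^sub>R mul m u"
    proof (rule l2_eqI)
      show "AE x in lborel. rep (mul m (r *\<^sub>R u)) x = rep (r *\<^sub>R mul m u) x"
        using rep_mul[OF assms, of "r *\<^sub>R u"] rep_mul[OF assms, of u] rep_scaleR[of r u] rep_scaleR[of r "mul m u"]
        by eventually_elim simp
    qed
    show "norm (mul m u) \<le> norm u * C" using norm_mul_le[OF m C] by (simp add: mult.commute)
  qed
qed

lemma mul_mul: assumes "bdd_mult m" "bdd_mult n" shows "mul m (mul n u) = mul (\<lambda>k. m k * n k) u"
proof (rule l2_eqI)
  show "AE x in lborel. rep (mul m (mul n u)) x = rep (mul (\<lambda>k. m k * n k) u) x"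
    using rep_mul[OF assms(1), of "mul n u"] rep_mul[OF assms(2), of u] rep_mul[OF bdd_mult_mult[OF assms], of u]
    by eventually_elim simp
qed

lemma mul_one: "mul (\<lambda>_. 1) u = u" by (simp add: mul_def)

text \<open>Stands in for division by \<open>m\<close>, whose reciprocal may be unbounded: in this
  way an equation is freed of a smoothing factor.\<close>

lemma mul_inj:
  assumes "bdd_mult m" "\<And>k. m k \<noteq> 0" "mul m u = mul m v"
  shows "u = v"
proof (rule l2_eqI)
  show "AE x in lborel. rep u x = rep v x"
    using rep_mul[OF assms(1), of u] rep_mul[OF assms(1), of v]
    by eventually_elim (use assms in auto)
qed

lemma mul_add_left: assumes "bdd_mult m" "bdd_mult n" shows "mul (\<lambda>k. m k + n k) u = mul m u + mul n u"
proof (rule l2_eqI)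
  show "AE x in lborel. rep (mul (\<lambda>k. m k + n k) u) x = rep (mul m u + mul n u) x"
    using rep_mul[OF assms(1), of u] rep_mul[OF assms(2), of u] rep_mul[OF bdd_mult_add[OF assms], of u] rep_add[of "mul m u" "mul n u"]
    by eventually_elim (simp add: algebra_simps)
qed

lemma mul_scale_left: assumes "bdd_mult m" shows "mul (\<lambda>k. of_real c * m k) u = c *\<^sub>R mul m u"
proof (rule l2_eqI)
  show "AE x in lborel. rep (mul (\<lambda>k. of_real c * m k) u) x = rep (c *\<^sub>R mul m u) x"
    using rep_mul[OF assms(1), of u] rep_mul[OF bdd_mult_mult[OF bdd_mult_const assms], of "of_real c" u] rep_scaleR[of c "mul m u"]
    by eventually_elim (simp add: scaleR_conv_of_real)
qed

lemma inner_mul: assumes "bdd_mult m" shows "inner (mul m u) v = inner u (mul (\<lambda>k. cnj (m k)) v)"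
proof -
  have [measurable]: "m \<in> borel_measurable borel" using assms by (rule bdd_mult_measurable)
  show ?thesis unfolding inner_l2_def
  proof (rule integral_cong_AE)
    show "AE x in lborel. Re (rep (mul m u) x * cnj (rep v x)) = Re (rep u x * cnj (rep (mul (\<lambda>k. cnj (m k)) v) x))"
      using rep_mul[OF assms, of u] rep_mul[OF bdd_mult_cnj[OF assms], of v]
      by eventually_elim (simp add: algebra_simps)
  qed measurable
qed

text \<open>The fixed points of \<open>herm\<close> are the Fourier transforms of real functions.\<close>

definition herm :: "l2 \<Rightarrow> l2" where "herm u = refl (cnjl u)"

lemma bounded_linear_herm: "bounded_linear herm"
  unfolding herm_def by (rule bounded_linear_compose[OF bounded_linear_refl bounded_linear_cnjl])

lemma herm_l2_of: "sq f \<Longrightarrow> herm (l2_of f) = l2_of (\<lambda>k. cnj (f (- k)))"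
  by (simp add: herm_def cnjl_l2_of refl_l2_of sq_cnj)

lemma rep_herm: "AE k in lborel. rep (herm u) k = cnj (rep u (- k))"
  using rep_l2_of[OF sq_cnj[OF sq_reflect[OF sq_rep[of u]]]] herm_l2_of[OF sq_rep[of u]] by simp

lemma herm_mul: assumes "bdd_mult m" shows "herm (mul m u) = mul (\<lambda>k. cnj (m (- k))) (herm u)"
proof (induction u rule: l2_induct_l2_of)
  case (1 f) then show ?case using assms by (simp add: mul_l2_of herm_l2_of sq_bdd_mult bdd_mult_cnj bdd_mult_reflect sq_cnj sq_reflect)
qed

text \<open>Dominated convergence gives strong convergence of the operators; for the unitary groups
  below, convergence in operator norm cannot be expected.\<close>

lemma mul_tendsto:
  fixes m :: "nat \<Rightarrow> real \<Rightarrow> complex"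
  assumes [measurable]: "\<And>n. m n \<in> borel_measurable borel" and C: "\<And>n k. cmod (m n k) \<le> C"
    and lim: "\<And>k. (\<lambda>n. m n k) \<longlonglongrightarrow> m' k"
  shows "(\<lambda>n. mul (m n) u) \<longlonglongrightarrow> mul m' u"
proof -
  have [measurable]: "m' \<in> borel_measurable borel" by (rule borel_measurable_LIMSEQ_metric[OF assms(1)]) (use lim in auto)
  have C': "cmod (m' k) \<le> C" for k
    by (rule LIMSEQ_le_const2[OF tendsto_norm[OF lim]]) (use C in auto)
  have C0: "C \<ge> 0" using order_trans[OF norm_ge_zero C'] .
  have bdd_mult: "bdd_mult (m n)" "bdd_mult m'" for n by (auto intro!: bmI C C')
  have s: "sq (\<lambda>k. m n k * rep u k)" "sq (\<lambda>k. m' k * rep u k)" for n by (auto intro!: sq_bdd_mult bdd_mult)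
  have "(\<lambda>n. LINT k|lborel. (cmod (m n k * rep u k - m' k * rep u k))\<^sup>2) \<longlonglongrightarrow> (LINT k|(lborel::real measure). 0)"
  proof (rule integral_dominated_convergence)
    show "integrable lborel (\<lambda>k. (2 * C)\<^sup>2 * (cmod (rep u k))\<^sup>2)" by (intro integrable_mult_right sq_integrable sq_rep)
    show "AE k in lborel. (\<lambda>n. (cmod (m n k * rep u k - m' k * rep u k))\<^sup>2) \<longlonglongrightarrow> 0"
    proof (rule AE_I2)
      fix k
      have "(\<lambda>n. (cmod (m n k * rep u k - m' k * rep u k))\<^sup>2) \<longlonglongrightarrow> (cmod (m' k * rep u k - m' k * rep u k))\<^sup>2"
        by (intro tendsto_intros lim)
      then show "(\<lambda>n. (cmod (m n k * rep u k - m' k * rep u k))\<^sup>2) \<longlonglongrightarrow> 0" by simp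
    qed
    show "AE k in lborel. norm ((cmod (m n k * rep u k - m' k * rep u k))\<^sup>2) \<le> (2 * C)\<^sup>2 * (cmod (rep u k))\<^sup>2" for n
    proof (rule AE_I2)
      fix k
      have "cmod (m n k - m' k) \<le> 2 * C" using norm_triangle_ineq4[of "m n k" "m' k"] C[of n k] C'[of k] by linarith
      then have "cmod (m n k * rep u k - m' k * rep u k) \<le> 2 * C * cmod (rep u k)"
        by (simp add: norm_mult mult_right_mono flip: left_diff_distrib)
      then have "(cmod (m n k * rep u k - m' k * rep u k))\<^sup>2 \<le> (2 * C * cmod (rep u k))\<^sup>2" by (rule power_mono) simp
      then show "norm ((cmod (m n k * rep u k - m' k * rep u k))\<^sup>2) \<le> (2 * C)\<^sup>2 * (cmod (rep u k))\<^sup>2"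
        by (simp add: power_mult_distrib)
    qed
  qed measurable
  moreover have "(LINT k|lborel. (cmod (m n k * rep u k - m' k * rep u k))\<^sup>2) = (norm (mul (m n) u - mul m' u))\<^sup>2" for n
    unfolding mul_def l2_of_diff[OF s] by (simp add: norm_l2_of_sq sq_diff s)
  ultimately have "(\<lambda>n. (norm (mul (m n) u - mul m' u))\<^sup>2) \<longlonglongrightarrow> 0" by simp
  then have "(\<lambda>n. sqrt ((norm (mul (m n) u - mul m' u))\<^sup>2)) \<longlonglongrightarrow> sqrt 0" by (rule tendsto_real_sqrt)
  then show ?thesis by (simp add: tendsto_norm_zero_iff LIM_zero_iff)
qed

lemma mul_tendsto_at:
  fixes m :: "real \<Rightarrow> real \<Rightarrow> complex"
  assumes "\<And>t. t \<in> S \<Longrightarrow> m t \<in> borel_measurable borel" "\<And>t k. t \<in> S \<Longrightarrow> cmod (m t k) \<le> C"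
    and lim: "\<And>k. ((\<lambda>t. m t k) \<longlongrightarrow> m' k) (at a within S)"
  shows "((\<lambda>t. mul (m t) u) \<longlongrightarrow> mul m' u) (at a within S)"
  unfolding tendsto_at_iff_sequentially
proof (intro allI impI)
  fix X :: "nat \<Rightarrow> real" assume X: "\<forall>i. X i \<in> S - {a}" "X \<longlonglongrightarrow> a"
  show "((\<lambda>t. mul (m t) u) \<circ> X) \<longlonglongrightarrow> mul m' u"
    unfolding o_def
  proof (rule mul_tendsto[where C = C])
    show "(\<lambda>n. m (X n) k) \<longlonglongrightarrow> m' k" for k
      using lim[of k, unfolded tendsto_at_iff_sequentially, rule_format, of X] X by (simp add: o_def)
  qed (use X assms in auto)
qed

section \<open>Weights\<close>

text \<open>The power of order \<open>r\<close> of the Japanese bracket; \<open>bessel r\<close> is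
  the symbol of (1 - d^2/dx^2)^(r/2).\<close>

definition bracket :: "real \<Rightarrow> real \<Rightarrow> real" where "bracket r k = (1 + k\<^sup>2) powr (r / 2)"
definition bessel :: "real \<Rightarrow> real \<Rightarrow> complex" where "bessel r k = of_real (bracket r k)"
text \<open>The derivative is \<open>riesz k * bessel 1 k = \<i> * k\<close>; splitting off the growing factor keeps all
  multipliers bounded.\<close>

definition riesz :: "real \<Rightarrow> complex" where "riesz k = \<i> * of_real (k * bracket (-1) k)"

lemma bracket_measurable [measurable]: "bracket r \<in> borel_measurable borel" unfolding bracket_def[abs_def] by measurable
lemma bessel_measurable [measurable]: "bessel r \<in> borel_measurable borel" unfolding bessel_def[abs_def] by measurable
lemma riesz_measurable [measurable]: "riesz \<in> borel_measurable borel" unfolding riesz_def[abs_def] by measurable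

lemma one_plus_sq_pos: "0 < 1 + (k::real)\<^sup>2" using zero_le_power2[of k] by linarith

lemma bracket_pos [simp]: "bracket r k > 0"
  using one_plus_sq_pos[of k] by (simp add: bracket_def)
lemma bracket_nonneg [simp]: "bracket r k \<ge> 0" by (rule less_imp_le) simp
lemma bracket_nz [simp]: "bracket r k \<noteq> 0" using bracket_pos[of r k] by linarith
lemma bracket_mult: "bracket r k * bracket q k = bracket (r + q) k"
  by (simp add: bracket_def add_divide_distrib powr_add)
lemma bracket_0 [simp]: "bracket 0 k = 1" using one_plus_sq_pos[of k] by (simp add: bracket_def)
lemma bracket_minus [simp]: "bracket r (- k) = bracket r k" by (simp add: bracket_def)
lemma bracket_mono: "r \<le> q \<Longrightarrow> bracket r k \<le> bracket q k" unfolding bracket_def by (intro powr_mono) auto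
lemma bracket_le_1: "r \<le> 0 \<Longrightarrow> bracket r k \<le> 1" using bracket_mono[of r 0] by simp
lemma bracket_2: "bracket 2 k = 1 + k\<^sup>2" using one_plus_sq_pos[of k] by (simp add: bracket_def)
lemma bracket_1_sq: "(bracket 1 k)\<^sup>2 = 1 + k\<^sup>2"
  using bracket_mult[of 1 k 1] bracket_2[of k] by (simp add: power2_eq_square)
lemma bracket_m1_sq: "(bracket (-1) k)\<^sup>2 = inverse (1 + k\<^sup>2)"
  using bracket_mult[of "-1" k "-1"] bracket_mult[of "-2" k 2] bracket_2[of k]
  by (metis add.right_neutral inverse_unique mult.commute bracket_0 power2_eq_square add.left_inverse one_add_one minus_add_distrib)
lemma abs_le_jb1: "\<bar>k\<bar> \<le> bracket 1 k"
  by (rule power2_le_imp_le) (simp_all add: bracket_1_sq)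

lemma bessel_mult: "bessel r k * bessel q k = bessel (r + q) k" by (simp add: bessel_def flip: bracket_mult)
lemma bessel_mult3: "bessel r k * (bessel q k * z) = bessel (r + q) k * z" by (simp flip: bessel_mult add: mult.assoc)
lemma bessel_0 [simp]: "bessel 0 k = 1" by (simp add: bessel_def)
lemma bessel_0_fun: "bessel 0 = (\<lambda>_. 1)" by (rule ext) simp
lemma bessel_nz [simp]: "bessel r k \<noteq> 0" by (simp add: bessel_def)
lemma cmod_bessel [simp]: "cmod (bessel r k) = bracket r k" by (simp add: bessel_def)
lemma cnj_bessel [simp]: "cnj (bessel r k) = bessel r k" by (simp add: bessel_def)
lemma bessel_minus [simp]: "bessel r (- k) = bessel r k" by (simp add: bessel_def)
lemma riesz_minus [simp]: "riesz (- k) = - riesz k" by (simp add: riesz_def)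
lemma cnj_riesz [simp]: "cnj (riesz k) = - riesz k" by (simp add: riesz_def)
lemma riesz_J1: "riesz k * bessel 1 k = \<i> * of_real k"
  using bracket_mult[of "-1" k 1] by (simp add: riesz_def bessel_def mult.assoc flip: of_real_mult)

lemma cmod_riesz_le: "cmod (riesz k) \<le> 1"
proof -
  have "\<bar>k\<bar> * bracket (-1) k \<le> bracket 1 k * bracket (-1) k" by (intro mult_right_mono abs_le_jb1) simp
  then show ?thesis by (simp add: riesz_def norm_mult abs_mult bracket_mult)
qed

lemma bdd_mult_bessel: "r \<le> 0 \<Longrightarrow> bdd_mult (bessel r)" by (rule bmI[where C = 1]) (auto intro: bracket_le_1)
lemma bdd_mult_riesz: "bdd_mult riesz" by (rule bmI[where C = 1]) (auto intro: cmod_riesz_le)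

lemma mul_bessel_bessel: "r \<le> 0 \<Longrightarrow> q \<le> 0 \<Longrightarrow> mul (bessel r) (mul (bessel q) u) = mul (bessel (r + q)) u"
  by (simp add: mul_mul bdd_mult_bessel bessel_mult)
lemma mul_bessel_0 [simp]: "mul (bessel 0) u = u" by (simp add: bessel_0_fun mul_one)
lemma mul_riesz_bessel: "r \<le> 0 \<Longrightarrow> mul riesz (mul (bessel r) u) = mul (bessel r) (mul riesz u)"
  by (simp add: mul_mul bdd_mult_bessel bdd_mult_riesz mult.commute)
lemma mul_bessel_inj: "r \<le> 0 \<Longrightarrow> mul (bessel r) u = mul (bessel r) v \<Longrightarrow> u = v"
  by (rule mul_inj[of "bessel r"]) (auto intro: bdd_mult_bessel)
lemma norm_mul_bessel_le: "r \<le> 0 \<Longrightarrow> norm (mul (bessel r) u) \<le> norm u"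
  using norm_mul_le[of "bessel r" 1 u] bracket_le_1[of r] by simp
lemma norm_mul_riesz_le: "norm (mul riesz u) \<le> norm u"
  using norm_mul_le[of riesz 1 u] cmod_riesz_le by simp
lemma inner_mul_bessel: "r \<le> 0 \<Longrightarrow> inner (mul (bessel r) u) v = inner u (mul (bessel r) v)"
  by (simp add: inner_mul bdd_mult_bessel)
lemma inner_mul_riesz: "inner (mul riesz u) v = - inner u (mul riesz v)"
proof -
  have "mul (\<lambda>k. - riesz k) v = - mul riesz v"
    using mul_scale_left[OF bdd_mult_riesz, of "-1" v] by simp
  then show ?thesis by (simp add: inner_mul bdd_mult_riesz)
qed
lemma herm_mul_bessel: "r \<le> 0 \<Longrightarrow> herm (mul (bessel r) u) = mul (bessel r) (herm u)" by (simp add: herm_mul bdd_mult_bessel)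
lemma herm_mul_riesz: "herm (mul riesz u) = mul riesz (herm u)" by (simp add: herm_mul bdd_mult_riesz)

text \<open>Peetre's inequality with a product on the right, so that both factors carry the weight.
  It serves where one factor is measured, weight included, by the L^1 norm of its transform.\<close>

lemma peetre: assumes "r \<ge> 0" shows "bracket r k \<le> 2 powr (r / 2) * (bracket r (k - l) * bracket r l)"
proof -
  have "1 + k\<^sup>2 \<le> 2 * ((1 + (k - l)\<^sup>2) * (1 + l\<^sup>2))"
  proof -
    have "(k - l + l)\<^sup>2 \<le> 2 * (k - l)\<^sup>2 + 2 * l\<^sup>2"
      using sum_squares_bound[of "k - l" l] unfolding power2_sum[of "k - l" l] by simp
    then have "k\<^sup>2 \<le> 2 * (k - l)\<^sup>2 + 2 * l\<^sup>2" by simp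
    moreover have "0 \<le> (k - l)\<^sup>2 * l\<^sup>2" by simp
    moreover have "2 * ((1 + (k - l)\<^sup>2) * (1 + l\<^sup>2)) = 2 + 2 * (k - l)\<^sup>2 + 2 * l\<^sup>2 + 2 * ((k - l)\<^sup>2 * l\<^sup>2)"
      by (simp add: distrib_left distrib_right)
    ultimately show ?thesis by linarith
  qed
  then have "(1 + k\<^sup>2) powr (r / 2) \<le> (2 * ((1 + (k - l)\<^sup>2) * (1 + l\<^sup>2))) powr (r / 2)"
    using assms by (intro powr_mono2) auto
  then show ?thesis by (simp add: bracket_def powr_mult)
qed

text \<open>One of the two frequencies is at least \<open>\<bar>k\<bar> / 2\<close> and bears the
  weight alone, so that the other factor keeps its decay and stays integrable.\<close>

lemma peetre_sum: assumes "r \<ge> 0" shows "bracket r k \<le> 2 powr r * (bracket r (k - l) + bracket r l)"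
proof -
  define m where "m = max \<bar>k - l\<bar> \<bar>l\<bar>"
  have "\<bar>k\<bar> \<le> 2 * m" using abs_triangle_ineq[of "k - l" l] by (auto simp: m_def max_def)
  then have "k\<^sup>2 \<le> (2 * m)\<^sup>2" by (metis abs_ge_zero power2_abs power_mono)
  then have "1 + k\<^sup>2 \<le> 4 * (1 + m\<^sup>2)" by (simp add: power_mult_distrib)
  then have "bracket r k \<le> (4 * (1 + m\<^sup>2)) powr (r / 2)"
    unfolding bracket_def using assms by (intro powr_mono2) auto
  also have "\<dots> = 2 powr r * bracket r m"
  proof -
    have "(4::real) powr (r / 2) = (2 powr 2) powr (r / 2)" by simp
    also have "\<dots> = 2 powr r" by (simp only: powr_powr) simp
    finally have "(4::real) powr (r / 2) = 2 powr r" .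
    moreover have "(4 * (1 + m\<^sup>2)) powr (r / 2) = 4 powr (r / 2) * (1 + m\<^sup>2) powr (r / 2)"
      by (rule powr_mult)
    ultimately show ?thesis by (simp only: bracket_def)
  qed
  also have "bracket r m \<le> bracket r (k - l) + bracket r l"
    by (auto simp: m_def max_def bracket_def)
  finally show ?thesis by simp
qed

lemma sq_bessel_m1: "sq (bessel (-1))"
  unfolding sq_def using integrable_inverse_one_plus_square by (simp add: bracket_m1_sq)

text \<open>The constant of the embedding of H^1 into the functions with integrable Fourier
  transform, by Cauchy-Schwarz against the weight of order -1.\<close>

definition bessel_const :: real where "bessel_const = norm (l2_of (bessel (-1)))"

lemma bessel_const_nonneg: "bessel_const \<ge> 0" by (simp add: bessel_const_def)

lemma bessel_m1_L1:
  assumes "r \<le> -1"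
  shows "integrable lborel (\<lambda>k. bessel r k * rep u k)" "(LINT k|lborel. cmod (bessel r k * rep u k)) \<le> bessel_const * norm u"
proof -
  show i: "integrable lborel (\<lambda>k. bessel r k * rep u k)"
  proof (rule sq_integrable_mult)
    show "sq (bessel r)" by (rule sq_dominated[OF sq_bessel_m1, where C = 1]) (auto intro: bracket_mono assms)
  qed simp
  have i1: "integrable lborel (\<lambda>k. bessel (-1) k * rep u k)" by (intro sq_integrable_mult sq_bessel_m1 sq_rep)
  have "(LINT k|lborel. cmod (bessel r k * rep u k)) \<le> (LINT k|lborel. cmod (bessel (-1) k * rep u k))"
    by (intro integral_mono integrable_norm i i1) (auto simp: norm_mult intro!: mult_right_mono bracket_mono assms)
  also have "\<dots> \<le> bessel_const * norm u" using cauchy_schwarz_l2_of[OF sq_bessel_m1 sq_rep[of u]] by (simp add: bessel_const_def)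
  finally show "(LINT k|lborel. cmod (bessel r k * rep u k)) \<le> bessel_const * norm u" .
qed

section \<open>Convolutions\<close>

text \<open>Young's inequality for L^1 and L^2: the modulus of \<open>a\<close> is split into two
  square roots, then Cauchy-Schwarz and Tonelli's theorem apply. The last claim makes the
  convolution integral available at almost every point.\<close>

lemma young_convol:
  assumes a: "integrable lborel a" and g: "sq g"
  shows "sq (convol a g)" "norm (l2_of (convol a g)) \<le> (LINT k|lborel. cmod (a k)) * norm (l2_of g)"
    "AE k in lborel. integrable lborel (\<lambda>l. a (k - l) * g l)"
proof -
  have [measurable]: "a \<in> borel_measurable borel" "g \<in> borel_measurable borel" using a g by (auto simp: sq_def)
  define A where "A = (LINT k|lborel. cmod (a k))"
  have A0: "A \<ge> 0" unfolding A_def by simp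
  have nnA: "(\<integral>\<^sup>+k. ennreal (cmod (a k)) \<partial>lborel) = ennreal A"
    unfolding A_def by (intro nn_integral_eq_integral integrable_norm a) auto
  have shiftA: "(\<integral>\<^sup>+l. ennreal (cmod (a (k - l))) \<partial>lborel) = ennreal A" for k
    using nn_integral_real_affine[of "\<lambda>l. ennreal (cmod (a l))" "-1" k] nnA by simp
  have shiftA': "(\<integral>\<^sup>+k. ennreal (cmod (a (k - l))) \<partial>lborel) = ennreal A" for l :: real
    using nn_integral_real_affine[of "\<lambda>l. ennreal (cmod (a l))" "1" "-l"] nnA by simp
  define h where "h k = (\<integral>\<^sup>+l. ennreal (cmod (a (k - l) * g l)) \<partial>lborel)" for k
  have [measurable]: "h \<in> borel_measurable lborel" unfolding h_def by measurable
  have h2: "(h k)\<^sup>2 \<le> ennreal A * (\<integral>\<^sup>+l. ennreal (cmod (a (k - l)) * (cmod (g l))\<^sup>2) \<partial>lborel)" for k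
  proof -
    have "h k = (\<integral>\<^sup>+l. ennreal (sqrt (cmod (a (k - l)))) * ennreal (sqrt (cmod (a (k - l))) * cmod (g l)) \<partial>lborel)"
      unfolding h_def by (intro nn_integral_cong) (simp add: norm_mult mult.assoc[symmetric] flip: ennreal_mult)
    then have "(h k)\<^sup>2 \<le> (\<integral>\<^sup>+l. (ennreal (sqrt (cmod (a (k - l)))))\<^sup>2 \<partial>lborel) *
       (\<integral>\<^sup>+l. (ennreal (sqrt (cmod (a (k - l))) * cmod (g l)))\<^sup>2 \<partial>lborel)"
      by (simp only:) (rule Cauchy_Schwarz_nn_integral, measurable)
    then show ?thesis by (simp add: ennreal_power shiftA power_mult_distrib)
  qed
  have "(\<integral>\<^sup>+k. (h k)\<^sup>2 \<partial>lborel) \<le> (\<integral>\<^sup>+k. ennreal A * (\<integral>\<^sup>+l. ennreal (cmod (a (k - l)) * (cmod (g l))\<^sup>2) \<partial>lborel) \<partial>lborel)"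
    by (intro nn_integral_mono h2)
  also have "\<dots> = ennreal A * (\<integral>\<^sup>+k. \<integral>\<^sup>+l. ennreal (cmod (a (k - l)) * (cmod (g l))\<^sup>2) \<partial>lborel \<partial>lborel)"
    by (rule nn_integral_cmult) measurable
  also have "(\<integral>\<^sup>+k. \<integral>\<^sup>+l. ennreal (cmod (a (k - l)) * (cmod (g l))\<^sup>2) \<partial>lborel \<partial>lborel)
     = (\<integral>\<^sup>+l. \<integral>\<^sup>+k. ennreal (cmod (a (k - l)) * (cmod (g l))\<^sup>2) \<partial>lborel \<partial>lborel)"
    by (rule lborel_pair.Fubini'[symmetric]) measurable
  also have "\<dots> = (\<integral>\<^sup>+l. ennreal A * ennreal ((cmod (g l))\<^sup>2) \<partial>lborel)"
    by (intro nn_integral_cong) (simp add: ennreal_mult nn_integral_multc shiftA')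
  also have "\<dots> = ennreal A * ennreal ((norm (l2_of g))\<^sup>2)"
    using nn_norm_l2_of[OF g] by (simp add: nn_integral_cmult)
  finally have int: "(\<integral>\<^sup>+k. (h k)\<^sup>2 \<partial>lborel) \<le> ennreal ((A * norm (l2_of g))\<^sup>2)"
    using A0 by (simp add: power_mult_distrib power2_eq_square ac_simps flip: ennreal_mult)
  then have "(\<integral>\<^sup>+k. (h k)\<^sup>2 \<partial>lborel) \<noteq> \<infinity>" by (auto simp: top_unique)
  then have "AE k in lborel. (h k)\<^sup>2 \<noteq> \<infinity>" by (intro nn_integral_PInf_AE) auto
  then show ae: "AE k in lborel. integrable lborel (\<lambda>l. a (k - l) * g l)"
  proof eventually_elim
    case (elim k)
    then have "h k < \<infinity>" by (cases "h k") (auto simp: power2_eq_square less_top)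
    then show ?case unfolding h_def by (intro integrableI_bounded) auto
  qed
  have "(\<integral>\<^sup>+k. ennreal ((cmod (convol a g k))\<^sup>2) \<partial>lborel) \<le> (\<integral>\<^sup>+k. (h k)\<^sup>2 \<partial>lborel)"
  proof (rule nn_integral_mono_AE, use ae in eventually_elim)
    case (elim k)
    \<comment> \<open>The normalizing factor of the convolution is at most 1 and is dropped from the
      bound.\<close>
    have "sqrt (2 * pi) \<ge> 1" using pi_gt3 by (simp add: real_le_rsqrt)
    then have "cmod (convol a g k) \<le> 1 * cmod (LINT l|lborel. a (k - l) * g l)"
      unfolding convol_def norm_mult by (intro mult_right_mono) (auto simp: norm_divide)
    then have "ennreal (cmod (convol a g k)) \<le> h k"
      unfolding h_def using integral_norm_bound_ennreal[OF elim] by (metis ennreal_leI mult_1 order_trans)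
    then have "(ennreal (cmod (convol a g k)))\<^sup>2 \<le> (h k)\<^sup>2" by (rule power_mono) simp
    then show ?case by (simp add: ennreal_power)
  qed
  with int have "(\<integral>\<^sup>+k. ennreal ((cmod (convol a g k))\<^sup>2) \<partial>lborel) \<le> ennreal ((A * norm (l2_of g))\<^sup>2)" by (rule order_trans[rotated])
  then show "sq (convol a g)" "norm (l2_of (convol a g)) \<le> (LINT k|lborel. cmod (a k)) * norm (l2_of g)"
    using norm_l2_of_le[of "convol a g" "A * norm (l2_of g)"] A0 by (auto simp: A_def)
qed

lemma sq_shift_reflect:
  assumes "sq f"
  shows "sq (\<lambda>l. f (k - l))"
proof -
  have [measurable]: "f \<in> borel_measurable borel" using assms by (auto simp: sq_def)
  have "(\<lambda>l. f (k - l)) \<in> borel_measurable borel" by measurable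
  then show ?thesis
    using lborel_integrable_real_affine[OF sq_integrable[OF assms], of "-1" k] by (simp add: sq_def)
qed

lemma convol_integrable_sq: "sq f \<Longrightarrow> sq g \<Longrightarrow> integrable lborel (\<lambda>l. f (k - l) * g l)"
  by (intro sq_integrable_mult sq_shift_reflect)

lemma convol_add_left: "sq f \<Longrightarrow> sq f' \<Longrightarrow> sq g \<Longrightarrow> convol (\<lambda>k. f k + f' k) g k = convol f g k + convol f' g k"
  using convol_integrable_sq[of f g k] convol_integrable_sq[of f' g k]
  by (simp add: convol_def distrib_right distrib_left add_divide_distrib)

lemma convol_scale_left: "convol (\<lambda>k. c * f k) g k = c * convol f g k"
  by (simp add: convol_def mult.assoc)
text \<open>The transform, with weight of order \<open>r\<close>, of the product of two functions whose transforms
  with weights of order \<open>p\<close> and \<open>q\<close> are \<open>u\<close> and \<open>v\<close>.\<close>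

definition wconv :: "real \<Rightarrow> real \<Rightarrow> real \<Rightarrow> l2 \<Rightarrow> l2 \<Rightarrow> l2" where
  "wconv r p q u v = l2_of (\<lambda>k. bessel r k * convol (\<lambda>k. bessel (-p) k * rep u k) (\<lambda>k. bessel (-q) k * rep v k) k)"

text \<open>Conditions under which multiplication maps H^p x H^q into H^r. The lower bound 1 for
  \<open>p\<close> and \<open>q\<close> matches \<open>bessel (-1)\<close>, the square integrable
  weight on which the estimates are built.\<close>

definition admissible :: "real \<Rightarrow> real \<Rightarrow> real \<Rightarrow> bool" where
  "admissible r p q \<longleftrightarrow> 0 \<le> r \<and> r \<le> p \<and> r \<le> q \<and> 1 \<le> p \<and> 1 \<le> q"

lemma sq_bessel_rep: "r \<le> 0 \<Longrightarrow> sq (\<lambda>k. bessel r k * rep u k)"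
  by (intro sq_bdd_mult bdd_mult_bessel sq_rep)

text \<open>Two dominating products fit the two summands of \<open>peetre_sum\<close>; where a
  single one suffices, the other is taken to be 0. The majorant is built from absolute values, so
  that Young's inequality applies to it.\<close>

lemma norm_convol_le:
  assumes [measurable]: "f \<in> borel_measurable borel" "g \<in> borel_measurable borel"
    and i: "integrable lborel (\<lambda>l. c (k - l) * d l)" and i': "integrable lborel (\<lambda>l. c' (k - l) * d' l)"
    and le: "\<And>l. cmod z * cmod (f (k - l) * g l) \<le> C * (cmod (c (k - l) * d l) + cmod (c' (k - l) * d' l))"
  shows "cmod (z * convol f g k) \<le> C * cmod (convol (\<lambda>k. of_real (cmod (c k))) (\<lambda>k. of_real (cmod (d k))) k +
     convol (\<lambda>k. of_real (cmod (c' k))) (\<lambda>k. of_real (cmod (d' k))) k)"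
proof -
  let ?s = "1 / sqrt (2 * pi)"
  have convol: "convol (\<lambda>k. of_real (cmod (c k))) (\<lambda>k. of_real (cmod (d k))) k = of_real (?s * (LINT l|lborel. cmod (c (k - l) * d l)))" for c d :: "real \<Rightarrow> complex"
    unfolding convol_def norm_mult of_real_mult[symmetric] integral_complex_of_real ..
  have "cmod (z * (LINT l|lborel. f (k - l) * g l)) \<le> C * ((LINT l|lborel. cmod (c (k - l) * d l)) + (LINT l|lborel. cmod (c' (k - l) * d' l)))"
  proof -
    have "cmod (LINT l|lborel. z * (f (k - l) * g l)) \<le> (LINT l|lborel. cmod (z * (f (k - l) * g l)))"
      by (rule integral_norm_bound)
    also have "\<dots> \<le> (LINT l|lborel. C * (cmod (c (k - l) * d l) + cmod (c' (k - l) * d' l)))"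
    proof (rule integral_mono)
      show i2: "integrable lborel (\<lambda>l. C * (cmod (c (k - l) * d l) + cmod (c' (k - l) * d' l)))"
        using i i' by (intro integrable_mult_right Bochner_Integration.integrable_add integrable_norm)
      show "cmod (z * (f (k - l) * g l)) \<le> C * (cmod (c (k - l) * d l) + cmod (c' (k - l) * d' l))" for l
        using le[of l] by (simp add: norm_mult)
      then show "integrable lborel (\<lambda>l. cmod (z * (f (k - l) * g l)))"
        by (intro Bochner_Integration.integrable_bound[OF i2]) (measurable, auto intro: order_trans[OF _ abs_ge_self])
    qed
    also have "\<dots> = C * ((LINT l|lborel. cmod (c (k - l) * d l)) + (LINT l|lborel. cmod (c' (k - l) * d' l)))"
      using i i' by simp
    finally show ?thesis by simp
  qed
  then have "?s * cmod (z * (LINT l|lborel. f (k - l) * g l)) \<le> ?s * (C * ((LINT l|lborel. cmod (c (k - l) * d l)) + (LINT l|lborel. cmod (c' (k - l) * d' l))))"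
    by (rule mult_left_mono) simp
  also have "\<dots> = C * (?s * ((LINT l|lborel. cmod (c (k - l) * d l)) + (LINT l|lborel. cmod (c' (k - l) * d' l))))" by simp
  also have "\<dots> = C * cmod (convol (\<lambda>k. of_real (cmod (c k))) (\<lambda>k. of_real (cmod (d k))) k +
     convol (\<lambda>k. of_real (cmod (c' k))) (\<lambda>k. of_real (cmod (d' k))) k)"
    unfolding convol of_real_add[symmetric] norm_of_real
    by (subst abs_of_nonneg) (auto intro!: add_nonneg_nonneg integral_nonneg_AE simp: distrib_left add_divide_distrib)
  finally show ?thesis by (simp add: convol_def norm_mult norm_divide)
qed

lemma integrable_of_cmod: "integrable M f \<Longrightarrow> integrable M (\<lambda>x. of_real (cmod (f x)) :: complex)"
  by (intro integrable_of_real integrable_norm)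

text \<open>By \<open>peetre_sum\<close> the weight of order \<open>r\<close> falls on one factor,
  which it leaves square integrable because \<open>r\<close> is at most \<open>p\<close> and
  \<open>q\<close>. The other factor keeps decay of order at least 1 and is integrable. Each of the
  two terms is estimated by Young's inequality and contributes one
  \<open>bessel_const\<close>.\<close>

lemma wconv_bound:
  assumes admissible: "admissible r p q"
  shows "sq (\<lambda>k. bessel r k * convol (\<lambda>k. bessel (-p) k * rep u k) (\<lambda>k. bessel (-q) k * rep v k) k)"
    "norm (wconv r p q u v) \<le> (2 powr r * (2 * bessel_const)) * norm u * norm v"
proof -
  let ?f = "\<lambda>k. bessel (-p) k * rep u k" and ?g = "\<lambda>k. bessel (-q) k * rep v k"
  let ?a = "\<lambda>w k. of_real (cmod (bessel (-1) k * rep w k)) :: complex" and ?n = "\<lambda>w k. of_real (cmod (rep w k)) :: complex"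
  have sqn: "sq (?n w)" "norm (l2_of (?n w)) = norm w" for w using norm_l2_of_cmod[OF sq_rep[of w]] by simp_all
  have inta: "integrable lborel (?a w)" for w by (intro integrable_of_cmod bessel_m1_L1) simp
  have inta': "(LINT k|lborel. cmod (?a w k)) \<le> bessel_const * norm w" for w using bessel_m1_L1(2)[of "-1" w] by simp
  note y = young_convol(1,2)[OF inta sqn(1)]
  have cvb: "norm (l2_of (convol (?a w) (?n w'))) \<le> bessel_const * norm w * norm w'" for w w'
    using order_trans[OF y(2)[of w w'] mult_right_mono[OF inta'[of w]]] sqn(2) by simp
  let ?b = "\<lambda>k. convol (?a u) (?n v) k + convol (?n u) (?a v) k"
  have comm: "convol (?n u) (?a v) = convol (?a v) (?n u)" by (rule ext) (rule convol_commute)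
  have sqb: "sq ?b" using sq_add[OF y(1)[of u v] y(1)[of v u]] by (simp only: comm)
  have "norm (l2_of ?b) \<le> norm (l2_of (convol (?a u) (?n v))) + norm (l2_of (convol (?a v) (?n u)))"
    using norm_triangle_ineq[of "l2_of (convol (?a u) (?n v))" "l2_of (convol (?a v) (?n u))"] l2_of_add[OF y(1)[of u v] y(1)[of v u]]
    by (simp only: comm)
  also have "\<dots> \<le> 2 * bessel_const * norm u * norm v" using cvb[of u v] cvb[of v u] by (simp add: algebra_simps)
  finally have nb: "norm (l2_of ?b) \<le> 2 * bessel_const * norm u * norm v" .
  have le: "AE k in lborel. cmod (bessel r k * convol ?f ?g k) \<le> 2 powr r * cmod (?b k)"
  proof (rule AE_I2)
    fix k
    have s: "sq (\<lambda>k. bessel (-1) k * rep w k)" for w by (rule sq_bessel_rep) simp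
    show "cmod (bessel r k * convol ?f ?g k) \<le> 2 powr r * cmod (?b k)"
    proof (rule norm_convol_le)
      fix l
      have "bracket r k * (bracket (-p) (k - l) * bracket (-q) l) \<le> (2 powr r * (bracket r (k - l) + bracket r l)) * (bracket (-p) (k - l) * bracket (-q) l)"
        using admissible by (intro mult_right_mono peetre_sum) (auto simp: admissible_def)
      also have "\<dots> = 2 powr r * (bracket (r - p) (k - l) * bracket (-q) l + bracket (-p) (k - l) * bracket (r - q) l)"
        by (simp add: bracket_mult[of r "k - l" "-p", simplified, symmetric] bracket_mult[of r l "-q", simplified, symmetric] algebra_simps)
      also have "\<dots> \<le> 2 powr r * (1 * bracket (-1) l + bracket (-1) (k - l) * 1)"
        using admissible by (intro mult_left_mono add_mono mult_mono bracket_mono bracket_le_1) (auto simp: admissible_def)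
      finally have "bracket r k * (bracket (-p) (k - l) * bracket (-q) l) * (cmod (rep u (k - l)) * cmod (rep v l)) \<le>
        2 powr r * (1 * bracket (-1) l + bracket (-1) (k - l) * 1) * (cmod (rep u (k - l)) * cmod (rep v l))"
        by (rule mult_right_mono) simp
      then show "cmod (bessel r k) * cmod (bessel (-p) (k - l) * rep u (k - l) * (bessel (-q) l * rep v l)) \<le>
         2 powr r * (cmod (bessel (-1) (k - l) * rep u (k - l) * rep v l) + cmod (rep u (k - l) * (bessel (-1) l * rep v l)))"
        by (simp add: norm_mult algebra_simps)
    qed (measurable, (intro convol_integrable_sq s sq_rep)+)
  qed
  show sq: "sq (\<lambda>k. bessel r k * convol ?f ?g k)" "norm (wconv r p q u v) \<le> (2 powr r * (2 * bessel_const)) * norm u * norm v"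
  proof -
    have m: "(\<lambda>k. bessel r k * convol ?f ?g k) \<in> borel_measurable lborel" by measurable
    show "sq (\<lambda>k. bessel r k * convol ?f ?g k)" using norm_l2_of_mono[OF sqb m le] by simp
    have "norm (wconv r p q u v) \<le> 2 powr r * norm (l2_of ?b)" unfolding wconv_def using norm_l2_of_mono[OF sqb m le] by simp
    also have "\<dots> \<le> 2 powr r * (2 * bessel_const * norm u * norm v)" by (rule mult_left_mono[OF nb]) simp
    finally show "norm (wconv r p q u v) \<le> (2 powr r * (2 * bessel_const)) * norm u * norm v" by (simp add: mult.assoc)
  qed
qed

lemma rep_wconv: "admissible r p q \<Longrightarrow> AE k in lborel. rep (wconv r p q u v) k = bessel r k * convol (\<lambda>k. bessel (-p) k * rep u k) (\<lambda>k. bessel (-q) k * rep v k) k"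
  unfolding wconv_def by (intro rep_l2_of wconv_bound)

lemma admissible_commute: "admissible r p q \<Longrightarrow> admissible r q p" by (auto simp: admissible_def)

lemma wconv_commute: "wconv r p q u v = wconv r q p v u"
  unfolding wconv_def by (subst convol_commute) simp

lemma convol_weighted_add:
  assumes "p \<ge> 0" "q \<ge> 0"
  shows "convol (\<lambda>k. bessel (-p) k * rep (u + u') k) (\<lambda>k. bessel (-q) k * rep v k) k =
    convol (\<lambda>k. bessel (-p) k * rep u k) (\<lambda>k. bessel (-q) k * rep v k) k + convol (\<lambda>k. bessel (-p) k * rep u' k) (\<lambda>k. bessel (-q) k * rep v k) k"
proof -
  have "convol (\<lambda>k. bessel (-p) k * rep (u + u') k) (\<lambda>k. bessel (-q) k * rep v k) k =
     convol (\<lambda>k. bessel (-p) k * rep u k + bessel (-p) k * rep u' k) (\<lambda>k. bessel (-q) k * rep v k) k"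
    by (rule convol_cong_AE) (use rep_add[of u u'] in \<open>auto elim!: eventually_mono simp: distrib_left\<close>)
  also have "\<dots> = convol (\<lambda>k. bessel (-p) k * rep u k) (\<lambda>k. bessel (-q) k * rep v k) k + convol (\<lambda>k. bessel (-p) k * rep u' k) (\<lambda>k. bessel (-q) k * rep v k) k"
    using assms by (intro convol_add_left sq_bessel_rep) auto
  finally show ?thesis .
qed

lemma convol_weighted_scale:
  shows "convol (\<lambda>k. bessel (-p) k * rep (c *\<^sub>R u) k) (\<lambda>k. bessel (-q) k * rep v k) k =
    c *\<^sub>R convol (\<lambda>k. bessel (-p) k * rep u k) (\<lambda>k. bessel (-q) k * rep v k) k"
proof -
  have "convol (\<lambda>k. bessel (-p) k * rep (c *\<^sub>R u) k) (\<lambda>k. bessel (-q) k * rep v k) k =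
     convol (\<lambda>k. of_real c * (bessel (-p) k * rep u k)) (\<lambda>k. bessel (-q) k * rep v k) k"
    by (rule convol_cong_AE) (use rep_scaleR[of c u] in \<open>auto elim!: eventually_mono simp: scaleR_conv_of_real\<close>)
  then show ?thesis by (simp add: convol_scale_left scaleR_conv_of_real)
qed

lemma bounded_bilinear_wconv:
  assumes admissible: "admissible r p q"
  shows "bounded_bilinear (wconv r p q)"
proof -
  have add: "wconv r p q (u + u') v = wconv r p q u v + wconv r p q u' v" if "admissible r p q" for r p q u u' v
  proof (rule l2_eqI)
    have pq: "p \<ge> 0" "q \<ge> 0" using that by (auto simp: admissible_def)
    show "AE x in lborel. rep (wconv r p q (u + u') v) x = rep (wconv r p q u v + wconv r p q u' v) x"
      using rep_wconv[OF that, of "u + u'" v] rep_wconv[OF that, of u v] rep_wconv[OF that, of u' v] rep_add[of "wconv r p q u v" "wconv r p q u' v"]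
      by eventually_elim (simp add: convol_weighted_add[OF pq] distrib_left)
  qed
  have scale: "wconv r p q (c *\<^sub>R u) v = c *\<^sub>R wconv r p q u v" if "admissible r p q" for r p q c u v
  proof (rule l2_eqI)
    show "AE x in lborel. rep (wconv r p q (c *\<^sub>R u) v) x = rep (c *\<^sub>R wconv r p q u v) x"
      using rep_wconv[OF that, of "c *\<^sub>R u" v] rep_wconv[OF that, of u v] rep_scaleR[of c "wconv r p q u v"]
      by eventually_elim (simp add: convol_weighted_scale)
  qed
  show ?thesis
  proof
    fix a a' b b' :: l2 and c :: real
    show "wconv r p q (a + a') b = wconv r p q a b + wconv r p q a' b" by (rule add[OF admissible])
    show "wconv r p q a (b + b') = wconv r p q a b + wconv r p q a b'"
      using add[OF admissible_commute[OF admissible]] by (subst (1 2 3) wconv_commute)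
    show "wconv r p q (c *\<^sub>R a) b = c *\<^sub>R wconv r p q a b" by (rule scale[OF admissible])
    show "wconv r p q a (c *\<^sub>R b) = c *\<^sub>R wconv r p q a b"
      using scale[OF admissible_commute[OF admissible]] by (subst (1 2) wconv_commute)
    show "\<exists>K. \<forall>a b. norm (wconv r p q a b) \<le> norm a * norm b * K"
      using wconv_bound(2)[OF admissible] by (intro exI[of _ "2 powr r * (2 * bessel_const)"]) (simp add: ac_simps)
  qed
qed

text \<open>One and the same product in two systems of weights. The shifts are nonpositive so that
  all the multipliers involved are bounded.\<close>

lemma wconv_reweight:
  assumes admissible: "admissible r p q" "admissible r' p' q'" and w: "c \<le> 0" "a \<le> 0" "b \<le> 0"
    and e: "r' = r + c" "p' = p - a" "q' = q - b"
  shows "mul (bessel c) (wconv r p q (mul (bessel a) u) (mul (bessel b) v)) = wconv r' p' q' u v"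
proof (rule l2_eqI)
  have convol: "convol (\<lambda>k. bessel (-p) k * rep (mul (bessel a) u) k) (\<lambda>k. bessel (-q) k * rep (mul (bessel b) v) k) k = convol (\<lambda>k. bessel (-p') k * rep u k) (\<lambda>k. bessel (-q') k * rep v k) k" for k
  proof (rule convol_cong_AE)
    show "AE k in lborel. bessel (-p) k * rep (mul (bessel a) u) k = bessel (-p') k * rep u k"
      using rep_mul[OF bdd_mult_bessel[OF w(2)], of u] by eventually_elim (simp add: e bessel_mult3)
    show "AE k in lborel. bessel (-q) k * rep (mul (bessel b) v) k = bessel (-q') k * rep v k"
      using rep_mul[OF bdd_mult_bessel[OF w(3)], of v] by eventually_elim (simp add: e bessel_mult3)
  qed measurable
  show "AE k in lborel. rep (mul (bessel c) (wconv r p q (mul (bessel a) u) (mul (bessel b) v))) k = rep (wconv r' p' q' u v) k"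
    using rep_mul[OF bdd_mult_bessel[OF w(1)], of "wconv r p q (mul (bessel a) u) (mul (bessel b) v)"] rep_wconv[OF admissible(1), of "mul (bessel a) u" "mul (bessel b) v"]
      rep_wconv[OF admissible(2), of u v]
    by eventually_elim (simp add: e bessel_mult3 add.commute convol[unfolded e])
qed

lemma convol_cnj_reflect: "convol (\<lambda>k. cnj (f (- k))) (\<lambda>k. cnj (g (- k))) k = cnj (convol f g (- k))"
proof -
  have "(LINT l|lborel. cnj (f (- (k - l))) * cnj (g (- l))) = (LINT l|lborel. cnj (f (- k - l) * g l))"
    by (subst lborel_integral_real_affine[where c = "-1" and t = 0]) (auto simp: algebra_simps)
  then show ?thesis by (simp add: convol_def del: complex_cnj_mult)
qed

text \<open>On the physical side: the product of real functions is real.\<close>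

lemma herm_wconv:
  assumes admissible: "admissible r p q"
  shows "herm (wconv r p q u v) = wconv r p q (herm u) (herm v)"
proof -
  let ?c = "convol (\<lambda>k. bessel (-p) k * rep u k) (\<lambda>k. bessel (-q) k * rep v k)"
  have "herm (wconv r p q u v) = l2_of (\<lambda>k. cnj (bessel r (- k) * ?c (- k)))"
    unfolding wconv_def by (rule herm_l2_of[OF wconv_bound(1)[OF admissible]])
  also have "(\<lambda>k. cnj (bessel r (- k) * ?c (- k))) = (\<lambda>k. bessel r k * convol (\<lambda>k. bessel (-p) k * rep (herm u) k) (\<lambda>k. bessel (-q) k * rep (herm v) k) k)"
  proof
    fix k
    have "convol (\<lambda>k. bessel (-p) k * rep (herm u) k) (\<lambda>k. bessel (-q) k * rep (herm v) k) k =
      convol (\<lambda>k. cnj (bessel (-p) (- k) * rep u (- k))) (\<lambda>k. cnj (bessel (-q) (- k) * rep v (- k))) k"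
      by (rule convol_cong_AE) (use rep_herm[of u] rep_herm[of v] in \<open>auto elim!: eventually_mono\<close>)
    also have "\<dots> = cnj (?c (- k))" by (rule convol_cnj_reflect)
    finally show "cnj (bessel r (- k) * ?c (- k)) = bessel r k * convol (\<lambda>k. bessel (-p) k * rep (herm u) k) (\<lambda>k. bessel (-q) k * rep (herm v) k) k"
      by simp
  qed
  finally show ?thesis unfolding wconv_def .
qed

text \<open>The L^1 norm of the weighted transform replaces a bound on the first function and its
  derivatives in L^\<infinity>. Under the long wave scaling it keeps the full amplitude, whereas the
  L^2 norm of a long wave is larger by a factor \<epsilon>^(-1/2).\<close>

lemma wconv_L1_bound:
  assumes admissible: "admissible r p q"
    and a: "integrable lborel (\<lambda>k. bessel r k * (bessel (-p) k * rep u k))"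
    and A: "(LINT k|lborel. cmod (bessel r k * (bessel (-p) k * rep u k))) \<le> A"
  shows "norm (wconv r p q u v) \<le> 2 powr (r / 2) * A * norm v"
proof -
  let ?f = "\<lambda>k. bessel (-p) k * rep u k" and ?g = "\<lambda>k. bessel (-q) k * rep v k"
  let ?a = "\<lambda>k. of_real (cmod (bessel r k * (bessel (-p) k * rep u k))) :: complex" and ?n = "\<lambda>k. of_real (cmod (rep v k)) :: complex"
  have inta: "integrable lborel ?a" by (intro integrable_of_cmod a)
  note y = young_convol[OF inta norm_l2_of_cmod(1)[OF sq_rep[of v]]]
  have nb: "norm (l2_of (convol ?a ?n)) \<le> A * norm v"
    using order_trans[OF y(2) mult_right_mono] A norm_l2_of_cmod(2)[OF sq_rep[of v]] by simp
  have m1: "(\<lambda>k. bessel (-p) k * rep u k) \<in> borel_measurable borel" for p u by measurable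
  have i0: "integrable lborel (\<lambda>l. (\<lambda>_. 0) (k - l) * (\<lambda>_. 0) l :: complex)" for k :: real by simp
  have "AE k in lborel. integrable lborel (\<lambda>l. bessel r (k - l) * (bessel (-p) (k - l) * rep u (k - l)) * rep v l)"
    using young_convol(3)[OF a sq_rep[of v]] .
  then have le: "AE k in lborel. cmod (bessel r k * convol ?f ?g k) \<le> 2 powr (r / 2) * cmod (convol ?a ?n k)"
  proof eventually_elim
    case (elim k)
    have "cmod (bessel r k * convol ?f ?g k) \<le> 2 powr (r / 2) * cmod (convol ?a ?n k + convol (\<lambda>k. of_real (cmod 0)) (\<lambda>k. of_real (cmod 0)) k)"
    proof (rule norm_convol_le[OF m1 m1 elim i0])
      fix l
      have "bracket r k * bracket (-q) l \<le> 2 powr (r / 2) * (bracket r (k - l) * bracket r l) * bracket (-q) l"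
        using admissible by (intro mult_right_mono peetre) (auto simp: admissible_def)
      also have "\<dots> = 2 powr (r / 2) * bracket r (k - l) * bracket (r - q) l" by (simp add: bracket_mult[of r l "-q", simplified, symmetric])
      also have "\<dots> \<le> 2 powr (r / 2) * bracket r (k - l) * 1" using admissible by (intro mult_left_mono bracket_le_1) (auto simp: admissible_def)
      finally have "bracket r k * bracket (-q) l * (bracket (-p) (k - l) * cmod (rep u (k - l)) * cmod (rep v l)) \<le>
         2 powr (r / 2) * bracket r (k - l) * 1 * (bracket (-p) (k - l) * cmod (rep u (k - l)) * cmod (rep v l))"
        by (rule mult_right_mono) simp
      then show "cmod (bessel r k) * cmod (bessel (- p) (k - l) * rep u (k - l) * (bessel (- q) l * rep v l))
         \<le> 2 powr (r / 2) * (cmod (bessel r (k - l) * (bessel (- p) (k - l) * rep u (k - l)) * rep v l) + cmod (0 * 0))"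
        by (simp add: norm_mult ac_simps)
    qed
    then show ?case by (simp add: convol_def)
  qed
  have m: "(\<lambda>k. bessel r k * convol ?f ?g k) \<in> borel_measurable lborel" by measurable
  have "norm (wconv r p q u v) \<le> 2 powr (r / 2) * norm (l2_of (convol ?a ?n))"
    unfolding wconv_def by (rule norm_l2_of_mono(2)[OF y(1) m le]) simp
  also have "\<dots> \<le> 2 powr (r / 2) * (A * norm v)" by (rule mult_left_mono[OF nb]) simp
  finally show ?thesis by (simp add: mult.assoc)
qed

section \<open>The commutator of weight and multiplication\<close>

lemma bracket_has_derivative: "(bracket s has_real_derivative s * x * bracket (s - 2) x) (at x)"
proof -
  have "((\<lambda>x. (1 + x\<^sup>2) powr (s / 2)) has_real_derivative s * x * (1 + x\<^sup>2) powr (s / 2 - 1)) (at x)"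
    by (rule DERIV_cong, rule DERIV_fun_powr[where g = "\<lambda>x. 1 + x\<^sup>2" and m = "2 * x"])
      (auto intro!: derivative_eq_intros simp: one_plus_sq_pos)
  then show ?thesis by (simp add: bracket_def[abs_def] diff_divide_distrib)
qed

lemma bracket_abs_mono: "r \<ge> 0 \<Longrightarrow> \<bar>x\<bar> \<le> \<bar>y\<bar> \<Longrightarrow> bracket r x \<le> bracket r y"
  unfolding bracket_def by (intro powr_mono2) (auto simp: abs_le_square_iff)

text \<open>The mean value theorem, with the derivative bounded crudely by
  \<open>s * bracket s z\<close>. No order is gained; what matters is the factor
  \<open>k - l\<close>, which becomes a derivative of the slowly varying function.\<close>

lemma bracket_diff_le:
  assumes s: "s \<ge> 0"
  shows "\<bar>bracket s k - bracket s l\<bar> \<le> s * \<bar>k - l\<bar> * (bracket s k + bracket s l)"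
proof -
  have main: "\<bar>bracket s b - bracket s a\<bar> \<le> s * \<bar>b - a\<bar> * (bracket s b + bracket s a)" if ab: "a < b" for a b
  proof -
    obtain z where z: "a < z" "z < b" "bracket s b - bracket s a = (b - a) * (s * z * bracket (s - 2) z)"
      using MVT2[OF ab, of "bracket s" "\<lambda>x. s * x * bracket (s - 2) x"] bracket_has_derivative by blast
    have "\<bar>z\<bar> * bracket (s - 2) z \<le> bracket 2 z * bracket (s - 2) z"
    proof (rule mult_right_mono)
      have "\<bar>z\<bar> \<le> bracket 1 z" by (rule abs_le_jb1)
      also have "\<dots> \<le> bracket 2 z" by (rule bracket_mono) simp
      finally show "\<bar>z\<bar> \<le> bracket 2 z" .
    qed simp
    also have "\<dots> = bracket s z" by (simp add: bracket_mult)
    also have "\<dots> \<le> bracket s b + bracket s a"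
    proof (cases "\<bar>z\<bar> \<le> \<bar>b\<bar>")
      case True then show ?thesis using bracket_abs_mono[OF s True] by (simp add: add_increasing2)
    next
      case False
      then have "\<bar>z\<bar> \<le> \<bar>a\<bar>" using z by auto
      then show ?thesis using bracket_abs_mono[OF s] by (simp add: add_increasing)
    qed
    finally have "\<bar>b - a\<bar> * (s * (\<bar>z\<bar> * bracket (s - 2) z)) \<le> \<bar>b - a\<bar> * (s * (bracket s b + bracket s a))"
      using s by (intro mult_left_mono) auto
    then show ?thesis using s by (simp add: z(3) abs_mult mult.assoc mult.left_commute)
  qed
  consider "k < l" | "k = l" | "l < k" by linarith
  then show ?thesis
  proof cases
    case 1 then show ?thesis using main[OF 1] by (simp add: abs_minus_commute add.commute)
  next
    case 2 show ?thesis unfolding 2 by simp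
  next
    case 3 then show ?thesis using main[OF 3] by simp
  qed
qed

text \<open>The order of the weights in \<open>l\<close> outweighs that of the remaining growth in
  \<open>k\<close>, and Peetre's inequality turns the quotient of the two into a weight in
  \<open>k - l\<close>. Thus all derivatives end on the slowly varying function. The factor 2 counts
  the two summands of \<open>bracket_diff_le\<close>.\<close>

lemma commutator_weight:
  assumes s: "s \<ge> 0"
  shows "\<bar>k\<bar> * (\<bar>bracket s k - bracket s l\<bar> * bracket (-1 - s) l) \<le> s * 2 * 2 powr ((1 + s) / 2) * (\<bar>k - l\<bar> * bracket (1 + s) (k - l))"
proof -
  have p: "bracket r k * bracket (- r) l \<le> 2 powr (r / 2) * bracket r (k - l)" if "r \<ge> 0" for r
  proof -
    have "bracket r k * bracket (- r) l \<le> 2 powr (r / 2) * (bracket r (k - l) * bracket r l) * bracket (- r) l"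
      using that by (intro mult_right_mono peetre) auto
    then show ?thesis by (simp add: bracket_mult mult.assoc)
  qed
  have "\<bar>k\<bar> * (\<bar>bracket s k - bracket s l\<bar> * bracket (-1 - s) l) \<le> bracket 1 k * ((s * \<bar>k - l\<bar> * (bracket s k + bracket s l)) * bracket (-1 - s) l)"
    by (intro mult_mono bracket_diff_le s abs_le_jb1) (use s in \<open>auto intro!: mult_nonneg_nonneg add_nonneg_nonneg\<close>)
  also have "\<dots> = s * \<bar>k - l\<bar> * (bracket (1 + s) k * bracket (- (1 + s)) l + bracket 1 k * bracket (- 1) l)"
    by (simp add: algebra_simps bracket_mult[of 1 k s, symmetric] bracket_mult[of s l "-1 - s", simplified, symmetric])
  also have "\<dots> \<le> s * \<bar>k - l\<bar> * (2 powr ((1 + s) / 2) * bracket (1 + s) (k - l) + 2 powr ((1 + s) / 2) * bracket (1 + s) (k - l))"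
  proof -
    have "bracket 1 k * bracket (- 1) l \<le> 2 powr (1 / 2) * bracket 1 (k - l)" by (rule p) simp
    also have "\<dots> \<le> 2 powr ((1 + s) / 2) * bracket (1 + s) (k - l)"
      using s by (intro mult_mono powr_mono bracket_mono) auto
    finally show ?thesis using p[of "1 + s"] s by (intro mult_left_mono add_mono) auto
  qed
  finally show ?thesis by (simp add: algebra_simps)
qed

text \<open>The commutator of \<open>(1 - \<partial>\<^sub>x\<^sup>2)\<^sup>s\<^sup>/\<^sup>2\<close> and \<open>f \<mapsto> 2 \<partial>\<^sub>x (\<psi> f)\<close>, where \<open>u\<close> and \<open>v\<close> represent \<open>\<psi>\<close> and \<open>f\<close>
  with weights of order \<open>1 + s\<close>.\<close>

definition commutator :: "real \<Rightarrow> l2 \<Rightarrow> l2 \<Rightarrow> l2" where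
  "commutator s u v = 2 *\<^sub>R mul riesz (wconv (1 + s) (1 + s) (1 + s) u v) - 2 *\<^sub>R mul riesz (wconv 1 (1 + s) 1 u v)"

text \<open>Up to normalization the kernel of the commutator is \<open>2 * \<i> * k * (bracket s k -
  bracket s l) * bracket (-1 - s) l\<close> times the transform of the first function at
  \<open>k - l\<close>. It is dominated through \<open>commutator_weight\<close>, and Young's
  inequality does the rest. For s = 0 weight and multiplication commute, whence the factor
  \<open>s\<close>.\<close>

lemma commutator_bound:
  assumes s: "s \<ge> 0"
    and a: "integrable lborel (\<lambda>k. of_real k * (bessel (1 + s) k * (bessel (- (1 + s)) k * rep u k)))"
    and A: "(LINT k|lborel. cmod (of_real k * (bessel (1 + s) k * (bessel (- (1 + s)) k * rep u k)))) \<le> A"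
  shows "norm (commutator s u v) \<le> s * 4 * 2 powr ((1 + s) / 2) * A * norm v"
proof -
  let ?w = "\<lambda>k. of_real k * (bessel (1 + s) k * (bessel (- (1 + s)) k * rep u k))"
  let ?a = "\<lambda>k. bessel (- (1 + s)) k * rep u k"
  let ?b = "\<lambda>k. bessel (- (1 + s)) k * rep v k" and ?b' = "\<lambda>k. bessel (- 1) k * rep v k"
  let ?n = "\<lambda>k. of_real (cmod (rep v k)) :: complex" and ?wn = "\<lambda>k. of_real (cmod (?w k)) :: complex"
  let ?C = "s * 4 * 2 powr ((1 + s) / 2)"
  have C0: "?C \<ge> 0" using s by simp
  have admissible: "admissible (1 + s) (1 + s) (1 + s)" "admissible 1 (1 + s) 1" using s by (auto simp: admissible_def)
  define h where "h k = 2 * riesz k * (bessel (1 + s) k * convol ?a ?b k - bessel 1 k * convol ?a ?b' k)" for k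
  have [measurable]: "h \<in> borel_measurable borel" unfolding h_def[abs_def] by measurable
  have rep: "AE k in lborel. rep (commutator s u v) k = h k"
    unfolding commutator_def h_def
    using rep_diff[of "2 *\<^sub>R mul riesz (wconv (1 + s) (1 + s) (1 + s) u v)" "2 *\<^sub>R mul riesz (wconv 1 (1 + s) 1 u v)"]
      rep_scaleR[of 2 "mul riesz (wconv (1 + s) (1 + s) (1 + s) u v)"] rep_scaleR[of 2 "mul riesz (wconv 1 (1 + s) 1 u v)"]
      rep_mul[OF bdd_mult_riesz, of "wconv (1 + s) (1 + s) (1 + s) u v"] rep_mul[OF bdd_mult_riesz, of "wconv 1 (1 + s) 1 u v"]
      rep_wconv[OF admissible(1), of u v] rep_wconv[OF admissible(2), of u v]
    by eventually_elim (simp add: scaleR_conv_of_real algebra_simps)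
  have intw: "integrable lborel ?wn" by (rule integrable_of_cmod[OF a])
  note y = young_convol[OF intw norm_l2_of_cmod(1)[OF sq_rep[of v]]]
  have nb: "norm (l2_of (convol ?wn ?n)) \<le> A * norm v"
    using order_trans[OF y(2) mult_right_mono] A norm_l2_of_cmod(2)[OF sq_rep[of v]] by simp
  have s0: "sq ?a" "sq ?b" "sq ?b'" using s by (auto intro!: sq_bessel_rep)
  have le: "AE k in lborel. cmod (h k) \<le> ?C * cmod (convol ?wn ?n k)"
    using young_convol(3)[OF a sq_rep[of v]]
  proof eventually_elim
    case (elim k)
    let ?K = "\<lambda>l. \<i> * of_real (2 * k * (bracket s k - bracket s l) * bracket (-1 - s) l) * (?a (k - l) * rep v l)"
    have XJ: "riesz k * bessel (1 + s) k = \<i> * of_real k * bessel s k"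
      using riesz_J1[of k] by (simp add: mult.assoc flip: bessel_mult)
    \<comment> \<open>The weights of the two terms differ by \<open>bessel s l\<close>, so that both
      convolutions combine into one integral.\<close>
    have e: "bessel (- 1) l = bessel s l * bessel (- (1 + s)) l" for l by (simp add: bessel_mult)
    have "h k = of_real (1 / sqrt (2 * pi)) * (2 * \<i> * of_real k * (bessel s k * (LINT l|lborel. ?a (k - l) * ?b l) - (LINT l|lborel. ?a (k - l) * ?b' l)))"
    proof -
      have "2 * riesz k * (bessel (1 + s) k * (c * i) - bessel 1 k * (c * i')) = c * (2 * \<i> * of_real k * (bessel s k * i - i'))" for c i i'
      proof -
        have "2 * riesz k * (bessel (1 + s) k * (c * i) - bessel 1 k * (c * i')) = 2 * c * ((riesz k * bessel (1 + s) k) * i - (riesz k * bessel 1 k) * i')"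
          by (simp add: algebra_simps)
        then show ?thesis unfolding XJ riesz_J1 by (simp add: algebra_simps)
      qed
      then show ?thesis unfolding h_def convol_def .
    qed
    also have "bessel s k * (LINT l|lborel. ?a (k - l) * ?b l) - (LINT l|lborel. ?a (k - l) * ?b' l)
       = (LINT l|lborel. bessel s k * (?a (k - l) * ?b l) - ?a (k - l) * ?b' l)"
      using convol_integrable_sq[OF s0(1,2)] convol_integrable_sq[OF s0(1,3)] by simp
    also have "2 * \<i> * of_real k * \<dots> = (LINT l|lborel. 2 * \<i> * of_real k * (bessel s k * (?a (k - l) * ?b l) - ?a (k - l) * ?b' l))"
      by simp
    also have "\<dots> = (LINT l|lborel. ?K l)"
    proof (rule Bochner_Integration.integral_cong)
      fix l
      show "2 * \<i> * of_real k * (bessel s k * (?a (k - l) * ?b l) - ?a (k - l) * ?b' l) = ?K l"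
        unfolding e by (simp add: bessel_def algebra_simps)
    qed simp
    finally have hk: "cmod (h k) = 1 / sqrt (2 * pi) * cmod (LINT l|lborel. ?K l)" by (simp add: norm_mult norm_divide)
    have Kle: "cmod (?K l) \<le> ?C * cmod (?w (k - l) * rep v l)" for l
    proof -
      have "cmod (?K l) = 2 * (\<bar>k\<bar> * (\<bar>bracket s k - bracket s l\<bar> * bracket (-1 - s) l)) * (cmod (?a (k - l)) * cmod (rep v l))"
        by (simp add: norm_mult abs_mult del: of_real_mult of_real_diff of_real_numeral)
      also have "\<dots> \<le> 2 * (s * 2 * 2 powr ((1 + s) / 2) * (\<bar>k - l\<bar> * bracket (1 + s) (k - l))) * (cmod (?a (k - l)) * cmod (rep v l))"
        by (intro mult_right_mono mult_left_mono commutator_weight s) auto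
      also have "\<dots> = ?C * cmod (?w (k - l) * rep v l)" by (simp add: norm_mult del: of_real_diff)
      finally show ?thesis .
    qed
    have "cmod (LINT l|lborel. ?K l) \<le> (LINT l|lborel. cmod (?K l))" by (rule integral_norm_bound)
    also have "\<dots> \<le> (LINT l|lborel. ?C * cmod (?w (k - l) * rep v l))"
    proof (rule integral_mono)
      show i: "integrable lborel (\<lambda>l. ?C * cmod (?w (k - l) * rep v l))"
        by (intro integrable_mult_right integrable_norm elim)
      show "integrable lborel (\<lambda>l. cmod (?K l))"
        by (rule Bochner_Integration.integrable_bound[OF i]) (measurable, use Kle in \<open>auto intro: order_trans[OF _ abs_ge_self]\<close>)
    qed (rule Kle)
    finally have "cmod (h k) \<le> 1 / sqrt (2 * pi) * (?C * (LINT l|lborel. cmod (?w (k - l) * rep v l)))"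
      unfolding hk by (intro mult_left_mono) auto
    also have "\<dots> = ?C * cmod (convol ?wn ?n k)"
    proof -
      have "convol ?wn ?n k = of_real (1 / sqrt (2 * pi) * (LINT l|lborel. cmod (?w (k - l) * rep v l)))"
        unfolding convol_def norm_mult of_real_mult[symmetric] integral_complex_of_real ..
      then show ?thesis by (simp only: norm_of_real) (simp add: abs_mult)
    qed
    finally show ?case .
  qed
  have "norm (commutator s u v) = norm (l2_of h)"
  proof -
    have "sq h" by (rule norm_l2_of_mono(1)[OF y(1) _ le C0]) measurable
    then have "l2_of h = l2_of (rep (commutator s u v))" by (subst l2_of_eq_iff) (use rep in \<open>auto elim: eventually_mono\<close>)
    then show ?thesis by simp
  qed
  also have "\<dots> \<le> ?C * norm (l2_of (convol ?wn ?n))"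
    by (rule norm_l2_of_mono(2)[OF y(1) _ le C0]) measurable
  also have "\<dots> \<le> ?C * (A * norm v)" by (rule mult_left_mono[OF nb C0])
  finally show ?thesis by (simp add: mult.assoc)
qed

text \<open>Multiplication by a real function is symmetric in L^2. The smoothing of order 2 against
  the output weight of order 1 leaves \<open>bessel (-1)\<close> on the left, the same weight as on
  the right, so that both sides are one triple product; Fubini's theorem exchanges the two
  frequencies.\<close>

lemma inner_wconv_symmetric:
  assumes p: "p \<ge> 1" and u: "herm u = u"
  shows "inner (mul (bessel (-2)) f) (wconv 1 p 1 u g) = inner (mul (bessel (-2)) g) (wconv 1 p 1 u f)"
proof -
  let ?a = "\<lambda>k. bessel (-p) k * rep u k" and ?b = "\<lambda>w k. bessel (-1) k * rep w k"
  have admissible: "admissible 1 p 1" using p by (simp add: admissible_def)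
  have sa: "sq ?a" using p by (intro sq_bessel_rep) simp
  have ia: "integrable lborel ?a" using p by (intro bessel_m1_L1) simp
  have b2: "bdd_mult (bessel (-2))" by (rule bdd_mult_bessel) simp
  have sb: "sq (?b w)" for w by (rule sq_bessel_rep) simp
  \<comment> \<open>A representative for which the symmetry of the transform of a real function
    holds at every point, since the double integral evaluates it at the differences
    \<open>k - l\<close>.\<close>
  define a where "a k = (?a k + cnj (?a (- k))) / 2" for k
  have ua: "AE k in lborel. ?a k = a k"
    using rep_herm[of u] unfolding u by eventually_elim (simp add: a_def)
  have a_sym: "a (- k) = cnj (a k)" for k by (simp add: a_def)
  have [measurable]: "a \<in> borel_measurable borel" unfolding a_def[abs_def] by measurable
  have sqa: "sq a" by (rule sq_cong_AE[OF sa ua]) measurable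
  have inta: "integrable lborel a" by (rule integrable_cong_AE_imp[OF ia _ ua]) measurable
  define T where "T f g = (LINT k|lborel. ?b f k * cnj (convol a (?b g) k))" for f g
  have cva: "convol ?a (?b g) = convol a (?b g)" for g
    by (rule ext, rule convol_cong_AE[OF ua], simp) measurable
  have sqcv: "sq (convol a (?b g))" for g by (rule young_convol(1)[OF inta sb])
  have inner: "inner (mul (bessel (-2)) f) (wconv 1 p 1 u g) = Re (T f g)" for f g
  proof -
    have "inner (mul (bessel (-2)) f) (wconv 1 p 1 u g) = (LINT k|lborel. Re (?b f k * cnj (convol a (?b g) k)))"
      unfolding inner_l2_def
    proof (rule integral_cong_AE)
      show "AE k in lborel. Re (rep (mul (bessel (-2)) f) k * cnj (rep (wconv 1 p 1 u g) k)) = Re (?b f k * cnj (convol a (?b g) k))"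
        using rep_mul[OF b2, of f] rep_wconv[OF admissible, of u g]
      proof eventually_elim
        case (elim k)
        have "rep (mul (bessel (-2)) f) k * cnj (rep (wconv 1 p 1 u g) k) = (bessel (-2) k * bessel 1 k) * rep f k * cnj (convol a (?b g) k)"
          using elim by (simp add: cva)
        then show ?case by (simp add: bessel_mult)
      qed
    qed measurable
    also have "\<dots> = Re (T f g)" unfolding T_def by (intro integral_Re sq_integrable_mult sq_cnj sb sqcv)
    finally show ?thesis .
  qed
  have "T f g = cnj (T g f)"
  proof -
    let ?h = "\<lambda>k l. ?b f k * cnj (a (k - l) * ?b g l)"
    let ?s = "1 / sqrt (2 * pi)"
    let ?ca = "\<lambda>k. of_real (cmod (a k)) :: complex" and ?cb = "\<lambda>k. of_real (cmod (?b g k)) :: complex"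
    have ica: "integrable lborel ?ca" by (rule integrable_of_cmod[OF inta])
    have int: "integrable (lborel \<Otimes>\<^sub>M lborel) (\<lambda>(k, l). ?h k l)"
    proof (rule lborel_pair.Fubini_integrable)
      show "(\<lambda>(k, l). ?h k l) \<in> borel_measurable (lborel \<Otimes>\<^sub>M lborel)" by measurable
      show "AE k in lborel. integrable lborel (\<lambda>l. case (k, l) of (k, l) \<Rightarrow> ?h k l)"
        by (intro AE_I2) (simp only: prod.case, intro integrable_mult_right integrable_cnj convol_integrable_sq sqa sb)
      have "integrable lborel (\<lambda>k. sqrt (2 * pi) * cmod (?b f k * convol ?ca ?cb k))"
        by (intro integrable_mult_right integrable_norm sq_integrable_mult sb young_convol(1) ica norm_l2_of_cmod(1))
      moreover have "sqrt (2 * pi) * cmod (?b f k * convol ?ca ?cb k) = (LINT l|lborel. norm (case (k, l) of (k, l) \<Rightarrow> ?h k l))" for k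
      proof -
        have "convol ?ca ?cb k = of_real (?s * (LINT l|lborel. cmod (a (k - l) * ?b g l)))"
          unfolding convol_def norm_mult of_real_mult[symmetric] integral_complex_of_real ..
        then have "cmod (convol ?ca ?cb k) = ?s * (LINT l|lborel. cmod (a (k - l) * ?b g l))"
          by (simp only: norm_of_real) (simp add: abs_mult)
        moreover have "norm (case (k, l) of (k, l) \<Rightarrow> ?h k l) = cmod (?b f k) * cmod (a (k - l) * ?b g l)" for l
          by (simp add: norm_mult)
        ultimately show ?thesis by (simp add: norm_mult)
      qed
      ultimately show "integrable lborel (\<lambda>k. LINT l|lborel. norm (case (k, l) of (k, l) \<Rightarrow> ?h k l))" by simp
    qed
    have "T f g = (LINT k|lborel. of_real ?s * (LINT l|lborel. ?h k l))"
      unfolding T_def by (rule Bochner_Integration.integral_cong) (simp_all add: convol_def del: complex_cnj_mult flip: Bochner_Integration.integral_cnj)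
    also have "\<dots> = of_real ?s * (LINT k|lborel. LINT l|lborel. ?h k l)" by simp
    also have "(LINT k|lborel. LINT l|lborel. ?h k l) = (LINT l|lborel. LINT k|lborel. ?h k l)"
      by (rule lborel_pair.Fubini_integral[OF int, symmetric])
    also have "of_real ?s * (LINT l|lborel. LINT k|lborel. ?h k l) = (LINT l|lborel. of_real ?s * (LINT k|lborel. ?h k l))" by simp
    also have "\<dots> = (LINT l|lborel. cnj (?b g l * cnj (convol a (?b f) l)))"
    proof (rule Bochner_Integration.integral_cong)
      fix l
      have "cnj (a (k - l)) = a (l - k)" for k using a_sym[of "k - l"] by simp
      then have "(LINT k|lborel. ?h k l) = (LINT k|lborel. cnj (?b g l) * (a (l - k) * ?b f k))"
        by (simp add: ac_simps)
      then show "of_real ?s * (LINT k|lborel. ?h k l) = cnj (?b g l * cnj (convol a (?b f) l))"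
        by (simp add: convol_def)
    qed simp
    also have "\<dots> = cnj (T g f)" unfolding T_def by (rule Bochner_Integration.integral_cnj)
    finally show ?thesis .
  qed
  then show ?thesis by (simp add: inner)
qed

section \<open>The Fourier transform of real functions\<close>

definition of_real_fun :: "(real \<Rightarrow> real) \<Rightarrow> real \<Rightarrow> complex" where "of_real_fun f x = of_real (f x)"
definition fhat :: "(real \<Rightarrow> real) \<Rightarrow> l2" where "fhat f = fourier_l2 (l2_of (of_real_fun f))"

lemma of_real_fun_measurable [measurable]: "f \<in> borel_measurable M \<Longrightarrow> of_real_fun f \<in> borel_measurable M"
  unfolding of_real_fun_def[abs_def] by measurable

lemma square_integrable_iff: "square_integrable f \<longleftrightarrow> sq (of_real_fun f)"
proof
  assume "sq (of_real_fun f)"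
  then have "of_real_fun f \<in> borel_measurable lborel" "integrable lborel (\<lambda>x. (f x)\<^sup>2)"
    by (auto simp: sq_def of_real_fun_def)
  moreover from this(1) have "(\<lambda>x. Re (of_real_fun f x)) \<in> borel_measurable lborel" by measurable
  ultimately show "square_integrable f" by (simp add: square_integrable_def of_real_fun_def)
qed (auto simp: square_integrable_def sq_def of_real_fun_def)

lemma sq_of_real_fun: "square_integrable f \<Longrightarrow> sq (of_real_fun f)" by (simp add: square_integrable_iff)

lemma truncated_fourier_eq: "truncated_fourier f R k = fourier_int (truncation R (of_real_fun f)) k"
  unfolding truncated_fourier_def fourier_int_def set_lebesgue_integral_def
  by (intro arg_cong2[where f = "(*)"] refl Bochner_Integration.integral_cong)
    (auto simp: truncation_def of_real_fun_def indicator_def)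

text \<open>Of \<open>fourier f\<close>, chosen by \<open>SOME\<close>, only the defining property
  is known. \<open>rep (fhat f)\<close> shows that a choice exists, and two mean-square limits of
  the same truncated integrals agree almost everywhere.\<close>

lemma fourier_eq:
  assumes f: "square_integrable f"
  shows "fourier f \<in> borel_measurable borel" "AE k in lborel. fourier f k = rep (fhat f) k"
proof -
  define P where "P g \<longleftrightarrow> g \<in> borel_measurable lborel \<and>
     ((\<lambda>R. \<integral>\<^sup>+ k. ennreal ((cmod (truncated_fourier f R k - g k))\<^sup>2) \<partial>lborel) \<longlongrightarrow> 0) at_top" for g
  have tm [measurable]: "truncated_fourier f R \<in> borel_measurable lborel" for R
  proof -
    have [measurable]: "f \<in> borel_measurable borel" using f by (auto simp: square_integrable_def)
    have "truncation R (of_real_fun f) \<in> borel_measurable borel" unfolding truncation_def[abs_def] by measurable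
    then show ?thesis unfolding truncated_fourier_eq[abs_def] by simp
  qed
  have 1: "P (rep (fhat f))"
    unfolding P_def
  proof
    have e: "(\<integral>\<^sup>+ k. ennreal ((cmod (truncated_fourier f R k - rep (fhat f) k))\<^sup>2) \<partial>lborel) = ennreal ((norm (fhat f - l2_of (fourier_int (truncation R (of_real_fun f)))))\<^sup>2)" for R
      using nn_norm_l2_of_diff[OF sq_fourier_int[OF l1_l2_truncation[OF sq_of_real_fun[OF f]]], of "fhat f" R] by (simp add: truncated_fourier_eq norm_minus_commute)
    have "((\<lambda>R. ennreal ((norm (fhat f - l2_of (fourier_int (truncation R (of_real_fun f)))))\<^sup>2)) \<longlongrightarrow> ennreal ((norm (fhat f - fhat f))\<^sup>2)) at_top"
      unfolding fhat_def by (intro tendsto_ennrealI tendsto_intros fourier_l2_tendsto sq_of_real_fun f)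
    then show "((\<lambda>R. \<integral>\<^sup>+ k. ennreal ((cmod (truncated_fourier f R k - rep (fhat f) k))\<^sup>2) \<partial>lborel) \<longlongrightarrow> 0) at_top"
      unfolding e by simp
  qed simp
  have "P (SOME g. P g)" by (rule someI[of P, OF 1])
  moreover have "fourier f = (SOME g. P g)" unfolding fourier_def P_def ..
  ultimately have 2: "P (fourier f)" by simp
  then show m: "fourier f \<in> borel_measurable borel" by (simp add: P_def)
  let ?t = "truncated_fourier f" and ?g = "fourier f" and ?h = "rep (fhat f)"
  note [measurable] = m
  have "(\<integral>\<^sup>+ k. ennreal ((cmod (?g k - ?h k))\<^sup>2) \<partial>lborel) \<le>
     2 * (\<integral>\<^sup>+ k. ennreal ((cmod (?t R k - ?g k))\<^sup>2) \<partial>lborel) + 2 * (\<integral>\<^sup>+ k. ennreal ((cmod (?t R k - ?h k))\<^sup>2) \<partial>lborel)" for R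
  proof -
    have "(\<integral>\<^sup>+ k. ennreal ((cmod (?g k - ?h k))\<^sup>2) \<partial>lborel) \<le> (\<integral>\<^sup>+ k. 2 * ennreal ((cmod (?t R k - ?g k))\<^sup>2) + 2 * ennreal ((cmod (?t R k - ?h k))\<^sup>2) \<partial>lborel)"
    proof (rule nn_integral_mono)
      fix k
      have "cmod (?g k - ?h k) \<le> cmod (?t R k - ?g k) + cmod (?t R k - ?h k)"
        using norm_triangle_ineq4[of "?t R k - ?h k" "?t R k - ?g k"] by simp
      then have "(cmod (?g k - ?h k))\<^sup>2 \<le> (cmod (?t R k - ?g k) + cmod (?t R k - ?h k))\<^sup>2" by (rule power_mono) simp
      also have "\<dots> \<le> 2 * (cmod (?t R k - ?g k))\<^sup>2 + 2 * (cmod (?t R k - ?h k))\<^sup>2"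
        using sum_squares_bound[of "cmod (?t R k - ?g k)" "cmod (?t R k - ?h k)"] by (simp add: power2_sum)
      finally have "ennreal ((cmod (?g k - ?h k))\<^sup>2) \<le> ennreal (2 * (cmod (?t R k - ?g k))\<^sup>2 + 2 * (cmod (?t R k - ?h k))\<^sup>2)"
        by (rule ennreal_leI)
      then show "ennreal ((cmod (?g k - ?h k))\<^sup>2) \<le> 2 * ennreal ((cmod (?t R k - ?g k))\<^sup>2) + 2 * ennreal ((cmod (?t R k - ?h k))\<^sup>2)"
        by (simp add: ennreal_mult)
    qed
    also have "\<dots> = 2 * (\<integral>\<^sup>+ k. ennreal ((cmod (?t R k - ?g k))\<^sup>2) \<partial>lborel) + 2 * (\<integral>\<^sup>+ k. ennreal ((cmod (?t R k - ?h k))\<^sup>2) \<partial>lborel)"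
      by (subst nn_integral_add) (auto simp: nn_integral_cmult)
    finally show ?thesis .
  qed
  moreover have "((\<lambda>R. 2 * (\<integral>\<^sup>+ k. ennreal ((cmod (?t R k - ?g k))\<^sup>2) \<partial>lborel) + 2 * (\<integral>\<^sup>+ k. ennreal ((cmod (?t R k - ?h k))\<^sup>2) \<partial>lborel)) \<longlongrightarrow> 2 * 0 + 2 * 0) at_top"
    using 1 2 unfolding P_def by (intro tendsto_add ennreal_tendsto_cmult) auto
  ultimately have "(\<integral>\<^sup>+ k. ennreal ((cmod (?g k - ?h k))\<^sup>2) \<partial>lborel) \<le> 2 * 0 + 2 * 0"
    by (intro tendsto_lowerbound[where F = at_top]) (auto intro: always_eventually)
  then have "(\<integral>\<^sup>+ k. ennreal ((cmod (?g k - ?h k))\<^sup>2) \<partial>lborel) = 0" by simp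
  then have "AE k in lborel. ennreal ((cmod (?g k - ?h k))\<^sup>2) = 0"
    by (subst (asm) nn_integral_0_iff_AE) auto
  then show "AE k in lborel. ?g k = ?h k" by eventually_elim (simp add: ennreal_eq_0_iff)
qed

lemma bracket_sq: "(bracket r k)\<^sup>2 = (1 + k\<^sup>2) powr r"
  unfolding power2_eq_square[of "bracket r k"] bracket_mult by (simp add: bracket_def)

text \<open>The bridge to the definition of Sobolev spaces: functions in \<open>sobolev r\<close>
  are those whose transform is divisible by \<open>bessel (- r)\<close>, and the quotient carries
  the norm.\<close>

lemma sobolevI:
  assumes f: "square_integrable f" and h: "fhat f = mul (bessel (- r)) h" and r: "r \<ge> 0"
  shows "f \<in> sobolev r" "sobolev_norm r f = ennreal (norm h)"
proof -
  have [measurable]: "fourier f \<in> borel_measurable borel" by (rule fourier_eq[OF f])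
  have b: "bdd_mult (bessel (- r))" using r by (intro bdd_mult_bessel) simp
  have ae: "AE k in lborel. (cmod (fourier f k))\<^sup>2 * (1 + k\<^sup>2) powr r = (cmod (rep h k))\<^sup>2"
    using fourier_eq(2)[OF f] rep_mul[OF b, of h]
  proof eventually_elim
    case (elim k)
    have "cmod (fourier f k) * bracket r k = cmod (rep h k)"
      using elim bracket_mult[of r k "- r"] by (simp add: h norm_mult mult.commute mult.left_commute)
    then have "(cmod (fourier f k) * bracket r k)\<^sup>2 = (cmod (rep h k))\<^sup>2" by simp
    then show ?case by (simp add: power_mult_distrib bracket_sq)
  qed
  have "integrable lborel (\<lambda>k. (cmod (fourier f k))\<^sup>2 * (1 + k\<^sup>2) powr r)"
    by (rule integrable_cong_AE_imp[OF sq_integrable[OF sq_rep[of h]]]) (measurable, use ae in \<open>auto elim: eventually_mono\<close>)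
  then show s: "f \<in> sobolev r" using f by (simp add: sobolev_def)
  have "(LINT k|lborel. (cmod (fourier f k))\<^sup>2 * (1 + k\<^sup>2) powr r) = (norm h)\<^sup>2"
    unfolding norm_l2_sq by (rule integral_cong_AE) (measurable, rule ae)
  then show "sobolev_norm r f = ennreal (norm h)" using s by (simp add: sobolev_norm_def)
qed

lemma sobolevD:
  assumes f: "f \<in> sobolev r" and r: "r \<ge> 0"
  obtains h where "square_integrable f" "fhat f = mul (bessel (- r)) h"
proof -
  have sf: "square_integrable f" and i: "integrable lborel (\<lambda>k. (cmod (fourier f k))\<^sup>2 * (1 + k\<^sup>2) powr r)"
    using f by (auto simp: sobolev_def)
  have [measurable]: "fourier f \<in> borel_measurable borel" by (rule fourier_eq[OF sf])
  have b: "bdd_mult (bessel (- r))" using r by (intro bdd_mult_bessel) simp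
  have s: "sq (\<lambda>k. bessel r k * fourier f k)"
    unfolding sq_def
  proof
    show "integrable lborel (\<lambda>k. (cmod (bessel r k * fourier f k))\<^sup>2)"
      using i by (simp add: norm_mult power_mult_distrib bracket_sq mult.commute)
  qed measurable
  have "fhat f = mul (bessel (- r)) (l2_of (\<lambda>k. bessel r k * fourier f k))"
  proof (rule l2_eqI)
    show "AE k in lborel. rep (fhat f) k = rep (mul (bessel (- r)) (l2_of (\<lambda>k. bessel r k * fourier f k))) k"
      using rep_mul[OF b, of "l2_of (\<lambda>k. bessel r k * fourier f k)"] rep_l2_of[OF s] fourier_eq(2)[OF sf]
      by eventually_elim (simp add: bessel_mult3)
  qed
  with sf show ?thesis by (rule that)
qed

lemma fhat_diff: "square_integrable f \<Longrightarrow> square_integrable g \<Longrightarrow> fhat (\<lambda>x. f x - g x) = fhat f - fhat g"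
  using l2_of_diff[OF sq_of_real_fun sq_of_real_fun, of f g] unfolding fhat_def
  by (simp add: of_real_fun_def[abs_def] flip: fourier_l2_linear_simps)

lemma fhat_scale: "square_integrable f \<Longrightarrow> fhat (\<lambda>x. c * f x) = c *\<^sub>R fhat f"
  using l2_of_scaleR[OF sq_of_real_fun, of f c] unfolding fhat_def
  by (simp add: of_real_fun_def[abs_def] scaleR_conv_of_real flip: fourier_l2_linear_simps)

lemma square_integrable_diff: "square_integrable f \<Longrightarrow> square_integrable g \<Longrightarrow> square_integrable (\<lambda>x. f x - g x)"
  using sq_diff[of "of_real_fun f" "of_real_fun g"] by (simp add: square_integrable_iff of_real_fun_def[abs_def])
lemma square_integrable_scale: "square_integrable f \<Longrightarrow> square_integrable (\<lambda>x. c * f x)"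
  using sq_cmult[of "of_real_fun f" "of_real c"] by (simp add: square_integrable_iff of_real_fun_def[abs_def])

lemma herm_fhat: assumes f: "square_integrable f" shows "herm (fhat f) = fhat f"
proof -
  have "cnjl (l2_of (of_real_fun f)) = l2_of (of_real_fun f)" using cnjl_l2_of[OF sq_of_real_fun[OF f]] by (simp add: of_real_fun_def[abs_def])
  then show ?thesis unfolding herm_def fhat_def using fourier_l2_cnjl[of "l2_of (of_real_fun f)"] by simp
qed

text \<open>For \<open>herm v = v\<close> the inverse transform is real almost everywhere, so that
  taking the real part only selects a real-valued representative.\<close>

definition physical :: "l2 \<Rightarrow> real \<Rightarrow> real" where "physical v x = Re (rep (inv_fourier_l2 v) x)"

lemma inv_fourier_l2_herm: "inv_fourier_l2 (herm v) = cnjl (inv_fourier_l2 v)"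
  by (simp add: inv_fourier_l2_def herm_def fourier_l2_refl fourier_l2_cnjl refl_cnjl)

lemma physical:
  assumes "herm v = v"
  shows "square_integrable (physical v)" "fhat (physical v) = v"
proof -
  have "AE x in lborel. rep (inv_fourier_l2 v) x = cnj (rep (inv_fourier_l2 v) x)"
    using rep_cnjl[of "inv_fourier_l2 v"] inv_fourier_l2_herm[of v] assms by simp
  then have ae: "AE x in lborel. rep (inv_fourier_l2 v) x = of_real_fun (physical v) x"
    by eventually_elim (simp add: of_real_fun_def physical_def complex_eq_iff)
  have m: "of_real_fun (physical v) \<in> borel_measurable borel"
    unfolding physical_def[abs_def] of_real_fun_def[abs_def] by measurable
  have "sq (of_real_fun (physical v))" by (rule sq_cong_AE[OF sq_rep ae]) (use m in simp)
  then show "square_integrable (physical v)" by (simp add: square_integrable_iff)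
  have "l2_of (of_real_fun (physical v)) = inv_fourier_l2 v" using l2_of_cong_AE[OF ae sq_rep] m by simp
  then show "fhat (physical v) = v" by (simp add: fhat_def)
qed

lemma inner_fhat:
  assumes f: "square_integrable f" and g: "square_integrable g"
  shows "inner (fhat f) (fhat g) = (LINT x|lborel. f x * g x)"
  unfolding fhat_def inner_fourier_l2_fourier_l2 inner_l2_of[OF sq_of_real_fun[OF f] sq_of_real_fun[OF g]]
  by (rule Bochner_Integration.integral_cong) (auto simp: of_real_fun_def)

lemma integrable_mult_square_integrable:
  assumes f: "square_integrable f" and g: "square_integrable g"
  shows "integrable lborel (\<lambda>x. f x * g x)"
  using integrable_Re[OF sq_integrable_mult[OF sq_of_real_fun[OF f] sq_of_real_fun[OF g]]] by (simp add: of_real_fun_def)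

text \<open>As \<open>p\<close> and \<open>q\<close> are at least 1, both transforms are integrable.
  Hence the functions are almost everywhere absolutely convergent inverse Fourier integrals, and the
  convolution theorem for integrable functions gives their product.\<close>

lemma fhat_mult:
  assumes f: "square_integrable f" "fhat f = mul (bessel (- p)) u" and g: "square_integrable g" "fhat g = mul (bessel (- q)) v"
    and pq: "p \<ge> 1" "q \<ge> 1"
  shows "square_integrable (\<lambda>x. f x * g x)" "fhat (\<lambda>x. f x * g x) = wconv 0 p q u v"
proof -
  let ?a = "\<lambda>k. bessel (-p) k * rep u k" and ?b = "\<lambda>k. bessel (-q) k * rep v k"
  have admissible: "admissible 0 p q" using pq by (simp add: admissible_def)
  have ra: "l1_l2 ?a" "l1_l2 ?b" unfolding l1_l2_def using pq by (auto intro!: sq_bessel_rep bessel_m1_L1)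
  have rc: "l1_l2 (convol ?a ?b)" using ra unfolding l1_l2_def by (auto intro!: convol_integrable young_convol(1))
  have G_L: "inv_fourier_l2 (l2_of w) = l2_of (\<lambda>x. fourier_int w (- x))" if "l1_l2 w" for w
    using that by (simp add: inv_fourier_l2_def fourier_l2_l2_of refl_l2_of sq_fourier_int)
  have ae: "AE x in lborel. of_real_fun f' x = fourier_int w (- x)" if "square_integrable f'" "fhat f' = l2_of w" "l1_l2 w" for f' w
  proof -
    have "l2_of (of_real_fun f') = l2_of (\<lambda>x. fourier_int w (- x))" using that inv_fourier_l2_fourier_l2[of "l2_of (of_real_fun f')"] G_L[OF that(3)] by (simp add: fhat_def)
    then show ?thesis using that by (subst (asm) l2_of_eq_iff) (auto intro: sq_of_real_fun sq_reflect sq_fourier_int)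
  qed
  have afg: "AE x in lborel. of_real_fun f x = fourier_int ?a (- x)" "AE x in lborel. of_real_fun g x = fourier_int ?b (- x)"
    using f g ra by (auto intro!: ae simp: mul_def)
  have prod: "AE x in lborel. fourier_int (convol ?a ?b) (- x) = of_real_fun (\<lambda>x. f x * g x) x"
    using afg
  proof eventually_elim
    case (elim x)
    have "fourier_int (convol ?a ?b) (- x) = fourier_int ?a (- x) * fourier_int ?b (- x)" using ra by (intro fourier_int_convol) (auto simp: l1_l2_def)
    then show ?case using elim by (simp add: of_real_fun_def)
  qed
  have [measurable]: "f \<in> borel_measurable borel" "g \<in> borel_measurable borel" using f g by (auto simp: square_integrable_def)
  have sc: "sq (\<lambda>x. fourier_int (convol ?a ?b) (- x))" by (intro sq_reflect sq_fourier_int rc)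
  have "sq (of_real_fun (\<lambda>x. f x * g x))" by (rule sq_cong_AE[OF sc prod]) measurable
  then show "square_integrable (\<lambda>x. f x * g x)" by (simp add: square_integrable_iff)
  have "l2_of (of_real_fun (\<lambda>x. f x * g x)) = inv_fourier_l2 (l2_of (convol ?a ?b))"
    unfolding G_L[OF rc] by (rule l2_of_cong_AE[OF prod sc, symmetric]) measurable
  then show "fhat (\<lambda>x. f x * g x) = wconv 0 p q u v" by (simp add: fhat_def wconv_def)
qed

section \<open>Dilations and translations\<close>

lemma sq_affine:
  assumes "sq f" "c \<noteq> 0"
  shows "sq (\<lambda>x. f (t + c * x))" "(norm (l2_of (\<lambda>x. f (t + c * x))))\<^sup>2 = (norm (l2_of f))\<^sup>2 / \<bar>c\<bar>"
proof -
  have [measurable]: "f \<in> borel_measurable borel" using assms by (auto simp: sq_def)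
  have "(\<lambda>x. f (t + c * x)) \<in> borel_measurable borel" by measurable
  then show s: "sq (\<lambda>x. f (t + c * x))"
    using lborel_integrable_real_affine[OF sq_integrable[OF assms(1)], of c t] assms by (simp add: sq_def)
  show "(norm (l2_of (\<lambda>x. f (t + c * x))))\<^sup>2 = (norm (l2_of f))\<^sup>2 / \<bar>c\<bar>"
    unfolding norm_l2_of_sq[OF s] norm_l2_of_sq[OF assms(1)]
    by (subst (2) lborel_integral_real_affine[of c _ t]) (use assms in auto)
qed

definition affine_subst :: "real \<Rightarrow> real \<Rightarrow> l2 \<Rightarrow> l2" where
  "affine_subst t c u = l2_of (\<lambda>x. rep u (t + c * x))"

lemma affine_subst_l2_of: assumes "sq f" "c \<noteq> 0" shows "affine_subst t c (l2_of f) = l2_of (\<lambda>x. f (t + c * x))"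
proof -
  have [measurable]: "f \<in> borel_measurable borel" using assms by (auto simp: sq_def)
  have "AE x in lborel. rep (l2_of f) (t + c * x) = f (t + c * x)"
    by (rule AE_borel_affine[OF assms(2) _ rep_l2_of[OF assms(1)]]) measurable
  then show ?thesis unfolding affine_subst_def by (subst l2_of_eq_iff) (use assms in \<open>auto intro: sq_affine\<close>)
qed

lemma norm_affine_subst: "c \<noteq> 0 \<Longrightarrow> norm (affine_subst t c u) = norm u / sqrt \<bar>c\<bar>"
proof -
  assume "c \<noteq> 0"
  then have "(norm (affine_subst t c u))\<^sup>2 = (norm u / sqrt \<bar>c\<bar>)\<^sup>2"
    using sq_affine(2)[OF sq_rep[of u], of c t] by (simp add: affine_subst_def power_divide)
  then show ?thesis by (simp add: power2_eq_iff_nonneg)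
qed

lemma bounded_linear_affine_subst: assumes c: "c \<noteq> 0" shows "bounded_linear (affine_subst t c)"
proof (rule bounded_linear_intro[where K = "1 / sqrt \<bar>c\<bar>"])
  fix u v :: l2 and r :: real
  show "affine_subst t c (u + v) = affine_subst t c u + affine_subst t c v"
  proof (induction u rule: l2_induct_l2_of)
    case (1 f) show ?case
    proof (induction v rule: l2_induct_l2_of)
      case (1 g) then show ?case using \<open>sq f\<close> c by (simp add: l2_of_add affine_subst_l2_of sq_add sq_affine)
    qed
  qed
  show "affine_subst t c (r *\<^sub>R u) = r *\<^sub>R affine_subst t c u"
    by (induction u rule: l2_induct_l2_of) (simp add: l2_of_scaleR affine_subst_l2_of sq_scaleR sq_affine c)
qed (simp add: norm_affine_subst c)

definition shift_phase :: "real \<Rightarrow> real \<Rightarrow> complex" where "shift_phase t k = cis (- (k * t))"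

lemma shift_phase_measurable [measurable]: "shift_phase t \<in> borel_measurable borel" unfolding shift_phase_def[abs_def] by measurable
lemma bdd_mult_shift_phase: "bdd_mult (shift_phase t)" by (rule bmI[where C = 1]) (auto simp: shift_phase_def)

lemma fourier_l2_affine_subst:
  assumes e: "e > 0"
  shows "fourier_l2 (affine_subst (- (e * t)) e u) = (1 / e) *\<^sub>R mul (shift_phase t) (affine_subst 0 (1 / e) (fourier_l2 u))"
proof (rule l2_dense_induct[of "\<lambda>u. fourier_l2 (affine_subst (- (e * t)) e u) = (1 / e) *\<^sub>R mul (shift_phase t) (affine_subst 0 (1 / e) (fourier_l2 u))"])
  have e': "e \<noteq> 0" "1 / e \<noteq> 0" using e by auto
  show "closed {u. fourier_l2 (affine_subst (- (e * t)) e u) = (1 / e) *\<^sub>R mul (shift_phase t) (affine_subst 0 (1 / e) (fourier_l2 u))}"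
    by (intro closed_eq_bounded_linear bounded_linear_compose[OF bounded_linear_fourier_l2 bounded_linear_affine_subst] e'
      bounded_linear_compose[OF bounded_linear_scaleR_right] bounded_linear_compose[OF bounded_linear_mul[OF bdd_mult_shift_phase]]
      bounded_linear_compose[OF bounded_linear_affine_subst bounded_linear_fourier_l2])
  fix f assume f: "l1_l2 f"
  have r: "l1_l2 (\<lambda>x. f (- (e * t) + e * x))"
    using f e' sq_affine[of f e "- (e * t)"] lborel_integrable_real_affine[of f e "- (e * t)"] by (simp add: l1_l2_def)
  have fourier_int: "fourier_int (\<lambda>x. f (- (e * t) + e * x)) k = (1 / e) *\<^sub>R (shift_phase t k * fourier_int f (0 + 1 / e * k))" for k
  proof -
    have "(LINT x|lborel. f (- (e * t) + e * x) * cis (- (k * x))) = \<bar>1 / e\<bar> *\<^sub>R (LINT x|lborel. f (- (e * t) + e * (t + 1 / e * x)) * cis (- (k * (t + 1 / e * x))))"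
      by (rule lborel_integral_real_affine) (use e in simp)
    also have "\<dots> = (1 / e) *\<^sub>R (LINT x|lborel. shift_phase t k * (f x * cis (- (1 / e * k * x))))"
    proof -
      have "f (- (e * t) + e * (t + 1 / e * x)) * cis (- (k * (t + 1 / e * x))) = shift_phase t k * (f x * cis (- (1 / e * k * x)))" for x
      proof -
        have "cis (- (k * (t + 1 / e * x))) = shift_phase t k * cis (- (1 / e * k * x))"
          unfolding shift_phase_def cis_mult by (rule arg_cong[where f = cis]) (simp add: algebra_simps)
        then show ?thesis using e by (simp add: distrib_left ac_simps)
      qed
      then show ?thesis using e by simp
    qed
    finally show ?thesis by (simp add: fourier_int_def scaleR_conv_of_real)
  qed
  have s: "sq (fourier_int f)" "sq (\<lambda>k. fourier_int f (0 + 1 / e * k))" using sq_fourier_int[OF f] sq_affine(1)[OF sq_fourier_int[OF f] e'(2), of 0] by auto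
  have "fourier_l2 (affine_subst (- (e * t)) e (l2_of f)) = l2_of (fourier_int (\<lambda>x. f (- (e * t) + e * x)))"
    using affine_subst_l2_of[OF l1_l2_sq[OF f] e'(1)] fourier_l2_l2_of[OF r] by simp
  also have "fourier_int (\<lambda>x. f (- (e * t) + e * x)) = (\<lambda>k. (1 / e) *\<^sub>R (shift_phase t k * fourier_int f (0 + 1 / e * k)))"
    by (rule ext) (rule fourier_int)
  also have "l2_of \<dots> = (1 / e) *\<^sub>R mul (shift_phase t) (l2_of (\<lambda>k. fourier_int f (0 + 1 / e * k)))"
    unfolding mul_l2_of[OF bdd_mult_shift_phase s(2)] by (rule l2_of_scaleR[symmetric]) (intro sq_bdd_mult bdd_mult_shift_phase s)
  also have "\<dots> = (1 / e) *\<^sub>R mul (shift_phase t) (affine_subst 0 (1 / e) (fourier_l2 (l2_of f)))"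
    using affine_subst_l2_of[OF s(1) e'(2)] fourier_l2_l2_of[OF f] by simp
  finally show "fourier_l2 (affine_subst (- (e * t)) e (l2_of f)) = (1 / e) *\<^sub>R mul (shift_phase t) (affine_subst 0 (1 / e) (fourier_l2 (l2_of f)))" .
qed

lemma fhat_affine:
  assumes f: "square_integrable f" and e: "e > 0"
  shows "square_integrable (\<lambda>x. f (e * (x - t)))"
    "fhat (\<lambda>x. f (e * (x - t))) = (1 / e) *\<^sub>R mul (shift_phase t) (affine_subst 0 (1 / e) (fhat f))"
proof -
  have eq: "of_real_fun (\<lambda>x. f (e * (x - t))) = (\<lambda>x. of_real_fun f (- (e * t) + e * x))"
    by (auto simp: of_real_fun_def algebra_simps)
  show "square_integrable (\<lambda>x. f (e * (x - t)))"
    unfolding square_integrable_iff eq using e by (intro sq_affine sq_of_real_fun f) simp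
  have "fhat (\<lambda>x. f (e * (x - t))) = fourier_l2 (affine_subst (- (e * t)) e (l2_of (of_real_fun f)))"
    unfolding fhat_def eq using affine_subst_l2_of[OF sq_of_real_fun[OF f], of e] e by simp
  then show "fhat (\<lambda>x. f (e * (x - t))) = (1 / e) *\<^sub>R mul (shift_phase t) (affine_subst 0 (1 / e) (fhat f))"
    unfolding fourier_l2_affine_subst[OF e] fhat_def .
qed

section \<open>Test functions\<close>

lemma test_function_deriv: assumes "test_function \<phi>" shows "test_function (deriv \<phi>)"
proof -
  obtain R where R: "\<And>x. \<phi> x \<noteq> 0 \<Longrightarrow> \<bar>x\<bar> \<le> R"
    using assms by (auto simp: test_function_def bounded_iff)
  have "\<bar>x\<bar> \<le> R" if "deriv \<phi> x \<noteq> 0" for x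
  proof (rule ccontr)
    assume "\<not> \<bar>x\<bar> \<le> R"
    then have x: "x \<in> - {-R..R}" by auto
    have "(\<phi> has_field_derivative 0) (at x)"
    proof (rule has_field_derivative_transform_within_open[where S = "- {-R..R}"])
      show "((\<lambda>_. 0) has_field_derivative 0) (at x)" by simp
      show "0 = \<phi> y" if "y \<in> - {-R..R}" for y using R[of y] that by fastforce
    qed (use x in auto)
    then show False using that by (simp add: DERIV_imp_deriv)
  qed
  then have "bounded {x. deriv \<phi> x \<noteq> 0}" by (auto simp: bounded_iff)
  moreover have "(deriv ^^ n) (deriv \<phi>) field_differentiable at x" for n x
    using assms unfolding test_function_def by (metis funpow.simps(2) funpow_swap1 o_apply)
  ultimately show ?thesis by (simp add: test_function_def)
qed

lemma test_function_DERIV: "test_function \<phi> \<Longrightarrow> (\<phi> has_real_derivative deriv \<phi> x) (at x)"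
  unfolding test_function_def DERIV_deriv_iff_field_differentiable by (metis funpow_0)

lemma test_function_continuous: "test_function \<phi> \<Longrightarrow> continuous_on S \<phi>"
  by (meson DERIV_isCont continuous_at_imp_continuous_on test_function_DERIV)

lemma test_function_support:
  assumes "test_function \<phi>"
  obtains R where "R > 0" "\<And>x. \<bar>x\<bar> \<ge> R \<Longrightarrow> \<phi> x = 0"
proof -
  obtain R where R: "\<And>x. \<phi> x \<noteq> 0 \<Longrightarrow> \<bar>x\<bar> \<le> R"
    using assms by (auto simp: test_function_def bounded_iff)
  show ?thesis by (rule that[of "\<bar>R\<bar> + 1"]) (use R in \<open>fastforce+\<close>)
qed

lemma compact_support_integrable:
  fixes f :: "real \<Rightarrow> 'a::euclidean_space"
  assumes c: "continuous_on UNIV f" and z: "\<And>x. \<bar>x\<bar> \<ge> R \<Longrightarrow> f x = 0"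
  shows "integrable lborel f"
proof -
  have "integrable lborel (\<lambda>x. indicator {-R..R} x *\<^sub>R f x)"
    by (rule borel_integrable_compact) (auto intro: continuous_on_subset[OF c])
  moreover have "indicator {-R..R} x *\<^sub>R f x = f x" for x using z[of x] by (auto simp: indicator_def abs_le_iff)
  ultimately show ?thesis by simp
qed

lemma continuous_of_real_fun: "continuous_on S \<phi> \<Longrightarrow> continuous_on S (of_real_fun \<phi>)"
  unfolding of_real_fun_def[abs_def] by (intro continuous_intros)

lemma l1_l2_test: assumes t: "test_function \<phi>" shows "l1_l2 (of_real_fun \<phi>)"
proof -
  obtain R where R: "\<And>x. \<bar>x\<bar> \<ge> R \<Longrightarrow> \<phi> x = 0" using test_function_support[OF t] by blast
  have c: "continuous_on UNIV (of_real_fun \<phi>)" by (intro continuous_of_real_fun test_function_continuous t)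
  have "integrable lborel (of_real_fun \<phi>)" by (rule compact_support_integrable[OF c, of R]) (simp add: of_real_fun_def R)
  moreover have "integrable lborel (\<lambda>x. (cmod (of_real_fun \<phi> x))\<^sup>2)"
    by (rule compact_support_integrable[of _ R], intro continuous_on_power continuous_on_norm c) (simp add: of_real_fun_def R)
  ultimately show ?thesis by (auto simp: l1_l2_def sq_def)
qed

lemma square_integrable_test: "test_function \<phi> \<Longrightarrow> square_integrable \<phi>"
  by (simp add: square_integrable_iff l1_l2_sq l1_l2_test)

text \<open>Integration by parts, as a single application of the fundamental theorem of calculus to
  \<open>\<phi> x * cis (- (k * x))\<close> on an interval at whose end points \<open>\<phi>\<close>
  vanishes.\<close>

lemma fourier_int_deriv:
  assumes t: "test_function \<phi>"
  shows "fourier_int (of_real_fun (deriv \<phi>)) k = \<i> * of_real k * fourier_int (of_real_fun \<phi>) k"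
proof -
  obtain R where R: "R > 0" "\<And>x. \<bar>x\<bar> \<ge> R \<Longrightarrow> \<phi> x = 0" using test_function_support[OF t] by blast
  have R': "deriv \<phi> x = 0" if "\<bar>x\<bar> > R" for x
  proof (rule DERIV_imp_deriv, rule has_field_derivative_transform_within_open[where S = "- {-R..R}"])
    show "((\<lambda>_. 0) has_field_derivative 0) (at x)" by simp
    show "0 = \<phi> y" if "y \<in> - {-R..R}" for y using R(2)[of y] that by fastforce
  qed (use that in auto)
  have t': "test_function (deriv \<phi>)" by (rule test_function_deriv[OF t])
  let ?fourier_l2 = "\<lambda>x. of_real_fun \<phi> x * cis (- (k * x))"
  let ?F' = "\<lambda>x. of_real_fun (deriv \<phi>) x * cis (- (k * x)) - \<i> * of_real k * (of_real_fun \<phi> x * cis (- (k * x)))"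
  have d: "(?fourier_l2 has_vector_derivative ?F' x) (at x within S)" for x S
    unfolding has_vector_derivative_complex_iff of_real_fun_def
    by (auto intro!: derivative_eq_intros has_field_derivative_at_within[OF test_function_DERIV[OF t]] simp: algebra_simps)
  have ccis: "continuous_on S (\<lambda>x. cis (- (k * x)))" for S
    by (intro continuous_on_cis continuous_intros)
  have "(LINT x|lborel. indicator {-R..R} x *\<^sub>R ?F' x) = ?fourier_l2 R - ?fourier_l2 (- R)"
    by (rule integral_FTC_atLeastAtMost[OF _ d])
      (use R in \<open>auto intro!: continuous_intros ccis continuous_of_real_fun test_function_continuous t t'\<close>)
  moreover have "indicator {-R..R} x *\<^sub>R ?F' x = ?F' x" for x
    using R(2)[of x] R'[of x] by (cases "\<bar>x\<bar> \<le> R") (auto simp: indicator_def of_real_fun_def)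
  ultimately have "(LINT x|lborel. ?F' x) = 0" using R by (simp add: of_real_fun_def)
  moreover have "integrable lborel (\<lambda>x. of_real_fun (deriv \<phi>) x * cis (- (k * x)))" "integrable lborel (\<lambda>x. of_real_fun \<phi> x * cis (- (k * x)))"
    using l1_l2_test[OF t] l1_l2_test[OF t'] by (auto intro!: integrable_times_cis simp: l1_l2_def)
  ultimately show ?thesis by (simp add: fourier_int_def)
qed

lemma fhat_test: "test_function \<phi> \<Longrightarrow> fhat \<phi> = l2_of (fourier_int (of_real_fun \<phi>))"
  unfolding fhat_def by (intro fourier_l2_l2_of l1_l2_test)

text \<open>The Fourier transforms of a test function and its derivatives share one rapidly decaying
  factor \<open>e\<close>, so that unbounded multipliers can be moved onto the test function.\<close>

lemma test_function_weighted:
  assumes t: "test_function \<phi>"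
  obtains e where "fhat \<phi> = mul (bessel (-4)) e" "fhat (deriv \<phi>) = mul (bessel (-3)) (mul riesz e)"
    "fhat ((deriv ^^ 2) \<phi>) = mul (bessel (-2)) (mul riesz (mul riesz e))"
    "fhat ((deriv ^^ 3) \<phi>) = mul (bessel (-1)) (mul riesz (mul riesz (mul riesz e)))"
    "fhat ((deriv ^^ 4) \<phi>) = mul riesz (mul riesz (mul riesz (mul riesz e)))"
proof -
  define f where "f n = fourier_int (of_real_fun ((deriv ^^ n) \<phi>))" for n
  have tn: "test_function ((deriv ^^ n) \<phi>)" for n by (induction n) (auto intro: t test_function_deriv)
  have f: "f (Suc n) k = \<i> * of_real k * f n k" for n k
    unfolding f_def using fourier_int_deriv[OF tn[of n], of k] by simp
  have fn: "f n k = (\<i> * of_real k) ^ n * f 0 k" for n k by (induction n) (auto simp: f)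
  have sf: "sq (f n)" for n unfolding f_def by (intro sq_fourier_int l1_l2_test tn)
  \<comment> \<open>The transform of (1 - d^2/dx^2)^2 \<phi>: writing it by derivatives shows that
    the product with the weight of order 4 is square integrable.\<close>
  define e where "e = l2_of (\<lambda>k. f 0 k - 2 * f 2 k + f 4 k)"
  have se: "sq (\<lambda>k. f 0 k - 2 * f 2 k + f 4 k)" by (intro sq_add sq_diff sq_cmult sf)
  have ek: "f 0 k - 2 * f 2 k + f 4 k = bessel 4 k * f 0 k" for k
  proof -
    have "bessel 4 k = bessel 2 k * bessel 2 k" by (simp add: bessel_mult)
    also have "bessel 2 k = 1 + (of_real k)\<^sup>2" by (simp add: bessel_def bracket_2)
    finally show ?thesis using fn[of 2 k] fn[of 4 k] by (simp add: power_mult_distrib algebra_simps power2_eq_square power4_eq_xxxx)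
  qed
  have re: "AE k in lborel. rep e k = bessel 4 k * f 0 k" using rep_l2_of[OF se] unfolding e_def ek .
  have Xn: "(\<i> * of_real k) ^ n * f 0 k = bessel (of_nat n - 4) k * (riesz k ^ n * (bessel 4 k * f 0 k))" for n k
  proof -
    have "bessel (real n) k = bessel 1 k ^ n" by (induction n) (auto simp: bessel_mult[symmetric] add.commute)
    then have "bessel (real n - 4) k * riesz k ^ n * bessel 4 k = (riesz k * bessel 1 k) ^ n"
      using bessel_mult[of "real n - 4" k 4] by (simp add: power_mult_distrib ac_simps)
    then show ?thesis unfolding riesz_J1 by (metis mult.assoc)
  qed
  have bX: "bdd_mult (\<lambda>k. riesz k ^ n)" for n by (induction n) (auto intro: bdd_mult_const bdd_mult_mult bdd_mult_riesz)
  have fh: "fhat ((deriv ^^ n) \<phi>) = mul (bessel (of_nat n - 4)) (mul (\<lambda>k. riesz k ^ n) e)" if "n \<le> 4" for n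
  proof (rule l2_eqI)
    have b: "bdd_mult (bessel (of_nat n - 4))" using that by (intro bdd_mult_bessel) simp
    show "AE k in lborel. rep (fhat ((deriv ^^ n) \<phi>)) k = rep (mul (bessel (of_nat n - 4)) (mul (\<lambda>k. riesz k ^ n) e)) k"
      using rep_mul[OF b, of "mul (\<lambda>k. riesz k ^ n) e"] rep_mul[OF bX[of n], of e] re rep_l2_of[OF sf[of n]]
      unfolding fhat_test[OF tn] f_def[symmetric]
      by eventually_elim (simp add: Xn fn[of n])
  qed
  have XX: "mul (\<lambda>k. riesz k ^ m) e = mul riesz (mul (\<lambda>k. riesz k ^ n) e)" if "m = Suc n" for m n
    unfolding that by (simp add: mul_mul bdd_mult_riesz bX)
  have s: "1 = Suc 0" "2 = Suc 1" "3 = Suc 2" "4 = Suc 3" by simp_all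
  have pow: "mul (\<lambda>k. riesz k ^ 0) e = e" by (simp add: mul_one)
  note X1 = XX[OF s(1), unfolded pow]
  note X2 = XX[OF s(2), unfolded X1]
  note X3 = XX[OF s(3), unfolded X2]
  note X4 = XX[OF s(4), unfolded X3]
  show ?thesis
  proof (rule that)
    show "fhat \<phi> = mul (bessel (-4)) e" using fh[of 0] unfolding pow by simp
    show "fhat (deriv \<phi>) = mul (bessel (-3)) (mul riesz e)" using fh[of 1] unfolding X1 by simp
    show "fhat ((deriv ^^ 2) \<phi>) = mul (bessel (-2)) (mul riesz (mul riesz e))" using fh[of 2] unfolding X2 by simp
    show "fhat ((deriv ^^ 3) \<phi>) = mul (bessel (-1)) (mul riesz (mul riesz (mul riesz e)))" using fh[of 3] unfolding X3 by simp
    show "fhat ((deriv ^^ 4) \<phi>) = mul riesz (mul riesz (mul riesz (mul riesz e)))" using fh[of 4] unfolding X4 by simp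
  qed
qed

subsection \<open>Bump functions\<close>

text \<open>A polynomial in 1/x times exp(-c/x), continued by 0: a family closed under
  differentiation that contains the standard flat function. Letting \<open>c\<close> tend to 0 makes
  the function with \<open>p = 1\<close> approach a jump.\<close>

definition flat_exp :: "real \<Rightarrow> real poly \<Rightarrow> real \<Rightarrow> real" where
  "flat_exp c p x = (if x \<le> 0 then 0 else poly p (1 / x) * exp (- (c / x)))"

text \<open>The additional power of \<open>y\<close>, of arbitrary exponent, makes the induction
  over the coefficients of \<open>p\<close> go through.\<close>

lemma poly_exp_tendsto_0:
  fixes c :: real
  assumes c: "c > 0"
  shows "((\<lambda>y. y ^ k * poly p y * exp (- (c * y))) \<longlongrightarrow> 0) at_top"
proof (induction p arbitrary: k)
  case 0 then show ?case by simp
next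
  case (pCons a p)
  have "((\<lambda>y. (1 / c) ^ k * ((c * y) ^ k / exp (c * y))) \<longlongrightarrow> (1 / c) ^ k * 0) at_top"
    by (intro tendsto_mult tendsto_const filterlim_compose[OF tendsto_power_div_exp_0]
      filterlim_tendsto_pos_mult_at_top[OF tendsto_const c filterlim_ident])
  then have b: "((\<lambda>y. y ^ k * exp (- (c * y))) \<longlongrightarrow> 0) at_top"
    using c by (simp add: power_mult_distrib power_divide exp_minus field_simps)
  have "((\<lambda>y. a * (y ^ k * exp (- (c * y))) + y ^ Suc k * poly p y * exp (- (c * y))) \<longlongrightarrow> a * 0 + 0) at_top"
    by (intro tendsto_intros b pCons)
  then show ?case by (simp add: algebra_simps)
qed

text \<open>The factor \<open>[:0, 0, 1:]\<close> is the 1/x^2 from the inner derivative of 1/x. At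
  the origin the difference quotient from the right tends to 0 since the exponential beats every
  power.\<close>

lemma flat_exp_DERIV:
  assumes c: "c > 0"
  shows "(flat_exp c p has_real_derivative flat_exp c ([:0, 0, 1:] * ([:c:] * p - pderiv p)) x) (at x)"
proof -
  let ?q = "[:0, 0, 1:] * ([:c:] * p - pderiv p)"
  consider "x < 0" | "x = 0" | "x > 0" by linarith
  then show ?thesis
  proof cases
    case 1
    show ?thesis
      by (rule has_field_derivative_transform_within_open[where S = "{..<0}" and f = "\<lambda>_. 0"]) (use 1 in \<open>auto simp: flat_exp_def\<close>)
  next
    case 3
    have "((\<lambda>x. poly p (1 / x) * exp (- (c / x))) has_real_derivative poly ?q (1 / x) * exp (- (c / x))) (at x)"
      using 3 by (auto intro!: derivative_eq_intros DERIV_chain2[OF poly_DERIV] simp: field_simps power2_eq_square)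
    then have "(flat_exp c p has_real_derivative poly ?q (1 / x) * exp (- (c / x))) (at x)"
      by (rule has_field_derivative_transform_within_open[where S = "{0<..}"]) (use 3 in \<open>auto simp: flat_exp_def\<close>)
    then show ?thesis using 3 by (simp add: flat_exp_def)
  next
    case 2
    have "((\<lambda>x. flat_exp c p x / x) \<longlongrightarrow> 0) (at 0)"
      unfolding filterlim_at_split
    proof
      show "((\<lambda>x. flat_exp c p x / x) \<longlongrightarrow> 0) (at_left 0)"
        by (rule tendsto_eventually) (auto simp: eventually_at_filter flat_exp_def)
      have "((\<lambda>x. (\<lambda>y. y ^ 1 * poly p y * exp (- (c * y))) (inverse x)) \<longlongrightarrow> 0) (at_right 0)"
        by (rule filterlim_compose[OF poly_exp_tendsto_0[OF c] filterlim_inverse_at_top_right])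
      then show "((\<lambda>x. flat_exp c p x / x) \<longlongrightarrow> 0) (at_right 0)"
        by (rule Lim_transform_eventually) (auto simp: eventually_at_filter flat_exp_def field_simps)
    qed
    then show ?thesis using 2 by (simp add: has_field_derivative_iff flat_exp_def)
  qed
qed

text \<open>Products of a flat function rising at \<open>a\<close> with a mirrored one at
  \<open>b\<close>. Differentiating the mirrored factor produces a minus sign, so closure under
  differences makes the set closed under derivatives, and its members are smooth.\<close>

inductive_set bumps :: "real \<Rightarrow> real \<Rightarrow> real \<Rightarrow> (real \<Rightarrow> real) set" for c a b where
  base: "(\<lambda>x. flat_exp c p (x - a) * flat_exp c q (b - x)) \<in> bumps c a b"
| diff: "f \<in> bumps c a b \<Longrightarrow> g \<in> bumps c a b \<Longrightarrow> (\<lambda>x. f x - g x) \<in> bumps c a b"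

lemma bumps_DERIV:
  assumes c: "c > 0" and f: "f \<in> bumps c a b"
  shows "\<exists>g \<in> bumps c a b. \<forall>x. (f has_real_derivative g x) (at x)"
  using f
proof induction
  case (base p q)
  let ?d = "\<lambda>p. [:0, 0, 1:] * ([:c:] * p - pderiv p)"
  have "((\<lambda>x. flat_exp c p (x - a) * flat_exp c q (b - x)) has_real_derivative
     flat_exp c (?d p) (x - a) * flat_exp c q (b - x) - flat_exp c p (x - a) * flat_exp c (?d q) (b - x)) (at x)" for x
    by (auto intro!: derivative_eq_intros DERIV_chain2[OF flat_exp_DERIV[OF c]])
  then show ?case
  proof (intro bexI allI)
    show "(\<lambda>x. flat_exp c (?d p) (x - a) * flat_exp c q (b - x) - flat_exp c p (x - a) * flat_exp c (?d q) (b - x)) \<in> bumps c a b"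
      by (intro bumps.diff bumps.base)
  qed
next
  case (diff f g)
  then obtain f' g' where "f' \<in> bumps c a b" "g' \<in> bumps c a b"
    "\<forall>x. (f has_real_derivative f' x) (at x)" "\<forall>x. (g has_real_derivative g' x) (at x)" by blast
  then show ?case by (intro bexI[of _ "\<lambda>x. f' x - g' x"]) (auto intro!: DERIV_diff bumps.diff)
qed

lemma bumps_test:
  assumes c: "c > 0" and f: "f \<in> bumps c a b"
  shows "test_function f"
proof -
  have "(deriv ^^ n) f \<in> bumps c a b" for n
  proof (induction n)
    case (Suc n)
    obtain g where g: "g \<in> bumps c a b" "\<forall>x. ((deriv ^^ n) f has_real_derivative g x) (at x)"
      using bumps_DERIV[OF c Suc] by blast
    then have "deriv ((deriv ^^ n) f) = g" by (auto intro: DERIV_imp_deriv)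
    with g show ?case by simp
  qed (use f in simp)
  then have d: "(deriv ^^ n) f field_differentiable at x" for n x
    using bumps_DERIV[OF c] unfolding field_differentiable_def by blast
  have "f x = 0" if "x \<notin> {a..b}" for x
    using f that by induction (auto simp: flat_exp_def)
  then have "{x. f x \<noteq> 0} \<subseteq> {a..b}" by blast
  then have "bounded {x. f x \<noteq> 0}" by (rule bounded_subset[rotated]) simp
  with d show ?thesis by (simp add: test_function_def)
qed

text \<open>Bumps with \<open>c = 1 / real (Suc n)\<close> are bounded by 1, vanish off
  \<open>{a..b}\<close> and tend to 1 inside. By dominated convergence the integrals over all
  intervals vanish, which determines a real function.\<close>

lemma test_functions_dense:
  assumes v: "herm v = v" and 0: "\<And>\<phi>. test_function \<phi> \<Longrightarrow> inner v (fhat \<phi>) = 0"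
  shows "v = 0"
proof -
  let ?g = "physical v"
  note g = physical[OF v]
  have [measurable]: "?g \<in> borel_measurable borel" using g(1) by (simp add: square_integrable_def)
  have gz: "(LINT x|lborel. ?g x * \<phi> x) = 0" if "test_function \<phi>" for \<phi>
    using 0[OF that] inner_fhat[OF g(1) square_integrable_test[OF that]] g(2) by simp
  have ind: "square_integrable (indicator {a..b})" for a b :: real
  proof -
    have "of_real_fun (indicator {a..b}) = indicator {a..b}" by (auto simp: of_real_fun_def indicator_def)
    then show ?thesis using indicator_interval(2)[of a b] by (simp add: square_integrable_iff)
  qed
  have int: "integrable lborel (\<lambda>x. indicator {a..b} x * ?g x)" for a b
    by (rule integrable_mult_square_integrable[OF ind g(1)])
  have "AE x in lborel. ?g x = 0"
  proof (rule AE_zero_of_interval_integrals[OF int])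
    fix a b :: real
    define \<phi> where "\<phi> n x = flat_exp (1 / real (Suc n)) 1 (x - a) * flat_exp (1 / real (Suc n)) 1 (b - x)" for n x
    have t: "test_function (\<phi> n)" for n
      unfolding \<phi>_def[abs_def] by (rule bumps_test[OF _ bumps.base]) simp
    have fl: "0 \<le> flat_exp (1 / real (Suc n)) 1 y" "flat_exp (1 / real (Suc n)) 1 y \<le> 1" for n y
      by (auto simp: flat_exp_def)
    have [measurable]: "\<phi> n \<in> borel_measurable borel" for n
      using square_integrable_test[OF t[of n]] by (simp add: square_integrable_def)
    have "(\<lambda>n. LINT x|lborel. ?g x * \<phi> n x) \<longlonglongrightarrow> (LINT x|lborel. indicator {a..b} x * ?g x)"
    proof (rule integral_dominated_convergence)
      show "integrable lborel (\<lambda>x. \<bar>indicator {a..b} x * ?g x\<bar>)" using int by (rule integrable_abs)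
      show "AE x in lborel. norm (?g x * \<phi> n x) \<le> \<bar>indicator {a..b} x * ?g x\<bar>" for n
      proof (rule AE_I2)
        fix x
        have "0 \<le> \<phi> n x" "\<phi> n x \<le> 1" unfolding \<phi>_def using fl by (auto intro: mult_le_one)
        moreover have "\<phi> n x = 0" if "x \<notin> {a..b}" using that by (auto simp: \<phi>_def flat_exp_def)
        ultimately show "norm (?g x * \<phi> n x) \<le> \<bar>indicator {a..b} x * ?g x\<bar>"
          by (cases "x \<in> {a..b}") (auto simp: abs_mult mult_left_le)
      qed
      have flim: "(\<lambda>n. flat_exp (1 / real (Suc n)) 1 y) \<longlonglongrightarrow> 1" if "y > 0" for y
      proof -
        have "(\<lambda>n. exp (- (inverse (real (Suc n)) / y))) \<longlonglongrightarrow> exp (- (0 / y))"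
          by (intro tendsto_intros LIMSEQ_inverse_real_of_nat) (use that in simp)
        then show ?thesis using that by (simp add: flat_exp_def inverse_eq_divide)
      qed
      have "AE x in lborel. x \<noteq> a \<and> x \<noteq> b" using AE_lborel_singleton[of a] AE_lborel_singleton[of b] by eventually_elim simp
      then show "AE x in lborel. (\<lambda>n. ?g x * \<phi> n x) \<longlonglongrightarrow> indicator {a..b} x * ?g x"
      proof eventually_elim
        case (elim x)
        show ?case
        proof (cases "x \<in> {a..b}")
          case True
          with elim have "x - a > 0" "b - x > 0" by auto
          then have "(\<lambda>n. ?g x * \<phi> n x) \<longlonglongrightarrow> ?g x * (1 * 1)"
            unfolding \<phi>_def by (intro tendsto_mult tendsto_const flim)
          then show ?thesis using True by simp
        next
          case False
          then have "\<phi> n x = 0" for n by (auto simp: \<phi>_def flat_exp_def)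
          then show ?thesis using False by simp
        qed
      qed
    qed measurable
    then show "(LINT x|lborel. indicator {a..b} x * ?g x) = 0" by (simp add: gz[OF t] LIMSEQ_const_iff)
  qed measurable
  then have "l2_of (of_real_fun ?g) = l2_of (\<lambda>_. 0)"
    by (intro l2_of_cong_AE sq_of_real_fun g) (auto simp: of_real_fun_def elim: eventually_mono)
  then have "fhat ?g = fourier_l2 0" by (simp add: fhat_def zero_l2_def)
  then show "v = 0" using g(2) bounded_linear.linear[OF bounded_linear_fourier_l2, THEN linear_0] by simp
qed

section \<open>Differential equations in Banach spaces\<close>

text \<open>\<open>(E t + d) * exp (- (c * t))\<close> does not increase. The constant
  \<open>d\<close> takes in an inhomogeneity of the differential inequality.\<close>

lemma gronwall:
  fixes E :: "real \<Rightarrow> real"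
  assumes der: "\<And>t. t \<in> {0..T} \<Longrightarrow> (E has_real_derivative E' t) (at t within {0..T})"
    and le: "\<And>t. t \<in> {0..T} \<Longrightarrow> E' t \<le> c * (E t + d)" and t: "t \<in> {0..T}"
  shows "E t + d \<le> (E 0 + d) * exp (c * t)"
proof -
  define f where "f s = (E s + d) * exp (- (c * s))" for s
  have f: "(f has_real_derivative E' s * exp (- (c * s)) - (E s + d) * (exp (- (c * s)) * c)) (at s within {0..T})" if "s \<in> {0..T}" for s
    unfolding f_def using der[OF that] by (auto intro!: derivative_eq_intros)
  have "f t \<le> f 0"
  proof (rule DERIV_nonpos_imp_decreasing_open[of 0 t f])
    show "0 \<le> t" using t by simp
    have "continuous_on {0..T} f"
      unfolding continuous_on_eq_continuous_within using f DERIV_continuous by blast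
    then show "continuous_on {0..t} f" by (rule continuous_on_subset) (use t in auto)
    fix s assume s: "0 < s" "s < t"
    then have sT: "s \<in> {0..T}" using t by auto
    have "at s within {0..T} = at s" by (rule at_within_Icc_at) (use s t in auto)
    with f[OF sT] have "(f has_real_derivative (E' s - c * (E s + d)) * exp (- (c * s))) (at s)"
      by (simp add: algebra_simps)
    moreover have "(E' s - c * (E s + d)) * exp (- (c * s)) \<le> 0"
      using le[OF sT] by (simp add: mult_nonpos_nonneg)
    ultimately show "\<exists>y. (f has_real_derivative y) (at s) \<and> y \<le> 0" by blast
  qed
  then have "(E t + d) * exp (- (c * t)) * exp (c * t) \<le> (E 0 + d) * exp (c * t)"
    by (intro mult_right_mono) (auto simp: f_def)
  moreover have "exp (- (c * t)) * exp (c * t) = 1" by (simp flip: exp_add)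
  ultimately show ?thesis by (simp add: mult.assoc)
qed

text \<open>Serves to show that a symmetry of the right-hand side passes to the solution: the
  transformed solution solves the same initial value problem. The squared distance obeys Gronwall's
  inequality.\<close>

lemma ode_unique:
  fixes y z :: "real \<Rightarrow> 'a::real_inner"
  assumes y: "\<And>t. t \<in> {0..T} \<Longrightarrow> (y has_vector_derivative f t (y t)) (at t within {0..T})"
    and z: "\<And>t. t \<in> {0..T} \<Longrightarrow> (z has_vector_derivative f t (z t)) (at t within {0..T})"
    and lip: "\<And>t x x'. t \<in> {0..T} \<Longrightarrow> norm (f t x - f t x') \<le> C * norm (x - x')"
    and init: "y 0 = z 0" and t: "t \<in> {0..T}"
  shows "y t = z t"
proof -
  let ?E = "\<lambda>t. inner (y t - z t) (y t - z t)"
  have "?E t + 0 \<le> (?E 0 + 0) * exp (2 * C * t)"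
  proof (rule gronwall[where T = T and E' = "\<lambda>t. 2 * inner (y t - z t) (f t (y t) - f t (z t))"])
    fix s assume s: "s \<in> {0..T}"
    have "((\<lambda>t. y t - z t) has_vector_derivative f s (y s) - f s (z s)) (at s within {0..T})"
      by (intro derivative_intros y z s)
    from bounded_bilinear.has_vector_derivative[OF bounded_bilinear_inner this this]
    show "(?E has_real_derivative 2 * inner (y s - z s) (f s (y s) - f s (z s))) (at s within {0..T})"
      by (simp add: has_real_derivative_iff_has_vector_derivative inner_commute)
    have "inner (y s - z s) (f s (y s) - f s (z s)) \<le> norm (y s - z s) * norm (f s (y s) - f s (z s))"
      by (rule norm_cauchy_schwarz)
    also have "\<dots> \<le> norm (y s - z s) * (C * norm (y s - z s))" by (intro mult_left_mono lip s) simp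
    finally show "2 * inner (y s - z s) (f s (y s) - f s (z s)) \<le> 2 * C * (?E s + 0)"
      by (simp add: power2_norm_eq_inner[symmetric] power2_eq_square mult.left_commute)
  qed (rule t)
  then show ?thesis using init by (simp add: inner_gt_zero_iff not_less[symmetric])
qed

text \<open>The whole interval is covered at once: in the norm weighted by
  \<open>exp (- (2 * C * t))\<close> the integral operator is a contraction with factor 1/2 for
  every \<open>T\<close>. The weight is built into the unknown \<open>z\<close>, with
  \<open>y t = exp (2 * C * t) *\<^sub>R z t\<close>.\<close>

lemma picard_lindelof:
  fixes f :: "real \<Rightarrow> 'a::banach \<Rightarrow> 'a"
  assumes T: "T > 0" and C: "C > 0"
    and lip: "\<And>t x y. t \<in> {0..T} \<Longrightarrow> norm (f t x - f t y) \<le> C * norm (x - y)"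
    and cont: "\<And>y. continuous_on {0..T} y \<Longrightarrow> continuous_on {0..T} (\<lambda>t. f t (y t))"
  shows "\<exists>y. y 0 = y0 \<and> (\<forall>t\<in>{0..T}. (y has_vector_derivative f t (y t)) (at t within {0..T}))"
proof -
  \<comment> \<open>The projection onto \<open>{0..T}\<close> extends functions on the interval to
    bounded continuous functions on the line, which form a complete metric space.\<close>
  define c where "c t = max 0 (min T t)" for t :: real
  have c: "c t \<in> {0..T}" for t using T by (auto simp: c_def)
  have cid: "c t = t" if "t \<in> {0..T}" for t using that by (auto simp: c_def)
  have cc: "continuous_on S c" for S unfolding c_def by (intro continuous_intros)
  define g where "g z \<tau> = f \<tau> (exp (2 * C * \<tau>) *\<^sub>R apply_bcontfun z \<tau>)" for z \<tau>
  have gc: "continuous_on {0..T} (g z)" for z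
    unfolding g_def by (intro cont continuous_intros continuous_on_apply_bcontfun)
  define P where "P z t = exp (- (2 * C * t)) *\<^sub>R (y0 + integral {0..t} (g z))" for z t
  have Pc: "continuous_on {0..T} (P z)" for z
    unfolding P_def by (intro continuous_intros indefinite_integral_continuous_1 integrable_continuous_interval gc)
  have Pb: "(\<lambda>t. P z (c t)) \<in> bcontfun" for z
  proof -
    have 1: "continuous_on UNIV (\<lambda>t. P z (c t))"
      by (rule continuous_on_compose2[OF Pc cc]) (use c in auto)
    have "bounded (P z ` {0..T})" by (intro compact_imp_bounded compact_continuous_image Pc compact_Icc)
    then have "bounded (range (\<lambda>t. P z (c t)))" by (rule bounded_subset) (use c in auto)
    with 1 show ?thesis by (simp add: bcontfun_def)
  qed
  define \<Phi> where "\<Phi> z = Bcontfun (\<lambda>t. P z (c t))" for z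
  have \<Phi>: "apply_bcontfun (\<Phi> z) t = P z (c t)" for z t
    unfolding \<Phi>_def using Bcontfun_inverse[OF Pb] by simp
  have contr: "dist (\<Phi> z) (\<Phi> w) \<le> 1 / 2 * dist z w" for z w
  proof (rule dist_bound)
    fix t
    let ?s = "c t" and ?d = "dist z w"
    have s: "?s \<in> {0..T}" by (rule c)
    have sub: "{0..?s} \<subseteq> {0..T}" using s by auto
    have int: "g z integrable_on {0..?s}" for z
      by (rule integrable_continuous_interval[OF continuous_on_subset[OF gc sub]])
    \<comment> \<open>The integral of \<open>C * exp (2 * C * \<tau>)\<close> gains a factor 1/2
      over the weight: this is the contraction factor.\<close>
    have hi: "((\<lambda>\<tau>. C * exp (2 * C * \<tau>) * ?d) has_integral (?d / 2 * exp (2 * C * ?s) - ?d / 2 * exp (2 * C * 0))) {0..?s}"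
      by (rule fundamental_theorem_of_calculus)
        (use s C in \<open>auto intro!: derivative_eq_intros simp flip: has_real_derivative_iff_has_vector_derivative\<close>)
    have "norm (integral {0..?s} (g z) - integral {0..?s} (g w)) = norm (integral {0..?s} (\<lambda>\<tau>. g z \<tau> - g w \<tau>))"
      by (simp add: Henstock_Kurzweil_Integration.integral_diff int)
    also have "\<dots> \<le> integral {0..?s} (\<lambda>\<tau>. C * exp (2 * C * \<tau>) * ?d)"
    proof (rule Henstock_Kurzweil_Integration.integral_norm_bound_integral)
      show "(\<lambda>\<tau>. g z \<tau> - g w \<tau>) integrable_on {0..?s}" by (intro integrable_diff int)
      show "(\<lambda>\<tau>. C * exp (2 * C * \<tau>) * ?d) integrable_on {0..?s}" using hi by blast
      fix \<tau> assume "\<tau> \<in> {0..?s}"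
      then have \<tau>: "\<tau> \<in> {0..T}" using sub by auto
      have "norm (g z \<tau> - g w \<tau>) \<le> C * norm (exp (2 * C * \<tau>) *\<^sub>R (apply_bcontfun z \<tau> - apply_bcontfun w \<tau>))"
        unfolding g_def scaleR_diff_right by (rule lip[OF \<tau>])
      also have "\<dots> \<le> C * (exp (2 * C * \<tau>) * ?d)"
        using C dist_bounded[of z \<tau> w] by (simp add: dist_norm mult_left_mono)
      finally show "norm (g z \<tau> - g w \<tau>) \<le> C * exp (2 * C * \<tau>) * ?d" by (simp add: mult.assoc)
    qed
    also have "\<dots> = ?d / 2 * exp (2 * C * ?s) - ?d / 2 * exp (2 * C * 0)" using hi by (rule integral_unique)
    also have "\<dots> \<le> ?d / 2 * exp (2 * C * ?s)" by simp
    finally have *: "norm (integral {0..?s} (g z) - integral {0..?s} (g w)) \<le> ?d / 2 * exp (2 * C * ?s)" .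
    have "dist (P z ?s) (P w ?s) = exp (- (2 * C * ?s)) * norm (integral {0..?s} (g z) - integral {0..?s} (g w))"
      unfolding P_def dist_norm by (simp flip: scaleR_diff_right)
    also have "\<dots> \<le> exp (- (2 * C * ?s)) * (?d / 2 * exp (2 * C * ?s))" by (rule mult_left_mono[OF *]) simp
    also have "\<dots> = 1 / 2 * ?d" by (simp add: exp_minus)
    finally show "dist (apply_bcontfun (\<Phi> z) t) (apply_bcontfun (\<Phi> w) t) \<le> 1 / 2 * dist z w" by (simp add: \<Phi>)
  qed
  have "\<exists>!z. \<Phi> z = z" by (rule banach_fix_type[of "1/2"]) (use contr in auto)
  then obtain z where z: "\<Phi> z = z" by blast
  define y where "y t = exp (2 * C * t) *\<^sub>R apply_bcontfun z t" for t
  have y: "y t = y0 + integral {0..t} (g z)" if "t \<in> {0..T}" for t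
  proof -
    have "y t = exp (2 * C * t) *\<^sub>R P z t" using \<Phi>[of z t] z cid[OF that] by (simp add: y_def)
    then show ?thesis by (simp add: P_def flip: exp_add)
  qed
  have gy: "g z t = f t (y t)" for t by (simp add: g_def y_def)
  show ?thesis
  proof (intro exI[of _ y] conjI ballI)
    show "y 0 = y0" using y[of 0] T by simp
    fix t assume t: "t \<in> {0..T}"
    have "((\<lambda>t. y0 + integral {0..t} (g z)) has_vector_derivative 0 + g z t) (at t within {0..T})"
      by (intro derivative_intros integral_has_vector_derivative gc t)
    then have "((\<lambda>t. y0 + integral {0..t} (g z)) has_vector_derivative f t (y t)) (at t within {0..T})" by (simp add: gy)
    then show "(y has_vector_derivative f t (y t)) (at t within {0..T})"
      by (rule has_vector_derivative_transform[OF t, rotated]) (use y in auto)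
  qed
qed

section \<open>Phase multipliers\<close>

definition phase :: "(real \<Rightarrow> real) \<Rightarrow> real \<Rightarrow> real \<Rightarrow> complex" where "phase \<phi> t k = cis (\<phi> k * t)"

lemma phase_measurable [measurable]:
  assumes [measurable]: "\<phi> \<in> borel_measurable borel"
  shows "phase \<phi> t \<in> borel_measurable borel"
  unfolding phase_def[abs_def] by measurable

lemma cmod_phase [simp]: "cmod (phase \<phi> t k) = 1" by (simp add: phase_def)

lemma bdd_mult_phase: "\<phi> \<in> borel_measurable borel \<Longrightarrow> bdd_mult (phase \<phi> t)" by (rule bmI[where C = 1]) auto

lemma norm_mul_phase: assumes "\<phi> \<in> borel_measurable borel" shows "norm (mul (phase \<phi> t) u) = norm u"
proof -
  have "norm (mul (phase \<phi> t) u) \<le> 1 * norm u" by (rule norm_mul_le) (use assms in auto)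
  moreover have "u = mul (phase (\<lambda>k. - \<phi> k) t) (mul (phase \<phi> t) u)"
    using assms by (simp add: mul_mul bdd_mult_phase) (simp add: phase_def cis_mult mul_one)
  then have "norm u \<le> 1 * norm (mul (phase \<phi> t) u)" using norm_mul_le[of "phase (\<lambda>k. - \<phi> k) t" 1 "mul (phase \<phi> t) u"] assms by simp
  ultimately show ?thesis by simp
qed

lemma tendsto_operator_family:
  fixes A :: "'b \<Rightarrow> 'a::real_normed_vector \<Rightarrow> 'c::real_normed_vector"
  assumes lin: "\<forall>\<^sub>F s in Fi. linear (A s)" and bd: "\<forall>\<^sub>F s in Fi. \<forall>u. norm (A s u) \<le> C * norm u"
    and lim: "((\<lambda>s. A s x) \<longlongrightarrow> l) Fi" and x: "(u \<longlongrightarrow> x) Fi"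
  shows "((\<lambda>s. A s (u s)) \<longlongrightarrow> l) Fi"
proof -
  have "((\<lambda>s. A s (u s - x)) \<longlongrightarrow> 0) Fi"
  proof (rule tendsto_norm_zero_cancel, rule tendsto_sandwich[OF _ _ tendsto_const])
    show "((\<lambda>s. C * norm (u s - x)) \<longlongrightarrow> 0) Fi"
      using tendsto_mult_right_zero[OF tendsto_norm_zero[OF LIM_zero[OF x]]] .
    show "\<forall>\<^sub>F s in Fi. norm (A s (u s - x)) \<le> C * norm (u s - x)" using bd by eventually_elim simp
  qed auto
  from tendsto_add[OF lim this] have "((\<lambda>s. A s x + A s (u s - x)) \<longlongrightarrow> l) Fi" by simp
  then show ?thesis
    by (rule Lim_transform_eventually) (use lin in \<open>eventually_elim, simp add: linear_diff\<close>)
qed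

text \<open>The product rule for strongly continuous families: \<open>A s\<close> is differentiated
  only along the fixed vector \<open>x t\<close>, and the uniform bound \<open>C\<close> controls it
  on the remainder of \<open>x\<close>.\<close>

lemma operator_family_derivative:
  fixes A :: "real \<Rightarrow> 'a::real_normed_vector \<Rightarrow> 'c::real_normed_vector"
  assumes lin: "\<And>s. linear (A s)" and bd: "\<And>s u. norm (A s u) \<le> C * norm u"
    and lim: "((\<lambda>s. A s x') \<longlongrightarrow> A t x') (at t within S)"
    and d: "((\<lambda>s. A s (x t)) has_vector_derivative D) (at t within S)"
    and x: "(x has_vector_derivative x') (at t within S)"
  shows "((\<lambda>s. A s (x s)) has_vector_derivative A t x' + D) (at t within S)"
proof -
  let ?q = "\<lambda>s. (1 / norm (s - t)) *\<^sub>R (x s - (x t + (s - t) *\<^sub>R x'))"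
  have q: "(?q \<longlongrightarrow> 0) (at t within S)"
    using x unfolding has_vector_derivative_def has_derivative_within by simp
  have Aq: "((\<lambda>s. A s (?q s)) \<longlongrightarrow> 0) (at t within S)"
    by (rule tendsto_operator_family[OF _ _ _ q, where C = C]) (use lin bd in \<open>auto simp: linear_0\<close>)
  have D: "((\<lambda>s. (1 / norm (s - t)) *\<^sub>R (A s (x t) - (A t (x t) + (s - t) *\<^sub>R D))) \<longlongrightarrow> 0) (at t within S)"
    using d unfolding has_vector_derivative_def has_derivative_within by simp
  have 3: "((\<lambda>s. ((s - t) / norm (s - t)) *\<^sub>R (A s x' - A t x')) \<longlongrightarrow> 0) (at t within S)"
  proof (rule tendsto_norm_zero_cancel, rule tendsto_sandwich[OF _ _ tendsto_const])
    show "((\<lambda>s. norm (A s x' - A t x')) \<longlongrightarrow> 0) (at t within S)"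
      using tendsto_norm_zero[OF LIM_zero[OF lim]] .
    have "\<bar>s - t\<bar> / \<bar>s - t\<bar> * n \<le> n" if "n \<ge> 0" for s n :: real using that by (cases "s = t") auto
    then show "\<forall>\<^sub>F s in at t within S. norm (((s - t) / norm (s - t)) *\<^sub>R (A s x' - A t x')) \<le> norm (A s x' - A t x')"
      by (intro always_eventually allI) (simp add: abs_divide)
  qed auto
  have "((\<lambda>s. A s (?q s) + (1 / norm (s - t)) *\<^sub>R (A s (x t) - (A t (x t) + (s - t) *\<^sub>R D)) + ((s - t) / norm (s - t)) *\<^sub>R (A s x' - A t x')) \<longlongrightarrow> 0 + 0 + 0) (at t within S)"
    by (intro tendsto_add Aq D 3)
  moreover have "A s (?q s) + (1 / norm (s - t)) *\<^sub>R (A s (x t) - (A t (x t) + (s - t) *\<^sub>R D)) + ((s - t) / norm (s - t)) *\<^sub>R (A s x' - A t x')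
     = (1 / norm (s - t)) *\<^sub>R (A s (x s) - (A t (x t) + (s - t) *\<^sub>R (A t x' + D)))" for s
  proof -
    have id: "a *\<^sub>R (P - (Q + d *\<^sub>R R)) + a *\<^sub>R (Q - (P' + d *\<^sub>R D)) + (a * d) *\<^sub>R (R - R') = a *\<^sub>R (P - (P' + d *\<^sub>R (R' + D)))"
      for a d and P P' Q R R' :: 'c by (simp add: algebra_simps)
    have "(s - t) / norm (s - t) = 1 / norm (s - t) * (s - t)" by simp
    then show ?thesis
      unfolding linear_scale[OF lin] linear_diff[OF lin] linear_add[OF lin] by (simp only: id)
  qed
  ultimately show ?thesis
    unfolding has_vector_derivative_def has_derivative_within
    by (auto intro: bounded_linear_scaleR_left)
qed

lemma cis_diff_le: "cmod (cis a - cis b) \<le> \<bar>a - b\<bar>"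
proof -
  have "cis a - cis b = cis b * (cis (a - b) - 1)" by (simp add: cis_mult algebra_simps)
  then have "cmod (cis a - cis b) = cmod (cis (a - b) - 1)" by (simp add: norm_mult)
  also have "\<dots> \<le> \<bar>a - b\<bar>" using iexp_approx1[of "a - b" 0] by (simp add: cis_conv_exp)
  finally show ?thesis .
qed

lemma mul_phase_tendsto:
  assumes [measurable]: "m \<in> borel_measurable borel" "\<phi> \<in> borel_measurable borel" and C: "\<And>k. cmod (m k) \<le> C"
  shows "((\<lambda>s. mul (\<lambda>k. m k * phase \<phi> s k) u) \<longlongrightarrow> mul (\<lambda>k. m k * phase \<phi> t k) u) (at t within S)"
proof (rule mul_tendsto_at[where C = C])
  show "((\<lambda>s. m k * phase \<phi> s k) \<longlongrightarrow> m k * phase \<phi> t k) (at t within S)" for k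
    unfolding phase_def by (intro tendsto_intros)
qed (use C in \<open>auto simp: norm_mult\<close>)

text \<open>The second bound says that \<open>m\<close> absorbs the factor \<open>\<phi>\<close>
  which differentiation produces. It dominates the difference quotients, because \<open>cis\<close>
  has Lipschitz constant 1.\<close>

lemma mul_phase_derivative:
  assumes [measurable]: "m \<in> borel_measurable borel" "\<phi> \<in> borel_measurable borel"
    and C: "\<And>k. cmod (m k) \<le> C" "\<And>k. cmod (m k) * \<bar>\<phi> k\<bar> \<le> C"
  shows "((\<lambda>s. mul (\<lambda>k. m k * phase \<phi> s k) u) has_vector_derivative mul (\<lambda>k. m k * (\<i> * of_real (\<phi> k)) * phase \<phi> t k) u) (at t within S)"
proof -
  let ?D = "\<lambda>k. m k * (\<i> * of_real (\<phi> k)) * phase \<phi> t k"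
  let ?q = "\<lambda>s k. of_real (1 / norm (s - t)) * (m k * phase \<phi> s k + of_real (-1) * (m k * phase \<phi> t k) + of_real (t - s) * ?D k)"
  have bdd_mult: "bdd_mult (\<lambda>k. m k * phase \<phi> s k)" "bdd_mult ?D" for s
    using C by (auto intro!: bmI[where C = C] simp: norm_mult)
  have eq: "(1 / norm (s - t)) *\<^sub>R (mul (\<lambda>k. m k * phase \<phi> s k) u - (mul (\<lambda>k. m k * phase \<phi> t k) u + (s - t) *\<^sub>R mul ?D u)) = mul (?q s) u" for s
  proof -
    have "mul (?q s) u = (1 / norm (s - t)) *\<^sub>R (mul (\<lambda>k. m k * phase \<phi> s k) u + (-1) *\<^sub>R mul (\<lambda>k. m k * phase \<phi> t k) u + (t - s) *\<^sub>R mul ?D u)"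
      by (simp only: mul_scale_left mul_add_left bdd_mult bdd_mult_add bdd_mult_mult bdd_mult_const)
    then show ?thesis by (simp add: algebra_simps)
  qed
  have "((\<lambda>s. mul (?q s) u) \<longlongrightarrow> mul (\<lambda>_. 0) u) (at t within S)"
  proof (rule mul_tendsto_at[where C = "2 * C"])
    fix s k
    have "cmod (phase \<phi> s k - phase \<phi> t k + of_real (t - s) * (\<i> * of_real (\<phi> k) * phase \<phi> t k)) \<le> 2 * (\<bar>\<phi> k\<bar> * \<bar>s - t\<bar>)"
    proof -
      have "cmod (phase \<phi> s k - phase \<phi> t k) \<le> \<bar>\<phi> k\<bar> * \<bar>s - t\<bar>"
        unfolding phase_def using cis_diff_le[of "\<phi> k * s" "\<phi> k * t"] by (simp add: abs_mult flip: right_diff_distrib)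
      moreover have "cmod (of_real (t - s) * (\<i> * of_real (\<phi> k) * phase \<phi> t k)) = \<bar>\<phi> k\<bar> * \<bar>s - t\<bar>"
        by (simp add: norm_mult abs_minus_commute del: of_real_diff)
      ultimately show ?thesis using norm_triangle_ineq[of "phase \<phi> s k - phase \<phi> t k" "of_real (t - s) * (\<i> * of_real (\<phi> k) * phase \<phi> t k)"] by linarith
    qed
    then have "1 / norm (s - t) * (cmod (m k) * cmod (phase \<phi> s k - phase \<phi> t k + of_real (t - s) * (\<i> * of_real (\<phi> k) * phase \<phi> t k))) \<le> 1 / norm (s - t) * (cmod (m k) * (2 * (\<bar>\<phi> k\<bar> * \<bar>s - t\<bar>)))"
      by (intro mult_left_mono) auto
    also have "\<dots> \<le> 2 * (cmod (m k) * \<bar>\<phi> k\<bar>)" by (cases "s = t") auto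
    also have "\<dots> \<le> 2 * C" using C(2) by simp
    also have "1 / norm (s - t) * (cmod (m k) * cmod (phase \<phi> s k - phase \<phi> t k + of_real (t - s) * (\<i> * of_real (\<phi> k) * phase \<phi> t k))) = cmod (?q s k)"
    proof -
      have "?q s k = of_real (1 / norm (s - t)) * (m k * (phase \<phi> s k - phase \<phi> t k + of_real (t - s) * (\<i> * of_real (\<phi> k) * phase \<phi> t k)))"
        by (simp add: algebra_simps)
      then show ?thesis by (simp only: norm_mult norm_of_real) simp
    qed
    finally show "cmod (?q s k) \<le> 2 * C" .
  next
    fix k
    have "((\<lambda>s. m k * phase \<phi> s k) has_vector_derivative ?D k) (at t within S)"
    proof -
      have "((\<lambda>s. phase \<phi> s k) has_vector_derivative \<i> * of_real (\<phi> k) * phase \<phi> t k) (at t within S)"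
        unfolding has_vector_derivative_complex_iff phase_def by (auto intro!: derivative_eq_intros)
      from has_vector_derivative_mult_right[OF this, of "m k"] show ?thesis by (simp add: mult.assoc)
    qed
    then have "((\<lambda>s. (1 / norm (s - t)) *\<^sub>R (m k * phase \<phi> s k - (m k * phase \<phi> t k + (s - t) *\<^sub>R ?D k))) \<longlongrightarrow> 0) (at t within S)"
      unfolding has_vector_derivative_def has_derivative_within by simp
    moreover have "(1 / norm (s - t)) *\<^sub>R (m k * phase \<phi> s k - (m k * phase \<phi> t k + (s - t) *\<^sub>R ?D k)) = ?q s k" for s
      by (simp add: scaleR_conv_of_real algebra_simps)
    ultimately show "((\<lambda>s. ?q s k) \<longlongrightarrow> 0) (at t within S)" by simp
  qed measurable
  moreover have "mul (\<lambda>_. 0) u = 0" by (simp add: mul_def zero_l2_def)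
  ultimately show ?thesis
    unfolding has_vector_derivative_def has_derivative_within eq
    by (auto intro: bounded_linear_scaleR_left)
qed

section \<open>The semilinear system\<close>

text \<open>The odd root of the dispersion relation \<omega>^2 = k^2 + k^4 of the linear Boussinesq
  equation. Oddness makes the propagator preserve real functions.\<close>

definition dispersion :: "real \<Rightarrow> real" where "dispersion k = k * bracket 1 k"

lemma dispersion_measurable [measurable]: "dispersion \<in> borel_measurable borel"
  unfolding dispersion_def[abs_def] by measurable

abbreviation propagator :: "real \<Rightarrow> l2 \<Rightarrow> l2" where "propagator t \<equiv> mul (phase dispersion t)"
abbreviation back_propagator :: "real \<Rightarrow> l2 \<Rightarrow> l2" where "back_propagator t \<equiv> mul (phase (\<lambda>k. - dispersion k) t)"

lemma bdd_mult_propagator: "bdd_mult (phase dispersion t)" "bdd_mult (phase (\<lambda>k. - dispersion k) t)" by (auto intro!: bdd_mult_phase)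

lemma norm_propagator: "norm (propagator t u) = norm u" "norm (back_propagator t u) = norm u" by (auto intro!: norm_mul_phase)

lemma propagator_back_propagator: "propagator t (back_propagator t u) = u" "back_propagator t (propagator t u) = u"
  by (simp_all add: mul_mul bdd_mult_propagator) (simp_all add: phase_def cis_mult mul_one)

lemma inner_propagator: "inner u (back_propagator t v) = inner (propagator t u) v" "inner u (propagator t v) = inner (back_propagator t u) v"
  by (simp_all add: inner_mul bdd_mult_propagator) (simp_all add: phase_def[abs_def] cis_cnj)

lemma herm_propagator: "herm (propagator t u) = propagator t (herm u)" "herm (back_propagator t u) = back_propagator t (herm u)"
  by (simp_all add: herm_mul bdd_mult_propagator) (simp_all add: phase_def[abs_def] cis_cnj dispersion_def)

lemma continuous_phase:
  assumes [measurable]: "\<phi> \<in> borel_measurable borel" and x: "continuous_on S x"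
  shows "continuous_on S (\<lambda>t. mul (phase \<phi> t) (x t))"
  unfolding continuous_on_def
proof
  fix t assume t: "t \<in> S"
  show "((\<lambda>t. mul (phase \<phi> t) (x t)) \<longlongrightarrow> mul (phase \<phi> t) (x t)) (at t within S)"
  proof (rule tendsto_operator_family[where A = "\<lambda>s. mul (phase \<phi> s)" and u = x and x = "x t" and C = 1])
    show "((\<lambda>s. mul (phase \<phi> s) (x t)) \<longlongrightarrow> mul (phase \<phi> t) (x t)) (at t within S)"
      using mul_phase_tendsto[of "\<lambda>_. 1" \<phi> 1 "x t" t S] by simp
    show "(x \<longlongrightarrow> x t) (at t within S)" using x t by (simp add: continuous_on_def)
  qed (auto intro!: always_eventually bounded_linear.linear bounded_linear_mul bdd_mult_phase simp: norm_mul_phase)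
qed

lemma phase_derivative:
  assumes m [measurable]: "m \<in> borel_measurable borel" and p [measurable]: "\<phi> \<in> borel_measurable borel"
    and C: "\<And>k. cmod (m k) \<le> C" "\<And>k. cmod (m k) * \<bar>\<phi> k\<bar> \<le> C"
    and x: "(x has_vector_derivative x') (at t within S)"
  shows "((\<lambda>s. mul m (mul (phase \<phi> s) (x s))) has_vector_derivative
     mul m (mul (phase \<phi> t) x') + mul (\<lambda>k. m k * (\<i> * of_real (\<phi> k))) (mul (phase \<phi> t) (x t))) (at t within S)"
proof -
  have b: "bdd_mult m" "bdd_mult (\<lambda>k. m k * (\<i> * of_real (\<phi> k)))" "bdd_mult (phase \<phi> s)" for s
    using C by (auto intro!: bmI[where C = C] bdd_mult_phase simp: norm_mult)
  have b2: "bdd_mult (\<lambda>k. m k * phase \<phi> s k)" for s by (intro bdd_mult_mult b)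
  have eq: "mul m (mul (phase \<phi> s) u) = mul (\<lambda>k. m k * phase \<phi> s k) u" for s u by (simp add: mul_mul b)
  have eq2: "mul (\<lambda>k. m k * (\<i> * of_real (\<phi> k))) (mul (phase \<phi> t) (x t)) = mul (\<lambda>k. m k * (\<i> * of_real (\<phi> k)) * phase \<phi> t k) (x t)"
    by (simp only: mul_mul b)
  show ?thesis
    unfolding eq eq2
  proof (rule operator_family_derivative[where A = "\<lambda>s. mul (\<lambda>k. m k * phase \<phi> s k)" and C = C])
    show "linear (mul (\<lambda>k. m k * phase \<phi> s k))" for s by (intro bounded_linear.linear bounded_linear_mul b2)
    show "norm (mul (\<lambda>k. m k * phase \<phi> s k) u) \<le> C * norm u" for s u by (rule norm_mul_le) (auto simp: norm_mult C)
    show "((\<lambda>s. mul (\<lambda>k. m k * phase \<phi> s k) x') \<longlongrightarrow> mul (\<lambda>k. m k * phase \<phi> t k) x') (at t within S)"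
      by (rule mul_phase_tendsto[OF m p C(1)])
    show "((\<lambda>s. mul (\<lambda>k. m k * phase \<phi> s k) (x t)) has_vector_derivative mul (\<lambda>k. m k * (\<i> * of_real (\<phi> k)) * phase \<phi> t k) (x t)) (at t within S)"
      by (rule mul_phase_derivative[OF m p C])
  qed (rule x)
qed

text \<open>In the weighted unknowns the generator has the symbol i k (1 + k^2)^(1/2), unbounded of
  order two; smoothing by two orders makes it the bounded \<open>riesz\<close>. This is why the
  evolution equations are stated for \<open>mul (bessel (-2))\<close> of the unknowns.\<close>

lemma bessel_dispersion: "bessel (-2) k * (\<i> * of_real (dispersion k)) = riesz k"
proof -
  have "bracket (-2) k * bracket 1 k = bracket (-1) k" by (simp add: bracket_mult)
  then have "bessel (-2) k * of_real (bracket 1 k) = of_real (bracket (-1) k)" by (simp add: bessel_def flip: of_real_mult)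
  then show ?thesis by (simp add: riesz_def dispersion_def mult.left_commute)
qed

lemma bessel_dispersion_le: "cmod (bessel (-2) k) * \<bar>dispersion k\<bar> \<le> 1"
proof -
  have "cmod (bessel (-2) k) * \<bar>dispersion k\<bar> = cmod (bessel (-2) k * (\<i> * of_real (dispersion k)))" by (simp add: norm_mult)
  then show ?thesis unfolding bessel_dispersion using cmod_riesz_le[of k] by simp
qed

lemma mul_uminus: "bdd_mult m \<Longrightarrow> mul (\<lambda>k. - m k) u = - mul m u"
  using mul_scale_left[of m "-1" u] by simp

lemma bounded_linear_diff': "bounded_linear f \<Longrightarrow> f (u - v) = f u - f v"
  by (rule linear_diff[OF bounded_linear.linear])
lemma bounded_linear_add': "bounded_linear f \<Longrightarrow> f (u + v) = f u + f v"
  by (rule linear_add[OF bounded_linear.linear])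
lemma bounded_linear_scale': "bounded_linear f \<Longrightarrow> f (c *\<^sub>R u) = c *\<^sub>R f u"
  by (rule linear_scale[OF bounded_linear.linear])
lemma bounded_linear_minus': "bounded_linear f \<Longrightarrow> f (- u) = - f u"
  by (rule linear_neg[OF bounded_linear.linear])
lemmas bl_simps = bounded_linear_diff' bounded_linear_add' bounded_linear_scale' bounded_linear_minus'

text \<open>The combinations r + p and r - p diagonalize the linear part. Undoing their free
  evolutions leads to the pair (a, b) with a Lipschitz right-hand side. Since a and b are
  differentiable without smoothing, the energy identity can be derived from them although r and p
  are differentiable only after smoothing.\<close>

lemma mild_solution:
  fixes N :: "real \<Rightarrow> l2 \<Rightarrow> l2"
  assumes T: "T > 0" and C: "C > 0"
    and lip: "\<And>t u v. t \<in> {0..T} \<Longrightarrow> norm (N t u - N t v) \<le> C * norm (u - v)"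
    and cont: "\<And>y. continuous_on {0..T} y \<Longrightarrow> continuous_on {0..T} (\<lambda>t. N t (y t))"
    and sgN: "\<And>t u. t \<in> {0..T} \<Longrightarrow> N t (herm u) = herm (N t u)"
  obtains r p where "r 0 = 0" "p 0 = 0" "continuous_on {0..T} r" "continuous_on {0..T} p"
    "\<And>t. t \<in> {0..T} \<Longrightarrow> ((\<lambda>t. mul (bessel (-2)) (r t)) has_vector_derivative mul riesz (p t)) (at t within {0..T})"
    "\<And>t. t \<in> {0..T} \<Longrightarrow> ((\<lambda>t. mul (bessel (-2)) (p t)) has_vector_derivative mul riesz (r t) + mul (bessel (-2)) (N t (r t))) (at t within {0..T})"
    "\<And>t. t \<in> {0..T} \<Longrightarrow> ((\<lambda>t. (norm (r t))\<^sup>2 + (norm (p t))\<^sup>2) has_real_derivative 2 * inner (p t) (N t (r t))) (at t within {0..T})"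
    "\<And>t. t \<in> {0..T} \<Longrightarrow> herm (r t) = r t" "\<And>t. t \<in> {0..T} \<Longrightarrow> herm (p t) = p t"
proof -
  \<comment> \<open>Recovers r from the pair (a, b).\<close>
  define R where "R t z = (1 / 2) *\<^sub>R (propagator t (fst z) + back_propagator t (snd z))" for t and z :: "l2 \<times> l2"
  define f where "f t z = (back_propagator t (N t (R t z)), - propagator t (N t (R t z)))" for t z
  have lin: "propagator t (u - v) = propagator t u - propagator t v" "back_propagator t (u - v) = back_propagator t u - back_propagator t v" for t u v
    by (simp_all add: bl_simps bounded_linear_mul bdd_mult_propagator)
  have R_lip: "norm (R t z - R t w) \<le> norm (z - w)" for t z w
  proof -
    have "R t z - R t w = (1 / 2) *\<^sub>R (propagator t (fst (z - w)) + back_propagator t (snd (z - w)))"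
      by (simp add: R_def lin algebra_simps)
    then have "norm (R t z - R t w) \<le> 1 / 2 * (norm (fst (z - w)) + norm (snd (z - w)))"
      using norm_triangle_ineq[of "propagator t (fst (z - w))" "back_propagator t (snd (z - w))"] by (simp add: norm_propagator)
    also have "\<dots> \<le> 1 / 2 * (norm (z - w) + norm (z - w))"
    proof (intro mult_left_mono add_mono)
      show "norm (fst (z - w)) \<le> norm (z - w)" "norm (snd (z - w)) \<le> norm (z - w)"
        by (metis norm_fst_le norm_snd_le prod.collapse)+
    qed simp
    finally show ?thesis by simp
  qed
  have f_lip: "norm (f t z - f t w) \<le> 2 * C * norm (z - w)" if t: "t \<in> {0..T}" for t z w
  proof -
    have "norm (f t z - f t w) \<le> norm (back_propagator t (N t (R t z) - N t (R t w))) + norm (- propagator t (N t (R t z) - N t (R t w)))"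
      unfolding f_def lin using norm_Pair_le[of "back_propagator t (N t (R t z)) - back_propagator t (N t (R t w))" "- (propagator t (N t (R t z)) - propagator t (N t (R t w)))"] by simp
    also have "\<dots> = 2 * norm (N t (R t z) - N t (R t w))" by (simp add: norm_propagator)
    also have "\<dots> \<le> 2 * (C * norm (R t z - R t w))" using lip[OF t] by simp
    also have "\<dots> \<le> 2 * (C * norm (z - w))" using R_lip C by (intro mult_left_mono) auto
    finally show ?thesis by simp
  qed
  have R_cont: "continuous_on {0..T} (\<lambda>t. R t (y t))" if "continuous_on {0..T} y" for y
    unfolding R_def by (intro continuous_intros continuous_phase that borel_measurable_uminus dispersion_measurable)
  have f_cont: "continuous_on {0..T} (\<lambda>t. f t (y t))" if "continuous_on {0..T} y" for y
    unfolding f_def by (intro continuous_intros continuous_phase cont R_cont that borel_measurable_uminus dispersion_measurable)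
  obtain y where y0: "y 0 = 0" and y: "\<And>t. t \<in> {0..T} \<Longrightarrow> (y has_vector_derivative f t (y t)) (at t within {0..T})"
    using picard_lindelof[of T "2 * C" f 0, OF T _ f_lip f_cont] C by auto
  have yc: "continuous_on {0..T} y"
    unfolding continuous_on_eq_continuous_within using has_vector_derivative_continuous[OF y] by blast
  define a where "a t = fst (y t)" for t
  define b where "b t = snd (y t)" for t
  define r where "r t = R t (y t)" for t
  define p where "p t = (1 / 2) *\<^sub>R (propagator t (a t) - back_propagator t (b t))" for t
  have r: "r t = (1 / 2) *\<^sub>R (propagator t (a t) + back_propagator t (b t))" for t by (simp add: r_def R_def a_def b_def)
  have a: "(a has_vector_derivative back_propagator t (N t (r t))) (at t within {0..T})" if "t \<in> {0..T}" for t
    using bounded_linear.has_vector_derivative[OF bounded_linear_fst y[OF that]] by (simp add: a_def[abs_def] f_def r_def)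
  have b: "(b has_vector_derivative - propagator t (N t (r t))) (at t within {0..T})" if "t \<in> {0..T}" for t
    using bounded_linear.has_vector_derivative[OF bounded_linear_snd y[OF that]] by (simp add: b_def[abs_def] f_def r_def)
  have ac: "continuous_on {0..T} a" "continuous_on {0..T} b" unfolding a_def b_def by (intro continuous_intros yc)+
  have rp: "r t + p t = propagator t (a t)" "r t - p t = back_propagator t (b t)" for t
    by (simp_all add: r p_def algebra_simps flip: scaleR_add_left)
  have bJ: "bdd_mult (bessel (-2))" by (rule bdd_mult_bessel) simp
  have XOm: "(\<lambda>k. bessel (-2) k * (\<i> * of_real (dispersion k))) = riesz" "(\<lambda>k. bessel (-2) k * (\<i> * of_real (- dispersion k))) = (\<lambda>k. - riesz k)"
    by (auto simp: bessel_dispersion fun_eq_iff simp flip: bessel_dispersion)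
  note blin = bounded_linear_mul[OF bJ] bounded_linear_mul[OF bdd_mult_riesz] bounded_linear_mul[OF bdd_mult_propagator(1)] bounded_linear_mul[OF bdd_mult_propagator(2)]
  have dE: "((\<lambda>t. mul (bessel (-2)) (propagator t (a t))) has_vector_derivative mul (bessel (-2)) (N t (r t)) + mul riesz (propagator t (a t))) (at t within {0..T})" if "t \<in> {0..T}" for t
  proof -
    have "((\<lambda>t. mul (bessel (-2)) (propagator t (a t))) has_vector_derivative mul (bessel (-2)) (propagator t (back_propagator t (N t (r t)))) + mul (\<lambda>k. bessel (-2) k * (\<i> * of_real (dispersion k))) (propagator t (a t))) (at t within {0..T})"
      by (rule phase_derivative[OF _ _ _ _ a[OF that], where C = 1]) (auto intro: bessel_dispersion_le[simplified] bracket_le_1)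
    then show ?thesis unfolding propagator_back_propagator XOm .
  qed
  have dM: "((\<lambda>t. mul (bessel (-2)) (back_propagator t (b t))) has_vector_derivative - mul (bessel (-2)) (N t (r t)) - mul riesz (back_propagator t (b t))) (at t within {0..T})" if "t \<in> {0..T}" for t
  proof -
    have "((\<lambda>t. mul (bessel (-2)) (back_propagator t (b t))) has_vector_derivative mul (bessel (-2)) (back_propagator t (- propagator t (N t (r t)))) + mul (\<lambda>k. bessel (-2) k * (\<i> * of_real (- dispersion k))) (back_propagator t (b t))) (at t within {0..T})"
      by (rule phase_derivative[OF _ _ _ _ b[OF that], where C = 1]) (auto intro: bessel_dispersion_le[simplified] bracket_le_1)
    then show ?thesis unfolding XOm mul_uminus[OF bdd_mult_riesz] by (simp add: bl_simps blin propagator_back_propagator)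
  qed
  show ?thesis
  proof (rule that[of r p])
    show "r 0 = 0" "p 0 = 0" using y0 by (simp_all add: r p_def a_def b_def bounded_linear.linear linear_0 blin)
    show "continuous_on {0..T} r" unfolding r_def by (rule R_cont[OF yc])
    show "continuous_on {0..T} p"
      unfolding p_def by (intro continuous_intros continuous_phase ac borel_measurable_uminus dispersion_measurable)
    fix t assume t: "t \<in> {0..T}"
    have "((\<lambda>t. (1 / 2) *\<^sub>R (mul (bessel (-2)) (propagator t (a t)) + mul (bessel (-2)) (back_propagator t (b t)))) has_vector_derivative
       (1 / 2) *\<^sub>R (mul (bessel (-2)) (N t (r t)) + mul riesz (propagator t (a t)) + (- mul (bessel (-2)) (N t (r t)) - mul riesz (back_propagator t (b t))))) (at t within {0..T})"
      by (intro bounded_linear.has_vector_derivative[OF bounded_linear_scaleR_right] derivative_intros dE dM t)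
    then show "((\<lambda>t. mul (bessel (-2)) (r t)) has_vector_derivative mul riesz (p t)) (at t within {0..T})"
      by (simp add: r p_def bl_simps blin)
    have "((\<lambda>t. (1 / 2) *\<^sub>R (mul (bessel (-2)) (propagator t (a t)) - mul (bessel (-2)) (back_propagator t (b t)))) has_vector_derivative
       (1 / 2) *\<^sub>R (mul (bessel (-2)) (N t (r t)) + mul riesz (propagator t (a t)) - (- mul (bessel (-2)) (N t (r t)) - mul riesz (back_propagator t (b t))))) (at t within {0..T})"
      by (intro bounded_linear.has_vector_derivative[OF bounded_linear_scaleR_right] derivative_intros dE dM t)
    moreover have "(1 / 2) *\<^sub>R (mul (bessel (-2)) (N t (r t)) + mul riesz (propagator t (a t)) - (- mul (bessel (-2)) (N t (r t)) - mul riesz (back_propagator t (b t))))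
       = mul riesz (r t) + mul (bessel (-2)) (N t (r t))"
      unfolding r[of t] by (simp add: bl_simps blin algebra_simps flip: scaleR_add_left)
    ultimately show "((\<lambda>t. mul (bessel (-2)) (p t)) has_vector_derivative mul riesz (r t) + mul (bessel (-2)) (N t (r t))) (at t within {0..T})"
      by (simp add: p_def bl_simps blin)
    \<comment> \<open>The parallelogram law, together with the isometry of the propagators,
      expresses the energy by the differentiable a and b.\<close>
    have nrp: "(norm (r t))\<^sup>2 + (norm (p t))\<^sup>2 = 1 / 2 * (inner (a t) (a t) + inner (b t) (b t))" for t
    proof -
      have "2 * ((norm (r t))\<^sup>2 + (norm (p t))\<^sup>2) = (norm (r t + p t))\<^sup>2 + (norm (r t - p t))\<^sup>2"
        by (simp add: power2_norm_eq_inner inner_add inner_diff algebra_simps inner_commute)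
      also have "\<dots> = inner (a t) (a t) + inner (b t) (b t)"
        unfolding rp norm_propagator by (simp add: power2_norm_eq_inner)
      finally show ?thesis by simp
    qed
    have "((\<lambda>t. 1 / 2 * (inner (a t) (a t) + inner (b t) (b t))) has_vector_derivative
      1 / 2 * ((inner (a t) (back_propagator t (N t (r t))) + inner (back_propagator t (N t (r t))) (a t)) + (inner (b t) (- propagator t (N t (r t))) + inner (- propagator t (N t (r t))) (b t)))) (at t within {0..T})"
      by (intro has_vector_derivative_mult_right has_vector_derivative_add
        bounded_bilinear.has_vector_derivative[OF bounded_bilinear_inner] a b t)
    moreover have "1 / 2 * ((inner (a t) (back_propagator t (N t (r t))) + inner (back_propagator t (N t (r t))) (a t)) + (inner (b t) (- propagator t (N t (r t))) + inner (- propagator t (N t (r t))) (b t))) = 2 * inner (p t) (N t (r t))"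
    proof -
      have "inner (a t) (back_propagator t (N t (r t))) = inner (r t + p t) (N t (r t))" "inner (b t) (propagator t (N t (r t))) = inner (r t - p t) (N t (r t))"
        unfolding inner_propagator rp by auto
      then show ?thesis by (simp add: inner_commute[of "back_propagator t _"] inner_commute[of "propagator t _"] inner_add_left inner_diff_left)
    qed
    ultimately show "((\<lambda>t. (norm (r t))\<^sup>2 + (norm (p t))\<^sup>2) has_real_derivative 2 * inner (p t) (N t (r t))) (at t within {0..T})"
      unfolding nrp has_real_derivative_iff_has_vector_derivative by simp
    \<comment> \<open>The symmetry of transforms of real functions, applied to both components; it
      commutes with the right-hand side, so that uniqueness applies to
      \<open>S (y t)\<close>.\<close>
    define S where "S z = (herm (fst z), herm (snd z))" for z :: "l2 \<times> l2"
    have bS: "bounded_linear S"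
      unfolding S_def by (intro bounded_linear_Pair bounded_linear_compose[OF bounded_linear_herm] bounded_linear_fst bounded_linear_snd)
    have RS: "R t (S z) = herm (R t z)" for t z by (simp add: R_def S_def herm_propagator bl_simps bounded_linear_herm)
    have fS: "f t (S z) = S (f t z)" if "t \<in> {0..T}" for t z
      unfolding f_def RS sgN[OF that] by (simp add: S_def herm_propagator bl_simps bounded_linear_herm)
    have "S (y t) = y t"
    proof (rule ode_unique[where T = T and C = "2 * C" and f = f])
      show "((\<lambda>t. S (y t)) has_vector_derivative f s (S (y s))) (at s within {0..T})" if "s \<in> {0..T}" for s
        unfolding fS[OF that] by (rule bounded_linear.has_vector_derivative[OF bS y[OF that]])
    qed (use y f_lip t y0 in \<open>auto simp: bS bounded_linear.linear linear_0\<close>)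
    then have ab: "herm (a t) = a t" "herm (b t) = b t" by (auto simp: S_def a_def b_def prod_eq_iff)
    then show "herm (r t) = r t" "herm (p t) = p t" by (simp_all add: r p_def bl_simps bounded_linear_herm herm_propagator)
  qed
qed

section \<open>The time derivative of the added quadratic form\<close>

lemma has_vector_derivative_quotient:
  assumes "(f has_vector_derivative D) (at t within S)"
  shows "((\<lambda>s. (1 / (s - t)) *\<^sub>R (f s - f t)) \<longlongrightarrow> D) (at t within S)"
proof -
  have q: "((\<lambda>s. (1 / norm (s - t)) *\<^sub>R (f s - (f t + (s - t) *\<^sub>R D))) \<longlongrightarrow> 0) (at t within S)"
    using assms unfolding has_vector_derivative_def has_derivative_within by simp
  have "((\<lambda>s. (1 / (s - t)) *\<^sub>R (f s - (f t + (s - t) *\<^sub>R D))) \<longlongrightarrow> 0) (at t within S)"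
    by (rule tendsto_norm_zero_cancel) (use tendsto_norm_zero[OF q] in \<open>simp add: abs_divide\<close>)
  from tendsto_add[OF this tendsto_const[of D]]
  have "((\<lambda>s. (1 / (s - t)) *\<^sub>R (f s - (f t + (s - t) *\<^sub>R D)) + D) \<longlongrightarrow> D) (at t within S)" by simp
  then show ?thesis
  proof (rule Lim_transform_eventually)
    show "\<forall>\<^sub>F s in at t within S. (1 / (s - t)) *\<^sub>R (f s - (f t + (s - t) *\<^sub>R D)) + D = (1 / (s - t)) *\<^sub>R (f s - f t)"
      unfolding eventually_at_filter
      by (intro always_eventually allI impI) (simp add: scaleR_diff_right scaleR_add_right)
  qed
qed

text \<open>The quadratic form is differentiable although \<open>r\<close> is not: symmetry puts every difference
  quotient of \<open>r\<close> into the slot that carries the smoothing operator \<open>mul (bessel (-2))\<close>.\<close>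

lemma quadratic_form_derivative:
  assumes s: "s \<ge> 0" and herm\<psi>: "\<And>t. t \<in> S \<Longrightarrow> herm (\<psi> t) = \<psi> t"
    and \<psi>: "(\<psi> has_vector_derivative \<psi>') (at t within S)"
    and r: "continuous_on S r" and t: "t \<in> S"
    and Jr: "((\<lambda>t. mul (bessel (-2)) (r t)) has_vector_derivative D) (at t within S)"
  shows "((\<lambda>t. inner (mul (bessel (-2)) (r t)) (wconv 1 (1 + s) 1 (\<psi> t) (r t))) has_real_derivative
    2 * inner D (wconv 1 (1 + s) 1 (\<psi> t) (r t)) + inner (mul (bessel (-2)) (r t)) (wconv 1 (1 + s) 1 \<psi>' (r t))) (at t within S)"
proof -
  let ?M = "\<lambda>t. wconv 1 (1 + s) 1 (\<psi> t)" and ?bessel = "mul (bessel (-2))"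
  have admissible: "admissible 1 (1 + s) 1" using s by (simp add: admissible_def)
  interpret M: bounded_bilinear "wconv 1 (1 + s) 1" by (rule bounded_bilinear_wconv[OF admissible])
  have bJ: "bounded_linear ?bessel" by (intro bounded_linear_mul bdd_mult_bessel) simp
  have sym: "inner (?bessel f) (?M u g) = inner (?bessel g) (?M u f)" if "u \<in> S" for f g u
    by (rule inner_wconv_symmetric[OF _ herm\<psi>[OF that]]) (use s in simp)
  have rl: "(r \<longlongrightarrow> r t) (at t within S)" using r t by (simp add: continuous_on_def)
  have \<psi>l: "(\<psi> \<longlongrightarrow> \<psi> t) (at t within S)" using has_vector_derivative_continuous[OF \<psi>] by (simp add: continuous_within)
  have "((\<lambda>u. inner ((1 / (u - t)) *\<^sub>R (?bessel (r u) - ?bessel (r t))) (?M u (r u))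
      + inner (?bessel (r t)) (wconv 1 (1 + s) 1 ((1 / (u - t)) *\<^sub>R (\<psi> u - \<psi> t)) (r u))
      + inner ((1 / (u - t)) *\<^sub>R (?bessel (r u) - ?bessel (r t))) (?M t (r t))) \<longlongrightarrow>
      inner D (?M t (r t)) + inner (?bessel (r t)) (wconv 1 (1 + s) 1 \<psi>' (r t)) + inner D (?M t (r t))) (at t within S)"
    by (intro tendsto_add tendsto_inner M.tendsto has_vector_derivative_quotient[OF Jr] has_vector_derivative_quotient[OF \<psi>] rl \<psi>l tendsto_const)
  moreover have "\<forall>\<^sub>F u in at t within S. inner ((1 / (u - t)) *\<^sub>R (?bessel (r u) - ?bessel (r t))) (?M u (r u))
      + inner (?bessel (r t)) (wconv 1 (1 + s) 1 ((1 / (u - t)) *\<^sub>R (\<psi> u - \<psi> t)) (r u))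
      + inner ((1 / (u - t)) *\<^sub>R (?bessel (r u) - ?bessel (r t))) (?M t (r t))
      = (inner (?bessel (r u)) (?M u (r u)) - inner (?bessel (r t)) (?M t (r t))) / (u - t)"
    unfolding eventually_at_filter
  proof (intro always_eventually allI impI)
    fix u
    \<comment> \<open>The increment of the right-hand \<open>r\<close> is moved to the left slot by
      the symmetry at time \<open>t\<close>; the form at time \<open>u\<close> takes only
      \<open>r u\<close> on its right.\<close>
    have "inner (?bessel (r u)) (?M u (r u)) - inner (?bessel (r t)) (?M t (r t)) =
      inner (?bessel (r u) - ?bessel (r t)) (?M u (r u)) + inner (?bessel (r t)) (wconv 1 (1 + s) 1 (\<psi> u - \<psi> t) (r u)) + inner (?bessel (r u) - ?bessel (r t)) (?M t (r t))"
      using sym[OF t, of "r t" "r u"] by (simp add: inner_diff_left inner_diff_right M.diff_left)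
    then show "inner ((1 / (u - t)) *\<^sub>R (?bessel (r u) - ?bessel (r t))) (?M u (r u))
      + inner (?bessel (r t)) (wconv 1 (1 + s) 1 ((1 / (u - t)) *\<^sub>R (\<psi> u - \<psi> t)) (r u))
      + inner ((1 / (u - t)) *\<^sub>R (?bessel (r u) - ?bessel (r t))) (?M t (r t))
      = (inner (?bessel (r u)) (?M u (r u)) - inner (?bessel (r t)) (?M t (r t))) / (u - t)"
      by (simp add: M.scaleR_left add_divide_distrib)
  qed
  ultimately have "((\<lambda>u. (inner (?bessel (r u)) (?M u (r u)) - inner (?bessel (r t)) (?M t (r t))) / (u - t)) \<longlongrightarrow>
      inner D (?M t (r t)) + inner (?bessel (r t)) (wconv 1 (1 + s) 1 \<psi>' (r t)) + inner D (?M t (r t))) (at t within S)"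
    by (rule Lim_transform_eventually)
  then show ?thesis unfolding has_field_derivative_iff by (simp add: algebra_simps)
qed

section \<open>The energy estimate for the truncated system\<close>

definition ball_retract :: "real \<Rightarrow> 'a::real_normed_vector \<Rightarrow> 'a" where
  "ball_retract d x = (if norm x \<le> d then x else (d / norm x) *\<^sub>R x)"

lemma norm_ball_retract_le: assumes "d \<ge> 0" shows "norm (ball_retract d x) \<le> d" "norm (ball_retract d x) \<le> norm x"
  using assms by (auto simp: ball_retract_def)

text \<open>The constant 2 is obtained from the triangle inequality alone: outside the ball one copy
  of the distance pays for changing the point and one for changing the scaling factor.\<close>

lemma ball_retract_lipschitz:
  assumes d: "d \<ge> 0"
  shows "norm (ball_retract d x - ball_retract d y) \<le> 2 * norm (x - y)"
proof -
  have one: "norm (x - ball_retract d y) \<le> 2 * norm (x - y)" if x: "norm x \<le> d" and y: "\<not> norm y \<le> d" for x y :: 'a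
  proof -
    have ny: "norm y > 0" using y d by linarith
    have "y - ball_retract d y = (1 - d / norm y) *\<^sub>R y" using y by (simp add: ball_retract_def algebra_simps)
    then have "norm (y - ball_retract d y) = \<bar>1 - d / norm y\<bar> * norm y" by simp
    also have "\<dots> = norm y - d"
    proof -
      have "0 \<le> 1 - d / norm y" using y ny by (simp add: divide_le_eq)
      then show ?thesis using ny by (simp add: algebra_simps)
    qed
    also have "\<dots> \<le> norm y - norm x" using x by simp
    also have "\<dots> \<le> norm (x - y)" by (metis norm_minus_commute norm_triangle_ineq2)
    finally show ?thesis using norm_triangle_ineq[of "x - y" "y - ball_retract d y"] by simp
  qed
  consider "norm x \<le> d" "norm y \<le> d" | "norm x \<le> d" "\<not> norm y \<le> d" | "\<not> norm x \<le> d" "norm y \<le> d"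
    | "\<not> norm x \<le> d" "\<not> norm y \<le> d" by blast
  then show ?thesis
  proof cases
    case 1 then show ?thesis by (simp add: ball_retract_def)
  next
    case 2 then show ?thesis using one[of x y] by (simp add: ball_retract_def)
  next
    case 3 then show ?thesis using one[of y x] by (simp add: ball_retract_def norm_minus_commute)
  next
    case 4
    then have n: "norm x > 0" "norm y > 0" using d by linarith+
    have "ball_retract d x - ball_retract d y = (d / norm x) *\<^sub>R (x - y) + (d / norm x - d / norm y) *\<^sub>R y"
      using 4 by (simp add: ball_retract_def algebra_simps)
    then have "norm (ball_retract d x - ball_retract d y) \<le> \<bar>d / norm x\<bar> * norm (x - y) + \<bar>d / norm x - d / norm y\<bar> * norm y"
      using norm_triangle_ineq[of "(d / norm x) *\<^sub>R (x - y)" "(d / norm x - d / norm y) *\<^sub>R y"] by simp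
    also have "\<bar>d / norm x - d / norm y\<bar> * norm y = \<bar>(d / norm x) * (norm y - norm x)\<bar>"
    proof -
      have "(d / norm x - d / norm y) * norm y = (d / norm x) * (norm y - norm x)" using n by (simp add: field_simps)
      then show ?thesis by (metis abs_mult abs_norm_cancel)
    qed
    also have "\<dots> = \<bar>d / norm x\<bar> * \<bar>norm y - norm x\<bar>" by (rule abs_mult)
    also have "\<bar>d / norm x\<bar> * norm (x - y) + \<bar>d / norm x\<bar> * \<bar>norm y - norm x\<bar> \<le> 1 * norm (x - y) + 1 * norm (x - y)"
    proof (intro add_mono mult_mono)
      show "\<bar>d / norm x\<bar> \<le> 1" "\<bar>d / norm x\<bar> \<le> 1" using 4 n d by (auto simp: divide_le_eq)
      show "\<bar>norm y - norm x\<bar> \<le> norm (x - y)" by (metis abs_minus_commute norm_triangle_ineq3)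
    qed auto
    finally show ?thesis by simp
  qed
qed

lemma norm_herm [simp]: "norm (herm u) = norm u" by (simp add: herm_def)

lemma herm_ball_retract: "herm (ball_retract d u) = ball_retract d (herm u)"
  by (simp add: ball_retract_def bl_simps bounded_linear_herm)

text \<open>The retraction makes the nonlinearity globally Lipschitz, so that solutions are global and no
  continuation argument is needed; it is inactive as long as the error stays below \<open>d\<close>.\<close>

definition nonlin :: "real \<Rightarrow> real \<Rightarrow> l2 \<Rightarrow> l2 \<Rightarrow> l2" where
  "nonlin s d \<psi> u = mul riesz (2 *\<^sub>R wconv (1 + s) (1 + s) (1 + s) \<psi> u + wconv (1 + s) (1 + s) (1 + s) (ball_retract d u) (ball_retract d u))"

lemma error_system:
  fixes s T d h b c0 c1 c2 :: real and \<psi> \<psi>' g :: "real \<Rightarrow> l2"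
  assumes s: "s \<ge> 0" and T: "T > 0" and d: "d > 0" and h: "h \<ge> 0" and b: "b \<ge> 0"
    and c: "c0 \<ge> 0" "c1 \<ge> 0" "c2 \<ge> 0"
    and B: "\<And>u v. norm (wconv (1 + s) (1 + s) (1 + s) u v) \<le> b * norm u * norm v"
    and \<psi>: "\<And>t. t \<in> {0..T} \<Longrightarrow> (\<psi> has_vector_derivative \<psi>' t) (at t within {0..T})"
    and herm\<psi>: "\<And>t. t \<in> {0..T} \<Longrightarrow> herm (\<psi> t) = \<psi> t"
    and g: "continuous_on {0..T} g" and sgg: "\<And>t. t \<in> {0..T} \<Longrightarrow> herm (g t) = g t"
    and gb: "\<And>t. t \<in> {0..T} \<Longrightarrow> norm (g t) \<le> c0 * d * h"
    and H1: "\<And>t u. t \<in> {0..T} \<Longrightarrow> norm (wconv 1 (1 + s) 1 (\<psi> t) u) \<le> 1 / 4 * norm u"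
    and H2: "\<And>t u. t \<in> {0..T} \<Longrightarrow> norm (wconv 1 (1 + s) 1 (\<psi>' t) u) \<le> c1 * d * norm u"
    and H3: "\<And>t u. t \<in> {0..T} \<Longrightarrow> norm (commutator s (\<psi> t) u) \<le> c2 * d * norm u"
  obtains r p where "continuous_on {0..T} r" "continuous_on {0..T} p"
    "\<And>t. t \<in> {0..T} \<Longrightarrow> ((\<lambda>t. mul (bessel (-2)) (r t)) has_vector_derivative mul riesz (p t)) (at t within {0..T})"
    "\<And>t. t \<in> {0..T} \<Longrightarrow> ((\<lambda>t. mul (bessel (-2)) (p t)) has_vector_derivative mul riesz (r t) + mul (bessel (-2)) (nonlin s d (\<psi> t) (r t) + g t)) (at t within {0..T})"
    "\<And>t. t \<in> {0..T} \<Longrightarrow> (norm (r t))\<^sup>2 \<le> 4 * h\<^sup>2 * exp ((2 * (c2 + b) + 2 * c0 + 4 * c1) * d * T)"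
    "\<And>t. t \<in> {0..T} \<Longrightarrow> herm (r t) = r t" "\<And>t. t \<in> {0..T} \<Longrightarrow> herm (p t) = p t"
proof -
  let ?B = "wconv (1 + s) (1 + s) (1 + s)" and ?M = "wconv 1 (1 + s) 1"
  have okB: "admissible (1 + s) (1 + s) (1 + s)" using s by (simp add: admissible_def)
  interpret B: bounded_bilinear ?B by (rule bounded_bilinear_wconv[OF okB])
  have bX: "bounded_linear (mul riesz)" by (intro bounded_linear_mul bdd_mult_riesz)
  have \<psi>c: "continuous_on {0..T} \<psi>"
    unfolding continuous_on_eq_continuous_within using has_vector_derivative_continuous[OF \<psi>] by blast
  have "bounded (\<psi> ` {0..T})" by (intro compact_imp_bounded compact_continuous_image \<psi>c compact_Icc)
  then obtain m where m: "m > 0" "\<And>t. t \<in> {0..T} \<Longrightarrow> norm (\<psi> t) \<le> m" by (auto simp: bounded_pos)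
  define N where "N t u = nonlin s d (\<psi> t) u + g t" for t u
  \<comment> \<open>The summand 1 keeps the Lipschitz constant positive, as
    \<open>mild_solution\<close> demands, also for \<open>b = 0\<close>.\<close>
  have Nlip: "norm (N t u - N t v) \<le> (2 * b * m + 4 * b * d + 1) * norm (u - v)" if t: "t \<in> {0..T}" for t u v
  proof -
    have "N t u - N t v = mul riesz (2 *\<^sub>R ?B (\<psi> t) (u - v) + (?B (ball_retract d u - ball_retract d v) (ball_retract d u) + ?B (ball_retract d v) (ball_retract d u - ball_retract d v)))"
      unfolding N_def nonlin_def by (simp add: bl_simps bX B.diff_right B.diff_left algebra_simps)
    then have "norm (N t u - N t v) \<le> norm (2 *\<^sub>R ?B (\<psi> t) (u - v) + (?B (ball_retract d u - ball_retract d v) (ball_retract d u) + ?B (ball_retract d v) (ball_retract d u - ball_retract d v)))"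
      using norm_mul_riesz_le by metis
    also have "\<dots> \<le> norm (2 *\<^sub>R ?B (\<psi> t) (u - v)) + (norm (?B (ball_retract d u - ball_retract d v) (ball_retract d u)) + norm (?B (ball_retract d v) (ball_retract d u - ball_retract d v)))"
      by (intro order_trans[OF norm_triangle_ineq] add_mono order_refl norm_triangle_ineq)
    also have "\<dots> \<le> 2 * (b * m * norm (u - v)) + (b * (2 * norm (u - v)) * d + b * d * (2 * norm (u - v)))"
    proof (intro add_mono)
      show "norm (2 *\<^sub>R ?B (\<psi> t) (u - v)) \<le> 2 * (b * m * norm (u - v))"
        using order_trans[OF B mult_right_mono[OF mult_left_mono[OF m(2)[OF t] b]]] by simp
      show "norm (?B (ball_retract d u - ball_retract d v) (ball_retract d u)) \<le> b * (2 * norm (u - v)) * d"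
        using b d by (intro order_trans[OF B] mult_mono ball_retract_lipschitz norm_ball_retract_le) auto
      show "norm (?B (ball_retract d v) (ball_retract d u - ball_retract d v)) \<le> b * d * (2 * norm (u - v))"
        using b d by (intro order_trans[OF B] mult_mono ball_retract_lipschitz norm_ball_retract_le) auto
    qed
    also have "\<dots> \<le> (2 * b * m + 4 * b * d + 1) * norm (u - v)" by (simp add: algebra_simps)
    finally show ?thesis .
  qed
  have retr_cont: "continuous_on S (ball_retract d)" for S :: "l2 set"
    by (rule lipschitz_on_continuous_on[where L = 2]) (use d ball_retract_lipschitz[of d] in \<open>auto simp: lipschitz_on_def dist_norm\<close>)
  have Ncont: "continuous_on {0..T} (\<lambda>t. N t (y t))" if y: "continuous_on {0..T} y" for y
  proof -
    have "continuous_on {0..T} (\<lambda>t. ball_retract d (y t))" by (rule continuous_on_compose2[OF retr_cont y]) auto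
    then show ?thesis unfolding N_def nonlin_def
      by (intro continuous_intros bounded_linear.continuous_on[OF bX] B.continuous_on \<psi>c y g)
  qed
  have Nsg: "N t (herm u) = herm (N t u)" if "t \<in> {0..T}" for t u
    unfolding N_def nonlin_def
    by (simp add: bl_simps bounded_linear_herm herm_mul_riesz herm_wconv[OF okB] herm\<psi>[OF that] sgg[OF that] herm_ball_retract)
  have Cpos: "2 * b * m + 4 * b * d + 1 > 0" using b m(1) d by (intro add_nonneg_pos add_nonneg_nonneg) auto
  obtain r p where rp0: "r 0 = 0" "p 0 = 0" and rc: "continuous_on {0..T} r" and pc: "continuous_on {0..T} p"
    and Jr: "\<And>t. t \<in> {0..T} \<Longrightarrow> ((\<lambda>t. mul (bessel (-2)) (r t)) has_vector_derivative mul riesz (p t)) (at t within {0..T})"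
    and Jp: "\<And>t. t \<in> {0..T} \<Longrightarrow> ((\<lambda>t. mul (bessel (-2)) (p t)) has_vector_derivative mul riesz (r t) + mul (bessel (-2)) (N t (r t))) (at t within {0..T})"
    and en: "\<And>t. t \<in> {0..T} \<Longrightarrow> ((\<lambda>t. (norm (r t))\<^sup>2 + (norm (p t))\<^sup>2) has_real_derivative 2 * inner (p t) (N t (r t))) (at t within {0..T})"
    and sgr: "\<And>t. t \<in> {0..T} \<Longrightarrow> herm (r t) = r t" and sgp: "\<And>t. t \<in> {0..T} \<Longrightarrow> herm (p t) = p t"
    by (rule mild_solution[OF T Cpos Nlip Ncont Nsg]) blast+
  \<comment> \<open>The correction of the energy. As \<open>mul (bessel (-2)) (r t)\<close> has
    derivative \<open>mul riesz (p t)\<close> and \<open>riesz\<close> is skew, its derivative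
    removes the linear term of \<open>N\<close> except for a commutator and a term with
    \<open>\<psi>' t\<close>.\<close>
  define q where "q t = inner (mul (bessel (-2)) (r t)) (?M (\<psi> t) (r t))" for t
  define E where "E t = 1 / 2 * ((norm (r t))\<^sup>2 + (norm (p t))\<^sup>2) + q t" for t
  define E' where "E' t = inner (p t) (N t (r t)) + (2 * inner (mul riesz (p t)) (?M (\<psi> t) (r t)) + inner (mul (bessel (-2)) (r t)) (?M (\<psi>' t) (r t)))" for t
  \<comment> \<open>By the lower bound for the energy, products of the norms of r and p are at most
    2 E and the squared norm of r is at most 4 E: hence the factors 2 and 4.\<close>
  let ?K = "2 * (c2 + b) + 2 * c0 + 4 * c1"
  have Eder: "(E has_real_derivative E' t) (at t within {0..T})" if t: "t \<in> {0..T}" for t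
  proof -
    have "((\<lambda>t. 1 / 2 * ((norm (r t))\<^sup>2 + (norm (p t))\<^sup>2) + q t) has_real_derivative 1 / 2 * (2 * inner (p t) (N t (r t))) +
      (2 * inner (mul riesz (p t)) (?M (\<psi> t) (r t)) + inner (mul (bessel (-2)) (r t)) (?M (\<psi>' t) (r t)))) (at t within {0..T})"
      unfolding q_def
      by (intro DERIV_add DERIV_cmult en t quadratic_form_derivative[OF s herm\<psi> \<psi> rc t Jr])
    then show ?thesis unfolding E_def[abs_def] E'_def by simp
  qed
  have Elow: "(norm (r t))\<^sup>2 + (norm (p t))\<^sup>2 \<le> 4 * E t" if t: "t \<in> {0..T}" for t
  proof -
    have "\<bar>q t\<bar> \<le> norm (mul (bessel (-2)) (r t)) * norm (?M (\<psi> t) (r t))" unfolding q_def by (rule Cauchy_Schwarz_ineq2)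
    also have "\<dots> \<le> norm (r t) * (1 / 4 * norm (r t))" by (intro mult_mono norm_mul_bessel_le H1 t) auto
    finally have "\<bar>q t\<bar> \<le> 1 / 4 * (norm (r t))\<^sup>2" by (simp add: power2_eq_square)
    then have "- q t \<le> 1 / 4 * (norm (r t))\<^sup>2" by linarith
    moreover have "0 \<le> (norm (p t))\<^sup>2" by simp
    moreover have "a + p \<le> 4 * (1 / 2 * (a + p) + q)" if "- q \<le> 1 / 4 * a" "0 \<le> p" for a p q :: real
      using that by (simp add: field_simps)
    ultimately show ?thesis unfolding E_def by blast
  qed
  have E'le: "E' t \<le> ?K * d * (E t + h\<^sup>2)" if t: "t \<in> {0..T}" for t
  proof -
    let ?r = "norm (r t)" and ?p = "norm (p t)"
    have "E' t = inner (p t) (commutator s (\<psi> t) (r t)) + inner (p t) (mul riesz (?B (ball_retract d (r t)) (ball_retract d (r t)))) + inner (p t) (g t) + inner (mul (bessel (-2)) (r t)) (?M (\<psi>' t) (r t))"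
      unfolding E'_def N_def nonlin_def commutator_def
      by (simp add: bl_simps bX inner_mul_riesz inner_add_right inner_diff_right)
    also have "\<dots> \<le> ?p * (c2 * d * ?r) + ?p * (b * d * ?r) + ?p * (c0 * d * h) + ?r * (c1 * d * ?r)"
    proof (intro add_mono)
      show "inner (p t) (commutator s (\<psi> t) (r t)) \<le> ?p * (c2 * d * ?r)"
        by (intro order_trans[OF norm_cauchy_schwarz] mult_left_mono H3 t) auto
      \<comment> \<open>One factor of the quadratic term is bounded by the radius \<open>d\<close>,
        the other by the norm of r, so that this term too has the rate \<open>d\<close>.\<close>
      have "norm (mul riesz (?B (ball_retract d (r t)) (ball_retract d (r t)))) \<le> b * d * ?r"
        using b d by (intro order_trans[OF norm_mul_riesz_le] order_trans[OF B] mult_mono norm_ball_retract_le) auto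
      then show "inner (p t) (mul riesz (?B (ball_retract d (r t)) (ball_retract d (r t)))) \<le> ?p * (b * d * ?r)"
        by (intro order_trans[OF norm_cauchy_schwarz] mult_left_mono) auto
      show "inner (p t) (g t) \<le> ?p * (c0 * d * h)"
        by (intro order_trans[OF norm_cauchy_schwarz] mult_left_mono gb t) auto
      show "inner (mul (bessel (-2)) (r t)) (?M (\<psi>' t) (r t)) \<le> ?r * (c1 * d * ?r)"
        by (intro order_trans[OF norm_cauchy_schwarz] mult_mono norm_mul_bessel_le H2 t) auto
    qed
    also have "\<dots> = d * ((c2 + b) * (?p * ?r) + c0 * (?p * h) + c1 * ?r\<^sup>2)" by (simp add: algebra_simps power2_eq_square)
    also have "\<dots> \<le> d * ((c2 + b) * (2 * E t) + c0 * (2 * (E t + h\<^sup>2)) + c1 * (4 * E t))"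
    proof (intro mult_left_mono add_mono)
      have "2 * (?p * ?r) \<le> ?p\<^sup>2 + ?r\<^sup>2" using sum_squares_bound[of ?p ?r] by simp
      then show "?p * ?r \<le> 2 * E t" using Elow[OF t] by linarith
      have "2 * (?p * h) \<le> ?p\<^sup>2 + h\<^sup>2" using sum_squares_bound[of ?p h] by simp
      moreover have "x \<le> 2 * (e + H)" if "2 * x \<le> P + H" "R + P \<le> 4 * e" "0 \<le> R" "0 \<le> H" for x e H P R :: real
        using that by simp
      ultimately show "?p * h \<le> 2 * (E t + h\<^sup>2)" using Elow[OF t] zero_le_power2[of ?r] zero_le_power2[of h] by blast
      show "?r\<^sup>2 \<le> 4 * E t" using Elow[OF t] zero_le_power2[of ?p] by linarith
    qed (use b c d in auto)
    also have "\<dots> \<le> ?K * d * (E t + h\<^sup>2)"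
    proof -
      have "0 \<le> d * ((2 * (c2 + b) + 4 * c1) * h\<^sup>2)" using b c d by (intro mult_nonneg_nonneg add_nonneg_nonneg) auto
      then show ?thesis by (simp add: algebra_simps)
    qed
    finally show ?thesis .
  qed
  \<comment> \<open>The solution starts exactly at the approximation, so the energy is fed by the
    residual alone.\<close>
  have "E 0 = 0" unfolding E_def q_def rp0
    using linear_0[OF bounded_linear.linear[OF bounded_linear_mul[OF bdd_mult_bessel[of "-2"]]]] by simp
  have bound: "(norm (r t))\<^sup>2 \<le> 4 * h\<^sup>2 * exp (?K * d * T)" if t: "t \<in> {0..T}" for t
  proof -
    have "E t + h\<^sup>2 \<le> (E 0 + h\<^sup>2) * exp (?K * d * t)" by (rule gronwall[OF Eder E'le t])
    also have "\<dots> \<le> h\<^sup>2 * exp (?K * d * T)"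
      unfolding \<open>E 0 = 0\<close> using b c d t by (auto intro!: mult_left_mono mult_nonneg_nonneg add_nonneg_nonneg)
    finally have "E t \<le> h\<^sup>2 * exp (?K * d * T)" using zero_le_power2[of h] by linarith
    then show ?thesis using Elow[OF t] zero_le_power2[of "norm (p t)"] by linarith
  qed
  show ?thesis by (rule that[of r p]) (use rc pc Jr Jp[unfolded N_def] bound sgr sgp in auto)
qed

section \<open>The long wave scaling\<close>

text \<open>The weight at the frequency k over the weight at the rescaled frequency k/e. Its modulus
  is at most 1 for r \<ge> 0 and 0 < e \<le> 1, since stretching a function makes its derivatives
  small.\<close>

definition wave_weight :: "real \<Rightarrow> real \<Rightarrow> real \<Rightarrow> complex" where "wave_weight e r k = bessel r k * bessel (- r) (k / e)"

text \<open>If \<open>u\<close> is the transform of \<open>f\<close> with weight of order \<open>r\<close>, then \<open>long_wave e r t u\<close> is that of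
  \<open>e\<^sup>2 f(e (x - t))\<close>.\<close>

definition long_wave :: "real \<Rightarrow> real \<Rightarrow> real \<Rightarrow> l2 \<Rightarrow> l2" where
  "long_wave e r t u = e *\<^sub>R mul (\<lambda>k. shift_phase t k * wave_weight e r k) (affine_subst 0 (1 / e) u)"

lemma wave_weight_measurable [measurable]: "wave_weight e r \<in> borel_measurable borel"
  unfolding wave_weight_def[abs_def] by measurable

lemma bracket_scale_le:
  assumes "0 < e" "e \<le> 1" "r \<ge> 0" shows "bracket r k \<le> bracket r (k / e)"
proof -
  have "\<bar>k\<bar> \<le> \<bar>k / e\<bar>" using assms by (simp add: abs_divide le_divide_eq mult_left_le)
  then show ?thesis using assms by (intro bracket_abs_mono) auto
qed

lemma cmod_wave_weight_le: assumes e: "0 < e" "e \<le> 1" and r: "r \<ge> 0" shows "cmod (wave_weight e r k) \<le> 1"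
proof -
  have "bracket r k * bracket (- r) (k / e) \<le> bracket r (k / e) * bracket (- r) (k / e)"
    by (intro mult_right_mono bracket_scale_le e r) simp
  then show ?thesis by (simp add: wave_weight_def norm_mult bracket_mult)
qed

lemma bdd_mult_mdwr: assumes e: "0 < e" "e \<le> 1" and r: "r \<ge> 0" shows "bdd_mult (\<lambda>k. shift_phase t k * wave_weight e r k)"
  by (rule bmI[where C = 1]) (use cmod_wave_weight_le[OF e r] in \<open>auto simp: norm_mult shift_phase_def\<close>)

lemma bounded_linear_long_wave: assumes e: "0 < e" "e \<le> 1" and r: "r \<ge> 0" shows "bounded_linear (long_wave e r t)"
  unfolding long_wave_def using e
  by (intro bounded_linear_compose[OF bounded_linear_scaleR_right]
    bounded_linear_compose[OF bounded_linear_mul[OF bdd_mult_mdwr[OF e r]]] bounded_linear_affine_subst) simp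

lemma long_wave_l2_of:
  assumes e: "0 < e" "e \<le> 1" and r: "r \<ge> 0" and f: "sq f"
  shows "long_wave e r t (l2_of f) = l2_of (\<lambda>k. of_real e * (shift_phase t k * wave_weight e r k * f (k / e)))"
    "sq (\<lambda>k. of_real e * (shift_phase t k * wave_weight e r k * f (k / e)))"
proof -
  have s: "sq (\<lambda>k. f (k / e))" using sq_affine(1)[OF f, of "1 / e" 0] e by simp
  have a: "affine_subst 0 (1 / e) (l2_of f) = l2_of (\<lambda>k. f (k / e))" using affine_subst_l2_of[OF f, of "1 / e" 0] e by simp
  show "long_wave e r t (l2_of f) = l2_of (\<lambda>k. of_real e * (shift_phase t k * wave_weight e r k * f (k / e)))"
    unfolding long_wave_def a mul_l2_of[OF bdd_mult_mdwr[OF e r] s] l2_of_scaleR[OF sq_bdd_mult[OF bdd_mult_mdwr[OF e r] s]] scaleR_conv_of_real ..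
  show "sq (\<lambda>k. of_real e * (shift_phase t k * wave_weight e r k * f (k / e)))"
    by (intro sq_cmult sq_bdd_mult[OF bdd_mult_mdwr[OF e r]] s)
qed

lemma rep_long_wave:
  assumes e: "0 < e" "e \<le> 1" and r: "r \<ge> 0"
  shows "AE k in lborel. rep (long_wave e r t u) k = of_real e * (shift_phase t k * wave_weight e r k * rep u (k / e))"
  using rep_l2_of[OF long_wave_l2_of(2)[OF e r sq_rep[of u], of t]] long_wave_l2_of(1)[OF e r sq_rep[of u], of t] by simp

text \<open>The amplitude e^2 and the factor 1/e of the transformed dilation leave e; the dilation
  of frequencies contributes the square root.\<close>

lemma norm_long_wave_le:
  assumes e: "0 < e" "e \<le> 1" and r: "r \<ge> 0"
  shows "norm (long_wave e r t u) \<le> e * sqrt e * norm u"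
proof -
  have "norm (mul (\<lambda>k. shift_phase t k * wave_weight e r k) (affine_subst 0 (1 / e) u)) \<le> 1 * norm (affine_subst 0 (1 / e) u)"
    by (rule norm_mul_le) (use cmod_wave_weight_le[OF e r] in \<open>auto simp: norm_mult shift_phase_def\<close>)
  also have "\<dots> = sqrt e * norm u" using e by (subst norm_affine_subst) (auto simp: real_sqrt_divide)
  finally show ?thesis using e by (simp add: long_wave_def mult.assoc)
qed

text \<open>Multiplication with \<open>m\<close> at the frequency k matches multiplication with
  \<open>n\<close> at the rescaled frequency k/e. The rules for weights and for derivatives are two
  instances.\<close>

lemma long_wave_mul:
  assumes e: "0 < e" "e \<le> 1" and r: "r \<ge> 0" "r' \<ge> 0" and b: "bdd_mult m" "bdd_mult n"
    and eq: "\<And>k. m k * wave_weight e r k = of_real c * (wave_weight e r' k * n (k / e))"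
  shows "mul m (long_wave e r t u) = c *\<^sub>R long_wave e r' t (mul n u)"
proof (induction u rule: l2_induct_l2_of)
  case (1 f)
  have "mul m (long_wave e r t (l2_of f)) = l2_of (\<lambda>k. m k * (of_real e * (shift_phase t k * wave_weight e r k * f (k / e))))"
    using long_wave_l2_of[OF e r(1) 1, of t] by (simp add: mul_l2_of b)
  also have "(\<lambda>k. m k * (of_real e * (shift_phase t k * wave_weight e r k * f (k / e)))) = (\<lambda>k. c *\<^sub>R (of_real e * (shift_phase t k * wave_weight e r' k * (n (k / e) * f (k / e)))))"
  proof
    fix k
    have "m k * (of_real e * (shift_phase t k * wave_weight e r k * f (k / e))) = of_real e * shift_phase t k * f (k / e) * (m k * wave_weight e r k)" by simp
    then show "m k * (of_real e * (shift_phase t k * wave_weight e r k * f (k / e))) = c *\<^sub>R (of_real e * (shift_phase t k * wave_weight e r' k * (n (k / e) * f (k / e))))"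
      unfolding eq by (simp add: scaleR_conv_of_real)
  qed
  also have "l2_of \<dots> = c *\<^sub>R long_wave e r' t (mul n (l2_of f))"
    using long_wave_l2_of[OF e r(2) sq_bdd_mult[OF b(2) 1], of t] by (simp add: mul_l2_of b 1 l2_of_scaleR)
  finally show ?case .
qed

lemma long_wave_bessel:
  assumes e: "0 < e" "e \<le> 1" and r: "r \<ge> 0" "c \<ge> 0" "r' = r + c"
  shows "mul (bessel (- c)) (long_wave e r' t u) = long_wave e r t (mul (bessel (- c)) u)"
proof -
  have "mul (bessel (- c)) (long_wave e r' t u) = 1 *\<^sub>R long_wave e r t (mul (bessel (- c)) u)"
  proof (rule long_wave_mul[OF e])
    fix k
    have "bessel (- c) k * wave_weight e r' k = (bessel (- c) k * bessel (r + c) k) * bessel (- r - c) (k / e)" by (simp add: wave_weight_def r)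
    also have "\<dots> = bessel r k * (bessel (- r) (k / e) * bessel (- c) (k / e))" by (simp add: bessel_mult)
    finally show "bessel (- c) k * wave_weight e r' k = of_real 1 * (wave_weight e r k * bessel (- c) (k / e))" by (simp add: wave_weight_def)
  qed (use r in \<open>auto intro: bdd_mult_bessel\<close>)
  then show ?thesis by simp
qed

lemma riesz_eq: "riesz k = \<i> * of_real k * bessel (-1) k" by (simp add: riesz_def bessel_def)

text \<open>The chain rule: a derivative in x is e times a derivative in X, and it lowers the order
  of the weight by one.\<close>

lemma long_wave_riesz:
  assumes e: "0 < e" "e \<le> 1" and r: "r \<ge> 0" "r' = r + 1"
  shows "mul riesz (long_wave e r' t u) = e *\<^sub>R long_wave e r t (mul riesz u)"
proof (rule long_wave_mul[OF e])
  fix k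
  have j: "bessel (r + 1) k = bessel 1 k * bessel r k" "bessel (- (r + 1)) (k / e) = bessel (- r) (k / e) * bessel (-1) (k / e)"
    by (simp_all add: bessel_mult add.commute)
  have "riesz k * wave_weight e r' k = (riesz k * bessel 1 k) * bessel r k * (bessel (- r) (k / e) * bessel (-1) (k / e))" by (simp only: wave_weight_def r j mult.assoc)
  also have "\<dots> = \<i> * of_real k * bessel r k * (bessel (- r) (k / e) * bessel (-1) (k / e))" by (simp add: riesz_J1)
  finally have "riesz k * wave_weight e r' k = \<i> * of_real k * bessel r k * (bessel (- r) (k / e) * bessel (-1) (k / e))" .
  moreover have "of_real e * (wave_weight e r k * riesz (k / e)) = \<i> * of_real k * bessel r k * (bessel (- r) (k / e) * bessel (-1) (k / e))"
    using e by (simp add: wave_weight_def riesz_eq)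
  ultimately show "riesz k * wave_weight e r' k = of_real e * (wave_weight e r k * riesz (k / e))" by simp
qed (use r in \<open>auto intro: bdd_mult_riesz\<close>)

text \<open>The operator 1 - d^2/dx^2 acts on the profile as 1 - e^2 d^2/dX^2; this is how the
  dispersive term of the Boussinesq equation is recovered.\<close>

lemma long_wave_2:
  assumes e: "0 < e" "e \<le> 1" and r: "r \<ge> 0" "r' = 2 + r"
  shows "long_wave e r' t u = long_wave e r t (mul (bessel (-2)) u - e\<^sup>2 *\<^sub>R mul riesz (mul riesz u))"
proof (induction u rule: l2_induct_l2_of)
  case (1 f)
  have r': "r' \<ge> 0" using r by simp
  have bJ: "bdd_mult (bessel (-2))" by (rule bdd_mult_bessel) simp
  have s: "sq (\<lambda>k. bessel (-2) k * f k)" "sq (\<lambda>k. riesz k * (riesz k * f k))" by (intro sq_bdd_mult bJ bdd_mult_riesz 1)+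
  have "mul (bessel (-2)) (l2_of f) - e\<^sup>2 *\<^sub>R mul riesz (mul riesz (l2_of f)) = l2_of (\<lambda>k. bessel (-2) k * f k - e\<^sup>2 *\<^sub>R (riesz k * (riesz k * f k)))"
    by (simp add: mul_l2_of bJ bdd_mult_riesz 1 sq_bdd_mult[OF bdd_mult_riesz 1] l2_of_scaleR[OF s(2)] l2_of_diff[OF s(1) sq_scaleR[OF s(2)]])
  moreover have "sq (\<lambda>k. bessel (-2) k * f k - e\<^sup>2 *\<^sub>R (riesz k * (riesz k * f k)))" by (intro sq_diff sq_scaleR s)
  moreover have "wave_weight e r' k * z = wave_weight e r k * (bessel (-2) (k / e) * z - e\<^sup>2 *\<^sub>R (riesz (k / e) * (riesz (k / e) * z)))" for k z
  proof -
    have "wave_weight e r' k = bessel r k * bessel (- r) (k / e) * (bessel 2 k * bessel (-2) (k / e))"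
    proof -
      have j: "bessel (2 + r) k = bessel 2 k * bessel r k" "bessel (- (2 + r)) (k / e) = bessel (-2) (k / e) * bessel (- r) (k / e)"
        by (simp_all add: bessel_mult)
      show ?thesis unfolding wave_weight_def r j by (simp add: ac_simps)
    qed
    moreover have "bessel 2 k * bessel (-2) (k / e) = bessel (-2) (k / e) - of_real (e\<^sup>2) * (riesz (k / e) * riesz (k / e))"
    proof -
      have "bessel 2 k = 1 + of_real (k\<^sup>2)" by (simp add: bessel_def bracket_2)
      moreover have "riesz (k / e) * riesz (k / e) = - of_real ((k / e)\<^sup>2) * bessel (-2) (k / e)"
        using bessel_mult[of "-1" "k / e" "-1"] by (simp add: riesz_eq power2_eq_square algebra_simps)
      moreover have "of_real (e\<^sup>2) * of_real ((k / e)\<^sup>2) = (of_real (k\<^sup>2) :: complex)"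
        using e by (simp add: power_divide flip: of_real_mult)
      ultimately show ?thesis by (simp add: distrib_right mult.assoc[symmetric] del: of_real_power of_real_divide)
    qed
    ultimately have "wave_weight e r' k = wave_weight e r k * (bessel (-2) (k / e) - of_real (e\<^sup>2) * (riesz (k / e) * riesz (k / e)))" by (simp only: wave_weight_def)
    then have "wave_weight e r' k * z = wave_weight e r k * (bessel (-2) (k / e) - of_real (e\<^sup>2) * (riesz (k / e) * riesz (k / e))) * z" by (rule arg_cong)
    also have "\<dots> = wave_weight e r k * (bessel (-2) (k / e) * z - e\<^sup>2 *\<^sub>R (riesz (k / e) * (riesz (k / e) * z)))"
      by (simp only: scaleR_conv_of_real right_diff_distrib left_diff_distrib mult.assoc)
    finally show ?thesis .
  qed
  ultimately show ?case using long_wave_l2_of(1)[OF e r' 1, of t] long_wave_l2_of(1)[OF e r(1), of "\<lambda>k. bessel (-2) k * f k - e\<^sup>2 *\<^sub>R (riesz k * (riesz k * f k))" t]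
    by (simp add: mult.assoc)
qed

text \<open>A product of two waves of amplitude e^2 has amplitude e^4, which is e^2 times that of a
  long wave.\<close>

lemma long_wave_wconv:
  assumes e: "0 < e" "e \<le> 1" and admissible: "admissible r p q"
  shows "wconv r p q (long_wave e p t u) (long_wave e q t v) = e\<^sup>2 *\<^sub>R long_wave e r t (wconv r p q u v)"
proof -
  have rpq: "r \<ge> 0" "p \<ge> 0" "q \<ge> 0" using admissible by (auto simp: admissible_def)
  let ?a = "\<lambda>k. bessel (-p) k * rep u k" and ?b = "\<lambda>k. bessel (-q) k * rep v k"
  have A: "AE k in lborel. bessel (-p) k * rep (long_wave e p t u) k = of_real e * shift_phase t k * (bessel (-p) (k / e) * rep u (k / e))" if "p \<ge> 0" for p u
    using rep_long_wave[OF e that, of t u]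
  proof eventually_elim
    case (elim k)
    have "bessel (-p) k * wave_weight e p k = bessel (-p) (k / e) * (bessel (-p) k * bessel p k)" by (simp add: wave_weight_def)
    then have "bessel (-p) k * wave_weight e p k = bessel (-p) (k / e)" by (simp add: bessel_mult)
    then have eq: "of_real e * shift_phase t k * (bessel (-p) k * wave_weight e p k) * z = of_real e * shift_phase t k * bessel (-p) (k / e) * z" for z by (simp only:)
    have "bessel (-p) k * (of_real e * (shift_phase t k * wave_weight e p k * z)) = of_real e * shift_phase t k * (bessel (-p) k * wave_weight e p k) * z" for z
      by (simp only: ac_simps)
    then show ?case unfolding elim eq by (simp add: mult.assoc)
  qed
  have convol: "convol (\<lambda>k. bessel (-p) k * rep (long_wave e p t u) k) (\<lambda>k. bessel (-q) k * rep (long_wave e q t v) k) k = of_real (e ^ 3) * shift_phase t k * convol ?a ?b (k / e)" for k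
  proof -
    have "convol (\<lambda>k. bessel (-p) k * rep (long_wave e p t u) k) (\<lambda>k. bessel (-q) k * rep (long_wave e q t v) k) k =
       convol (\<lambda>k. of_real e * shift_phase t k * ?a (k / e)) (\<lambda>k. of_real e * shift_phase t k * ?b (k / e)) k"
      by (rule convol_cong_AE[OF A[OF rpq(2)] A[OF rpq(3)]]) measurable
    also have "\<dots> = of_real (1 / sqrt (2 * pi)) * (\<bar>e\<bar> *\<^sub>R (LINT l|lborel. (of_real e * shift_phase t (k - (0 + e * l)) * ?a ((k - (0 + e * l)) / e)) * (of_real e * shift_phase t (0 + e * l) * ?b ((0 + e * l) / e))))"
      unfolding convol_def by (subst lborel_integral_real_affine[of e _ 0]) (use e in auto)
    also have "(LINT l|lborel. (of_real e * shift_phase t (k - (0 + e * l)) * ?a ((k - (0 + e * l)) / e)) * (of_real e * shift_phase t (0 + e * l) * ?b ((0 + e * l) / e)))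
      = (LINT l|lborel. of_real (e * e) * shift_phase t k * (?a (k / e - l) * ?b l))"
    proof (rule Bochner_Integration.integral_cong)
      fix l
      have "shift_phase t (k - e * l) * shift_phase t (e * l) = shift_phase t k"
        unfolding shift_phase_def cis_mult by (rule arg_cong[where f = cis]) (simp add: algebra_simps)
      moreover have "(k - e * l) / e = k / e - l" using e by (simp add: diff_divide_distrib)
      ultimately show "(of_real e * shift_phase t (k - (0 + e * l)) * ?a ((k - (0 + e * l)) / e)) * (of_real e * shift_phase t (0 + e * l) * ?b ((0 + e * l) / e))
        = of_real (e * e) * shift_phase t k * (?a (k / e - l) * ?b l)"
        using e by (simp add: mult.commute mult.left_commute)
    qed simp
    also have "of_real (1 / sqrt (2 * pi)) * (\<bar>e\<bar> *\<^sub>R (LINT l|lborel. of_real (e * e) * shift_phase t k * (?a (k / e - l) * ?b l)))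
      = of_real (e ^ 3) * shift_phase t k * convol ?a ?b (k / e)"
      using e by (simp add: convol_def scaleR_conv_of_real power3_eq_cube)
    finally show ?thesis .
  qed
  show ?thesis
  proof (rule l2_eqI)
    have "1 / e \<noteq> 0" using e by simp
    have sc: "AE k in lborel. rep (wconv r p q u v) (k / e) = bessel r (k / e) * convol ?a ?b (k / e)"
      using AE_borel_affine[OF \<open>1 / e \<noteq> 0\<close> _ rep_wconv[OF admissible, of u v], of 0] by simp
    show "AE k in lborel. rep (wconv r p q (long_wave e p t u) (long_wave e q t v)) k = rep (e\<^sup>2 *\<^sub>R long_wave e r t (wconv r p q u v)) k"
      using rep_wconv[OF admissible, of "long_wave e p t u" "long_wave e q t v"] rep_scaleR[of "e\<^sup>2" "long_wave e r t (wconv r p q u v)"] rep_long_wave[OF e rpq(1), of t "wconv r p q u v"] sc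
    proof eventually_elim
      case (elim k)
      have "bessel (- r) (k / e) * bessel r (k / e) = 1" by (simp add: bessel_mult)
      then have wj: "wave_weight e r k * bessel r (k / e) = bessel r k" by (simp add: wave_weight_def mult.assoc)
      then show ?case using elim unfolding convol
        by (simp add: scaleR_conv_of_real power3_eq_cube power2_eq_square mult.assoc mult.left_commute flip: wj)
    qed
  qed
qed

lemma shift_phase_eq: "shift_phase t = phase (\<lambda>k. - k) t" by (auto simp: shift_phase_def phase_def)

lemma long_wave_tendsto:
  assumes e: "0 < e" "e \<le> 1" and r: "r \<ge> 0"
  shows "((\<lambda>s. long_wave e r s u) \<longlongrightarrow> long_wave e r t u) (at t within S)"
  unfolding long_wave_def shift_phase_eq mult.commute[of "phase _ _ _"]
  by (intro tendsto_intros mul_phase_tendsto[where C = 1] cmod_wave_weight_le e r) measurable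

lemma long_wave_continuous:
  assumes e: "0 < e" "e \<le> 1" and r: "r \<ge> 0" and u: "continuous_on S u"
  shows "continuous_on S (\<lambda>t. long_wave e r t (u t))"
  unfolding continuous_on_def
proof
  fix t assume t: "t \<in> S"
  show "((\<lambda>t. long_wave e r t (u t)) \<longlongrightarrow> long_wave e r t (u t)) (at t within S)"
    by (rule tendsto_operator_family[where A = "\<lambda>s. long_wave e r s" and u = u and x = "u t" and C = "e * sqrt e"])
      (use u t e r in \<open>auto intro!: always_eventually bounded_linear.linear bounded_linear_long_wave norm_long_wave_le long_wave_tendsto simp: continuous_on_def\<close>)
qed

text \<open>The translation in \<open>long_wave\<close> costs one derivative, whence the second factorization of \<open>u t\<close>.\<close>

lemma long_wave_derivative:
  assumes e: "0 < e" "e \<le> 1" and r: "r \<ge> 0"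
    and u: "(u has_vector_derivative u') (at t within S)" and v: "u t = mul (bessel (-1)) v"
  shows "((\<lambda>t. long_wave e r t (u t)) has_vector_derivative long_wave e r t u' - e *\<^sub>R long_wave e r t (mul riesz v)) (at t within S)"
proof -
  \<comment> \<open>The wave weight with an additional decay of order one in k/e; it absorbs the
    factor k that the derivative of the translation produces.\<close>
  define m where "m k = bessel r k * bessel (- r - 1) (k / e)" for k
  have [measurable]: "m \<in> borel_measurable borel" unfolding m_def[abs_def] by measurable
  have m: "m k = wave_weight e r k * bessel (-1) (k / e)" for k by (simp add: m_def wave_weight_def bessel_mult mult.assoc)
  have C1: "cmod (m k) \<le> 1" for k
  proof -
    have "cmod (wave_weight e r k) * cmod (bessel (-1) (k / e)) \<le> 1 * 1" by (intro mult_mono cmod_wave_weight_le e r) (auto intro: bracket_le_1)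
    then show ?thesis by (simp add: m norm_mult)
  qed
  have C2: "cmod (m k) * \<bar>- k\<bar> \<le> 1" for k
  proof -
    have "cmod (riesz y) = \<bar>y\<bar> * bracket (-1) y" for y by (simp add: riesz_def norm_mult abs_mult)
    then have "\<bar>k / e\<bar> * bracket (-1) (k / e) \<le> 1" using cmod_riesz_le[of "k / e"] by simp
    then have "e * (\<bar>k / e\<bar> * bracket (-1) (k / e)) \<le> 1 * 1" using e by (intro mult_mono) auto
    then have k: "\<bar>k\<bar> * bracket (-1) (k / e) \<le> 1" using e by (simp add: abs_divide)
    have "cmod (wave_weight e r k) * (\<bar>k\<bar> * bracket (-1) (k / e)) \<le> 1 * 1" by (intro mult_mono cmod_wave_weight_le e r k) auto
    then show ?thesis by (simp add: m norm_mult ac_simps)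
  qed
  have eq: "long_wave e r s (mul (bessel (-1)) v) = e *\<^sub>R mul (\<lambda>k. m k * phase (\<lambda>k. - k) s k) (affine_subst 0 (1 / e) v)" for s
  proof -
    have b: "bdd_mult (\<lambda>k. m k * phase (\<lambda>k. - k) s k)" by (intro bdd_mult_mult bdd_mult_phase bmI[OF _ C1]) measurable
    show ?thesis
    proof (induction v rule: l2_induct_l2_of)
      case (1 f)
      have bJ: "bdd_mult (bessel (-1))" by (rule bdd_mult_bessel) simp
      have s: "sq (\<lambda>k. f (k / e))" using sq_affine(1)[OF 1, of "1 / e" 0] e by simp
      have a: "affine_subst 0 (1 / e) (l2_of f) = l2_of (\<lambda>k. f (k / e))" using affine_subst_l2_of[OF 1, of "1 / e" 0] e by simp
      have "long_wave e r s (mul (bessel (-1)) (l2_of f)) = l2_of (\<lambda>k. of_real e * (shift_phase s k * wave_weight e r k * (bessel (-1) (k / e) * f (k / e))))"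
        using long_wave_l2_of(1)[OF e r sq_bdd_mult[OF bJ 1], of s] by (simp add: mul_l2_of[OF bJ 1])
      also have "\<dots> = e *\<^sub>R mul (\<lambda>k. m k * phase (\<lambda>k. - k) s k) (affine_subst 0 (1 / e) (l2_of f))"
      proof -
        have "of_real e * (shift_phase s k * wave_weight e r k * (bessel (-1) (k / e) * f (k / e))) = e *\<^sub>R (m k * phase (\<lambda>k. - k) s k * f (k / e))" for k
          unfolding m shift_phase_eq by (simp add: scaleR_conv_of_real)
        then show ?thesis unfolding a mul_l2_of[OF b s] l2_of_scaleR[OF sq_bdd_mult[OF b s]] by simp
      qed
      finally show ?case .
    qed
  qed
  have d: "((\<lambda>s. long_wave e r s (u t)) has_vector_derivative e *\<^sub>R mul (\<lambda>k. m k * (\<i> * of_real (- k)) * phase (\<lambda>k. - k) t k) (affine_subst 0 (1 / e) v)) (at t within S)"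
    unfolding v eq
    by (intro bounded_linear.has_vector_derivative[OF bounded_linear_scaleR_right] mul_phase_derivative[where C = 1] C1 C2) measurable
  have D: "e *\<^sub>R mul (\<lambda>k. m k * (\<i> * of_real (- k)) * phase (\<lambda>k. - k) t k) (affine_subst 0 (1 / e) v) = - (e *\<^sub>R long_wave e r t (mul riesz v))"
  proof -
    have b: "bdd_mult (\<lambda>k. m k * (\<i> * of_real (- k)) * phase (\<lambda>k. - k) t k)"
      by (rule bmI[where C = 1]) (measurable, use C2 in \<open>simp add: norm_mult\<close>)
    show ?thesis
    proof (induction v rule: l2_induct_l2_of)
      case (1 f)
      have s: "sq (\<lambda>k. f (k / e))" using sq_affine(1)[OF 1, of "1 / e" 0] e by simp
      have a: "affine_subst 0 (1 / e) (l2_of f) = l2_of (\<lambda>k. f (k / e))" using affine_subst_l2_of[OF 1, of "1 / e" 0] e by simp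
      have sW: "sq (\<lambda>k. of_real e * (shift_phase t k * wave_weight e r k * (riesz (k / e) * f (k / e))))" by (rule long_wave_l2_of(2)[OF e r sq_bdd_mult[OF bdd_mult_riesz 1]])
      have "- (e *\<^sub>R long_wave e r t (mul riesz (l2_of f))) = (- e) *\<^sub>R l2_of (\<lambda>k. of_real e * (shift_phase t k * wave_weight e r k * (riesz (k / e) * f (k / e))))"
        using long_wave_l2_of(1)[OF e r sq_bdd_mult[OF bdd_mult_riesz 1], of t] by (simp add: mul_l2_of[OF bdd_mult_riesz 1])
      also have "\<dots> = l2_of (\<lambda>k. (- e) *\<^sub>R (of_real e * (shift_phase t k * wave_weight e r k * (riesz (k / e) * f (k / e)))))"
        by (rule l2_of_scaleR[OF sW])
      also have "(\<lambda>k. (- e) *\<^sub>R (of_real e * (shift_phase t k * wave_weight e r k * (riesz (k / e) * f (k / e))))) = (\<lambda>k. e *\<^sub>R (m k * (\<i> * of_real (- k)) * phase (\<lambda>k. - k) t k * f (k / e)))"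
      proof
        fix k
        have "of_real e * riesz (k / e) = \<i> * of_real k * bessel (-1) (k / e)" using e by (simp add: riesz_eq)
        then have "of_real e * (shift_phase t k * wave_weight e r k * (riesz (k / e) * f (k / e))) = shift_phase t k * wave_weight e r k * (\<i> * of_real k * bessel (-1) (k / e)) * f (k / e)"
          by (metis mult.assoc mult.left_commute)
        then show "(- e) *\<^sub>R (of_real e * (shift_phase t k * wave_weight e r k * (riesz (k / e) * f (k / e)))) = e *\<^sub>R (m k * (\<i> * of_real (- k)) * phase (\<lambda>k. - k) t k * f (k / e))"
          by (simp add: m shift_phase_eq ac_simps)
      qed
      finally show ?case unfolding a mul_l2_of[OF b s] l2_of_scaleR[OF sq_bdd_mult[OF b s]] by simp
    qed
  qed
  have "((\<lambda>t. long_wave e r t (u t)) has_vector_derivative long_wave e r t u' + - (e *\<^sub>R long_wave e r t (mul riesz v))) (at t within S)"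
    by (rule operator_family_derivative[where A = "\<lambda>s. long_wave e r s" and C = "e * sqrt e"])
      (use d[unfolded D] u e r in \<open>auto intro!: bounded_linear.linear bounded_linear_long_wave norm_long_wave_le long_wave_tendsto\<close>)
  then show ?thesis by simp
qed

lemma herm_long_wave: assumes e: "0 < e" "e \<le> 1" and r: "r \<ge> 0" shows "herm (long_wave e r t u) = long_wave e r t (herm u)"
proof (induction u rule: l2_induct_l2_of)
  case (1 f)
  have w: "cnj (shift_phase t (- k)) = shift_phase t k" "cnj (wave_weight e r (- k)) = wave_weight e r k" for k
    by (simp_all add: shift_phase_def cis_cnj wave_weight_def)
  show ?case
    using long_wave_l2_of[OF e r 1, of t] long_wave_l2_of(1)[OF e r sq_cnj[OF sq_reflect[OF 1]], of t]
    by (simp add: herm_l2_of 1 w)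
qed

lemma fhat_long_wave:
  assumes e: "0 < e" "e \<le> 1" and r: "r \<ge> 0" and f: "square_integrable f" "fhat f = mul (bessel (- r)) u"
  shows "square_integrable (\<lambda>x. e\<^sup>2 * f (e * (x - t)))"
    "fhat (\<lambda>x. e\<^sup>2 * f (e * (x - t))) = mul (bessel (- r)) (long_wave e r t u)"
proof -
  note a = fhat_affine[OF f(1) e(1), of t]
  show "square_integrable (\<lambda>x. e\<^sup>2 * f (e * (x - t)))" by (rule square_integrable_scale[OF a(1)])
  have "fhat (\<lambda>x. e\<^sup>2 * f (e * (x - t))) = e *\<^sub>R mul (shift_phase t) (affine_subst 0 (1 / e) (mul (bessel (- r)) u))"
    unfolding fhat_scale[OF a(1)] a(2) f(2) using e by (simp add: power2_eq_square)
  also have "\<dots> = long_wave e 0 t (mul (bessel (- r)) u)" by (simp add: long_wave_def wave_weight_def)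
  also have "\<dots> = mul (bessel (- r)) (long_wave e r t u)" using long_wave_bessel[OF e, of 0 r r t u] r by simp
  finally show "fhat (\<lambda>x. e\<^sup>2 * f (e * (x - t))) = mul (bessel (- r)) (long_wave e r t u)" .
qed

text \<open>One factor e is explicit in \<open>long_wave\<close>, the other comes from substituting
  k/e in the L^1 integral; together they give the full amplitude e^2. The order \<open>c\<close> is
  surplus smoothness of the profile, spent on making the weighted transform integrable.\<close>

lemma long_wave_L1_weighted:
  assumes e: "0 < e" "e \<le> 1" and p: "p \<ge> 0" and q: "q - p - c \<le> -1" and c: "c \<ge> 0"
    and [measurable]: "w \<in> borel_measurable borel" and w: "\<And>k. cmod (w k) \<le> a * bracket q (k / e)" and a: "a \<ge> 0"
  shows "integrable lborel (\<lambda>k. w k * (bessel (- p) k * rep (long_wave e p t (mul (bessel (- c)) v)) k))"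
    "(LINT k|lborel. cmod (w k * (bessel (- p) k * rep (long_wave e p t (mul (bessel (- c)) v)) k))) \<le> a * e\<^sup>2 * (bessel_const * norm v)"
proof -
  let ?u = "mul (bessel (- c)) v"
  let ?h = "\<lambda>k. w k * (bessel (- p) k * rep (long_wave e p t ?u) k)"
  let ?B = "\<lambda>k. bessel (q - p - c) k * rep v k"
  note B = bessel_m1_L1[OF q, of v]
  have e1: "1 / e \<noteq> 0" using e by simp
  have bJ: "bdd_mult (bessel (- c))" using c by (intro bdd_mult_bessel) simp
  have sc: "AE k in lborel. rep ?u (0 + 1 / e * k) = bessel (- c) (0 + 1 / e * k) * rep v (0 + 1 / e * k)"
    by (rule AE_borel_affine[OF e1 _ rep_mul[OF bJ, of v]]) measurable
  have le: "AE k in lborel. cmod (?h k) \<le> a * e * cmod (?B (0 + 1 / e * k))"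
    using rep_long_wave[OF e p, of t ?u] sc
  proof eventually_elim
    case (elim k)
    have "cmod (?h k) = e * (cmod (w k) * (bracket (- p) k * bracket p k) * (bracket (- p) (k / e) * bracket (- c) (k / e) * cmod (rep v (k / e))))"
      using elim e by (simp add: norm_mult shift_phase_def wave_weight_def)
    also have "\<dots> = e * (cmod (w k) * (bracket (- p) (k / e) * bracket (- c) (k / e) * cmod (rep v (k / e))))" by (simp add: bracket_mult)
    also have "\<dots> \<le> e * (a * bracket q (k / e) * (bracket (- p) (k / e) * bracket (- c) (k / e) * cmod (rep v (k / e))))"
      using e by (intro mult_left_mono mult_right_mono w) auto
    also have "\<dots> = a * e * cmod (?B (0 + 1 / e * k))"
    proof -
      have "bracket (q - p - c) (k / e) = bracket q (k / e) * bracket (- p) (k / e) * bracket (- c) (k / e)" by (simp add: bracket_mult)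
      then show ?thesis by (simp add: norm_mult)
    qed
    finally show ?case .
  qed
  have iB: "integrable lborel (\<lambda>k. ?B (0 + 1 / e * k))" by (rule lborel_integrable_real_affine[OF B(1) e1])
  have iB': "integrable lborel (\<lambda>k. a * e * cmod (?B (0 + 1 / e * k)))" by (intro integrable_mult_right integrable_norm iB)
  show i: "integrable lborel ?h"
    by (rule Bochner_Integration.integrable_bound[OF iB'])
      (measurable, use le a e in \<open>auto elim!: eventually_mono simp: abs_mult\<close>)
  have "(LINT k|lborel. cmod (?h k)) \<le> (LINT k|lborel. a * e * cmod (?B (0 + 1 / e * k)))"
    by (intro integral_mono_AE integrable_norm i iB' le)
  also have "\<dots> = a * e * (e * (LINT k|lborel. cmod (?B k)))"
  proof -
    have "(LINT k|lborel. cmod (?B k)) = \<bar>1 / e\<bar> *\<^sub>R (LINT k|lborel. cmod (?B (0 + 1 / e * k)))"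
      by (rule lborel_integral_real_affine[OF e1])
    then show ?thesis using e by simp
  qed
  also have "\<dots> \<le> a * e * (e * (bessel_const * norm v))" using B(2) e a by (intro mult_left_mono) auto
  finally show "(LINT k|lborel. cmod (?h k)) \<le> a * e\<^sup>2 * (bessel_const * norm v)" by (simp add: power2_eq_square mult.assoc)
qed

lemma long_wave_L1:
  assumes e: "0 < e" "e \<le> 1" and p: "p \<ge> 0" and j: "j \<ge> 0" "j - p - c \<le> -1" and c: "c \<ge> 0"
  shows "integrable lborel (\<lambda>k. bessel j k * (bessel (- p) k * rep (long_wave e p t (mul (bessel (- c)) v)) k))"
    "(LINT k|lborel. cmod (bessel j k * (bessel (- p) k * rep (long_wave e p t (mul (bessel (- c)) v)) k))) \<le> e\<^sup>2 * (bessel_const * norm v)"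
  using long_wave_L1_weighted[OF e p j(2) c, of "bessel j" 1 t v] bracket_scale_le[OF e j(1)] by simp_all

text \<open>A factor \<open>k\<close> stands for a derivative of the rescaled function and yields a factor \<open>e\<close>.\<close>

lemma long_wave_L1_derivative:
  assumes e: "0 < e" "e \<le> 1" and p: "p \<ge> 0" and j: "j \<ge> 0" "j + 1 - p - c \<le> -1" and c: "c \<ge> 0"
  shows "integrable lborel (\<lambda>k. of_real k * (bessel j k * (bessel (- p) k * rep (long_wave e p t (mul (bessel (- c)) v)) k)))"
    "(LINT k|lborel. cmod (of_real k * (bessel j k * (bessel (- p) k * rep (long_wave e p t (mul (bessel (- c)) v)) k)))) \<le> e ^ 3 * (bessel_const * norm v)"
proof -
  have w: "cmod (of_real k * bessel j k) \<le> e * bracket (j + 1) (k / e)" for k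
  proof -
    have "\<bar>k / e\<bar> * bracket j k \<le> bracket 1 (k / e) * bracket j (k / e)" by (intro mult_mono abs_le_jb1 bracket_scale_le e j) auto
    then have "e * (\<bar>k / e\<bar> * bracket j k) \<le> e * (bracket 1 (k / e) * bracket j (k / e))" using e by (intro mult_left_mono) auto
    moreover have "e * (\<bar>k / e\<bar> * bracket j k) = cmod (of_real k * bessel j k)" using e by (simp add: norm_mult abs_divide)
    moreover have "bracket 1 (k / e) * bracket j (k / e) = bracket (j + 1) (k / e)" unfolding bracket_mult by (rule arg_cong2[OF _ refl]) simp
    ultimately show ?thesis by metis
  qed
  have m: "(\<lambda>k. of_real k * bessel j k) \<in> borel_measurable borel" by measurable
  have e0: "0 \<le> e" using e by simp
  have g: "integrable lborel (\<lambda>k. (of_real k * bessel j k) * (bessel (- p) k * rep (long_wave e p t (mul (bessel (- c)) v)) k))"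
    "(LINT k|lborel. cmod ((of_real k * bessel j k) * (bessel (- p) k * rep (long_wave e p t (mul (bessel (- c)) v)) k))) \<le> e * e\<^sup>2 * (bessel_const * norm v)"
    by (rule long_wave_L1_weighted[where w = "\<lambda>k. of_real k * bessel j k" and q = "j + 1" and a = e]; fact)+
  have E: "e ^ 3 = e * e\<^sup>2" by (simp add: power3_eq_cube power2_eq_square)
  show "integrable lborel (\<lambda>k. of_real k * (bessel j k * (bessel (- p) k * rep (long_wave e p t (mul (bessel (- c)) v)) k)))"
    "(LINT k|lborel. cmod (of_real k * (bessel j k * (bessel (- p) k * rep (long_wave e p t (mul (bessel (- c)) v)) k)))) \<le> e ^ 3 * (bessel_const * norm v)"
    using g by (simp_all only: mult.assoc E)
qed

section \<open>The Korteweg-de Vries equation on the Fourier side\<close>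

text \<open>The difference of \<open>v\<close> and the primitive of \<open>y\<close> has a vanishing
  derivative when paired with any test function, hence is constant by density. The smoothing of
  order \<open>a\<close>, under which the pairing is expressed, is removed by injectivity.\<close>

lemma weak_derivative:
  assumes a: "a \<ge> 0" and y: "continuous_on {0..T} y"
    and sgv: "\<And>t. t \<in> {0..T} \<Longrightarrow> herm (v t) = v t" and sgy: "\<And>t. t \<in> {0..T} \<Longrightarrow> herm (y t) = y t"
    and weak: "\<And>\<phi> t. test_function \<phi> \<Longrightarrow> t \<in> {0..T} \<Longrightarrow>
      ((\<lambda>t. inner (mul (bessel (- a)) (v t)) (fhat \<phi>)) has_real_derivative inner (mul (bessel (- a)) (y t)) (fhat \<phi>)) (at t within {0..T})"
    and t: "t \<in> {0..T}"
  shows "(v has_vector_derivative y t) (at t within {0..T})"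
proof -
  define Y where "Y t = integral {0..t} y" for t
  have Y: "(Y has_vector_derivative y t) (at t within {0..T})" if "t \<in> {0..T}" for t
    unfolding Y_def by (rule integral_has_vector_derivative[OF y that])
  have bl: "bounded_linear (mul (bessel (- a)))" using a by (intro bounded_linear_mul bdd_mult_bessel) simp
  have eq: "v t = v 0 + Y t" if t: "t \<in> {0..T}" for t
  proof -
    have 0: "0 \<in> {0..T}" using t by auto
    have sgY: "herm (Y t) = Y t"
    proof -
      have "y integrable_on {0..t}" using t by (intro integrable_continuous_real continuous_on_subset[OF y]) auto
      then have "herm (Y t) = integral {0..t} (\<lambda>x. herm (y x))"
        unfolding Y_def using integral_linear[OF _ bounded_linear_herm, of y "{0..t}"] by (simp add: o_def)
      also have "\<dots> = Y t" unfolding Y_def using t by (intro integral_cong sgy) auto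
      finally show ?thesis .
    qed
    let ?P = "\<lambda>t. v t - v 0 - Y t"
    have "mul (bessel (- a)) (?P t) = 0"
    proof (rule test_functions_dense)
      show "herm (mul (bessel (- a)) (?P t)) = mul (bessel (- a)) (?P t)"
        using a sgv[OF t] sgv[OF 0] sgY by (simp add: herm_mul_bessel bl_simps[OF bounded_linear_herm])
      fix \<phi> assume p: "test_function \<phi>"
      let ?f = "\<lambda>t. inner (mul (bessel (- a)) (?P t)) (fhat \<phi>)"
      have split: "?f t = inner (mul (bessel (- a)) (v t)) (fhat \<phi>) - inner (mul (bessel (- a)) (v 0)) (fhat \<phi>) - inner (mul (bessel (- a)) (Y t)) (fhat \<phi>)" for t
        by (simp add: bl_simps[OF bl] inner_diff_left)
      have d: "(?f has_real_derivative 0) (at t within {0..T})" if "t \<in> {0..T}" for t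
      proof -
        have "((\<lambda>t. inner (mul (bessel (- a)) (Y t)) (fhat \<phi>)) has_real_derivative inner (mul (bessel (- a)) (y t)) (fhat \<phi>)) (at t within {0..T})"
          unfolding has_real_derivative_iff_has_vector_derivative
          by (intro bounded_linear.has_vector_derivative[OF bounded_linear_inner_left] bounded_linear.has_vector_derivative[OF bl] Y that)
        from DERIV_diff[OF DERIV_diff[OF weak[OF p that] DERIV_const] this] show ?thesis unfolding split by simp
      qed
      obtain c where c: "\<And>t. t \<in> {0..T} \<Longrightarrow> ?f t = c"
        using has_field_derivative_zero_constant[OF convex_closed_interval d] by metis
      have "?f 0 = 0" by (simp add: Y_def bl_simps[OF bl] linear_0[OF bounded_linear.linear[OF bl]])
      then show "?f t = 0" using c[OF t] c[OF 0] by simp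
    qed
    then have "?P t = 0" using mul_bessel_inj[of "- a" "?P t" 0] a by (simp add: linear_0[OF bounded_linear.linear[OF bl]])
    then show ?thesis by (simp add: algebra_simps)
  qed
  have "((\<lambda>t. v 0 + Y t) has_vector_derivative 0 + y t) (at t within {0..T})"
    by (intro has_vector_derivative_add has_vector_derivative_const Y t)
  then have d: "((\<lambda>t. v 0 + Y t) has_vector_derivative y t) (at t within {0..T})" by simp
  show ?thesis by (rule has_vector_derivative_transform[OF t eq d])
qed

text \<open>The flux \<open>(\<partial>\<^sub>X\<^sup>2 A - A\<^sup>2) / 2\<close>, with weights of order \<open>3 + s\<close>, and the time derivative of it,
  with weights of order \<open>s\<close>, where \<open>h\<close> stands for \<open>A\<close> with weights of order \<open>5 + s\<close>.\<close>

definition flux :: "real \<Rightarrow> l2 \<Rightarrow> l2" where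
  "flux s h = (1 / 2) *\<^sub>R (mul riesz (mul riesz h) - wconv (3 + s) (5 + s) (5 + s) h h)"

definition flux' :: "real \<Rightarrow> l2 \<Rightarrow> l2" where
  "flux' s h = (1 / 2) *\<^sub>R mul riesz (mul riesz (mul riesz (flux s h))) - wconv s (2 + s) (2 + s) (mul (bessel (-3)) h) (mul riesz (flux s h))"

lemma herm_scaleR: "herm (c *\<^sub>R u) = c *\<^sub>R herm u" by (simp add: bl_simps[OF bounded_linear_herm])
lemma herm_diff: "herm (u - v) = herm u - herm v" by (simp add: bl_simps[OF bounded_linear_herm])
lemma herm_add: "herm (u + v) = herm u + herm v" by (simp add: bl_simps[OF bounded_linear_herm])
lemma herm_minus: "herm (- u) = - herm u" by (simp add: bl_simps[OF bounded_linear_herm])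

lemma herm_flux:
  assumes s: "s \<ge> 0" and h: "herm h = h"
  shows "herm (flux s h) = flux s h" "herm (flux' s h) = flux' s h"
proof -
  have admissible: "admissible (3 + s) (5 + s) (5 + s)" "admissible s (2 + s) (2 + s)" using s by (auto simp: admissible_def)
  show a: "herm (flux s h) = flux s h"
    by (simp add: flux_def herm_scaleR herm_diff herm_mul_riesz herm_wconv[OF admissible(1)] h)
  show "herm (flux' s h) = flux' s h"
    by (simp add: flux'_def herm_scaleR herm_diff herm_mul_riesz herm_mul_bessel herm_wconv[OF admissible(2)] h a)
qed

lemma continuous_flux:
  assumes s: "s \<ge> 0" and h: "continuous_on S h"
  shows "continuous_on S (\<lambda>t. flux s (h t))" "continuous_on S (\<lambda>t. flux' s (h t))"
proof -
  have admissible: "admissible (3 + s) (5 + s) (5 + s)" "admissible s (2 + s) (2 + s)" using s by (auto simp: admissible_def)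
  note riesz = bounded_linear.continuous_on[OF bounded_linear_mul[OF bdd_mult_riesz]]
  have bessel: "bounded_linear (mul (bessel (-3)))" by (intro bounded_linear_mul bdd_mult_bessel) simp
  show a: "continuous_on S (\<lambda>t. flux s (h t))" unfolding flux_def
    by (intro continuous_intros riesz bounded_bilinear.continuous_on[OF bounded_bilinear_wconv[OF admissible(1)]] h)
  show "continuous_on S (\<lambda>t. flux' s (h t))" unfolding flux'_def
    by (intro continuous_intros riesz bounded_bilinear.continuous_on[OF bounded_bilinear_wconv[OF admissible(2)]]
      bounded_linear.continuous_on[OF bessel] h a)
qed

text \<open>Both sides represent the same product with weight of order s; the orders 5 + s = (2 + s)
  + 3 of the factors are only booked differently.\<close>

lemma wconv_weight_bessel:
  assumes s: "s \<ge> 0"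
  shows "mul (bessel (-3)) (wconv (3 + s) (5 + s) (5 + s) u v) = wconv s (2 + s) (2 + s) (mul (bessel (-3)) u) (mul (bessel (-3)) v)"
proof -
  have admissible: "admissible (3 + s) (5 + s) (5 + s)" "admissible s (2 + s) (2 + s)" "admissible s (5 + s) (5 + s)" using s by (auto simp: admissible_def)
  have "mul (bessel (-3)) (wconv (3 + s) (5 + s) (5 + s) u v) = wconv s (5 + s) (5 + s) u v"
    by (rule wconv_reweight[OF admissible(1) admissible(3), of "-3" 0 0 u v, unfolded mul_bessel_0]) auto
  moreover have "wconv s (2 + s) (2 + s) (mul (bessel (-3)) u) (mul (bessel (-3)) v) = wconv s (5 + s) (5 + s) u v"
    by (rule wconv_reweight[OF admissible(2) admissible(3), of 0 "-3" "-3" u v, unfolded mul_bessel_0]) auto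
  ultimately show ?thesis by (rule trans[OF _ sym])
qed

text \<open>Known is the time derivative of \<open>mul (bessel (-3)) (h t)\<close>, so the flux is
  rewritten in terms of it; the KdV equation in the form A_T = Q_X, with Q the flux, then enters
  through the product rule.\<close>

lemma flux_derivative:
  assumes s: "s \<ge> 0"
    and h: "((\<lambda>t. mul (bessel (-3)) (h t)) has_vector_derivative mul riesz (flux s (h t))) (at t within S)"
  shows "((\<lambda>t. mul (bessel (-3)) (flux s (h t))) has_vector_derivative flux' s (h t)) (at t within S)"
proof -
  have admissible: "admissible s (2 + s) (2 + s)" using s by (auto simp: admissible_def)
  let ?b = "\<lambda>t. mul (bessel (-3)) (h t)" and ?c = "wconv s (2 + s) (2 + s)"
  have bl: "bounded_linear (mul (bessel (-3)))" by (intro bounded_linear_mul bdd_mult_bessel) simp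
  have riesz: "((\<lambda>t. mul riesz (f t)) has_vector_derivative mul riesz f') (at t within S)" if "(f has_vector_derivative f') (at t within S)" for f f'
    by (rule bounded_linear.has_vector_derivative[OF bounded_linear_mul[OF bdd_mult_riesz] that])
  have eq: "mul (bessel (-3)) (flux s (h t)) = (1 / 2) *\<^sub>R (mul riesz (mul riesz (?b t)) - ?c (?b t) (?b t))" for t
    by (simp add: flux_def bl_simps[OF bl] mul_riesz_bessel wconv_weight_bessel[OF s])
  have "((\<lambda>t. (1 / 2) *\<^sub>R (mul riesz (mul riesz (?b t)) - ?c (?b t) (?b t))) has_vector_derivative
    (1 / 2) *\<^sub>R (mul riesz (mul riesz (mul riesz (flux s (h t)))) - (?c (?b t) (mul riesz (flux s (h t))) + ?c (mul riesz (flux s (h t))) (?b t)))) (at t within S)"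
    by (intro bounded_linear.has_vector_derivative[OF bounded_linear_scaleR_right] has_vector_derivative_diff riesz h
      bounded_bilinear.has_vector_derivative[OF bounded_bilinear_wconv[OF admissible]])
  moreover have "(1 / 2) *\<^sub>R (mul riesz (mul riesz (mul riesz (flux s (h t)))) - (?c (?b t) (mul riesz (flux s (h t))) + ?c (mul riesz (flux s (h t))) (?b t))) = flux' s (h t)"
    unfolding flux'_def wconv_commute[of s "2 + s" "2 + s" "mul riesz (flux s (h t))" "?b t"] by (simp add: scaleR_diff_right flip: scaleR_2)
  ultimately show ?thesis unfolding eq by simp
qed

text \<open>In a pairing only the total order of the two weights counts.\<close>

lemma weight_commute: "r \<le> 0 \<Longrightarrow> q \<le> 0 \<Longrightarrow> r' \<le> 0 \<Longrightarrow> q' \<le> 0 \<Longrightarrow> r + q = r' + q' \<Longrightarrow>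
  inner (mul (bessel r) u) (mul (bessel q) v) = inner (mul (bessel r') u) (mul (bessel q') v)"
  by (metis inner_mul_bessel mul_bessel_bessel)

lemma inner_weight_riesz: "r \<le> 0 \<Longrightarrow> q \<le> 0 \<Longrightarrow>
  inner (mul (bessel r) (mul riesz u)) (mul (bessel q) v) = - inner (mul (bessel r) u) (mul (bessel q) (mul riesz v))"
  by (metis mul_riesz_bessel inner_mul_riesz)

text \<open>The weak equation determines the time derivative of \<open>A\<close> as an element of
  H^(2+s), three orders below \<open>A\<close>, whence the smoothing of order 3. Continuity of
  \<open>h\<close>, and so of the flux, lets the equation be integrated in time.\<close>

lemma kdv_profile:
  assumes s: "s \<ge> 0" and A: "continuous_into_sobolev T (5 + s) A" and kdv: "kdv_solution T A"
  obtains h where "\<And>t. t \<in> {0..T} \<Longrightarrow> square_integrable (A t)"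
    "\<And>t. t \<in> {0..T} \<Longrightarrow> fhat (A t) = mul (bessel (- (5 + s))) (h t)"
    "\<And>t. t \<in> {0..T} \<Longrightarrow> herm (h t) = h t" "continuous_on {0..T} h"
    "\<And>t. t \<in> {0..T} \<Longrightarrow> ((\<lambda>t. mul (bessel (-3)) (h t)) has_vector_derivative mul riesz (flux s (h t))) (at t within {0..T})"
proof -
  have "\<exists>g. square_integrable (A t) \<and> fhat (A t) = mul (bessel (- (5 + s))) g" if "t \<in> {0..T}" for t
  proof -
    have "A t \<in> sobolev (5 + s)" using A that by (auto simp: continuous_into_sobolev_def)
    then show ?thesis using s by (elim sobolevD) auto
  qed
  then obtain h where A2: "square_integrable (A t)" and h: "fhat (A t) = mul (bessel (- (5 + s))) (h t)" if "t \<in> {0..T}" for t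
    by metis
  have sgh: "herm (h t) = h t" if "t \<in> {0..T}" for t
  proof (rule mul_bessel_inj)
    show "mul (bessel (- (5 + s))) (herm (h t)) = mul (bessel (- (5 + s))) (h t)"
      using herm_fhat[OF A2[OF that]] s by (simp add: h[OF that] herm_mul_bessel)
  qed (use s in simp)
  have c: "continuous_on {0..T} h"
    unfolding continuous_on_def
  proof
    fix t assume t: "t \<in> {0..T}"
    have "sobolev_norm (5 + s) (\<lambda>x. A t' x - A t x) = ennreal (norm (h t' - h t))" if t': "t' \<in> {0..T}" for t'
    proof (rule sobolevI(2))
      show "square_integrable (\<lambda>x. A t' x - A t x)" by (intro square_integrable_diff A2 t t')
      have bl: "bounded_linear (mul (bessel (- (5 + s))))" using s by (intro bounded_linear_mul bdd_mult_bessel) simp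
      show "fhat (\<lambda>x. A t' x - A t x) = mul (bessel (- (5 + s))) (h t' - h t)"
        by (simp only: fhat_diff[OF A2[OF t'] A2[OF t]] h[OF t'] h[OF t] bl_simps[OF bl])
    qed (use s in simp)
    then have "eventually (\<lambda>t'. sobolev_norm (5 + s) (\<lambda>x. A t' x - A t x) = ennreal (norm (h t' - h t))) (at t within {0..T})"
      by (auto simp: eventually_at_filter)
    moreover have "((\<lambda>t'. sobolev_norm (5 + s) (\<lambda>x. A t' x - A t x)) \<longlongrightarrow> 0) (at t within {0..T})"
      using A t by (auto simp: continuous_into_sobolev_def)
    ultimately have "((\<lambda>t'. ennreal (norm (h t' - h t))) \<longlongrightarrow> ennreal 0) (at t within {0..T})"
      by (simp add: tendsto_cong)
    then have "((\<lambda>t'. norm (h t' - h t)) \<longlongrightarrow> 0) (at t within {0..T})"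
      by (rule tendsto_ennrealD) auto
    then show "(h \<longlongrightarrow> h t) (at t within {0..T})"
      unfolding tendsto_norm_zero_iff by (rule LIM_zero_cancel)
  qed
  have admissible: "admissible (3 + s) (5 + s) (5 + s)" "admissible 0 (5 + s) (5 + s)" using s by (auto simp: admissible_def)
  have d: "((\<lambda>t. mul (bessel (-3)) (h t)) has_vector_derivative mul riesz (flux s (h t))) (at t within {0..T})" if "t \<in> {0..T}" for t
  \<comment> \<open>The order 2 + s is what remains of 5 + s after
    \<open>bessel (-3)\<close>.\<close>
  proof (rule weak_derivative[where a = "2 + s", OF _ _ _ _ _ that])
    show "2 + s \<ge> 0" using s by simp
    show "continuous_on {0..T} (\<lambda>t. mul riesz (flux s (h t)))"
      by (intro bounded_linear.continuous_on[OF bounded_linear_mul[OF bdd_mult_riesz]] continuous_flux s c)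
    show "herm (mul (bessel (-3)) (h t)) = mul (bessel (-3)) (h t)" "herm (mul riesz (flux s (h t))) = mul riesz (flux s (h t))" if "t \<in> {0..T}" for t
      by (simp_all add: herm_mul_bessel herm_mul_riesz sgh[OF that] herm_flux[OF s])
    fix \<phi> t assume p: "test_function \<phi>" and t: "t \<in> {0..T}"
    obtain e where e: "fhat \<phi> = mul (bessel (-4)) e" "fhat (deriv \<phi>) = mul (bessel (-3)) (mul riesz e)"
      "fhat ((deriv ^^ 3) \<phi>) = mul (bessel (-1)) (mul riesz (mul riesz (mul riesz e)))"
      using test_function_weighted[OF p] by metis
    have p1: "test_function (deriv \<phi>)" "test_function ((deriv ^^ 3) \<phi>)"
      using p by (simp_all add: test_function_deriv numeral_3_eq_3)
    note q = square_integrable_test[OF p] square_integrable_test[OF p1(1)] square_integrable_test[OF p1(2)]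
    have A0: "((\<lambda>t. LINT x|lborel. A t x * \<phi> x) has_real_derivative
          (LINT x|lborel. - (1/2) * (A t x * (deriv ^^ 3) \<phi> x) + (1/2) * ((A t x)\<^sup>2 * deriv \<phi> x))) (at t within {0..T})"
      using kdv p t unfolding kdv_solution_def by blast
    have lhs: "(LINT x|lborel. A t x * \<phi> x) = inner (mul (bessel (- (2 + s))) (mul (bessel (-3)) (h t))) (fhat \<phi>)" if t: "t \<in> {0..T}" for t
      using inner_fhat[OF A2[OF t] q(1)] s by (simp add: h[OF t] mul_bessel_bessel add.commute)
    let ?c = "wconv (3 + s) (5 + s) (5 + s) (h t) (h t)"
    have sq2: "square_integrable (\<lambda>x. A t x * A t x)" "fhat (\<lambda>x. A t x * A t x) = wconv 0 (5 + s) (5 + s) (h t) (h t)"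
      using fhat_mult[OF A2[OF t] h[OF t] A2[OF t] h[OF t]] s by auto
    have c0: "wconv 0 (5 + s) (5 + s) (h t) (h t) = mul (bessel (- (3 + s))) ?c"
      using wconv_reweight[OF admissible, of "- (3 + s)" 0 0 "h t" "h t"] s by simp
    have "(LINT x|lborel. - (1/2) * (A t x * (deriv ^^ 3) \<phi> x) + (1/2) * ((A t x)\<^sup>2 * deriv \<phi> x))
      = - (1/2) * inner (fhat (A t)) (fhat ((deriv ^^ 3) \<phi>)) + 1/2 * inner (fhat (\<lambda>x. A t x * A t x)) (fhat (deriv \<phi>))"
      unfolding inner_fhat[OF A2[OF t] q(3)] inner_fhat[OF sq2(1) q(2)]
      using integrable_mult_square_integrable[OF A2[OF t] q(3)] integrable_mult_square_integrable[OF sq2(1) q(2)]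
      by (subst Bochner_Integration.integral_add) (auto simp: power2_eq_square)
    also have "\<dots> = inner (mul (bessel (- (2 + s))) (mul riesz (flux s (h t)))) (fhat \<phi>)"
    proof -
      have "inner (mul (bessel (- (2 + s))) (mul riesz (mul riesz (mul riesz (h t))))) (fhat \<phi>) = - inner (fhat (A t)) (fhat ((deriv ^^ 3) \<phi>))"
      proof -
        have "inner (mul (bessel (- (2 + s))) (mul riesz (mul riesz (mul riesz (h t))))) (mul (bessel (-4)) e) = - inner (mul (bessel (- (2 + s))) (h t)) (mul (bessel (-4)) (mul riesz (mul riesz (mul riesz e))))"
          using s by (simp add: inner_weight_riesz)
        also have "inner (mul (bessel (- (2 + s))) (h t)) (mul (bessel (-4)) (mul riesz (mul riesz (mul riesz e)))) = inner (mul (bessel (- (5 + s))) (h t)) (mul (bessel (-1)) (mul riesz (mul riesz (mul riesz e))))"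
          using s by (intro weight_commute) auto
        finally show ?thesis by (simp only: e h[OF t])
      qed
      moreover have "inner (mul (bessel (- (2 + s))) (mul riesz ?c)) (fhat \<phi>) = - inner (fhat (\<lambda>x. A t x * A t x)) (fhat (deriv \<phi>))"
      proof -
        have "inner (mul (bessel (- (2 + s))) (mul riesz ?c)) (mul (bessel (-4)) e) = - inner (mul (bessel (- (2 + s))) ?c) (mul (bessel (-4)) (mul riesz e))"
          using s by (simp add: inner_weight_riesz)
        also have "inner (mul (bessel (- (2 + s))) ?c) (mul (bessel (-4)) (mul riesz e)) = inner (mul (bessel (- (3 + s))) ?c) (mul (bessel (-3)) (mul riesz e))"
          using s by (intro weight_commute) auto
        finally show ?thesis by (simp only: e sq2 c0)
      qed
      moreover have bl: "bounded_linear (mul (bessel (- (2 + s))))" using s by (intro bounded_linear_mul bdd_mult_bessel) simp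
      have "inner (mul (bessel (- (2 + s))) (mul riesz (flux s (h t)))) (fhat \<phi>) = 1/2 * (inner (mul (bessel (- (2 + s))) (mul riesz (mul riesz (mul riesz (h t))))) (fhat \<phi>) - inner (mul (bessel (- (2 + s))) (mul riesz ?c)) (fhat \<phi>))"
        by (simp only: flux_def bl_simps[OF bl] bl_simps[OF bounded_linear_mul[OF bdd_mult_riesz]] inner_scaleR_left inner_diff_left)
      ultimately show ?thesis by simp
    qed
    finally have "((\<lambda>t. LINT x|lborel. A t x * \<phi> x) has_real_derivative inner (mul (bessel (- (2 + s))) (mul riesz (flux s (h t)))) (fhat \<phi>)) (at t within {0..T})"
      using A0 by simp
    then show "((\<lambda>t. inner (mul (bessel (- (2 + s))) (mul (bessel (-3)) (h t))) (fhat \<phi>)) has_real_derivative inner (mul (bessel (- (2 + s))) (mul riesz (flux s (h t)))) (fhat \<phi>)) (at t within {0..T})"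
      by (rule has_field_derivative_transform_within[OF _ zero_less_one t]) (simp add: lhs)
  qed
  show ?thesis by (rule that[of h]) (use A2 h sgh c d in blast)+
qed

section \<open>From the Fourier side to solutions of the Boussinesq equation\<close>

text \<open>The identity (1 + k^2) / (1 + k^2) = 1, with the two summands written as bounded
  multipliers. It merges the second and the fourth derivative of a test function.\<close>

lemma bessel_m2_X2: "mul (bessel (-2)) w - mul riesz (mul riesz w) = w"
proof (induction w rule: l2_induct_l2_of)
  case (1 f)
  have bJ: "bdd_mult (bessel (-2))" by (rule bdd_mult_bessel) simp
  have s: "sq (\<lambda>k. bessel (-2) k * f k)" "sq (\<lambda>k. riesz k * f k)" "sq (\<lambda>k. riesz k * (riesz k * f k))" by (intro sq_bdd_mult bJ bdd_mult_riesz 1)+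
  have "bessel (-2) k - riesz k * riesz k = 1" for k
  proof -
    have "riesz k * riesz k = - of_real (k\<^sup>2) * (bessel (-1) k * bessel (-1) k)" by (simp add: riesz_eq power2_eq_square algebra_simps)
    also have "bessel (-1) k * bessel (-1) k = bessel (-2) k" by (simp add: bessel_mult)
    finally have "bessel (-2) k - riesz k * riesz k = (1 + of_real (k\<^sup>2)) * bessel (-2) k" by (simp add: algebra_simps)
    also have "1 + of_real (k\<^sup>2) = bessel 2 k" by (simp add: bessel_def bracket_2)
    finally show ?thesis by (simp add: bessel_mult)
  qed
  then have "bessel (-2) k * f k - riesz k * (riesz k * f k) = f k" for k
    by (metis left_diff_distrib mult.assoc mult_1)
  then show ?case by (simp add: mul_l2_of bJ bdd_mult_riesz 1 s l2_of_diff)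
qed

text \<open>The smoothing in the hypotheses is paid for by the decay of the test function's
  transform: in each pairing the weights are redistributed so that \<open>bessel (-2)\<close> stands
  on the differentiated unknown.\<close>

lemma boussinesq_from_profile:
  assumes s: "s \<ge> 0" and sgu: "\<And>t. t \<in> {0..T} \<Longrightarrow> herm (u t) = u t"
    and du: "\<And>t. t \<in> {0..T} \<Longrightarrow> ((\<lambda>t. mul (bessel (-2)) (u t)) has_vector_derivative mul riesz (p t)) (at t within {0..T})"
    and dp: "\<And>t. t \<in> {0..T} \<Longrightarrow> ((\<lambda>t. mul (bessel (-2)) (p t)) has_vector_derivative
       mul riesz (u t) + mul (bessel (-2)) (mul riesz (wconv (1 + s) (1 + s) (1 + s) (u t) (u t)))) (at t within {0..T})"
  shows "boussinesq_solution T (\<lambda>t. physical (mul (bessel (- (1 + s))) (u t)))"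
  unfolding boussinesq_solution_def
proof (intro allI impI)
  fix \<phi> assume t: "test_function \<phi>"
  obtain e where e: "fhat \<phi> = mul (bessel (-4)) e" "fhat ((deriv ^^ 2) \<phi>) = mul (bessel (-2)) (mul riesz (mul riesz e))"
      "fhat ((deriv ^^ 4) \<phi>) = mul riesz (mul riesz (mul riesz (mul riesz e)))"
    using test_function_weighted[OF t] by metis
  have t24: "test_function ((deriv ^^ 2) \<phi>)" "test_function ((deriv ^^ 4) \<phi>)"
    using t by (simp_all add: test_function_deriv eval_nat_numeral)
  note q = square_integrable_test[OF t] square_integrable_test[OF t24(1)] square_integrable_test[OF t24(2)]
  let ?u = "\<lambda>t. physical (mul (bessel (- (1 + s))) (u t))"
  have u: "square_integrable (?u t)" "fhat (?u t) = mul (bessel (- (1 + s))) (u t)" if "t \<in> {0..T}" for t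
  proof -
    have "herm (mul (bessel (- (1 + s))) (u t)) = mul (bessel (- (1 + s))) (u t)" using s sgu[OF that] by (simp add: herm_mul_bessel)
    from physical[OF this] show "square_integrable (?u t)" "fhat (?u t) = mul (bessel (- (1 + s))) (u t)" by auto
  qed
  \<comment> \<open>As u_t = p_x, this is the pairing of p with the negative of
    \<open>deriv \<phi>\<close>, with two orders of smoothing placed on p to make it
    differentiable.\<close>
  define v where "v t = - inner (mul (bessel (-2)) (p t)) (mul (bessel (- (1 + s))) (mul riesz e))" for t
  show "\<exists>v. \<forall>t\<in>{0..T}. ((\<lambda>t'. LINT x|lborel. ?u t' x * \<phi> x) has_real_derivative v t) (at t within {0..T}) \<and>
        (v has_real_derivative
          (LINT x|lborel. ?u t x * (deriv ^^ 2) \<phi> x - ?u t x * (deriv ^^ 4) \<phi> x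
                          + (?u t x)\<^sup>2 * (deriv ^^ 2) \<phi> x)) (at t within {0..T})"
  proof (intro exI[of _ v] ballI conjI)
    fix t assume t: "t \<in> {0..T}"
    have pair: "(LINT x|lborel. ?u t x * \<phi> x) = inner (mul (bessel (-2)) (u t)) (mul (bessel (- (3 + s))) e)" if "t \<in> {0..T}" for t
    proof -
      have "(LINT x|lborel. ?u t x * \<phi> x) = inner (mul (bessel (- (1 + s))) (u t)) (mul (bessel (-4)) e)"
        using inner_fhat[OF u(1)[OF that] q(1)] by (simp only: u(2)[OF that] e)
      also have "\<dots> = inner (mul (bessel (-2)) (u t)) (mul (bessel (- (3 + s))) e)" using s by (intro weight_commute) auto
      finally show ?thesis .
    qed
    have "((\<lambda>t. inner (mul (bessel (-2)) (u t)) (mul (bessel (- (3 + s))) e)) has_real_derivative inner (mul riesz (p t)) (mul (bessel (- (3 + s))) e)) (at t within {0..T})"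
      unfolding has_real_derivative_iff_has_vector_derivative
      by (intro bounded_linear.has_vector_derivative[OF bounded_linear_inner_left] du t)
    moreover have "inner (mul riesz (p t)) (mul (bessel (- (3 + s))) e) = v t"
    proof -
      have "inner (mul riesz (p t)) (mul (bessel (- (3 + s))) e) = - inner (mul (bessel 0) (p t)) (mul (bessel (- (3 + s))) (mul riesz e))"
        using inner_weight_riesz[of 0 "- (3 + s)" "p t" e] s by simp
      also have "inner (mul (bessel 0) (p t)) (mul (bessel (- (3 + s))) (mul riesz e)) = inner (mul (bessel (-2)) (p t)) (mul (bessel (- (1 + s))) (mul riesz e))"
        using s by (intro weight_commute) auto
      finally show ?thesis by (simp only: v_def)
    qed
    ultimately have "((\<lambda>t. inner (mul (bessel (-2)) (u t)) (mul (bessel (- (3 + s))) e)) has_real_derivative v t) (at t within {0..T})" by simp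
    then show "((\<lambda>t'. LINT x|lborel. ?u t' x * \<phi> x) has_real_derivative v t) (at t within {0..T})"
      by (rule has_field_derivative_transform_within[OF _ zero_less_one t]) (simp only: pair)
    let ?c = "wconv (1 + s) (1 + s) (1 + s) (u t) (u t)"
    have admissible: "admissible (1 + s) (1 + s) (1 + s)" "admissible 0 (1 + s) (1 + s)" using s by (auto simp: admissible_def)
    have c0: "wconv 0 (1 + s) (1 + s) (u t) (u t) = mul (bessel (- (1 + s))) ?c"
      by (rule wconv_reweight[OF admissible, of "- (1 + s)" 0 0 "u t" "u t", unfolded mul_bessel_0, symmetric]) (use s in auto)
    have sq2: "square_integrable (\<lambda>x. ?u t x * ?u t x)" "fhat (\<lambda>x. ?u t x * ?u t x) = mul (bessel (- (1 + s))) ?c"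
      using fhat_mult[OF u[OF t] u[OF t]] s by (auto simp: c0)
    have "(v has_real_derivative - inner (mul riesz (u t) + mul (bessel (-2)) (mul riesz ?c)) (mul (bessel (- (1 + s))) (mul riesz e))) (at t within {0..T})"
      unfolding v_def has_real_derivative_iff_has_vector_derivative
      by (intro has_vector_derivative_minus bounded_linear.has_vector_derivative[OF bounded_linear_inner_left] dp t)
    moreover have "- inner (mul riesz (u t) + mul (bessel (-2)) (mul riesz ?c)) (mul (bessel (- (1 + s))) (mul riesz e))
      = (LINT x|lborel. ?u t x * (deriv ^^ 2) \<phi> x - ?u t x * (deriv ^^ 4) \<phi> x + (?u t x)\<^sup>2 * (deriv ^^ 2) \<phi> x)"
    proof -
      have "(LINT x|lborel. ?u t x * (deriv ^^ 2) \<phi> x - ?u t x * (deriv ^^ 4) \<phi> x + (?u t x)\<^sup>2 * (deriv ^^ 2) \<phi> x)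
        = inner (fhat (?u t)) (fhat ((deriv ^^ 2) \<phi>)) - inner (fhat (?u t)) (fhat ((deriv ^^ 4) \<phi>)) + inner (fhat (\<lambda>x. ?u t x * ?u t x)) (fhat ((deriv ^^ 2) \<phi>))"
        unfolding inner_fhat[OF u(1)[OF t] q(2)] inner_fhat[OF u(1)[OF t] q(3)] inner_fhat[OF sq2(1) q(2)]
        using integrable_mult_square_integrable[OF u(1)[OF t] q(2)] integrable_mult_square_integrable[OF u(1)[OF t] q(3)]
          integrable_mult_square_integrable[OF sq2(1) q(2)] by (simp add: power2_eq_square)
      also have "\<dots> = inner (mul (bessel (- (1 + s))) (u t)) (mul (bessel (-2)) (mul riesz (mul riesz e)) - mul riesz (mul riesz (mul riesz (mul riesz e))))
        + inner (mul (bessel (- (1 + s))) ?c) (mul (bessel (-2)) (mul riesz (mul riesz e)))"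
        by (simp only: u(2)[OF t] e sq2 inner_diff_right)
      also have "mul (bessel (-2)) (mul riesz (mul riesz e)) - mul riesz (mul riesz (mul riesz (mul riesz e))) = mul riesz (mul riesz e)" by (rule bessel_m2_X2)
      also have "inner (mul (bessel (- (1 + s))) (u t)) (mul riesz (mul riesz e)) = - inner (mul riesz (u t)) (mul (bessel (- (1 + s))) (mul riesz e))"
      proof -
        have "inner (mul (bessel (- (1 + s))) (u t)) (mul riesz (mul riesz e)) = inner (u t) (mul (bessel (- (1 + s))) (mul riesz (mul riesz e)))"
          using s by (simp add: inner_mul_bessel)
        also have "\<dots> = inner (u t) (mul riesz (mul (bessel (- (1 + s))) (mul riesz e)))" using s by (simp add: mul_riesz_bessel)
        also have "\<dots> = - inner (mul riesz (u t)) (mul (bessel (- (1 + s))) (mul riesz e))" by (simp add: inner_mul_riesz)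
        finally show ?thesis .
      qed
      also have "inner (mul (bessel (- (1 + s))) ?c) (mul (bessel (-2)) (mul riesz (mul riesz e))) = - inner (mul (bessel (-2)) (mul riesz ?c)) (mul (bessel (- (1 + s))) (mul riesz e))"
      proof -
        have "inner (mul (bessel (- (1 + s))) ?c) (mul (bessel (-2)) (mul riesz (mul riesz e))) = inner (mul (bessel (-2)) ?c) (mul (bessel (- (1 + s))) (mul riesz (mul riesz e)))"
          using s by (intro weight_commute) auto
        also have "\<dots> = - inner (mul (bessel (-2)) (mul riesz ?c)) (mul (bessel (- (1 + s))) (mul riesz e))" using s by (subst inner_weight_riesz) auto
        finally show ?thesis .
      qed
      finally show ?thesis by (simp add: inner_add_left)
    qed
    ultimately show "(v has_real_derivative
          (LINT x|lborel. ?u t x * (deriv ^^ 2) \<phi> x - ?u t x * (deriv ^^ 4) \<phi> x + (?u t x)\<^sup>2 * (deriv ^^ 2) \<phi> x)) (at t within {0..T})"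
      by (rule subst[rotated])
  qed
qed

lemma physical_sobolev:
  assumes r: "r \<ge> 0" and u: "herm u = u"
  shows "square_integrable (physical (mul (bessel (- r)) u))" "fhat (physical (mul (bessel (- r)) u)) = mul (bessel (- r)) u"
  using physical[of "mul (bessel (- r)) u"] r u by (auto simp: herm_mul_bessel)

lemma continuous_into_sobolev_physical:
  assumes r: "r \<ge> 0" and sgu: "\<And>t. t \<in> {0..T} \<Longrightarrow> herm (u t) = u t" and c: "continuous_on {0..T} u"
  shows "continuous_into_sobolev T r (\<lambda>t. physical (mul (bessel (- r)) (u t)))"
  unfolding continuous_into_sobolev_def
proof (intro ballI conjI)
  fix t assume t: "t \<in> {0..T}"
  note p = physical_sobolev[OF r sgu]
  show "physical (mul (bessel (- r)) (u t)) \<in> sobolev r" by (rule sobolevI(1)[OF p[OF t] r])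
  have bl: "bounded_linear (mul (bessel (- r)))" using r by (intro bounded_linear_mul bdd_mult_bessel) simp
  have n: "sobolev_norm r (\<lambda>x. physical (mul (bessel (- r)) (u t')) x - physical (mul (bessel (- r)) (u t)) x) = ennreal (norm (u t' - u t))"
    if t': "t' \<in> {0..T}" for t'
  proof (rule sobolevI(2)[OF _ _ r])
    show "square_integrable (\<lambda>x. physical (mul (bessel (- r)) (u t')) x - physical (mul (bessel (- r)) (u t)) x)"
      by (intro square_integrable_diff p t t')
    show "fhat (\<lambda>x. physical (mul (bessel (- r)) (u t')) x - physical (mul (bessel (- r)) (u t)) x) = mul (bessel (- r)) (u t' - u t)"
      by (simp only: fhat_diff[OF p(1)[OF t'] p(1)[OF t]] p(2)[OF t] p(2)[OF t'] bl_simps[OF bl])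
  qed
  have "(u \<longlongrightarrow> u t) (at t within {0..T})" using c t unfolding continuous_on_def by blast
  then have "((\<lambda>t'. norm (u t' - u t)) \<longlongrightarrow> 0) (at t within {0..T})" by (intro tendsto_norm_zero LIM_zero)
  then have "((\<lambda>t'. ennreal (norm (u t' - u t))) \<longlongrightarrow> ennreal 0) (at t within {0..T})" by (rule tendsto_ennrealI)
  moreover have "eventually (\<lambda>t'. sobolev_norm r (\<lambda>x. physical (mul (bessel (- r)) (u t')) x - physical (mul (bessel (- r)) (u t)) x) = ennreal (norm (u t' - u t))) (at t within {0..T})"
    using n by (auto simp: eventually_at_filter)
  ultimately show "((\<lambda>t'. sobolev_norm r (\<lambda>x. physical (mul (bessel (- r)) (u t')) x - physical (mul (bessel (- r)) (u t)) x)) \<longlongrightarrow> 0) (at t within {0..T})"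
    by (simp add: tendsto_cong)
qed

section \<open>The approximation\<close>

lemma rescaled_derivative:
  fixes f :: "real \<Rightarrow> 'a::real_normed_vector"
  assumes e: "e > 0" and f: "\<And>t. t \<in> {0..T} \<Longrightarrow> (f has_vector_derivative f' t) (at t within {0..T})"
    and t: "t \<in> {0..T / e}"
  shows "((\<lambda>t. f (e * t)) has_vector_derivative e *\<^sub>R f' (e * t)) (at t within {0..T / e})"
proof -
  have i: "(\<lambda>t. e * t) ` {0..T / e} \<subseteq> {0..T}" using e by (auto simp: field_simps)
  have "((\<lambda>t. e * t) has_vector_derivative e) (at t within {0..T / e})"
    by (auto intro!: derivative_eq_intros simp flip: has_real_derivative_iff_has_vector_derivative)
  moreover have "(f has_vector_derivative f' (e * t)) (at (e * t) within (\<lambda>t. e * t) ` {0..T / e})"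
    by (rule has_vector_derivative_within_subset[OF f i]) (use t e in \<open>auto simp: field_simps\<close>)
  ultimately show ?thesis using vector_diff_chain_within[of "\<lambda>t. e * t" e t "{0..T / e}" f] by (simp add: o_def)
qed

context
  fixes s e :: real and H :: "real \<Rightarrow> l2"
  assumes s: "s \<ge> 0" and e: "0 < e" "e \<le> 1"
begin

text \<open>\<open>H\<close> is the profile with weight of order 5 + s at slow time;
  \<open>bessel (-4)\<close> turns this into the order 1 + s of the error.\<close>

definition ansatz :: "real \<Rightarrow> l2" where
  "ansatz t = long_wave e (1 + s) t (mul (bessel (-4)) (H t))"

text \<open>This is the time derivative in the form that bounds it by \<open>e\<^sup>3\<close> in \<open>L\<^sup>\<infinity>\<close>.\<close>

definition ansatz' :: "real \<Rightarrow> l2" where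
  "ansatz' t = e *\<^sub>R long_wave e (1 + s) t (mul (bessel (-1)) (mul riesz (e\<^sup>2 *\<^sub>R flux s (H t) - mul (bessel (-2)) (H t))))"

text \<open>The companion p, with weight of order s: the flux is lowered from 3 + s and the profile
  from 5 + s. The common amplitude e^2 is part of \<open>long_wave\<close>.\<close>

definition ansatz_flux :: "real \<Rightarrow> l2" where
  "ansatz_flux t = long_wave e s t (e\<^sup>2 *\<^sub>R mul (bessel (-3)) (flux s (H t)) - mul (bessel (-5)) (H t))"

lemma s1: "1 + s \<ge> 0" using s by simp

lemmas lin_long_wave = bl_simps[OF bounded_linear_long_wave[OF e]]
lemma blJ: "r \<le> 0 \<Longrightarrow> bounded_linear (mul (bessel r))" by (intro bounded_linear_mul bdd_mult_bessel)
lemmas lin_riesz = bl_simps[OF bounded_linear_mul[OF bdd_mult_riesz]]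
lemmas lin_bessel = bl_simps[OF blJ]

lemma ansatz_derivative:
  assumes dH: "((\<lambda>t. mul (bessel (-3)) (H t)) has_vector_derivative e ^ 3 *\<^sub>R mul riesz (flux s (H t))) (at t within S)"
  shows "(ansatz has_vector_derivative ansatz' t) (at t within S)"
proof -
  let ?Q = "flux s (H t)"
  have "((\<lambda>t. mul (bessel (-1)) (mul (bessel (-3)) (H t))) has_vector_derivative mul (bessel (-1)) (e ^ 3 *\<^sub>R mul riesz ?Q)) (at t within S)"
    by (rule bounded_linear.has_vector_derivative[OF blJ dH]) simp
  then have "((\<lambda>t. mul (bessel (-4)) (H t)) has_vector_derivative e ^ 3 *\<^sub>R mul (bessel (-1)) (mul riesz ?Q)) (at t within S)"
    by (simp add: mul_bessel_bessel lin_bessel)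
  from long_wave_derivative[OF e s1 this, of "mul (bessel (-3)) (H t)"]
  have "(ansatz has_vector_derivative long_wave e (1 + s) t (e ^ 3 *\<^sub>R mul (bessel (-1)) (mul riesz ?Q)) - e *\<^sub>R long_wave e (1 + s) t (mul riesz (mul (bessel (-3)) (H t)))) (at t within S)"
    by (simp add: mul_bessel_bessel flip: ansatz_def[abs_def])
  moreover have "long_wave e (1 + s) t (e ^ 3 *\<^sub>R mul (bessel (-1)) (mul riesz ?Q)) - e *\<^sub>R long_wave e (1 + s) t (mul riesz (mul (bessel (-3)) (H t))) = ansatz' t"
    by (simp add: ansatz'_def lin_long_wave[OF s1] lin_riesz lin_bessel mul_riesz_bessel mul_bessel_bessel scaleR_diff_right power3_eq_cube power2_eq_square)
  ultimately show ?thesis by simp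
qed

text \<open>The first equation of the system, u_t = p_x, which the approximation satisfies without
  residual.\<close>

lemma ansatz'_ansatz_flux: "mul (bessel (-2)) (ansatz' t) = mul riesz (ansatz_flux t)"
proof -
  let ?w = "e\<^sup>2 *\<^sub>R flux s (H t) - mul (bessel (-2)) (H t)"
  have "mul riesz (long_wave e (2 + s) t (mul (bessel (-1)) ?w)) = e *\<^sub>R long_wave e (1 + s) t (mul riesz (mul (bessel (-1)) ?w))"
    using s by (intro long_wave_riesz e) auto
  then have 1: "ansatz' t = mul riesz (long_wave e (2 + s) t (mul (bessel (-1)) ?w))" by (simp add: ansatz'_def mul_riesz_bessel)
  have "mul (bessel (-2)) (long_wave e (2 + s) t (mul (bessel (-1)) ?w)) = long_wave e s t (mul (bessel (-2)) (mul (bessel (-1)) ?w))"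
    using s by (intro long_wave_bessel e) auto
  also have "\<dots> = ansatz_flux t" by (simp add: ansatz_flux_def mul_bessel_bessel lin_bessel)
  finally show ?thesis by (simp add: 1 flip: mul_riesz_bessel)
qed

text \<open>The derivative of the flux Q enters twice with the factor -e^5, through the slow time
  derivative of -e^2 A and through the translation of e^4 Q; this doubling cancels the 1/2 in Q and
  yields the dispersive and the nonlinear term. The residual is e^7 times the slow time derivative
  of Q, here e^5 times a wave of amplitude e^2.\<close>

lemma ansatz_flux_derivative:
  assumes dH: "((\<lambda>t. mul (bessel (-3)) (H t)) has_vector_derivative e ^ 3 *\<^sub>R mul riesz (flux s (H t))) (at t within S)"
    and dQ: "((\<lambda>t. mul (bessel (-3)) (flux s (H t))) has_vector_derivative e ^ 3 *\<^sub>R flux' s (H t)) (at t within S)"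
  shows "((\<lambda>t. mul (bessel (-2)) (ansatz_flux t)) has_vector_derivative mul riesz (ansatz t) +
    mul (bessel (-2)) (mul riesz (wconv (1 + s) (1 + s) (1 + s) (ansatz t) (ansatz t)) + e ^ 5 *\<^sub>R long_wave e s t (flux' s (H t)))) (at t within S)"
proof -
  let ?Q = "flux s (H t)" and ?h = "H t"
  let ?c = "wconv (3 + s) (5 + s) (5 + s) ?h ?h" and ?q = "wconv (1 + s) (1 + s) (1 + s)"
  have "((\<lambda>t. e\<^sup>2 *\<^sub>R mul (bessel (-3)) (flux s (H t)) - mul (bessel (-2)) (mul (bessel (-3)) (H t))) has_vector_derivative
    e\<^sup>2 *\<^sub>R (e ^ 3 *\<^sub>R flux' s (H t)) - mul (bessel (-2)) (e ^ 3 *\<^sub>R mul riesz ?Q)) (at t within S)"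
    by (intro has_vector_derivative_diff bounded_linear.has_vector_derivative[OF bounded_linear_scaleR_right]
      bounded_linear.has_vector_derivative[OF blJ] dH dQ) simp
  then have d: "((\<lambda>t. e\<^sup>2 *\<^sub>R mul (bessel (-3)) (flux s (H t)) - mul (bessel (-5)) (H t)) has_vector_derivative
    e ^ 5 *\<^sub>R flux' s (H t) - e ^ 3 *\<^sub>R mul (bessel (-2)) (mul riesz ?Q)) (at t within S)"
    by (simp add: mul_bessel_bessel lin_bessel flip: power_add)
  have v: "e\<^sup>2 *\<^sub>R mul (bessel (-3)) ?Q - mul (bessel (-5)) ?h = mul (bessel (-1)) (e\<^sup>2 *\<^sub>R mul (bessel (-2)) ?Q - mul (bessel (-4)) ?h)"
    by (simp add: lin_bessel mul_bessel_bessel)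
  have "(ansatz_flux has_vector_derivative long_wave e s t (e ^ 5 *\<^sub>R flux' s (H t) - e ^ 3 *\<^sub>R mul (bessel (-2)) (mul riesz ?Q))
     - e *\<^sub>R long_wave e s t (mul riesz (e\<^sup>2 *\<^sub>R mul (bessel (-2)) ?Q - mul (bessel (-4)) ?h))) (at t within S)"
    using long_wave_derivative[OF e s d v] by (simp flip: ansatz_flux_def[abs_def])
  from bounded_linear.has_vector_derivative[OF blJ this, of "-2"]
  have D: "((\<lambda>t. mul (bessel (-2)) (ansatz_flux t)) has_vector_derivative mul (bessel (-2)) (long_wave e s t (e ^ 5 *\<^sub>R flux' s (H t) - e ^ 3 *\<^sub>R mul (bessel (-2)) (mul riesz ?Q))
     - e *\<^sub>R long_wave e s t (mul riesz (e\<^sup>2 *\<^sub>R mul (bessel (-2)) ?Q - mul (bessel (-4)) ?h)))) (at t within S)" by simp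
  let ?w = "mul riesz (mul (bessel (-2)) ?h)"
  have Q2: "2 *\<^sub>R mul (bessel (-2)) ?Q = mul (bessel (-2)) (mul riesz (mul riesz ?h)) - mul (bessel (-2)) ?c"
    by (simp add: flux_def lin_bessel)
  have E1: "e ^ 3 *\<^sub>R mul (bessel (-2)) (mul riesz ?Q) + e *\<^sub>R mul riesz (e\<^sup>2 *\<^sub>R mul (bessel (-2)) ?Q - mul (bessel (-4)) ?h)
     = e ^ 3 *\<^sub>R mul riesz (2 *\<^sub>R mul (bessel (-2)) ?Q) - e *\<^sub>R mul riesz (mul (bessel (-4)) ?h)"
    by (simp add: lin_riesz mul_riesz_bessel scaleR_diff_right scaleR_2 power3_eq_cube power2_eq_square algebra_simps)
  have E2: "e ^ 5 *\<^sub>R flux' s (H t) - e ^ 3 *\<^sub>R mul (bessel (-2)) (mul riesz ?Q) - e *\<^sub>R mul riesz (e\<^sup>2 *\<^sub>R mul (bessel (-2)) ?Q - mul (bessel (-4)) ?h)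
     = e *\<^sub>R (mul (bessel (-2)) ?w - e\<^sup>2 *\<^sub>R mul riesz (mul riesz ?w)) + e ^ 3 *\<^sub>R mul riesz (mul (bessel (-2)) ?c) + e ^ 5 *\<^sub>R flux' s (H t)"
  proof -
    have "e ^ 5 *\<^sub>R flux' s (H t) - e ^ 3 *\<^sub>R mul (bessel (-2)) (mul riesz ?Q) - e *\<^sub>R mul riesz (e\<^sup>2 *\<^sub>R mul (bessel (-2)) ?Q - mul (bessel (-4)) ?h)
      = e ^ 5 *\<^sub>R flux' s (H t) - (e ^ 3 *\<^sub>R mul riesz (2 *\<^sub>R mul (bessel (-2)) ?Q) - e *\<^sub>R mul riesz (mul (bessel (-4)) ?h))"
      unfolding E1[symmetric] by (simp add: algebra_simps)
    also have "\<dots> = e *\<^sub>R (mul (bessel (-2)) ?w - e\<^sup>2 *\<^sub>R mul riesz (mul riesz ?w)) + e ^ 3 *\<^sub>R mul riesz (mul (bessel (-2)) ?c) + e ^ 5 *\<^sub>R flux' s (H t)"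
      unfolding Q2 by (simp add: lin_riesz mul_riesz_bessel mul_bessel_bessel scaleR_diff_right power3_eq_cube power2_eq_square)
    finally show ?thesis .
  qed
  \<comment> \<open>The linear terms of orders e and e^3 together form the profile of x-derivatives
    of u - u_xx.\<close>
  have W2: "long_wave e s t (mul (bessel (-2)) ?w - e\<^sup>2 *\<^sub>R mul riesz (mul riesz ?w)) = long_wave e (2 + s) t ?w"
    using long_wave_2[OF e s, of "2 + s" t ?w] by simp
  have lin: "e *\<^sub>R mul (bessel (-2)) (long_wave e (2 + s) t ?w) = mul riesz (ansatz t)"
  proof -
    have "mul (bessel (-2)) (long_wave e (2 + s) t ?w) = long_wave e s t (mul (bessel (-2)) ?w)" using s by (intro long_wave_bessel e) auto
    moreover have "mul riesz (ansatz t) = e *\<^sub>R long_wave e s t (mul riesz (mul (bessel (-4)) ?h))" unfolding ansatz_def using s by (intro long_wave_riesz e) auto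
    ultimately show ?thesis by (simp add: mul_riesz_bessel mul_bessel_bessel)
  qed
  have quad: "mul riesz (?q (ansatz t) (ansatz t)) = e ^ 3 *\<^sub>R long_wave e s t (mul riesz (mul (bessel (-2)) ?c))"
  proof -
    have admissible: "admissible (1 + s) (1 + s) (1 + s)" "admissible (3 + s) (5 + s) (5 + s)" "admissible (1 + s) (5 + s) (5 + s)" using s by (auto simp: admissible_def)
    have "?q (ansatz t) (ansatz t) = e\<^sup>2 *\<^sub>R long_wave e (1 + s) t (?q (mul (bessel (-4)) ?h) (mul (bessel (-4)) ?h))"
      unfolding ansatz_def by (rule long_wave_wconv[OF e admissible(1)])
    also have "?q (mul (bessel (-4)) ?h) (mul (bessel (-4)) ?h) = wconv (1 + s) (5 + s) (5 + s) ?h ?h"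
      by (rule wconv_reweight[OF admissible(1) admissible(3), of 0 "-4" "-4" ?h ?h, unfolded mul_bessel_0]) auto
    also have "\<dots> = mul (bessel (-2)) ?c"
      by (rule wconv_reweight[OF admissible(2) admissible(3), of "-2" 0 0 ?h ?h, unfolded mul_bessel_0, symmetric]) auto
    finally have "mul riesz (?q (ansatz t) (ansatz t)) = e\<^sup>2 *\<^sub>R mul riesz (long_wave e (1 + s) t (mul (bessel (-2)) ?c))" by (simp only: lin_riesz)
    also have "mul riesz (long_wave e (1 + s) t (mul (bessel (-2)) ?c)) = e *\<^sub>R long_wave e s t (mul riesz (mul (bessel (-2)) ?c))" using s by (intro long_wave_riesz e) auto
    finally show ?thesis by (simp add: power3_eq_cube power2_eq_square)
  qed
  have "mul (bessel (-2)) (long_wave e s t (e ^ 5 *\<^sub>R flux' s (H t) - e ^ 3 *\<^sub>R mul (bessel (-2)) (mul riesz ?Q))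
     - e *\<^sub>R long_wave e s t (mul riesz (e\<^sup>2 *\<^sub>R mul (bessel (-2)) ?Q - mul (bessel (-4)) ?h)))
    = mul (bessel (-2)) (long_wave e s t (e ^ 5 *\<^sub>R flux' s (H t) - e ^ 3 *\<^sub>R mul (bessel (-2)) (mul riesz ?Q) - e *\<^sub>R mul riesz (e\<^sup>2 *\<^sub>R mul (bessel (-2)) ?Q - mul (bessel (-4)) ?h)))"
    by (simp only: lin_long_wave[OF s])
  also have "\<dots> = e *\<^sub>R mul (bessel (-2)) (long_wave e (2 + s) t ?w) + mul (bessel (-2)) (e ^ 3 *\<^sub>R long_wave e s t (mul riesz (mul (bessel (-2)) ?c)) + e ^ 5 *\<^sub>R long_wave e s t (flux' s (H t)))"
    unfolding E2 W2[symmetric] by (simp only: lin_long_wave[OF s] lin_bessel order_refl neg_numeral_le_zero add.assoc)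
  also have "\<dots> = mul riesz (ansatz t) + mul (bessel (-2)) (mul riesz (?q (ansatz t) (ansatz t)) + e ^ 5 *\<^sub>R long_wave e s t (flux' s (H t)))"
    unfolding lin quad ..
  finally show ?thesis using D by simp
qed

lemma herm_ansatz:
  assumes h: "herm (H t) = H t"
  shows "herm (ansatz t) = ansatz t" "herm (ansatz_flux t) = ansatz_flux t" "herm (long_wave e s t (flux' s (H t))) = long_wave e s t (flux' s (H t))"
  by (simp_all add: ansatz_def ansatz_flux_def herm_long_wave[OF e] s s1 herm_mul_bessel herm_diff herm_scaleR h herm_flux[OF s h])

section \<open>Powers of e in the bounds for the approximation\<close>

context
  fixes M :: real and t :: real
  assumes M: "M \<ge> 0" "norm (H t) \<le> M" "norm (flux s (H t)) \<le> M" "norm (flux' s (H t)) \<le> M"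
begin

text \<open>The four orders between the profile and the ansatz supply the decay that makes the
  weighted transform integrable. The power e^2 suffices, since this bound only keeps the added
  quadratic form below the energy.\<close>

lemma ansatz_small: "norm (wconv 1 (1 + s) 1 (ansatz t) u) \<le> 2 powr (1 / 2) * (e\<^sup>2 * (bessel_const * M)) * norm u"
proof (rule wconv_L1_bound)
  show "admissible 1 (1 + s) 1" using s by (simp add: admissible_def)
  have j: "1 - (1 + s) - 4 \<le> -1" using s by simp
  note g = long_wave_L1[OF e s1 zero_le_one j, of t "H t"]
  show "integrable lborel (\<lambda>k. bessel 1 k * (bessel (- (1 + s)) k * rep (ansatz t) k))" unfolding ansatz_def using g(1) by simp
  have "(LINT k|lborel. cmod (bessel 1 k * (bessel (- (1 + s)) k * rep (ansatz t) k))) \<le> e\<^sup>2 * (bessel_const * norm (H t))" unfolding ansatz_def using g(2) by simp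
  also have "\<dots> \<le> e\<^sup>2 * (bessel_const * M)" by (intro mult_left_mono M bessel_const_nonneg) simp
  finally show "(LINT k|lborel. cmod (bessel 1 k * (bessel (- (1 + s)) k * rep (ansatz t) k))) \<le> e\<^sup>2 * (bessel_const * M)" .
qed

lemma ansatz'_small: "norm (wconv 1 (1 + s) 1 (ansatz' t) u) \<le> (2 powr (1 / 2) * (bessel_const * (2 * M))) * e ^ 3 * norm u"
proof -
  let ?w = "mul riesz (e\<^sup>2 *\<^sub>R flux s (H t) - mul (bessel (-2)) (H t))"
  let ?l = "long_wave e (1 + s) t (mul (bessel (-1)) ?w)"
  have admissible: "admissible 1 (1 + s) 1" using s by (simp add: admissible_def)
  have j: "1 - (1 + s) - 1 \<le> -1" using s by simp
  have "norm ?w \<le> norm (e\<^sup>2 *\<^sub>R flux s (H t)) + norm (mul (bessel (-2)) (H t))"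
    by (rule order_trans[OF norm_mul_riesz_le norm_triangle_ineq4])
  also have "\<dots> \<le> 1 * M + M"
  proof (intro add_mono)
    have "e\<^sup>2 \<le> 1" using e by (simp add: power_le_one)
    then show "norm (e\<^sup>2 *\<^sub>R flux s (H t)) \<le> 1 * M" unfolding norm_scaleR by (intro mult_mono M) auto
    show "norm (mul (bessel (-2)) (H t)) \<le> M" by (rule order_trans[OF norm_mul_bessel_le M(2)]) simp
  qed
  finally have w: "norm ?w \<le> 2 * M" by simp
  note g = long_wave_L1[OF e s1 zero_le_one j zero_le_one, of t ?w]
  have "norm (wconv 1 (1 + s) 1 ?l u) \<le> 2 powr (1 / 2) * (e\<^sup>2 * (bessel_const * (2 * M))) * norm u"
  proof (rule wconv_L1_bound[OF admissible g(1)])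
    have "e\<^sup>2 * (bessel_const * norm ?w) \<le> e\<^sup>2 * (bessel_const * (2 * M))" by (intro mult_left_mono w bessel_const_nonneg) simp
    with g(2) show "(LINT k|lborel. cmod (bessel 1 k * (bessel (- (1 + s)) k * rep ?l k))) \<le> e\<^sup>2 * (bessel_const * (2 * M))" by (rule order_trans)
  qed
  then have "e * norm (wconv 1 (1 + s) 1 ?l u) \<le> e * (2 powr (1 / 2) * (e\<^sup>2 * (bessel_const * (2 * M))) * norm u)"
    using e by (intro mult_left_mono) auto
  moreover have "norm (wconv 1 (1 + s) 1 (ansatz' t) u) = e * norm (wconv 1 (1 + s) 1 ?l u)"
    unfolding ansatz'_def bounded_bilinear.scaleR_left[OF bounded_bilinear_wconv[OF admissible]] norm_scaleR using e by simp
  ultimately show ?thesis by (simp add: power3_eq_cube power2_eq_square ac_simps)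
qed

text \<open>The factor k in the bound of the commutator is a derivative of a long wave and supplies
  the third power of e.\<close>

lemma ansatz_commutator: "norm (commutator s (ansatz t) u) \<le> (s * 4 * 2 powr ((1 + s) / 2) * (bessel_const * M)) * e ^ 3 * norm u"
proof -
  have j: "1 + s + 1 - (1 + s) - 4 \<le> -1" by simp
  note g = long_wave_L1_derivative[OF e s1 s1 j, of t "H t"]
  have "norm (commutator s (ansatz t) u) \<le> s * 4 * 2 powr ((1 + s) / 2) * (e ^ 3 * (bessel_const * M)) * norm u"
  proof (rule commutator_bound[OF s])
    show "integrable lborel (\<lambda>k. of_real k * (bessel (1 + s) k * (bessel (- (1 + s)) k * rep (ansatz t) k)))" unfolding ansatz_def using g(1) by simp
    have "(LINT k|lborel. cmod (of_real k * (bessel (1 + s) k * (bessel (- (1 + s)) k * rep (ansatz t) k)))) \<le> e ^ 3 * (bessel_const * norm (H t))" unfolding ansatz_def using g(2) by simp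
    also have "\<dots> \<le> e ^ 3 * (bessel_const * M)" using e by (intro mult_left_mono M bessel_const_nonneg) simp
    finally show "(LINT k|lborel. cmod (of_real k * (bessel (1 + s) k * (bessel (- (1 + s)) k * rep (ansatz t) k)))) \<le> e ^ 3 * (bessel_const * M)" .
  qed
  then show ?thesis by (simp add: ac_simps)
qed

text \<open>The total e^(13/2) is split into the rate e^3 and the target size e^(7/2), the form
  which \<open>error_system\<close> asks for.\<close>

lemma residual_small: "norm (e ^ 5 *\<^sub>R long_wave e s t (flux' s (H t))) \<le> M * e ^ 3 * (e ^ 3 * sqrt e)"
proof -
  have "norm (long_wave e s t (flux' s (H t))) \<le> e * sqrt e * M"
    by (rule order_trans[OF norm_long_wave_le[OF e s]]) (use e M in \<open>auto intro: mult_left_mono\<close>)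
  then have "e ^ 5 * norm (long_wave e s t (flux' s (H t))) \<le> e ^ 5 * (e * sqrt e * M)" using e by (intro mult_left_mono) auto
  then show ?thesis using e by (simp add: eval_nat_numeral ac_simps)
qed

end

end

text \<open>The exponent \<open>2 * (c2 + b) + 2 * c0 + 4 * c1\<close> of
  \<open>error_system\<close>, with the bounds for commutator, product, residual and time derivative
  of the approximation inserted.\<close>

definition growth :: "real \<Rightarrow> real \<Rightarrow> real" where
  "growth s M = 2 * (s * 4 * 2 powr ((1 + s) / 2) * (bessel_const * M) + 2 powr (1 + s) * (2 * bessel_const)) + 2 * M +
     4 * (2 powr (1 / 2) * (bessel_const * (2 * M)))"

text \<open>The rate e^3 times the length T / e^3 of the time interval leaves an exponent
  independent of e. By \<open>e1\<close> the added form is dominated by the energy; by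
  \<open>e2\<close> the error stays below e^3, so that the cut-off acts as the identity and the
  truncated solution solves the actual equation.\<close>

lemma boussinesq_system:
  assumes s: "s \<ge> 0" and e: "0 < e" "e \<le> 1" and T: "T > 0" and M: "M \<ge> 0"
    and h: "continuous_on {0..T} h" and sgh: "\<And>t. t \<in> {0..T} \<Longrightarrow> herm (h t) = h t"
    and dh: "\<And>t. t \<in> {0..T} \<Longrightarrow> ((\<lambda>t. mul (bessel (-3)) (h t)) has_vector_derivative mul riesz (flux s (h t))) (at t within {0..T})"
    and B: "\<And>t. t \<in> {0..T} \<Longrightarrow> norm (h t) \<le> M" "\<And>t. t \<in> {0..T} \<Longrightarrow> norm (flux s (h t)) \<le> M"
      "\<And>t. t \<in> {0..T} \<Longrightarrow> norm (flux' s (h t)) \<le> M"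
    and e1: "2 powr (1 / 2) * (e\<^sup>2 * (bessel_const * M)) \<le> 1 / 4"
    and e2: "2 * exp (growth s M * T / 2) * sqrt e \<le> 1"
  obtains u p where "continuous_on {0..T / e ^ 3} u" "\<And>t. t \<in> {0..T / e ^ 3} \<Longrightarrow> herm (u t) = u t"
    "\<And>t. t \<in> {0..T / e ^ 3} \<Longrightarrow> ((\<lambda>t. mul (bessel (-2)) (u t)) has_vector_derivative mul riesz (p t)) (at t within {0..T / e ^ 3})"
    "\<And>t. t \<in> {0..T / e ^ 3} \<Longrightarrow> ((\<lambda>t. mul (bessel (-2)) (p t)) has_vector_derivative
       mul riesz (u t) + mul (bessel (-2)) (mul riesz (wconv (1 + s) (1 + s) (1 + s) (u t) (u t)))) (at t within {0..T / e ^ 3})"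
    "\<And>t. t \<in> {0..T / e ^ 3} \<Longrightarrow> norm (u t - long_wave e (1 + s) t (mul (bessel (-4)) (h (e ^ 3 * t)))) \<le> 2 * exp (growth s M * T / 2) * (e ^ 3 * sqrt e)"
proof -
  define H where "H t = h (e ^ 3 * t)" for t
  define S where "S = {0..T / e ^ 3}"
  have e3: "e ^ 3 > 0" using e by simp
  have S: "e ^ 3 * t \<in> {0..T}" if "t \<in> S" for t
    using that e unfolding S_def by (auto simp: field_simps)
  have dH: "((\<lambda>t. mul (bessel (-3)) (H t)) has_vector_derivative e ^ 3 *\<^sub>R mul riesz (flux s (H t))) (at t within S)" if "t \<in> S" for t
    unfolding H_def S_def by (rule rescaled_derivative[OF e3 dh]) (use that S_def in auto)
  have dQ: "((\<lambda>t. mul (bessel (-3)) (flux s (H t))) has_vector_derivative e ^ 3 *\<^sub>R flux' s (H t)) (at t within S)" if "t \<in> S" for t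
    unfolding H_def S_def by (rule rescaled_derivative[OF e3 flux_derivative[OF s dh]]) (use that S_def in auto)
  have cH: "continuous_on S H" unfolding H_def
    by (rule continuous_on_compose2[OF h]) (use S in \<open>auto intro!: continuous_intros\<close>)
  have sgH: "herm (H t) = H t" if "t \<in> S" for t unfolding H_def by (rule sgh[OF S[OF that]])
  have BH: "norm (H t) \<le> M" "norm (flux s (H t)) \<le> M" "norm (flux' s (H t)) \<le> M" if "t \<in> S" for t
    unfolding H_def using B[OF S[OF that]] by auto
  note lwd = ansatz_derivative[OF s e dH] and lpd = ansatz_flux_derivative[OF s e dH dQ]
  \<comment> \<open>The error has to compensate the residual of the approximation, whence the
    sign.\<close>
  let ?g = "\<lambda>t. - (e ^ 5 *\<^sub>R long_wave e s t (flux' s (H t)))"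
  let ?h = "e ^ 3 * sqrt e"
  let ?q = "wconv (1 + s) (1 + s) (1 + s)"
  have admissible: "admissible (1 + s) (1 + s) (1 + s)" using s by (simp add: admissible_def)
  obtain r p where r: "continuous_on S r"
    "\<And>t. t \<in> S \<Longrightarrow> ((\<lambda>t. mul (bessel (-2)) (r t)) has_vector_derivative mul riesz (p t)) (at t within S)"
    "\<And>t. t \<in> S \<Longrightarrow> ((\<lambda>t. mul (bessel (-2)) (p t)) has_vector_derivative mul riesz (r t) + mul (bessel (-2)) (nonlin s (e ^ 3) (ansatz s e H t) (r t) + ?g t)) (at t within S)"
    "\<And>t. t \<in> S \<Longrightarrow> (norm (r t))\<^sup>2 \<le> 4 * ?h\<^sup>2 * exp (growth s M * e ^ 3 * (T / e ^ 3))"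
    "\<And>t. t \<in> S \<Longrightarrow> herm (r t) = r t"
  proof (rule error_system[of s "T / e ^ 3" "e ^ 3" ?h "2 powr (1 + s) * (2 * bessel_const)" M "2 powr (1 / 2) * (bessel_const * (2 * M))"
        "s * 4 * 2 powr ((1 + s) / 2) * (bessel_const * M)" "ansatz s e H" "ansatz' s e H" ?g, folded S_def growth_def])
    show "norm (?q u v) \<le> 2 powr (1 + s) * (2 * bessel_const) * norm u * norm v" for u v by (rule wconv_bound(2)[OF admissible])
    show "continuous_on S ?g"
      by (intro continuous_intros long_wave_continuous e s continuous_flux cH)
    fix t assume t: "t \<in> S"
    note B = BH[OF t]
    show "(ansatz s e H has_vector_derivative ansatz' s e H t) (at t within S)" by (rule lwd[OF t])
    show "herm (ansatz s e H t) = ansatz s e H t" "herm (?g t) = ?g t"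
      using herm_ansatz[where H = H and t = t, OF s e sgH[OF t]] by (simp_all add: herm_minus herm_scaleR)
    show "norm (?g t) \<le> M * e ^ 3 * ?h" unfolding norm_minus_cancel by (rule residual_small[where H = H and t = t, OF s e M B])
    fix u :: l2
    have "2 powr (1 / 2) * (e\<^sup>2 * (bessel_const * M)) * norm u \<le> 1 / 4 * norm u" by (intro mult_right_mono e1) simp
    with ansatz_small[where H = H and t = t and u = u, OF s e M B] show "norm (wconv 1 (1 + s) 1 (ansatz s e H t) u) \<le> 1 / 4 * norm u" by (rule order_trans)
    show "norm (wconv 1 (1 + s) 1 (ansatz' s e H t) u) \<le> 2 powr (1 / 2) * (bessel_const * (2 * M)) * e ^ 3 * norm u"
      by (rule ansatz'_small[where H = H and t = t, OF s e M B])
    show "norm (commutator s (ansatz s e H t) u) \<le> s * 4 * 2 powr ((1 + s) / 2) * (bessel_const * M) * e ^ 3 * norm u"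
      by (rule ansatz_commutator[where H = H and t = t, OF s e M B])
  qed (use s e T M bessel_const_nonneg in auto)
  have small: "norm (r t) \<le> 2 * exp (growth s M * T / 2) * ?h" if t: "t \<in> S" for t
  proof (rule power2_le_imp_le)
    have "(exp (growth s M * T / 2))\<^sup>2 = exp (growth s M * T)" by (simp add: power2_eq_square flip: exp_add)
    then show "(norm (r t))\<^sup>2 \<le> (2 * exp (growth s M * T / 2) * ?h)\<^sup>2"
      using r(4)[OF t] e by (simp add: power_mult_distrib mult.assoc mult.left_commute mult.commute)
  qed (use e in simp)
  have ball_retract: "ball_retract (e ^ 3) (r t) = r t" if t: "t \<in> S" for t
  proof -
    have "2 * exp (growth s M * T / 2) * ?h = e ^ 3 * (2 * exp (growth s M * T / 2) * sqrt e)" by simp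
    also have "\<dots> \<le> e ^ 3 * 1" using e3 by (intro mult_left_mono e2) simp
    finally have "norm (r t) \<le> e ^ 3" using small[OF t] by simp
    then show ?thesis by (simp add: ball_retract_def)
  qed
  let ?u = "\<lambda>t. ansatz s e H t + r t" and ?p = "\<lambda>t. ansatz_flux s e H t + p t"
  have bl2: "bounded_linear (mul (bessel (-2)))" by (intro bounded_linear_mul bdd_mult_bessel) simp
  note lin2 = bl_simps[OF bl2] and linX = bl_simps[OF bounded_linear_mul[OF bdd_mult_riesz]]
  have du: "((\<lambda>t. mul (bessel (-2)) (?u t)) has_vector_derivative mul riesz (?p t)) (at t within S)" if t: "t \<in> S" for t
  proof -
    have "((\<lambda>t. mul (bessel (-2)) (ansatz s e H t) + mul (bessel (-2)) (r t)) has_vector_derivative mul (bessel (-2)) (ansatz' s e H t) + mul riesz (p t)) (at t within S)"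
      by (intro has_vector_derivative_add bounded_linear.has_vector_derivative[OF bl2] lwd r(2) t)
    then show ?thesis using ansatz'_ansatz_flux[OF s e] by (simp add: lin2 linX)
  qed
  have dp: "((\<lambda>t. mul (bessel (-2)) (?p t)) has_vector_derivative mul riesz (?u t) + mul (bessel (-2)) (mul riesz (?q (?u t) (?u t)))) (at t within S)"
    if t: "t \<in> S" for t
  proof -
    interpret q: bounded_bilinear ?q by (rule bounded_bilinear_wconv[OF admissible])
    \<comment> \<open>The square of approximation plus error: the two last terms are the
      nonlinearity of the error system, once the retraction is the identity.\<close>
    have "?q (?u t) (?u t) = ?q (ansatz s e H t) (ansatz s e H t) + (2 *\<^sub>R ?q (ansatz s e H t) (r t) + ?q (r t) (r t))"
      by (simp add: q.add_left q.add_right wconv_commute[of _ _ _ "r t" "ansatz s e H t"] scaleR_2)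
    then have "mul riesz (?q (?u t) (?u t)) = mul riesz (?q (ansatz s e H t) (ansatz s e H t)) + nonlin s (e ^ 3) (ansatz s e H t) (r t)"
      by (simp only: nonlin_def ball_retract[OF t] linX)
    moreover have "((\<lambda>t. mul (bessel (-2)) (ansatz_flux s e H t) + mul (bessel (-2)) (p t)) has_vector_derivative
      (mul riesz (ansatz s e H t) + mul (bessel (-2)) (mul riesz (?q (ansatz s e H t) (ansatz s e H t)) + e ^ 5 *\<^sub>R long_wave e s t (flux' s (H t)))) +
      (mul riesz (r t) + mul (bessel (-2)) (nonlin s (e ^ 3) (ansatz s e H t) (r t) + ?g t))) (at t within S)"
      by (intro has_vector_derivative_add lpd r(3) t)
    ultimately show ?thesis by (simp add: lin2 linX algebra_simps)
  qed
  have cu: "continuous_on S ?u"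
  proof (intro continuous_on_add r(1))
    show "continuous_on S (ansatz s e H)"
      unfolding continuous_on_eq_continuous_within by (intro ballI has_vector_derivative_continuous[OF lwd])
  qed
  have sgu: "herm (?u t) = ?u t" if "t \<in> S" for t
    using herm_ansatz[OF s e] sgH[OF that] r(5)[OF that] by (simp add: herm_add)
  have "norm (?u t - long_wave e (1 + s) t (mul (bessel (-4)) (h (e ^ 3 * t)))) \<le> 2 * exp (growth s M * T / 2) * ?h" if "t \<in> S" for t
    using small[OF that] by (simp add: ansatz_def[OF s e] H_def)
  with cu sgu du dp show ?thesis unfolding S_def by (rule that)
qed

theorem theorem1p1:
  fixes s T\<^sub>0 :: real and A :: "real \<Rightarrow> real \<Rightarrow> real"
  assumes "s \<ge> 0" and "T\<^sub>0 > 0"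
    and "continuous_into_sobolev T\<^sub>0 (5 + s) A"
    and "kdv_solution T\<^sub>0 A"
  shows "\<exists>\<epsilon>\<^sub>0 > 0. \<exists>C > 0. \<forall>\<epsilon>\<in>{0<..<\<epsilon>\<^sub>0}. \<exists>u :: real \<Rightarrow> real \<Rightarrow> real.
    continuous_into_sobolev (T\<^sub>0 / \<epsilon> ^ 3) (1 + s) u \<and>
    boussinesq_solution (T\<^sub>0 / \<epsilon> ^ 3) u \<and>
    (SUP t\<in>{0..T\<^sub>0 / \<epsilon> ^ 3}.
        sobolev_norm (1 + s) (\<lambda>x. u t x - \<epsilon>\<^sup>2 * A (\<epsilon> ^ 3 * t) (\<epsilon> * (x - t))))
      \<le> ennreal (C * \<epsilon> powr (7 / 2))"
proof -
  note s = assms(1) and T = assms(2)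
  have s1: "1 + s \<ge> 0" using s by simp
  obtain h where A2: "\<And>t. t \<in> {0..T\<^sub>0} \<Longrightarrow> square_integrable (A t)"
    and h: "\<And>t. t \<in> {0..T\<^sub>0} \<Longrightarrow> fhat (A t) = mul (bessel (- (5 + s))) (h t)"
    and sgh: "\<And>t. t \<in> {0..T\<^sub>0} \<Longrightarrow> herm (h t) = h t" and c: "continuous_on {0..T\<^sub>0} h"
    and dh: "\<And>t. t \<in> {0..T\<^sub>0} \<Longrightarrow> ((\<lambda>t. mul (bessel (-3)) (h t)) has_vector_derivative mul riesz (flux s (h t))) (at t within {0..T\<^sub>0})"
    by (rule kdv_profile[OF assms(1,3,4)]) blast
  \<comment> \<open>Compactness of the time interval turns continuity of profile, flux and flux
    derivative into bounds independent of \<epsilon>.\<close>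
  have bounded: "\<exists>B. \<forall>t\<in>{0..T\<^sub>0}. norm (f t) \<le> B" if "continuous_on {0..T\<^sub>0} f" for f :: "real \<Rightarrow> l2"
    using compact_imp_bounded[OF compact_continuous_image[OF that compact_Icc]] by (auto simp: bounded_iff)
  obtain M1 M2 M3 where "\<And>t. t \<in> {0..T\<^sub>0} \<Longrightarrow> norm (h t) \<le> M1" "\<And>t. t \<in> {0..T\<^sub>0} \<Longrightarrow> norm (flux s (h t)) \<le> M2"
    "\<And>t. t \<in> {0..T\<^sub>0} \<Longrightarrow> norm (flux' s (h t)) \<le> M3"
    using bounded[OF c] bounded[OF continuous_flux(1)[OF s c]] bounded[OF continuous_flux(2)[OF s c]] by metis
  moreover define M where "M = max 0 (max M1 (max M2 M3))"
  ultimately have M: "M \<ge> 0" and B: "\<And>t. t \<in> {0..T\<^sub>0} \<Longrightarrow> norm (h t) \<le> M" "\<And>t. t \<in> {0..T\<^sub>0} \<Longrightarrow> norm (flux s (h t)) \<le> M"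
    "\<And>t. t \<in> {0..T\<^sub>0} \<Longrightarrow> norm (flux' s (h t)) \<le> M" by (auto simp: M_def le_max_iff_disj)
  define C where "C = 2 * exp (growth s M * T\<^sub>0 / 2)"
  define K where "K = 2 powr (1 / 2) * (bessel_const * M)"
  \<comment> \<open>The bound 1 is what the scaling lemmas need, \<open>1 / C\<^sup>2\<close> keeps
    the error inside the ball of the cut-off, and the last bound keeps the quadratic form small. In
    it \<open>K + 1\<close> avoids a vanishing denominator.\<close>
  define \<epsilon>0 where "\<epsilon>0 = min 1 (min (1 / C\<^sup>2) (1 / (4 * (K + 1))))"
  have C: "C > 0" by (simp add: C_def)
  have K: "K \<ge> 0" using M bessel_const_nonneg by (simp add: K_def)
  have pos: "\<epsilon>0 > 0" using C K by (simp add: \<epsilon>0_def)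
  show ?thesis
  proof (rule exI[of _ \<epsilon>0], intro conjI pos exI[of _ C] C ballI)
    fix \<epsilon> assume "\<epsilon> \<in> {0<..<\<epsilon>0}"
    then have e: "0 < \<epsilon>" "\<epsilon> \<le> 1" and eC: "\<epsilon> \<le> 1 / C\<^sup>2" and eK: "\<epsilon> \<le> 1 / (4 * (K + 1))" by (auto simp: \<epsilon>0_def)
    have e1: "2 powr (1 / 2) * (\<epsilon>\<^sup>2 * (bessel_const * M)) \<le> 1 / 4"
    proof -
      have "\<epsilon>\<^sup>2 * K \<le> \<epsilon> * K" using e K by (intro mult_right_mono) (auto simp: power2_eq_square mult_left_le)
      also have "\<dots> \<le> \<epsilon> * (K + 1)" using e by simp
      also have "\<dots> \<le> 1 / (4 * (K + 1)) * (K + 1)" using K by (intro mult_right_mono eK) simp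
      also have "\<dots> = 1 / 4" using K by (simp add: field_simps)
      finally show ?thesis by (simp add: K_def mult.left_commute)
    qed
    have e2: "C * sqrt \<epsilon> \<le> 1"
    proof -
      have "sqrt \<epsilon> \<le> sqrt (1 / C\<^sup>2)" using eC by simp
      also have "\<dots> = 1 / C" using C by (simp add: real_sqrt_divide)
      finally show ?thesis using C by (simp add: field_simps)
    qed
    have powr: "\<epsilon> ^ 3 * sqrt \<epsilon> = \<epsilon> powr (7 / 2)"
    proof -
      have "\<epsilon> ^ 3 * sqrt \<epsilon> = \<epsilon> powr 3 * \<epsilon> powr (1 / 2)" using e by (simp add: powr_half_sqrt powr_numeral)
      also have "\<dots> = \<epsilon> powr (7 / 2)" by (simp flip: powr_add)
      finally show ?thesis .
    qed
    let ?T = "T\<^sub>0 / \<epsilon> ^ 3"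
    obtain u p where cu: "continuous_on {0..?T} u" and sgu: "\<And>t. t \<in> {0..?T} \<Longrightarrow> herm (u t) = u t"
      and du: "\<And>t. t \<in> {0..?T} \<Longrightarrow> ((\<lambda>t. mul (bessel (-2)) (u t)) has_vector_derivative mul riesz (p t)) (at t within {0..?T})"
      and dp: "\<And>t. t \<in> {0..?T} \<Longrightarrow> ((\<lambda>t. mul (bessel (-2)) (p t)) has_vector_derivative
       mul riesz (u t) + mul (bessel (-2)) (mul riesz (wconv (1 + s) (1 + s) (1 + s) (u t) (u t)))) (at t within {0..?T})"
      and err: "\<And>t. t \<in> {0..?T} \<Longrightarrow> norm (u t - long_wave \<epsilon> (1 + s) t (mul (bessel (-4)) (h (\<epsilon> ^ 3 * t)))) \<le> C * (\<epsilon> ^ 3 * sqrt \<epsilon>)"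
      by (rule boussinesq_system[OF s e T M c sgh dh B e1 e2[unfolded C_def], folded C_def]) blast+
    let ?u = "\<lambda>t. physical (mul (bessel (- (1 + s))) (u t))"
    have "sobolev_norm (1 + s) (\<lambda>x. ?u t x - \<epsilon>\<^sup>2 * A (\<epsilon> ^ 3 * t) (\<epsilon> * (x - t))) \<le> ennreal (C * \<epsilon> powr (7 / 2))"
      if t: "t \<in> {0..?T}" for t
    proof -
      have t': "\<epsilon> ^ 3 * t \<in> {0..T\<^sub>0}" using t e by (auto simp: field_simps)
      have "fhat (A (\<epsilon> ^ 3 * t)) = mul (bessel (- (1 + s))) (mul (bessel (-4)) (h (\<epsilon> ^ 3 * t)))" using s by (simp add: h[OF t'] mul_bessel_bessel)
      note a = fhat_long_wave[OF e s1 A2[OF t'] this, of t] and p = physical_sobolev[OF s1 sgu[OF t]]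
      have bl: "bounded_linear (mul (bessel (- (1 + s))))" using s by (intro bounded_linear_mul bdd_mult_bessel) simp
      have "sobolev_norm (1 + s) (\<lambda>x. ?u t x - \<epsilon>\<^sup>2 * A (\<epsilon> ^ 3 * t) (\<epsilon> * (x - t))) = ennreal (norm (u t - long_wave \<epsilon> (1 + s) t (mul (bessel (-4)) (h (\<epsilon> ^ 3 * t)))))"
        by (rule sobolevI(2)[OF square_integrable_diff[OF p(1) a(1)] _ s1]) (simp only: fhat_diff[OF p(1) a(1)] p(2) a(2) bl_simps[OF bl])
      also have "\<dots> \<le> ennreal (C * \<epsilon> powr (7 / 2))" using err[OF t] unfolding powr by (rule ennreal_leI)
      finally show ?thesis .
    qed
    then have "(SUP t\<in>{0..?T}. sobolev_norm (1 + s) (\<lambda>x. ?u t x - \<epsilon>\<^sup>2 * A (\<epsilon> ^ 3 * t) (\<epsilon> * (x - t)))) \<le> ennreal (C * \<epsilon> powr (7 / 2))"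
      by (rule SUP_least)
    then show "\<exists>u. continuous_into_sobolev ?T (1 + s) u \<and> boussinesq_solution ?T u \<and>
        (SUP t\<in>{0..?T}. sobolev_norm (1 + s) (\<lambda>x. u t x - \<epsilon>\<^sup>2 * A (\<epsilon> ^ 3 * t) (\<epsilon> * (x - t)))) \<le> ennreal (C * \<epsilon> powr (7 / 2))"
      by (intro exI[of _ ?u] conjI continuous_into_sobolev_physical[OF s1 sgu cu] boussinesq_from_profile[OF s sgu du dp])
  qed
qed

end
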